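(* If $\mathcal{Q}$ is a small Girard quantaloid, then there are equivalences of quantaloids $$\mathbf{D}(\mathcal{Q}\text{-}\mathbf{Dist})\simeq\mathbf{B}(\mathcal{Q}\text{-}\mathbf{Dist})\simeq(\mathcal{Q}\text{-}\mathbf{IntDist})_{\mathsf o}\simeq(\mathcal{Q}\text{-}\mathbf{ClsDist})_{\mathsf{cl}}\simeq(\mathcal{Q}\text{-}\mathbf{Sup})^{\mathrm{op}}.$$
   Context: **Quantaloids.** A quantaloid is a (possibly large) category whose hom-sets are complete lattices and whose composition preserves arbitrary joins in each variable. For arrows $u:p\to q$, $v:q\to r$, $w:p\to r$ the arrows $w\swarrow u:q\to r$ and $v\searrow w:p\to q$ are determined by $v\circ u\le w\iff v\le w\swarrow u\iff u\le v\searrow w$. A homomorphism of quantaloids is a functor preserving joins of arrows; it is an equivalence of quantaloids if the underlying functor is an equivalence of categories. The opposite quantaloid reverses arrows and keeps the order on hom-sets. A congruence on a quantaloid is a family of equivalence relations on the hom-sets compatible with composition and arbitrary joins; it induces a quotient quantaloid with the same objects and with equivalence classes as arrows. A quantaloid is small if its objects form a set. A quantaloid $\mathcal{Q}$ is Girard if it is equipped with a family $\{d_q:q\to q\}_{q\in\mathrm{ob}\,\mathcal{Q}}$ such that $d_p\swarrow u=u\searrow d_q$ and $(d_p\swarrow u)\searrow d_p=u=d_q\swarrow(u\searrow d_q)$ for all $u:p\to q$. **$\mathcal{Q}$-categories and $\mathcal{Q}$-distributors.** A $\mathcal{Q}$-category $X$ is a set $X$ with a type map $|\cdot|:X\to\mathrm{ob}\,\mathcal{Q}$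 and hom-arrows $1_X^\natural(x,y)\in\mathcal{Q}(|x|,|y|)$ with $1_{|x|}\le 1_X^\natural(x,x)$ and $1_X^\natural(y,z)\circ 1_X^\natural(x,y)\le 1_X^\natural(x,z)$. Its underlying preorder is $x\le y\iff |x|=|y|$ and $1_{|x|}\le 1_X^\natural(x,y)$; $X$ is separated if this preorder is antisymmetric. A $\mathcal{Q}$-functor $f:X\to Y$ is a type-preserving map with $1_X^\natural(x,y)\le 1_Y^\natural(fx,fy)$; $\mathcal{Q}$-functors are ordered pointwise; $f\dashv g$ ($g:Y\to X$) means $1_Y^\natural(fx,y)=1_X^\natural(x,gy)$ for all $x,y$. A $\mathcal{Q}$-distributor $\phi:X\nrightarrow Y$ is a family $\phi(x,y)\in\mathcal{Q}(|x|,|y|)$ with $1_Y^\natural(y,y')\circ\phi(x,y)\circ 1_X^\natural(x',x)\le\phi(x',y')$. They form a quantaloid $\mathcal{Q}\text{-}\mathbf{Dist}$ with pointwise order, $(\psi\circ\phi)(x,z)=\bigvee_y\psi(y,z)\circ\phi(x,y)$, identities $1_X^\natural$, $(\xi\swarrow\phi)(y,z)=\bigwedge_x\xi(x,z)\swarrow\phi(x,y)$ and $(\psi\searrow\xi)(x,y)=\bigwedge_z\psi(y,z)\searrow\xi(x,z)$. **Presheaves.** $\{q\}$ is the one-object $\mathcal{Q}$-category of type $q$ with hom $1_q$. $\mathsf{P}X$ is the $\mathcal{Q}$-category of all $\mathcal{Q}$-distributors $\mu:X\nrightarrow\{q\}$ (of type $q$; $q\in\mathrm{ob}\,\mathcal{Q}$),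 with $1_{\mathsf{P}X}^\natural(\mu,\mu')=\mu'\swarrow\mu$. For $\zeta:X\nrightarrow Y$, $\zeta^*:\mathsf{P}Y\to\mathsf{P}X$ is $\zeta^*\lambda=\lambda\circ\zeta$. **$\mathbf{D}$ and $\mathbf{B}$.** For a quantaloid $\mathcal{C}$ (here $\mathcal{C}=\mathcal{Q}\text{-}\mathbf{Dist}$): $\mathbf{Arr}(\mathcal{C})$ has $\mathcal{C}$-arrows as objects and pairs $(s:p\to p',t:q\to q')$ with $v\circ s=t\circ u$ as arrows from $u:p\to q$ to $v:p'\to q'$; $\mathbf{D}(\mathcal{C})$ is its quotient identifying $(s,t),(s',t')$ iff $v\circ s=v\circ s'$. $\mathbf{ChuCon}(\mathcal{C})$ has $\mathcal{C}$-arrows as objects and pairs $(s:p\to p',t:q\to q')$ with $u\swarrow s=t\searrow v$ as arrows from $u$ to $v$; $\mathbf{B}(\mathcal{C})$ is its quotient identifying $(s,t),(s',t')$ iff $u\swarrow s=u\swarrow s'$. In $\mathbf{Arr}(\mathcal{C})$ and $\mathbf{ChuCon}(\mathcal{C})$ composition and order are componentwise. **Interior spaces.** A $\mathcal{Q}$-interior space $(X,a)$ is a $\mathcal{Q}$-category $X$ with a $\mathcal{Q}$-functor $a:\mathsf{P}X\to\mathsf{P}X$ such that $a\le 1_{\mathsf{P}X}$ and $aa=a$. A continuous $\mathcal{Q}$-distributor $\zeta:(X,a)\nrightarrow(Y,b)$ is a $\mathcal{Q}$-distributor $\zeta:X\nrightarrow Y$ with $\zeta^*b\le a\zeta^*$.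 These form the quantaloid $\mathcal{Q}\text{-}\mathbf{IntDist}$ (structure as in $\mathcal{Q}\text{-}\mathbf{Dist}$), and $(\mathcal{Q}\text{-}\mathbf{IntDist})_{\mathsf o}$ is its quotient by the congruence $\zeta\sim\zeta'\iff\zeta^*b=\zeta'^*b$. **Closure spaces.** A $\mathcal{Q}$-closure space $(X,c)$ is a $\mathcal{Q}$-category $X$ with a $\mathcal{Q}$-functor $c:\mathsf{P}X\to\mathsf{P}X$ such that $1_{\mathsf{P}X}\le c$ and $cc=c$. A continuous $\mathcal{Q}$-distributor $\zeta:(X,c)\nrightarrow(Y,d)$ is a $\mathcal{Q}$-distributor $\zeta:X\nrightarrow Y$ with $\zeta^*d\le c\zeta^*$; its closure $\mathsf{cl}\,\zeta$ is given by $(\mathsf{cl}\,\zeta)(-,y)=c(\zeta(-,y))$, and $\zeta$ is closed if $\mathsf{cl}\,\zeta=\zeta$. $(\mathcal{Q}\text{-}\mathbf{ClsDist})_{\mathsf{cl}}$ is the quantaloid of $\mathcal{Q}$-closure spaces and closed continuous $\mathcal{Q}$-distributors, with pointwise order, composition of $\zeta$ followed by $\eta$ given by $\mathsf{cl}(\eta\circ\zeta)$, identities $\mathsf{cl}(1_X^\natural)$, and joins $\mathsf{cl}(\bigvee_i\zeta_i)$. **$\mathcal{Q}\text{-}\mathbf{Sup}$.** A $\mathcal{Q}$-category $X$ is complete if the Yoneda embedding $X\to\mathsf{P}X$, $x\mapsto 1_X^\natural(-,x)$, has a left adjoint. $\mathcal{Q}\text{-}\mathbf{Sup}$ is the quantaloid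 of separated complete $\mathcal{Q}$-categories and left adjoint $\mathcal{Q}$-functors, ordered pointwise. *)

theory Defs
  imports Main "HOL-Algebra.Complete_Lattice"
begin

unbundle cardinal_syntax

section \<open>Sets and classes\<close>

text \<open>
  The quantaloids of all \<open>Q\<close>-categories, \<open>Q\<close>-interior spaces etc. are large: one needs a notion
  of smallness that is stable under the formation of presheaves. HOL has no built-in one, so it is
  given by a HOL set \<open>U\<close> of strongly inaccessible cardinality, following von Neumann's
  limitation of size: the sets (as opposed to classes) are the collections strictly smaller
  than \<open>U\<close>. Up to bijection these are exactly the elements of the Grothendieck
  universe of the same cardinality. The elements of \<open>U\<close> itself only serve as points of
  \<open>Q\<close>-categories.
\<close>

definition small :: "'v set \<Rightarrow> 'a set \<Rightarrow> bool" where
  "small U A \<longleftrightarrow> |A| <o |U|"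

definition inaccessible :: "'v set \<Rightarrow> bool" where
  "inaccessible U \<longleftrightarrow>
     natLeq <o |U| \<and> regularCard |U| \<and> (\<forall>A \<subseteq> U. small U A \<longrightarrow> small U (Pow A))"

section \<open>Quantaloids\<close>

text \<open>
  Hom-sets are ordered sets of HOL-Algebra, indexed by domain and codomain, and need not be
  disjoint. For \<open>u : p \<rightarrow> q\<close> and \<open>v : q \<rightarrow> r\<close>, the composite \<open>v \<circ> u : p \<rightarrow> r\<close> is
  \<open>Cmp C p q r v u\<close>.
\<close>

record ('o, 'a) quantaloid_data =
  Obj :: "'o set"
  Hom :: "'o \<Rightarrow> 'o \<Rightarrow> 'a gorder"
  Cmp :: "'o \<Rightarrow> 'o \<Rightarrow> 'o \<Rightarrow> 'a \<Rightarrow> 'a \<Rightarrow> 'a"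
  Idn :: "'o \<Rightarrow> 'a"

abbreviation arr :: "('o, 'a) quantaloid_data \<Rightarrow> 'o \<Rightarrow> 'o \<Rightarrow> 'a set" where
  "arr C p q \<equiv> carrier (Hom C p q)"

definition category :: "('o, 'a) quantaloid_data \<Rightarrow> bool" where
  "category C \<longleftrightarrow>
     (\<forall>p\<in>Obj C. Idn C p \<in> arr C p p) \<and>
     (\<forall>p\<in>Obj C. \<forall>q\<in>Obj C. \<forall>r\<in>Obj C. \<forall>u\<in>arr C p q. \<forall>v\<in>arr C q r.
        Cmp C p q r v u \<in> arr C p r) \<and>
     (\<forall>p\<in>Obj C. \<forall>q\<in>Obj C. \<forall>u\<in>arr C p q.
        Cmp C p p q u (Idn C p) = u \<and> Cmp C p q q (Idn C q) u = u) \<and>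
     (\<forall>p\<in>Obj C. \<forall>q\<in>Obj C. \<forall>r\<in>Obj C. \<forall>s\<in>Obj C.
        \<forall>u\<in>arr C p q. \<forall>v\<in>arr C q r. \<forall>w\<in>arr C r s.
        Cmp C p r s w (Cmp C p q r v u) = Cmp C p q s (Cmp C q r s w v) u)"

definition quantaloid :: "('o, 'a) quantaloid_data \<Rightarrow> bool" where
  "quantaloid C \<longleftrightarrow>
     category C \<and>
     (\<forall>p\<in>Obj C. \<forall>q\<in>Obj C. complete_lattice (Hom C p q)) \<and>
     (\<forall>p\<in>Obj C. \<forall>q\<in>Obj C. \<forall>r\<in>Obj C. \<forall>u\<in>arr C p q. \<forall>V \<subseteq> arr C q r.
        Cmp C p q r (\<Squnion>\<^bsub>Hom C q r\<^esub> V) u = \<Squnion>\<^bsub>Hom C p r\<^esub> ((\<lambda>v. Cmp C p q r v u) ` V)) \<and>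
     (\<forall>p\<in>Obj C. \<forall>q\<in>Obj C. \<forall>r\<in>Obj C. \<forall>v\<in>arr C q r. \<forall>W \<subseteq> arr C p q.
        Cmp C p q r v (\<Squnion>\<^bsub>Hom C p q\<^esub> W) = \<Squnion>\<^bsub>Hom C p r\<^esub> ((\<lambda>u. Cmp C p q r v u) ` W))"

text \<open>In a small quantaloid the hom-sets, being sets, are small as well.\<close>

definition small_quantaloid :: "'v set \<Rightarrow> ('o, 'a) quantaloid_data \<Rightarrow> bool" where
  "small_quantaloid U Q \<longleftrightarrow>
     quantaloid Q \<and> small U (Obj Q) \<and> (\<forall>p\<in>Obj Q. \<forall>q\<in>Obj Q. small U (arr Q p q))"

text \<open>
  \<open>lres C p q r w u\<close> is \<open>w \<swarrow> u : q \<rightarrow> r\<close> for \<open>u : p \<rightarrow> q\<close>, \<open>w : p \<rightarrow> r\<close>;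
  \<open>rres C p q r v w\<close> is \<open>v \<searrow> w : p \<rightarrow> q\<close> for \<open>v : q \<rightarrow> r\<close>, \<open>w : p \<rightarrow> r\<close>.
\<close>

definition lres :: "('o, 'a) quantaloid_data \<Rightarrow> 'o \<Rightarrow> 'o \<Rightarrow> 'o \<Rightarrow> 'a \<Rightarrow> 'a \<Rightarrow> 'a" where
  "lres C p q r w u =
     (THE x. x \<in> arr C q r \<and>
        (\<forall>v\<in>arr C q r. Cmp C p q r v u \<sqsubseteq>\<^bsub>Hom C p r\<^esub> w \<longleftrightarrow> v \<sqsubseteq>\<^bsub>Hom C q r\<^esub> x))"

definition rres :: "('o, 'a) quantaloid_data \<Rightarrow> 'o \<Rightarrow> 'o \<Rightarrow> 'o \<Rightarrow> 'a \<Rightarrow> 'a \<Rightarrow> 'a" where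
  "rres C p q r v w =
     (THE x. x \<in> arr C p q \<and>
        (\<forall>u\<in>arr C p q. Cmp C p q r v u \<sqsubseteq>\<^bsub>Hom C p r\<^esub> w \<longleftrightarrow> u \<sqsubseteq>\<^bsub>Hom C p q\<^esub> x))"

definition girard_quantaloid :: "('o, 'a) quantaloid_data \<Rightarrow> ('o \<Rightarrow> 'a) \<Rightarrow> bool" where
  "girard_quantaloid Q d \<longleftrightarrow>
     quantaloid Q \<and>
     (\<forall>q\<in>Obj Q. d q \<in> arr Q q q) \<and>
     (\<forall>p\<in>Obj Q. \<forall>q\<in>Obj Q. \<forall>u\<in>arr Q p q.
        lres Q p q p (d p) u = rres Q q p q u (d q) \<and>
        rres Q p q p (lres Q p q p (d p) u) (d p) = u \<and>
        lres Q q p q (d q) (rres Q q p q u (d q)) = u)"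

definition op_quantaloid :: "('o, 'a) quantaloid_data \<Rightarrow> ('o, 'a) quantaloid_data" where
  "op_quantaloid C =
     \<lparr>Obj = Obj C, Hom = (\<lambda>p q. Hom C q p), Cmp = (\<lambda>p q r v u. Cmp C r q p u v), Idn = Idn C\<rparr>"

text \<open>
  Quotient by a congruence \<open>R\<close>. Since \<open>R\<close> is compatible with joins, the class of a join is the join
  of the classes, whence \<open>[f] \<le> [g]\<close> iff \<open>[f \<or> g] = [g]\<close>.
\<close>

definition quotient_quantaloid ::
  "('o, 'a) quantaloid_data \<Rightarrow> ('o \<Rightarrow> 'o \<Rightarrow> 'a rel) \<Rightarrow> ('o, 'a set) quantaloid_data" where
  "quotient_quantaloid C R =
     \<lparr>Obj = Obj C,
      Hom = (\<lambda>p q. \<lparr>carrier = arr C p q // R p q, eq = (=),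
                    le = (\<lambda>F G. \<exists>f\<in>F. \<exists>g\<in>G. f \<squnion>\<^bsub>Hom C p q\<^esub> g \<in> G)\<rparr>),
      Cmp = (\<lambda>p q r G F. \<Union>f\<in>F. \<Union>g\<in>G. R p r `` {Cmp C p q r g f}),
      Idn = (\<lambda>p. R p p `` {Idn C p})\<rparr>"

section \<open>Homomorphisms and equivalences of quantaloids\<close>

definition is_functor ::
  "('o, 'a) quantaloid_data \<Rightarrow> ('p, 'b) quantaloid_data \<Rightarrow>
   ('o \<Rightarrow> 'p) \<Rightarrow> ('o \<Rightarrow> 'o \<Rightarrow> 'a \<Rightarrow> 'b) \<Rightarrow> bool" where
  "is_functor C D Fo Fa \<longleftrightarrow>
     (\<forall>p\<in>Obj C. Fo p \<in> Obj D) \<and>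
     (\<forall>p\<in>Obj C. \<forall>q\<in>Obj C. \<forall>u\<in>arr C p q. Fa p q u \<in> arr D (Fo p) (Fo q)) \<and>
     (\<forall>p\<in>Obj C. Fa p p (Idn C p) = Idn D (Fo p)) \<and>
     (\<forall>p\<in>Obj C. \<forall>q\<in>Obj C. \<forall>r\<in>Obj C. \<forall>u\<in>arr C p q. \<forall>v\<in>arr C q r.
        Fa p r (Cmp C p q r v u) = Cmp D (Fo p) (Fo q) (Fo r) (Fa q r v) (Fa p q u))"

definition is_iso :: "('o, 'a) quantaloid_data \<Rightarrow> 'o \<Rightarrow> 'o \<Rightarrow> 'a \<Rightarrow> bool" where
  "is_iso C p q u \<longleftrightarrow>
     u \<in> arr C p q \<and> (\<exists>v\<in>arr C q p. Cmp C p q p v u = Idn C p \<and> Cmp C q p q u v = Idn C q)"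

definition natural_iso ::
  "('o, 'a) quantaloid_data \<Rightarrow> ('p, 'b) quantaloid_data \<Rightarrow>
   ('o \<Rightarrow> 'p) \<Rightarrow> ('o \<Rightarrow> 'o \<Rightarrow> 'a \<Rightarrow> 'b) \<Rightarrow> ('o \<Rightarrow> 'p) \<Rightarrow> ('o \<Rightarrow> 'o \<Rightarrow> 'a \<Rightarrow> 'b) \<Rightarrow>
   ('o \<Rightarrow> 'b) \<Rightarrow> bool" where
  "natural_iso C D Fo Fa Go Ga \<eta> \<longleftrightarrow>
     (\<forall>p\<in>Obj C. is_iso D (Fo p) (Go p) (\<eta> p)) \<and>
     (\<forall>p\<in>Obj C. \<forall>q\<in>Obj C. \<forall>u\<in>arr C p q.
        Cmp D (Fo p) (Fo q) (Go q) (\<eta> q) (Fa p q u) =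
        Cmp D (Fo p) (Go p) (Go q) (Ga p q u) (\<eta> p))"

definition category_equivalence ::
  "('o, 'a) quantaloid_data \<Rightarrow> ('p, 'b) quantaloid_data \<Rightarrow>
   ('o \<Rightarrow> 'p) \<Rightarrow> ('o \<Rightarrow> 'o \<Rightarrow> 'a \<Rightarrow> 'b) \<Rightarrow> bool" where
  "category_equivalence C D Fo Fa \<longleftrightarrow>
     is_functor C D Fo Fa \<and>
     (\<exists>Go Ga. is_functor D C Go Ga \<and>
        (\<exists>\<eta>. natural_iso C C (\<lambda>p. p) (\<lambda>p q u. u)
               (\<lambda>p. Go (Fo p)) (\<lambda>p q u. Ga (Fo p) (Fo q) (Fa p q u)) \<eta>) \<and>
        (\<exists>\<epsilon>. natural_iso D D (\<lambda>p. Fo (Go p)) (\<lambda>p q u. Fa (Go p) (Go q) (Ga p q u))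
               (\<lambda>p. p) (\<lambda>p q u. u) \<epsilon>))"

definition quantaloid_hom ::
  "('o, 'a) quantaloid_data \<Rightarrow> ('p, 'b) quantaloid_data \<Rightarrow>
   ('o \<Rightarrow> 'p) \<Rightarrow> ('o \<Rightarrow> 'o \<Rightarrow> 'a \<Rightarrow> 'b) \<Rightarrow> bool" where
  "quantaloid_hom C D Fo Fa \<longleftrightarrow>
     quantaloid C \<and> quantaloid D \<and> is_functor C D Fo Fa \<and>
     (\<forall>p\<in>Obj C. \<forall>q\<in>Obj C. \<forall>V \<subseteq> arr C p q.
        Fa p q (\<Squnion>\<^bsub>Hom C p q\<^esub> V) = \<Squnion>\<^bsub>Hom D (Fo p) (Fo q)\<^esub> (Fa p q ` V))"

definition quantaloid_equiv ::
  "('o, 'a) quantaloid_data \<Rightarrow> ('p, 'b) quantaloid_data \<Rightarrow> bool" (infix "\<simeq>\<^sub>q" 50) where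
  "C \<simeq>\<^sub>q D \<longleftrightarrow> (\<exists>Fo Fa. quantaloid_hom C D Fo Fa \<and> category_equivalence C D Fo Fa)"

section \<open>The constructions \<open>D\<close> and \<open>B\<close>\<close>

text \<open>An object \<open>(p, q, u)\<close> stands for the arrow \<open>u : p \<rightarrow> q\<close>.\<close>

definition Arrows :: "('o, 'a) quantaloid_data \<Rightarrow> ('o \<times> 'o \<times> 'a) set" where
  "Arrows C = {(p, q, u). p \<in> Obj C \<and> q \<in> Obj C \<and> u \<in> arr C p q}"

definition componentwise_quantaloid ::
  "('o, 'a) quantaloid_data \<Rightarrow> ('o \<times> 'o \<times> 'a \<Rightarrow> 'o \<times> 'o \<times> 'a \<Rightarrow> ('a \<times> 'a) set) \<Rightarrow>
   ('o \<times> 'o \<times> 'a, 'a \<times> 'a) quantaloid_data" where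
  "componentwise_quantaloid C H =
     \<lparr>Obj = Arrows C,
      Hom = (\<lambda>(p, q, u) (p', q', v).
        \<lparr>carrier = H (p, q, u) (p', q', v), eq = (=),
         le = (\<lambda>(s, t) (s', t'). s \<sqsubseteq>\<^bsub>Hom C p p'\<^esub> s' \<and> t \<sqsubseteq>\<^bsub>Hom C q q'\<^esub> t')\<rparr>),
      Cmp = (\<lambda>(p, q, u) (p', q', v) (p'', q'', w) (s', t') (s, t).
        (Cmp C p p' p'' s' s, Cmp C q q' q'' t' t)),
      Idn = (\<lambda>(p, q, u). (Idn C p, Idn C q))\<rparr>"

definition Arr_quantaloid ::
  "('o, 'a) quantaloid_data \<Rightarrow> ('o \<times> 'o \<times> 'a, 'a \<times> 'a) quantaloid_data" where
  "Arr_quantaloid C = componentwise_quantaloid C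
     (\<lambda>(p, q, u) (p', q', v).
        {(s, t) \<in> arr C p p' \<times> arr C q q'. Cmp C p p' q' v s = Cmp C p q q' t u})"

definition ChuCon_quantaloid ::
  "('o, 'a) quantaloid_data \<Rightarrow> ('o \<times> 'o \<times> 'a, 'a \<times> 'a) quantaloid_data" where
  "ChuCon_quantaloid C = componentwise_quantaloid C
     (\<lambda>(p, q, u) (p', q', v).
        {(s, t) \<in> arr C p p' \<times> arr C q q'. lres C p p' q u s = rres C p' q q' t v})"

definition D_quantaloid ::
  "('o, 'a) quantaloid_data \<Rightarrow> ('o \<times> 'o \<times> 'a, ('a \<times> 'a) set) quantaloid_data" where
  "D_quantaloid C = quotient_quantaloid (Arr_quantaloid C)
     (\<lambda>(p, q, u) (p', q', v).
        {((s, t), (s', t')).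
           (s, t) \<in> arr (Arr_quantaloid C) (p, q, u) (p', q', v) \<and>
           (s', t') \<in> arr (Arr_quantaloid C) (p, q, u) (p', q', v) \<and>
           Cmp C p p' q' v s = Cmp C p p' q' v s'})"

definition B_quantaloid ::
  "('o, 'a) quantaloid_data \<Rightarrow> ('o \<times> 'o \<times> 'a, ('a \<times> 'a) set) quantaloid_data" where
  "B_quantaloid C = quotient_quantaloid (ChuCon_quantaloid C)
     (\<lambda>(p, q, u) (p', q', v).
        {((s, t), (s', t')).
           (s, t) \<in> arr (ChuCon_quantaloid C) (p, q, u) (p', q', v) \<and>
           (s', t') \<in> arr (ChuCon_quantaloid C) (p, q, u) (p', q', v) \<and>
           lres C p p' q u s = lres C p p' q u s'})"

section \<open>\<open>Q\<close>-categories\<close>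

text \<open>
  The components \<open>ty\<close> (the type map) and \<open>hm\<close> (the hom-arrows), like all distributors and functors
  below, are extensional functions, so that HOL equality is equality of the mathematical objects.
\<close>

record ('x, 'o, 'a) qcat_data =
  pts :: "'x set"
  ty :: "'x \<Rightarrow> 'o"
  hm :: "'x \<Rightarrow> 'x \<Rightarrow> 'a"

definition qcat :: "('o, 'a) quantaloid_data \<Rightarrow> ('x, 'o, 'a) qcat_data \<Rightarrow> bool" where
  "qcat Q X \<longleftrightarrow>
     ty X \<in> pts X \<rightarrow>\<^sub>E Obj Q \<and>
     hm X \<in> (\<Pi>\<^sub>E x\<in>pts X. \<Pi>\<^sub>E y\<in>pts X. arr Q (ty X x) (ty X y)) \<and>
     (\<forall>x\<in>pts X. Idn Q (ty X x) \<sqsubseteq>\<^bsub>Hom Q (ty X x) (ty X x)\<^esub> hm X x x) \<and>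
     (\<forall>x\<in>pts X. \<forall>y\<in>pts X. \<forall>z\<in>pts X.
        Cmp Q (ty X x) (ty X y) (ty X z) (hm X y z) (hm X x y)
          \<sqsubseteq>\<^bsub>Hom Q (ty X x) (ty X z)\<^esub> hm X x z)"

definition small_qcat :: "'v set \<Rightarrow> ('o, 'a) quantaloid_data \<Rightarrow> ('v, 'o, 'a) qcat_data \<Rightarrow> bool" where
  "small_qcat U Q X \<longleftrightarrow> qcat Q X \<and> pts X \<subseteq> U \<and> small U (pts X)"

definition under_le ::
  "('o, 'a) quantaloid_data \<Rightarrow> ('x, 'o, 'a) qcat_data \<Rightarrow> 'x \<Rightarrow> 'x \<Rightarrow> bool" where
  "under_le Q X x y \<longleftrightarrow>
     ty X x = ty X y \<and> Idn Q (ty X x) \<sqsubseteq>\<^bsub>Hom Q (ty X x) (ty X y)\<^esub> hm X x y"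

definition separated :: "('o, 'a) quantaloid_data \<Rightarrow> ('x, 'o, 'a) qcat_data \<Rightarrow> bool" where
  "separated Q X \<longleftrightarrow>
     (\<forall>x\<in>pts X. \<forall>y\<in>pts X. under_le Q X x y \<and> under_le Q X y x \<longrightarrow> x = y)"

definition qfunctors ::
  "('o, 'a) quantaloid_data \<Rightarrow> ('x, 'o, 'a) qcat_data \<Rightarrow> ('y, 'o, 'a) qcat_data \<Rightarrow> ('x \<Rightarrow> 'y) set" where
  "qfunctors Q X Y =
     {f \<in> pts X \<rightarrow>\<^sub>E pts Y.
        (\<forall>x\<in>pts X. ty Y (f x) = ty X x) \<and>
        (\<forall>x\<in>pts X. \<forall>y\<in>pts X. hm X x y \<sqsubseteq>\<^bsub>Hom Q (ty X x) (ty X y)\<^esub> hm Y (f x) (f y))}"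

definition pointwise_le ::
  "('o, 'a) quantaloid_data \<Rightarrow> ('x, 'o, 'a) qcat_data \<Rightarrow> ('y, 'o, 'a) qcat_data \<Rightarrow>
   ('x \<Rightarrow> 'y) \<Rightarrow> ('x \<Rightarrow> 'y) \<Rightarrow> bool" where
  "pointwise_le Q X Y f g \<longleftrightarrow> (\<forall>x\<in>pts X. under_le Q Y (f x) (g x))"

text \<open>\<open>f \<stileturn> g\<close> for \<open>Q\<close>-functors \<open>f : X \<rightarrow> Y\<close> and \<open>g : Y \<rightarrow> X\<close>.\<close>

definition adjoint ::
  "('o, 'a) quantaloid_data \<Rightarrow> ('x, 'o, 'a) qcat_data \<Rightarrow> ('y, 'o, 'a) qcat_data \<Rightarrow>
   ('x \<Rightarrow> 'y) \<Rightarrow> ('y \<Rightarrow> 'x) \<Rightarrow> bool" where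
  "adjoint Q X Y f g \<longleftrightarrow>
     f \<in> qfunctors Q X Y \<and> g \<in> qfunctors Q Y X \<and>
     (\<forall>x\<in>pts X. \<forall>y\<in>pts Y. hm Y (f x) y = hm X x (g y))"

section \<open>\<open>Q\<close>-distributors\<close>

definition dists ::
  "('o, 'a) quantaloid_data \<Rightarrow> ('x, 'o, 'a) qcat_data \<Rightarrow> ('y, 'o, 'a) qcat_data \<Rightarrow>
   ('x \<Rightarrow> 'y \<Rightarrow> 'a) set" where
  "dists Q X Y =
     {\<phi> \<in> (\<Pi>\<^sub>E x\<in>pts X. \<Pi>\<^sub>E y\<in>pts Y. arr Q (ty X x) (ty Y y)).
        \<forall>x\<in>pts X. \<forall>x'\<in>pts X. \<forall>y\<in>pts Y. \<forall>y'\<in>pts Y.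
          Cmp Q (ty X x') (ty Y y) (ty Y y') (hm Y y y')
            (Cmp Q (ty X x') (ty X x) (ty Y y) (\<phi> x y) (hm X x' x))
          \<sqsubseteq>\<^bsub>Hom Q (ty X x') (ty Y y')\<^esub> \<phi> x' y'}"

definition dist_le ::
  "('o, 'a) quantaloid_data \<Rightarrow> ('x, 'o, 'a) qcat_data \<Rightarrow> ('y, 'o, 'a) qcat_data \<Rightarrow>
   ('x \<Rightarrow> 'y \<Rightarrow> 'a) \<Rightarrow> ('x \<Rightarrow> 'y \<Rightarrow> 'a) \<Rightarrow> bool" where
  "dist_le Q X Y \<phi> \<psi> \<longleftrightarrow>
     (\<forall>x\<in>pts X. \<forall>y\<in>pts Y. \<phi> x y \<sqsubseteq>\<^bsub>Hom Q (ty X x) (ty Y y)\<^esub> \<psi> x y)"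

definition dist_comp ::
  "('o, 'a) quantaloid_data \<Rightarrow> ('x, 'o, 'a) qcat_data \<Rightarrow> ('y, 'o, 'a) qcat_data \<Rightarrow>
   ('z, 'o, 'a) qcat_data \<Rightarrow> ('y \<Rightarrow> 'z \<Rightarrow> 'a) \<Rightarrow> ('x \<Rightarrow> 'y \<Rightarrow> 'a) \<Rightarrow> 'x \<Rightarrow> 'z \<Rightarrow> 'a" where
  "dist_comp Q X Y Z \<psi> \<phi> =
     (\<lambda>x\<in>pts X. \<lambda>z\<in>pts Z. \<Squnion>\<^bsub>Hom Q (ty X x) (ty Z z)\<^esub>
        ((\<lambda>y. Cmp Q (ty X x) (ty Y y) (ty Z z) (\<psi> y z) (\<phi> x y)) ` pts Y))"

text \<open>\<open>\<xi> \<swarrow> \<phi>\<close> for \<open>\<phi>\<close> from \<open>X\<close> to \<open>Y\<close> and \<open>\<xi>\<close> from \<open>X\<close> to \<open>Z\<close>.\<close>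

definition dist_lres ::
  "('o, 'a) quantaloid_data \<Rightarrow> ('x, 'o, 'a) qcat_data \<Rightarrow> ('y, 'o, 'a) qcat_data \<Rightarrow>
   ('z, 'o, 'a) qcat_data \<Rightarrow> ('x \<Rightarrow> 'z \<Rightarrow> 'a) \<Rightarrow> ('x \<Rightarrow> 'y \<Rightarrow> 'a) \<Rightarrow> 'y \<Rightarrow> 'z \<Rightarrow> 'a" where
  "dist_lres Q X Y Z \<xi> \<phi> =
     (\<lambda>y\<in>pts Y. \<lambda>z\<in>pts Z. \<Sqinter>\<^bsub>Hom Q (ty Y y) (ty Z z)\<^esub>
        ((\<lambda>x. lres Q (ty X x) (ty Y y) (ty Z z) (\<xi> x z) (\<phi> x y)) ` pts X))"

definition QDist ::
  "'v set \<Rightarrow> ('o, 'a) quantaloid_data \<Rightarrow> (('v, 'o, 'a) qcat_data, 'v \<Rightarrow> 'v \<Rightarrow> 'a) quantaloid_data" where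
  "QDist U Q =
     \<lparr>Obj = {X. small_qcat U Q X},
      Hom = (\<lambda>X Y. \<lparr>carrier = dists Q X Y, eq = (=), le = dist_le Q X Y\<rparr>),
      Cmp = dist_comp Q,
      Idn = hm\<rparr>"

section \<open>Presheaves\<close>

definition singleton_qcat :: "('o, 'a) quantaloid_data \<Rightarrow> 'o \<Rightarrow> (unit, 'o, 'a) qcat_data" where
  "singleton_qcat Q q = \<lparr>pts = {()}, ty = (\<lambda>_. q), hm = (\<lambda>_ _. Idn Q q)\<rparr>"

text \<open>A presheaf is a pair \<open>(q, \<mu>)\<close> of its type and a distributor \<open>\<mu>\<close> from \<open>X\<close> to \<open>{q}\<close>.\<close>

type_synonym ('x, 'o, 'a) presheaf = "'o \<times> ('x \<Rightarrow> unit \<Rightarrow> 'a)"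

definition presheaves ::
  "('o, 'a) quantaloid_data \<Rightarrow> ('x, 'o, 'a) qcat_data \<Rightarrow> ('x, 'o, 'a) presheaf set" where
  "presheaves Q X = (SIGMA q:Obj Q. dists Q X (singleton_qcat Q q))"

definition P ::
  "('o, 'a) quantaloid_data \<Rightarrow> ('x, 'o, 'a) qcat_data \<Rightarrow>
   (('x, 'o, 'a) presheaf, 'o, 'a) qcat_data" where
  "P Q X =
     \<lparr>pts = presheaves Q X,
      ty = restrict fst (presheaves Q X),
      hm = (\<lambda>m\<in>presheaves Q X. \<lambda>m'\<in>presheaves Q X.
        dist_lres Q X (singleton_qcat Q (fst m)) (singleton_qcat Q (fst m')) (snd m') (snd m) () ())\<rparr>"

text \<open>The presheaf \<open>\<zeta>(-, y)\<close> for a distributor \<open>\<zeta>\<close> from \<open>X\<close> to \<open>Y\<close>.\<close>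

definition column ::
  "('x, 'o, 'a) qcat_data \<Rightarrow> ('y, 'o, 'a) qcat_data \<Rightarrow> ('x \<Rightarrow> 'y \<Rightarrow> 'a) \<Rightarrow> 'y \<Rightarrow>
   ('x, 'o, 'a) presheaf" where
  "column X Y \<zeta> y = (ty Y y, \<lambda>x\<in>pts X. \<lambda>_. \<zeta> x y)"

definition yoneda :: "('x, 'o, 'a) qcat_data \<Rightarrow> 'x \<Rightarrow> ('x, 'o, 'a) presheaf" where
  "yoneda X = restrict (column X X (hm X)) (pts X)"

text \<open>The map \<open>\<zeta>\<^sup>*\<close> from presheaves on \<open>Y\<close> to presheaves on \<open>X\<close>.\<close>

definition pull ::
  "('o, 'a) quantaloid_data \<Rightarrow> ('x, 'o, 'a) qcat_data \<Rightarrow> ('y, 'o, 'a) qcat_data \<Rightarrow>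
   ('x \<Rightarrow> 'y \<Rightarrow> 'a) \<Rightarrow> ('y, 'o, 'a) presheaf \<Rightarrow> ('x, 'o, 'a) presheaf" where
  "pull Q X Y \<zeta> =
     (\<lambda>l\<in>presheaves Q Y. (fst l, dist_comp Q X Y (singleton_qcat Q (fst l)) (snd l) \<zeta>))"

section \<open>Interior and closure spaces\<close>

type_synonym ('x, 'o, 'a) space =
  "('x, 'o, 'a) qcat_data \<times> (('x, 'o, 'a) presheaf \<Rightarrow> ('x, 'o, 'a) presheaf)"

definition interior_space ::
  "'v set \<Rightarrow> ('o, 'a) quantaloid_data \<Rightarrow> ('v, 'o, 'a) space \<Rightarrow> bool" where
  "interior_space U Q = (\<lambda>(X, a).
     small_qcat U Q X \<and> a \<in> qfunctors Q (P Q X) (P Q X) \<and>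
     pointwise_le Q (P Q X) (P Q X) a (\<lambda>m. m) \<and>
     (\<forall>m\<in>presheaves Q X. a (a m) = a m))"

definition closure_space ::
  "'v set \<Rightarrow> ('o, 'a) quantaloid_data \<Rightarrow> ('v, 'o, 'a) space \<Rightarrow> bool" where
  "closure_space U Q = (\<lambda>(X, c).
     small_qcat U Q X \<and> c \<in> qfunctors Q (P Q X) (P Q X) \<and>
     pointwise_le Q (P Q X) (P Q X) (\<lambda>m. m) c \<and>
     (\<forall>m\<in>presheaves Q X. c (c m) = c m))"

definition continuous_dists ::
  "('o, 'a) quantaloid_data \<Rightarrow> ('x, 'o, 'a) space \<Rightarrow> ('x, 'o, 'a) space \<Rightarrow> ('x \<Rightarrow> 'x \<Rightarrow> 'a) set" where
  "continuous_dists Q = (\<lambda>(X, a) (Y, b).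
     {\<zeta> \<in> dists Q X Y.
        pointwise_le Q (P Q Y) (P Q X) (\<lambda>l. pull Q X Y \<zeta> (b l)) (\<lambda>l. a (pull Q X Y \<zeta> l))})"

definition IntDist ::
  "'v set \<Rightarrow> ('o, 'a) quantaloid_data \<Rightarrow> (('v, 'o, 'a) space, 'v \<Rightarrow> 'v \<Rightarrow> 'a) quantaloid_data" where
  "IntDist U Q =
     \<lparr>Obj = {S. interior_space U Q S},
      Hom = (\<lambda>S T. \<lparr>carrier = continuous_dists Q S T, eq = (=), le = dist_le Q (fst S) (fst T)\<rparr>),
      Cmp = (\<lambda>S T V. dist_comp Q (fst S) (fst T) (fst V)),
      Idn = (\<lambda>S. hm (fst S))\<rparr>"

definition IntDist_o ::
  "'v set \<Rightarrow> ('o, 'a) quantaloid_data \<Rightarrow>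
   (('v, 'o, 'a) space, ('v \<Rightarrow> 'v \<Rightarrow> 'a) set) quantaloid_data" where
  "IntDist_o U Q = quotient_quantaloid (IntDist U Q)
     (\<lambda>(X, a) (Y, b).
        {(\<zeta>, \<zeta>'). \<zeta> \<in> continuous_dists Q (X, a) (Y, b) \<and> \<zeta>' \<in> continuous_dists Q (X, a) (Y, b) \<and>
           (\<forall>l\<in>presheaves Q Y. pull Q X Y \<zeta> (b l) = pull Q X Y \<zeta>' (b l))})"

definition cl ::
  "('x, 'o, 'a) space \<Rightarrow> ('x, 'o, 'a) space \<Rightarrow> ('x \<Rightarrow> 'x \<Rightarrow> 'a) \<Rightarrow> 'x \<Rightarrow> 'x \<Rightarrow> 'a" where
  "cl = (\<lambda>(X, c) (Y, d) \<zeta>. \<lambda>x\<in>pts X. \<lambda>y\<in>pts Y. snd (c (column X Y \<zeta> y)) x ())"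

definition ClsDist_cl ::
  "'v set \<Rightarrow> ('o, 'a) quantaloid_data \<Rightarrow> (('v, 'o, 'a) space, 'v \<Rightarrow> 'v \<Rightarrow> 'a) quantaloid_data" where
  "ClsDist_cl U Q =
     \<lparr>Obj = {S. closure_space U Q S},
      Hom = (\<lambda>S T. \<lparr>carrier = {\<zeta> \<in> continuous_dists Q S T. cl S T \<zeta> = \<zeta>}, eq = (=),
                    le = dist_le Q (fst S) (fst T)\<rparr>),
      Cmp = (\<lambda>S T V \<eta> \<zeta>. cl S V (dist_comp Q (fst S) (fst T) (fst V) \<eta> \<zeta>)),
      Idn = (\<lambda>S. cl S S (hm (fst S)))\<rparr>"

section \<open>Complete \<open>Q\<close>-categories\<close>

definition complete_qcat :: "('o, 'a) quantaloid_data \<Rightarrow> ('x, 'o, 'a) qcat_data \<Rightarrow> bool" where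
  "complete_qcat Q X \<longleftrightarrow> (\<exists>s. adjoint Q (P Q X) X s (yoneda X))"

definition QSup ::
  "'v set \<Rightarrow> ('o, 'a) quantaloid_data \<Rightarrow> (('v, 'o, 'a) qcat_data, 'v \<Rightarrow> 'v) quantaloid_data" where
  "QSup U Q =
     \<lparr>Obj = {X. small_qcat U Q X \<and> separated Q X \<and> complete_qcat Q X},
      Hom = (\<lambda>X Y. \<lparr>carrier = {f. \<exists>g. adjoint Q X Y f g}, eq = (=), le = pointwise_le Q X Y\<rparr>),
      Cmp = (\<lambda>X Y Z g f. compose (pts X) g f),
      Idn = (\<lambda>X. restrict (\<lambda>x. x) (pts X))\<rparr>"

end

theory Submission
  imports Defs
begin

text \<open>
  All five quantaloids are compared with one. For \<open>C = Q\<close>-\<open>Dist\<close>, an arrow \<open>(s, t)\<close> of \<open>D(C)\<close> from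
  \<open>u : p \<rightarrow> q\<close> to \<open>v : p' \<rightarrow> q'\<close> is determined by its diagonal \<open>v \<circ> s = t \<circ> u : p \<rightarrow> q'\<close>, so \<open>D(C)\<close> is
  equivalent to a quantaloid whose arrows are those arrows of \<open>C\<close> that factor both through \<open>v\<close> and
  through \<open>u\<close>. The dualizing family of \<open>Q\<close> gives a pointwise negation \<open>\<not>\<close> on \<open>C\<close> with
  \<open>w \<swarrow> u = \<not>(u \<circ> \<not>w)\<close> and \<open>v \<searrow> w = \<not>(\<not>w \<circ> v)\<close>. The other four map to it as follows, fully and,
  after passing to the respective quotient, faithfully:
  \<^item> \<open>B(C)\<close>: \<open>u \<mapsto> \<not>u\<close>, since \<open>u \<swarrow> s = t \<searrow> v\<close> says \<open>s \<circ> \<not>u = \<not>v \<circ> t\<close>;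
  \<^item> interior spaces: \<open>(X, a)\<close> goes to the evaluation \<open>(x, \<mu>) \<mapsto> \<mu>(x)\<close> from \<open>X\<close> to the
    fixed points of \<open>a\<close>;
  \<^item> closure spaces: \<open>(X, c)\<close> goes to the negated evaluation from the fixed points of \<open>c\<close> to \<open>X\<close>;
  \<^item> complete \<open>Q\<close>-categories: \<open>A\<close> goes to the negation of its identity distributor, and a left adjoint
    to its negated graph.
\<close>

section \<open>Joins in complete lattices\<close>

text \<open>Using one common target means that only functors into it are ever checked; the inverse
  functors are chosen once, abstractly. It also spares a separate proof that each quotient is a
  quantaloid: category laws, completeness and distributivity are pulled back along bijective order
  embeddings of hom-sets. Each comparison then rests on one fact: the condition on morphisms
  (continuity, being a left adjoint) says that a certain square of distributors exists. Interior
  operators are built from joins, so composites suffice for them; closure operators and suprema are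
  described by meets of residuals, and negation turns these into composites. The set-theoretic
  obstacle is that the fixed points of an operator are presheaves and yet must again form an object
  of the quantaloid of distributors: strong inaccessibility keeps the set of presheaves small, and a
  chosen injection into \<open>U\<close> supplies points of the required type.\<close>

lemma partial_orderI:
  assumes "eq L = (=)"
    and "\<And>x. x \<in> carrier L \<Longrightarrow> le L x x"
    and "\<And>x y. \<lbrakk>x \<in> carrier L; y \<in> carrier L; le L x y; le L y x\<rbrakk> \<Longrightarrow> x = y"
    and "\<And>x y z. \<lbrakk>x \<in> carrier L; y \<in> carrier L; z \<in> carrier L; le L x y; le L y z\<rbrakk> \<Longrightarrow> le L x z"
  shows "partial_order L"
proof
  show "x .=\<^bsub>L\<^esub> x" if "x \<in> carrier L" for x using assms(1) by simp
  show "y .=\<^bsub>L\<^esub> x" if "x .=\<^bsub>L\<^esub> y" for x y using assms(1) that by simp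
  show "x .=\<^bsub>L\<^esub> z" if "x .=\<^bsub>L\<^esub> y" "y .=\<^bsub>L\<^esub> z" for x y z using assms(1) that by simp
  show "x .=\<^bsub>L\<^esub> y" if "le L x y" "le L y x" "x \<in> carrier L" "y \<in> carrier L" for x y
    using assms(1,3) that by simp
  show "(.=\<^bsub>L\<^esub>) = (=)" by (rule assms(1))
  show "le L x x" if "x \<in> carrier L" for x by (rule assms(2)[OF that])
  show "le L x z" if "le L x y" "le L y z" "x \<in> carrier L" "y \<in> carrier L" "z \<in> carrier L" for x y z
    by (rule assms(4)[OF that(3-5,1,2)])
  show "le L x z \<longleftrightarrow> le L y w" if "x .=\<^bsub>L\<^esub> y" "z .=\<^bsub>L\<^esub> w" for x y z w
    using that assms(1) by simp
qed

text \<open>A relation instead of the operator \<open>\<Squnion>\<close>: the operator is a choice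
  with no useful value until a join is known to exist, whereas the relation can be moved along order
  isomorphisms beforehand.\<close>

definition join_of :: "'a gorder \<Rightarrow> 'a set \<Rightarrow> 'a \<Rightarrow> bool" where
  "join_of L A s \<longleftrightarrow> s \<in> carrier L \<and> (\<forall>a\<in>A. le L a s) \<and>
     (\<forall>z\<in>carrier L. (\<forall>a\<in>A. le L a z) \<longrightarrow> le L s z)"

lemma least_Upper_iff: "A \<subseteq> carrier L \<Longrightarrow> least L s (Upper L A) \<longleftrightarrow> join_of L A s"
  unfolding least_def Upper_def join_of_def by blast

lemma partial_order_antisym:
  "\<lbrakk>partial_order L; x \<in> carrier L; y \<in> carrier L; le L x y; le L y x\<rbrakk> \<Longrightarrow> x = y"
  by (rule partial_order.le_antisym)

lemma join_of_unique: "\<lbrakk>partial_order L; join_of L A s; join_of L A t\<rbrakk> \<Longrightarrow> s = t"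
  unfolding join_of_def by (meson partial_order_antisym)

lemma sup_eqI:
  assumes "partial_order L" "A \<subseteq> carrier L" "join_of L A s"
  shows "\<Squnion>\<^bsub>L\<^esub> A = s"
  unfolding Lattice.sup_def least_Upper_iff[OF assms(2)]
  using assms(3) by (rule some_equality) (rule join_of_unique[OF assms(1) _ assms(3)])

lemma join_eqI:
  assumes "partial_order L" "x \<in> carrier L" "y \<in> carrier L" "join_of L {x, y} s"
  shows "x \<squnion>\<^bsub>L\<^esub> y = s"
  unfolding join_def using assms by (intro sup_eqI) auto

text \<open>Infima come from joins: the infimum of \<open>A\<close> is the join of its set of lower
  bounds, since every element of \<open>A\<close> is an upper bound of that set.\<close>

lemma complete_latticeI:
  assumes L: "partial_order L" and ex: "\<And>A. A \<subseteq> carrier L \<Longrightarrow> \<exists>s. join_of L A s"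
  shows "complete_lattice L"
proof -
  interpret partial_order L by (rule L)
  show ?thesis
  proof
    fix A assume A: "A \<subseteq> carrier L"
    show "\<exists>s. least L s (Upper L A)" using ex[OF A] least_Upper_iff[OF A] by blast
    have "Lower L A \<subseteq> carrier L" by simp
    then obtain s where s: "join_of L (Lower L A) s" using ex by blast
    have "greatest L s (Lower L A)"
      using s A unfolding greatest_def join_of_def Lower_def by blast
    then show "\<exists>i. greatest L i (Lower L A)" ..
  qed
qed

lemma join_of_sup:
  assumes "complete_lattice L" "A \<subseteq> carrier L"
  shows "join_of L A (\<Squnion>\<^bsub>L\<^esub> A)"
proof -
  interpret complete_lattice L by (rule assms)
  obtain s where "join_of L A s" using sup_exists[OF assms(2)] least_Upper_iff[OF assms(2)] by blast
  then show ?thesis using sup_eqI[OF partial_order_axioms assms(2)] by simp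
qed

lemma complete_lattice_po: "complete_lattice L \<Longrightarrow> partial_order L"
  unfolding complete_lattice_def by blast

text \<open>A bijective order embedding matches the upper bounds of \<open>A\<close> with those of
  its image; surjectivity is what brings upper bounds back from \<open>M\<close>.\<close>

lemma join_of_image_iff:
  assumes "bij_betw f (carrier L) (carrier M)"
    and "\<And>x y. \<lbrakk>x \<in> carrier L; y \<in> carrier L\<rbrakk> \<Longrightarrow> le L x y \<longleftrightarrow> le M (f x) (f y)"
    and A: "A \<subseteq> carrier L" and "s \<in> carrier L"
  shows "join_of M (f ` A) (f s) \<longleftrightarrow> join_of L A s"
proof -
  have "carrier M = f ` carrier L" using assms(1) by (simp add: bij_betw_def)
  then show ?thesis
    using assms unfolding join_of_def by (auto simp: subset_iff)
qed

section \<open>Quantaloids\<close>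

text \<open>Stated for an arbitrary join \<open>s\<close> rather than for \<open>\<Squnion>\<close>,
  so that in an instance \<open>s\<close> may be replaced, by uniqueness, with an explicit
  join.\<close>

lemma quantaloidI:
  assumes cat: "category C"
    and po: "\<And>p q. \<lbrakk>p \<in> Obj C; q \<in> Obj C\<rbrakk> \<Longrightarrow> partial_order (Hom C p q)"
    and ex: "\<And>p q V. \<lbrakk>p \<in> Obj C; q \<in> Obj C; V \<subseteq> arr C p q\<rbrakk> \<Longrightarrow> \<exists>s. join_of (Hom C p q) V s"
    and left: "\<And>p q r u V s. \<lbrakk>p \<in> Obj C; q \<in> Obj C; r \<in> Obj C; u \<in> arr C p q; V \<subseteq> arr C q r;
      join_of (Hom C q r) V s\<rbrakk> \<Longrightarrow> join_of (Hom C p r) ((\<lambda>v. Cmp C p q r v u) ` V) (Cmp C p q r s u)"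
    and right: "\<And>p q r v V s. \<lbrakk>p \<in> Obj C; q \<in> Obj C; r \<in> Obj C; v \<in> arr C q r; V \<subseteq> arr C p q;
      join_of (Hom C p q) V s\<rbrakk> \<Longrightarrow> join_of (Hom C p r) ((\<lambda>u. Cmp C p q r v u) ` V) (Cmp C p q r v s)"
  shows "quantaloid C"
proof -
  have cmp: "Cmp C p q r v u \<in> arr C p r"
    if "p \<in> Obj C" "q \<in> Obj C" "r \<in> Obj C" "u \<in> arr C p q" "v \<in> arr C q r" for p q r u v
    using cat that unfolding category_def by blast
  have cl: "complete_lattice (Hom C p q)" if "p \<in> Obj C" "q \<in> Obj C" for p q
    using complete_latticeI[OF po[OF that] ex[OF that]] by blast
  show ?thesis
    unfolding quantaloid_def
  proof (intro conjI ballI allI impI cat cl)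
    fix p q r u V assume *: "p \<in> Obj C" "q \<in> Obj C" "r \<in> Obj C" "u \<in> arr C p q" "V \<subseteq> arr C q r"
    show "Cmp C p q r (\<Squnion>\<^bsub>Hom C q r\<^esub> V) u = \<Squnion>\<^bsub>Hom C p r\<^esub> ((\<lambda>v. Cmp C p q r v u) ` V)"
      using left[OF * join_of_sup[OF cl[OF *(2,3)] *(5)]] * cmp
      by (intro sup_eqI[symmetric] po) auto
  next
    fix p q r v W assume *: "p \<in> Obj C" "q \<in> Obj C" "r \<in> Obj C" "v \<in> arr C q r" "W \<subseteq> arr C p q"
    show "Cmp C p q r v (\<Squnion>\<^bsub>Hom C p q\<^esub> W) = \<Squnion>\<^bsub>Hom C p r\<^esub> ((\<lambda>u. Cmp C p q r v u) ` W)"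
      using right[OF * join_of_sup[OF cl[OF *(1,2)] *(5)]] * cmp
      by (intro sup_eqI[symmetric] po) auto
  qed
qed

locale quantaloid_loc =
  fixes C :: "('o, 'a) quantaloid_data"
  assumes quantaloid: "quantaloid C"
begin

lemma Idn_in [simp, intro]: "p \<in> Obj C \<Longrightarrow> Idn C p \<in> arr C p p"
  using quantaloid unfolding quantaloid_def category_def by simp

lemma Cmp_in [simp, intro]:
  "\<lbrakk>p \<in> Obj C; q \<in> Obj C; r \<in> Obj C; u \<in> arr C p q; v \<in> arr C q r\<rbrakk> \<Longrightarrow> Cmp C p q r v u \<in> arr C p r"
  using quantaloid unfolding quantaloid_def category_def by simp

lemma Cmp_Idn [simp]:
  assumes "p \<in> Obj C" "q \<in> Obj C" "u \<in> arr C p q"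
  shows "Cmp C p p q u (Idn C p) = u" "Cmp C p q q (Idn C q) u = u"
  using quantaloid assms unfolding quantaloid_def category_def by simp_all

lemma Cmp_assoc:
  assumes "p \<in> Obj C" "q \<in> Obj C" "r \<in> Obj C" "s \<in> Obj C" "u \<in> arr C p q" "v \<in> arr C q r" "w \<in> arr C r s"
  shows "Cmp C p r s w (Cmp C p q r v u) = Cmp C p q s (Cmp C q r s w v) u"
  using quantaloid assms unfolding quantaloid_def category_def by (elim conjE) simp

lemma Hom_cl: "\<lbrakk>p \<in> Obj C; q \<in> Obj C\<rbrakk> \<Longrightarrow> complete_lattice (Hom C p q)"
  using quantaloid unfolding quantaloid_def by simp

lemma Hom_po: "\<lbrakk>p \<in> Obj C; q \<in> Obj C\<rbrakk> \<Longrightarrow> partial_order (Hom C p q)"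
  by (simp add: Hom_cl complete_lattice_po)

lemma le_refl [simp, intro]:
  assumes "p \<in> Obj C" "q \<in> Obj C" "u \<in> arr C p q" shows "le (Hom C p q) u u"
proof -
  interpret partial_order "Hom C p q" using assms by (simp add: Hom_po)
  show ?thesis using assms by simp
qed

lemma le_trans:
  assumes "p \<in> Obj C" "q \<in> Obj C" "u \<in> arr C p q" "v \<in> arr C p q" "w \<in> arr C p q"
    "le (Hom C p q) u v" "le (Hom C p q) v w"
  shows "le (Hom C p q) u w"
proof -
  interpret partial_order "Hom C p q" using assms by (simp add: Hom_po)
  show ?thesis using assms local.le_trans by blast
qed

lemma le_antisym:
  assumes "p \<in> Obj C" "q \<in> Obj C" "u \<in> arr C p q" "v \<in> arr C p q"
    "le (Hom C p q) u v" "le (Hom C p q) v u"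
  shows "u = v"
  using assms Hom_po partial_order_antisym by metis

text \<open>Indirect equality. Residuals and hom-arrows of presheaves are known only by what lies
  below them, so this is how they are compared.\<close>

lemma eq_iff:
  assumes "p \<in> Obj C" "q \<in> Obj C" "u \<in> arr C p q" "v \<in> arr C p q"
    "\<And>f. f \<in> arr C p q \<Longrightarrow> le (Hom C p q) f u \<longleftrightarrow> le (Hom C p q) f v"
  shows "u = v"
  using assms le_antisym le_refl by meson

lemma sup_join_of:
  "\<lbrakk>p \<in> Obj C; q \<in> Obj C; V \<subseteq> arr C p q\<rbrakk> \<Longrightarrow> join_of (Hom C p q) V (\<Squnion>\<^bsub>Hom C p q\<^esub> V)"
  by (simp add: Hom_cl join_of_sup)

lemma sup_in [simp, intro]:
  "\<lbrakk>p \<in> Obj C; q \<in> Obj C; V \<subseteq> arr C p q\<rbrakk> \<Longrightarrow> \<Squnion>\<^bsub>Hom C p q\<^esub> V \<in> arr C p q"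
  using sup_join_of unfolding join_of_def by blast

lemma sup_le_iff:
  assumes "p \<in> Obj C" "q \<in> Obj C" "V \<subseteq> arr C p q" "w \<in> arr C p q"
  shows "le (Hom C p q) (\<Squnion>\<^bsub>Hom C p q\<^esub> V) w \<longleftrightarrow> (\<forall>v\<in>V. le (Hom C p q) v w)"
proof -
  note j = sup_join_of[OF assms(1-3), unfolded join_of_def]
  have "le (Hom C p q) v w" if "le (Hom C p q) (\<Squnion>\<^bsub>Hom C p q\<^esub> V) w" "v \<in> V" for v
    using le_trans[OF assms(1,2) _ _ assms(4) _ that(1), of v] j that(2) assms(3) by auto
  with j assms(4) show ?thesis by blast
qed

lemma le_sup:
  "\<lbrakk>p \<in> Obj C; q \<in> Obj C; V \<subseteq> arr C p q; v \<in> V\<rbrakk> \<Longrightarrow> le (Hom C p q) v (\<Squnion>\<^bsub>Hom C p q\<^esub> V)"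
  using sup_join_of unfolding join_of_def by blast

lemma Cmp_sup_left:
  "\<lbrakk>p \<in> Obj C; q \<in> Obj C; r \<in> Obj C; u \<in> arr C p q; V \<subseteq> arr C q r\<rbrakk>
   \<Longrightarrow> Cmp C p q r (\<Squnion>\<^bsub>Hom C q r\<^esub> V) u = \<Squnion>\<^bsub>Hom C p r\<^esub> ((\<lambda>v. Cmp C p q r v u) ` V)"
  using quantaloid unfolding quantaloid_def by simp

lemma Cmp_sup_right:
  "\<lbrakk>p \<in> Obj C; q \<in> Obj C; r \<in> Obj C; v \<in> arr C q r; W \<subseteq> arr C p q\<rbrakk>
   \<Longrightarrow> Cmp C p q r v (\<Squnion>\<^bsub>Hom C p q\<^esub> W) = \<Squnion>\<^bsub>Hom C p r\<^esub> ((\<lambda>u. Cmp C p q r v u) ` W)"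
  using quantaloid unfolding quantaloid_def by simp

lemma Cmp_sup_left_le_iff:
  assumes "p \<in> Obj C" "q \<in> Obj C" "r \<in> Obj C" "u \<in> arr C p q" "V \<subseteq> arr C q r" "w \<in> arr C p r"
  shows "le (Hom C p r) (Cmp C p q r (\<Squnion>\<^bsub>Hom C q r\<^esub> V) u) w \<longleftrightarrow>
    (\<forall>v\<in>V. le (Hom C p r) (Cmp C p q r v u) w)"
  using assms by (subst Cmp_sup_left, simp_all, subst sup_le_iff) auto

lemma Cmp_sup_right_le_iff:
  assumes "p \<in> Obj C" "q \<in> Obj C" "r \<in> Obj C" "v \<in> arr C q r" "W \<subseteq> arr C p q" "w \<in> arr C p r"
  shows "le (Hom C p r) (Cmp C p q r v (\<Squnion>\<^bsub>Hom C p q\<^esub> W)) w \<longleftrightarrow>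
    (\<forall>u\<in>W. le (Hom C p r) (Cmp C p q r v u) w)"
  using assms by (subst Cmp_sup_right, simp_all, subst sup_le_iff) auto

lemma le_iff_sup:
  assumes "p \<in> Obj C" "q \<in> Obj C" "u \<in> arr C p q" "v \<in> arr C p q"
  shows "le (Hom C p q) u v \<longleftrightarrow> \<Squnion>\<^bsub>Hom C p q\<^esub> {u, v} = v"
proof
  assume "le (Hom C p q) u v"
  then show "\<Squnion>\<^bsub>Hom C p q\<^esub> {u, v} = v"
    using assms by (intro sup_eqI) (auto simp: Hom_po join_of_def)
qed (use le_sup[OF assms(1,2), of "{u, v}" u] assms in auto)

text \<open>Monotonicity is the preservation of the binary join of \<open>v\<close> and
  \<open>v'\<close>, which equals \<open>v'\<close> when \<open>v \<le> v'\<close>.\<close>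

lemma Cmp_mono_left:
  assumes "p \<in> Obj C" "q \<in> Obj C" "r \<in> Obj C" "u \<in> arr C p q" "v \<in> arr C q r" "v' \<in> arr C q r"
    "le (Hom C q r) v v'"
  shows "le (Hom C p r) (Cmp C p q r v u) (Cmp C p q r v' u)"
  using Cmp_sup_left_le_iff[OF assms(1-4), of "{v, v'}" "Cmp C p q r v' u"] assms
    le_iff_sup[OF assms(2,3,5,6)] by simp

lemma Cmp_mono_right:
  assumes "p \<in> Obj C" "q \<in> Obj C" "r \<in> Obj C" "v \<in> arr C q r" "u \<in> arr C p q" "u' \<in> arr C p q"
    "le (Hom C p q) u u'"
  shows "le (Hom C p r) (Cmp C p q r v u) (Cmp C p q r v u')"
  using Cmp_sup_right_le_iff[OF assms(1-4), of "{u, u'}" "Cmp C p q r v u'"] assms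
    le_iff_sup[OF assms(1,2,5,6)] by simp

lemma is_iso_Idn: "p \<in> Obj C \<Longrightarrow> is_iso C p p (Idn C p)"
  unfolding is_iso_def by auto

lemma is_iso_inverse:
  assumes "is_iso C p q u"
  obtains v where "v \<in> arr C q p" "Cmp C p q p v u = Idn C p" "Cmp C q p q u v = Idn C q"
    "is_iso C q p v"
  using assms unfolding is_iso_def by auto

lemma is_iso_Cmp:
  assumes o: "p \<in> Obj C" "q \<in> Obj C" "r \<in> Obj C" and u: "is_iso C p q u" and v: "is_iso C q r v"
  shows "is_iso C p r (Cmp C p q r v u)"
proof -
  obtain u' where u': "u' \<in> arr C q p" "Cmp C p q p u' u = Idn C p" "Cmp C q p q u u' = Idn C q"
    using u unfolding is_iso_def by auto
  obtain v' where v': "v' \<in> arr C r q" "Cmp C q r q v' v = Idn C q" "Cmp C r q r v v' = Idn C r"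
    using v unfolding is_iso_def by auto
  have a: "u \<in> arr C p q" "v \<in> arr C q r" using u v unfolding is_iso_def by auto
  have "Cmp C p r p (Cmp C r q p u' v') (Cmp C p q r v u) = Cmp C p q p u' (Cmp C p q q (Cmp C q r q v' v) u)"
    using o a u'(1) v'(1) by (simp add: Cmp_assoc)
  moreover have "Cmp C r p r (Cmp C p q r v u) (Cmp C r q p u' v') = Cmp C r q r v
    (Cmp C r q q (Cmp C q p q u u') v')"
    using o a u'(1) v'(1) by (simp add: Cmp_assoc)
  ultimately show ?thesis
    unfolding is_iso_def using o a u' v' by (auto intro!: bexI[of _ "Cmp C r q p u' v'"])
qed

end

section \<open>Equivalences of quantaloids\<close>

text \<open>The choice-free form of an equivalence. Preservation of joins is not listed because it
  follows: the maps on hom-sets are order isomorphisms.\<close>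

definition weak_equivalence ::
  "('o, 'a) quantaloid_data \<Rightarrow> ('p, 'b) quantaloid_data \<Rightarrow>
   ('o \<Rightarrow> 'p) \<Rightarrow> ('o \<Rightarrow> 'o \<Rightarrow> 'a \<Rightarrow> 'b) \<Rightarrow> bool" where
  "weak_equivalence C E Fo Fa \<longleftrightarrow>
     quantaloid C \<and> quantaloid E \<and> is_functor C E Fo Fa \<and>
     (\<forall>p\<in>Obj C. \<forall>q\<in>Obj C. bij_betw (Fa p q) (arr C p q) (arr E (Fo p) (Fo q)) \<and>
        (\<forall>u\<in>arr C p q. \<forall>v\<in>arr C p q.
           le (Hom C p q) u v \<longleftrightarrow> le (Hom E (Fo p) (Fo q)) (Fa p q u) (Fa p q v))) \<and>
     (\<forall>x\<in>Obj E. \<exists>p\<in>Obj C. \<exists>w. is_iso E (Fo p) x w)"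

text \<open>That \<open>C\<close> is a quantaloid is part of the conclusion. Each law of
  \<open>C\<close> holds because its image under the injective \<open>Fa\<close> holds in
  \<open>E\<close>, and a join in a hom-set of \<open>C\<close> is the preimage of the join of the
  image.\<close>

lemma weak_equivalenceI:
  assumes E: "quantaloid E"
    and obj: "\<And>p. p \<in> Obj C \<Longrightarrow> Fo p \<in> Obj E"
    and eqs: "\<And>p q. \<lbrakk>p \<in> Obj C; q \<in> Obj C\<rbrakk> \<Longrightarrow> eq (Hom C p q) = (=)"
    and idn: "\<And>p. p \<in> Obj C \<Longrightarrow> Idn C p \<in> arr C p p \<and> Fa p p (Idn C p) = Idn E (Fo p)"
    and cmp: "\<And>p q r u v. \<lbrakk>p \<in> Obj C; q \<in> Obj C; r \<in> Obj C; u \<in> arr C p q; v \<in> arr C q r\<rbrakk> \<Longrightarrow>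
      Cmp C p q r v u \<in> arr C p r \<and>
      Fa p r (Cmp C p q r v u) = Cmp E (Fo p) (Fo q) (Fo r) (Fa q r v) (Fa p q u)"
    and bij: "\<And>p q. \<lbrakk>p \<in> Obj C; q \<in> Obj C\<rbrakk> \<Longrightarrow> bij_betw (Fa p q) (arr C p q) (arr E (Fo p) (Fo q))"
    and ord: "\<And>p q u v. \<lbrakk>p \<in> Obj C; q \<in> Obj C; u \<in> arr C p q; v \<in> arr C p q\<rbrakk> \<Longrightarrow>
      le (Hom C p q) u v \<longleftrightarrow> le (Hom E (Fo p) (Fo q)) (Fa p q u) (Fa p q v)"
    and eso: "\<And>x. x \<in> Obj E \<Longrightarrow> \<exists>p\<in>Obj C. \<exists>w. is_iso E (Fo p) x w"
  shows "weak_equivalence C E Fo Fa"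
proof -
  interpret E: quantaloid_loc E by standard (rule E)
  have Fin: "Fa p q u \<in> arr E (Fo p) (Fo q)" if "p \<in> Obj C" "q \<in> Obj C" "u \<in> arr C p q" for p q u
    using bij[OF that(1,2)] that(3) by (auto simp: bij_betw_def)
  have inj: "u = v" if "p \<in> Obj C" "q \<in> Obj C" "u \<in> arr C p q" "v \<in> arr C p q" "Fa p q u = Fa p q v"
    for p q u v
    using bij[OF that(1,2)] that(3-5) by (auto simp: bij_betw_def dest: inj_onD)
  have unit: "Cmp C p p q u (Idn C p) = u" "Cmp C p q q (Idn C q) u = u"
    if "p \<in> Obj C" "q \<in> Obj C" "u \<in> arr C p q" for p q u
    using that by (intro inj[of p q]; simp add: idn cmp obj Fin)+
  have assoc: "Cmp C p r s w (Cmp C p q r v u) = Cmp C p q s (Cmp C q r s w v) u"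
    if "p \<in> Obj C" "q \<in> Obj C" "r \<in> Obj C" "s \<in> Obj C" "u \<in> arr C p q" "v \<in> arr C q r" "w \<in> arr C r s"
    for p q r s u v w
    using that by (intro inj[of p s]; simp add: cmp obj Fin E.Cmp_assoc)
  have cat: "category C"
    unfolding category_def by (simp add: idn cmp unit assoc)
  have po: "partial_order (Hom C p q)" if p: "p \<in> Obj C" "q \<in> Obj C" for p q
  proof (rule partial_orderI)
    show "u = v" if "u \<in> arr C p q" "v \<in> arr C p q" "le (Hom C p q) u v" "le (Hom C p q) v u" for u v
      using that p by (intro inj[OF p] E.le_antisym[of "Fo p" "Fo q"]) (auto simp: ord[OF p] obj Fin)
    show "le (Hom C p q) u w" if "u \<in> arr C p q" "v \<in> arr C p q" "w \<in> arr C p q"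
      "le (Hom C p q) u v" "le (Hom C p q) v w" for u v w
      using that p E.le_trans[of "Fo p" "Fo q" "Fa p q u" "Fa p q v" "Fa p q w"]
      by (auto simp: ord[OF p] obj Fin)
  qed (use p in \<open>auto simp: eqs ord obj Fin\<close>)
  have join_iff: "join_of (Hom E (Fo p) (Fo q)) (Fa p q ` V) (Fa p q s) \<longleftrightarrow> join_of (Hom C p q) V s"
    if "p \<in> Obj C" "q \<in> Obj C" "V \<subseteq> arr C p q" "s \<in> arr C p q" for p q V s
    using that by (intro join_of_image_iff bij ord)
  have "quantaloid C"
  proof (rule quantaloidI[OF cat po])
    fix p q V assume *: "p \<in> Obj C" "q \<in> Obj C" "V \<subseteq> arr C p q"
    have "Fa p q ` V \<subseteq> arr E (Fo p) (Fo q)" using Fin * by auto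
    then have j: "join_of (Hom E (Fo p) (Fo q)) (Fa p q ` V) (\<Squnion>\<^bsub>Hom E (Fo p) (Fo q)\<^esub> (Fa p q ` V))"
      using * obj by (simp add: E.sup_join_of)
    then have "\<Squnion>\<^bsub>Hom E (Fo p) (Fo q)\<^esub> (Fa p q ` V) \<in> Fa p q ` arr C p q"
      using bij[OF *(1,2)] by (simp add: bij_betw_def join_of_def)
    then obtain s where "s \<in> arr C p q" "\<Squnion>\<^bsub>Hom E (Fo p) (Fo q)\<^esub> (Fa p q ` V) = Fa p q s" by blast
    with j join_iff[OF *] show "\<exists>s. join_of (Hom C p q) V s" by auto
  next
    fix p q r u V s assume *: "p \<in> Obj C" "q \<in> Obj C" "r \<in> Obj C" "u \<in> arr C p q" "V \<subseteq> arr C q r"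
      "join_of (Hom C q r) V s"
    then have s: "s \<in> arr C q r" by (simp add: join_of_def)
    have V: "Fa q r ` V \<subseteq> arr E (Fo q) (Fo r)" using * Fin by auto
    have F: "Fa q r s = \<Squnion>\<^bsub>Hom E (Fo q) (Fo r)\<^esub> (Fa q r ` V)"
      using * V s by (intro sup_eqI[symmetric] E.Hom_po) (simp_all add: obj join_iff)
    have im: "Fa p r ` (\<lambda>v. Cmp C p q r v u) ` V = (\<lambda>v. Cmp E (Fo p) (Fo q) (Fo r) v (Fa p q u)) ` Fa q r ` V"
      unfolding image_image using * cmp by (intro image_cong) auto
    have "(\<lambda>v. Cmp E (Fo p) (Fo q) (Fo r) v (Fa p q u)) ` Fa q r ` V \<subseteq> arr E (Fo p) (Fo r)"
      using * V obj Fin by auto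
    then show "join_of (Hom C p r) ((\<lambda>v. Cmp C p q r v u) ` V) (Cmp C p q r s u)"
      using * s V obj Fin cmp
      by (subst join_iff[symmetric]) (auto simp: im F E.Cmp_sup_left intro!: E.sup_join_of)
  next
    fix p q r v V s assume *: "p \<in> Obj C" "q \<in> Obj C" "r \<in> Obj C" "v \<in> arr C q r" "V \<subseteq> arr C p q"
      "join_of (Hom C p q) V s"
    then have s: "s \<in> arr C p q" by (simp add: join_of_def)
    have V: "Fa p q ` V \<subseteq> arr E (Fo p) (Fo q)" using * Fin by auto
    have F: "Fa p q s = \<Squnion>\<^bsub>Hom E (Fo p) (Fo q)\<^esub> (Fa p q ` V)"
      using * V s by (intro sup_eqI[symmetric] E.Hom_po) (simp_all add: obj join_iff)
    have im: "Fa p r ` (\<lambda>u. Cmp C p q r v u) ` V = (\<lambda>u. Cmp E (Fo p) (Fo q) (Fo r) (Fa q r v) u) ` Fa p q ` V"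
      unfolding image_image using * cmp by (intro image_cong) auto
    have "(\<lambda>u. Cmp E (Fo p) (Fo q) (Fo r) (Fa q r v) u) ` Fa p q ` V \<subseteq> arr E (Fo p) (Fo r)"
      using * V obj Fin by auto
    then show "join_of (Hom C p r) ((\<lambda>u. Cmp C p q r v u) ` V) (Cmp C p q r v s)"
      using * s V obj Fin cmp
      by (subst join_iff[symmetric]) (auto simp: im F E.Cmp_sup_right intro!: E.sup_join_of)
  qed
  then show ?thesis
    unfolding weak_equivalence_def is_functor_def by (simp add: E obj idn cmp bij ord eso Fin)
qed

locale weak_equiv =
  C: quantaloid_loc C + E: quantaloid_loc E
  for C :: "('o, 'a) quantaloid_data" and E :: "('p, 'b) quantaloid_data"
    and Fo :: "'o \<Rightarrow> 'p" and Fa :: "'o \<Rightarrow> 'o \<Rightarrow> 'a \<Rightarrow> 'b" +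
  assumes weak_equivalence: "weak_equivalence C E Fo Fa"
begin

lemma is_functor: "is_functor C E Fo Fa"
  using weak_equivalence unfolding weak_equivalence_def by simp

lemma obj [simp]: "p \<in> Obj C \<Longrightarrow> Fo p \<in> Obj E"
  using weak_equivalence unfolding weak_equivalence_def is_functor_def by simp

lemma Fa_in [simp]: "\<lbrakk>p \<in> Obj C; q \<in> Obj C; u \<in> arr C p q\<rbrakk> \<Longrightarrow> Fa p q u \<in> arr E (Fo p) (Fo q)"
  using weak_equivalence unfolding weak_equivalence_def is_functor_def by simp

lemma Fa_Idn [simp]: "p \<in> Obj C \<Longrightarrow> Fa p p (Idn C p) = Idn E (Fo p)"
  using weak_equivalence unfolding weak_equivalence_def is_functor_def by simp

lemma Fa_Cmp [simp]: "\<lbrakk>p \<in> Obj C; q \<in> Obj C; r \<in> Obj C; u \<in> arr C p q; v \<in> arr C q r\<rbrakk> \<Longrightarrow>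
   Fa p r (Cmp C p q r v u) = Cmp E (Fo p) (Fo q) (Fo r) (Fa q r v) (Fa p q u)"
  using weak_equivalence unfolding weak_equivalence_def is_functor_def by simp

lemma bij: "\<lbrakk>p \<in> Obj C; q \<in> Obj C\<rbrakk> \<Longrightarrow> bij_betw (Fa p q) (arr C p q) (arr E (Fo p) (Fo q))"
  using weak_equivalence unfolding weak_equivalence_def by simp

lemma ord: "\<lbrakk>p \<in> Obj C; q \<in> Obj C; u \<in> arr C p q; v \<in> arr C p q\<rbrakk> \<Longrightarrow>
   le (Hom C p q) u v \<longleftrightarrow> le (Hom E (Fo p) (Fo q)) (Fa p q u) (Fa p q v)"
  using weak_equivalence unfolding weak_equivalence_def by simp

lemma eso: "x \<in> Obj E \<Longrightarrow> \<exists>p\<in>Obj C. \<exists>w. is_iso E (Fo p) x w"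
  using weak_equivalence unfolding weak_equivalence_def by simp

lemma faithful:
  "\<lbrakk>p \<in> Obj C; q \<in> Obj C; u \<in> arr C p q; v \<in> arr C p q; Fa p q u = Fa p q v\<rbrakk> \<Longrightarrow> u = v"
  using bij[of p q] by (auto simp: bij_betw_def dest: inj_onD)

lemma full:
  assumes "p \<in> Obj C" "q \<in> Obj C" "w \<in> arr E (Fo p) (Fo q)"
  obtains u where "u \<in> arr C p q" "Fa p q u = w"
proof -
  have "w \<in> Fa p q ` arr C p q" using bij[OF assms(1,2)] assms(3) by (simp add: bij_betw_def)
  with that show ?thesis by blast
qed

text \<open>Fullness lifts \<open>w\<close> and its inverse; faithfulness shows that the lifts are
  mutually inverse, because their images are.\<close>

lemma reflects_iso:
  assumes p: "p \<in> Obj C" "q \<in> Obj C" and w: "is_iso E (Fo p) (Fo q) w"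
  obtains u where "is_iso C p q u" "Fa p q u = w"
proof -
  obtain w' where w': "w' \<in> arr E (Fo q) (Fo p)" "Cmp E (Fo p) (Fo q) (Fo p) w' w = Idn E (Fo p)"
    "Cmp E (Fo q) (Fo p) (Fo q) w w' = Idn E (Fo q)" and w1: "w \<in> arr E (Fo p) (Fo q)"
    using w unfolding is_iso_def by blast
  obtain u where u: "u \<in> arr C p q" "Fa p q u = w" using full[OF p w1] .
  obtain v where v: "v \<in> arr C q p" "Fa q p v = w'" using full[OF p(2,1) w'(1)] .
  have "Cmp C p q p v u = Idn C p"
    using p u v w' by (intro faithful[of p p]) auto
  moreover have "Cmp C q p q u v = Idn C q"
    using p u v w' by (intro faithful[of q q]) auto
  ultimately show ?thesis using u v that unfolding is_iso_def by blast
qed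

lemma quantaloid_hom: "quantaloid_hom C E Fo Fa"
proof -
  have "Fa p q (\<Squnion>\<^bsub>Hom C p q\<^esub> V) = \<Squnion>\<^bsub>Hom E (Fo p) (Fo q)\<^esub> (Fa p q ` V)"
    if *: "p \<in> Obj C" "q \<in> Obj C" "V \<subseteq> arr C p q" for p q V
  proof (rule sup_eqI[symmetric])
    show "join_of (Hom E (Fo p) (Fo q)) (Fa p q ` V) (Fa p q (\<Squnion>\<^bsub>Hom C p q\<^esub> V))"
      using * join_of_image_iff[OF bij[OF *(1,2)] ord[OF *(1,2)] *(3)] C.sup_join_of[OF *] by auto
  qed (use * in \<open>auto simp: E.Hom_po\<close>)
  then show ?thesis
    using weak_equivalence unfolding quantaloid_hom_def weak_equivalence_def by simp
qed

end

lemma weak_equiv_iff: "weak_equiv C E Fo Fa \<longleftrightarrow> weak_equivalence C E Fo Fa"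
  unfolding weak_equiv_def weak_equiv_axioms_def quantaloid_loc_def weak_equivalence_def by blast

lemma weak_equivalence_id: "quantaloid C \<Longrightarrow> weak_equivalence C C (\<lambda>p. p) (\<lambda>p q u. u)"
  using quantaloid_loc.is_iso_Idn[of C]
  unfolding weak_equivalence_def is_functor_def quantaloid_loc_def by (auto simp: bij_betw_def)

text \<open>The inverse of \<open>w \<mapsto> s' w t\<close> is \<open>w \<mapsto> s w t'\<close>.
  Both maps are monotone, so the bijection is an order isomorphism.\<close>

lemma (in quantaloid_loc) conjugation:
  assumes o: "a \<in> Obj C" "b \<in> Obj C" "c \<in> Obj C" "d \<in> Obj C"
    and t: "t \<in> arr C a b" "t' \<in> arr C b a" "Cmp C a b a t' t = Idn C a" "Cmp C b a b t t' = Idn C b"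
    and s: "s \<in> arr C d c" "s' \<in> arr C c d" "Cmp C d c d s' s = Idn C d" "Cmp C c d c s s' = Idn C c"
  shows "bij_betw (\<lambda>w. Cmp C a c d s' (Cmp C a b c w t)) (arr C b c) (arr C a d)"
    and "\<lbrakk>w \<in> arr C b c; w' \<in> arr C b c\<rbrakk> \<Longrightarrow> le (Hom C b c) w w' \<longleftrightarrow>
      le (Hom C a d) (Cmp C a c d s' (Cmp C a b c w t)) (Cmp C a c d s' (Cmp C a b c w' t))"
proof -
  have 1: "Cmp C b d c s (Cmp C b a d (Cmp C a c d s' (Cmp C a b c w t)) t') = w"
    if "w \<in> arr C b c" for w
  proof -
    have "Cmp C b d c s (Cmp C b a d (Cmp C a c d s' (Cmp C a b c w t)) t') =
      Cmp C b c c (Cmp C c d c s s') (Cmp C b b c w (Cmp C b a b t t'))"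
      using that o t(1,2) s(1,2) by (simp add: Cmp_assoc)
    then show ?thesis using that o t s by simp
  qed
  have 2: "Cmp C a c d s' (Cmp C a b c (Cmp C b d c s (Cmp C b a d w t')) t) = w"
    if "w \<in> arr C a d" for w
  proof -
    have "Cmp C a c d s' (Cmp C a b c (Cmp C b d c s (Cmp C b a d w t')) t) =
      Cmp C a d d (Cmp C d c d s' s) (Cmp C a a d w (Cmp C a b a t' t))"
      using that o t(1,2) s(1,2) by (simp add: Cmp_assoc)
    then show ?thesis using that o t s by simp
  qed
  show "bij_betw (\<lambda>w. Cmp C a c d s' (Cmp C a b c w t)) (arr C b c) (arr C a d)"
    by (rule bij_betwI[where g = "\<lambda>w. Cmp C b d c s (Cmp C b a d w t')"]) (use o t s 1 2 in auto)
  assume w: "w \<in> arr C b c" "w' \<in> arr C b c"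
  show "le (Hom C b c) w w' \<longleftrightarrow>
      le (Hom C a d) (Cmp C a c d s' (Cmp C a b c w t))
        (Cmp C a c d s' (Cmp C a b c w' t))" (is "_ \<longleftrightarrow> le _ ?x ?y")
  proof
    assume "le (Hom C b c) w w'"
    with w o t s show "le (Hom C a d) ?x ?y"
      by (intro Cmp_mono_right Cmp_mono_left) auto
  next
    assume "le (Hom C a d) ?x ?y"
    with w o t s have "le (Hom C b c) (Cmp C b d c s (Cmp C b a d ?x t')) (Cmp C b d c s (Cmp C b a d ?y t'))"
      by - (rule Cmp_mono_right, (simp; fail)+, rule Cmp_mono_left, auto)
    then show "le (Hom C b c) w w'" by (simp only: 1[OF w(1)] 1[OF w(2)])
  qed
qed

text \<open>The functor is obtained by choice: \<open>p\<close> goes to some \<open>Ko p\<close>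
  whose image under the second functor is isomorphic to \<open>F1o p\<close> by
  \<open>\<theta> p\<close>; an arrow is conjugated by these isomorphisms and then lifted through
  the fully faithful second functor.\<close>

lemma weak_equivalence_cospan:
  assumes "weak_equivalence C1 E F1o F1a" and "weak_equivalence C2 E F2o F2a"
  shows "\<exists>Ko Ka \<theta>. weak_equivalence C1 C2 Ko Ka \<and>
    natural_iso C1 E (\<lambda>p. F2o (Ko p)) (\<lambda>p q u. F2a (Ko p) (Ko q) (Ka p q u)) F1o F1a \<theta>"
proof -
  interpret F1: weak_equiv C1 E F1o F1a by (simp add: weak_equiv_iff assms)
  interpret F2: weak_equiv C2 E F2o F2a by (simp add: weak_equiv_iff assms)
  have "\<forall>p\<in>Obj C1. \<exists>k w. k \<in> Obj C2 \<and> is_iso E (F2o k) (F1o p) w"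
    using F2.eso[OF F1.obj] by blast
  then obtain Ko \<theta> where Ko: "\<And>p. p \<in> Obj C1 \<Longrightarrow> Ko p \<in> Obj C2"
    and \<theta>: "\<And>p. p \<in> Obj C1 \<Longrightarrow> is_iso E (F2o (Ko p)) (F1o p) (\<theta> p)"
    by metis
  have \<theta>in: "\<theta> p \<in> arr E (F2o (Ko p)) (F1o p)" if "p \<in> Obj C1" for p
    using \<theta>[OF that] by (simp add: is_iso_def)
  have "\<forall>p\<in>Obj C1. \<exists>w. w \<in> arr E (F1o p) (F2o (Ko p)) \<and>
     Cmp E (F2o (Ko p)) (F1o p) (F2o (Ko p)) w (\<theta> p) = Idn E (F2o (Ko p)) \<and>
     Cmp E (F1o p) (F2o (Ko p)) (F1o p) (\<theta> p) w = Idn E (F1o p)"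
    using \<theta> unfolding is_iso_def by blast
  then obtain \<theta>' where "\<forall>p\<in>Obj C1. \<theta>' p \<in> arr E (F1o p) (F2o (Ko p)) \<and>
     Cmp E (F2o (Ko p)) (F1o p) (F2o (Ko p)) (\<theta>' p) (\<theta> p) = Idn E (F2o (Ko p)) \<and>
     Cmp E (F1o p) (F2o (Ko p)) (F1o p) (\<theta> p) (\<theta>' p) = Idn E (F1o p)"
    by metis
  then have \<theta>'in: "\<And>p. p \<in> Obj C1 \<Longrightarrow> \<theta>' p \<in> arr E (F1o p) (F2o (Ko p))"
    and \<theta>'1: "\<And>p. p \<in> Obj C1 \<Longrightarrow> Cmp E (F2o (Ko p)) (F1o p) (F2o (Ko p)) (\<theta>' p) (\<theta> p) = Idn E (F2o (Ko p))"
    and \<theta>'2: "\<And>p. p \<in> Obj C1 \<Longrightarrow> Cmp E (F1o p) (F2o (Ko p)) (F1o p) (\<theta> p) (\<theta>' p) = Idn E (F1o p)"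
    by auto
  \<comment> \<open>\<open>T\<close> transports arrows of \<open>E\<close> along
    \<open>\<theta>\<close>. It is functorial and makes \<open>\<theta>\<close> natural, and both
    properties pass to its lift \<open>Ka\<close>.\<close>
  define T where "T p q w = Cmp E (F2o (Ko p)) (F1o q) (F2o (Ko q)) (\<theta>' q)
    (Cmp E (F2o (Ko p)) (F1o p) (F1o q) w (\<theta> p))"
    for p q w
  define Ka where "Ka p q u = inv_into (arr C2 (Ko p) (Ko q)) (F2a (Ko p) (Ko q)) (T p q (F1a p q u))"
    for p q u
  note conj = F1.E.conjugation[OF _ F1.obj F1.obj _ \<theta>in \<theta>'in \<theta>'1 \<theta>'2 \<theta>in \<theta>'in \<theta>'1 \<theta>'2]
  have Tbij: "bij_betw (T p q) (arr E (F1o p) (F1o q)) (arr E (F2o (Ko p)) (F2o (Ko q)))"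
    if "p \<in> Obj C1" "q \<in> Obj C1" for p q
    unfolding T_def using that Ko by (intro conj(1)) auto
  have Tord: "le (Hom E (F1o p) (F1o q)) w w' \<longleftrightarrow> le (Hom E (F2o (Ko p)) (F2o (Ko q))) (T p q w) (T p q w')"
    if "p \<in> Obj C1" "q \<in> Obj C1" "w \<in> arr E (F1o p) (F1o q)" "w' \<in> arr E (F1o p) (F1o q)" for p q w w'
    unfolding T_def using that Ko by (intro conj(2)) auto
  have Tin: "T p q w \<in> arr E (F2o (Ko p)) (F2o (Ko q))"
    if "p \<in> Obj C1" "q \<in> Obj C1" "w \<in> arr E (F1o p) (F1o q)" for p q w
    using Tbij[OF that(1,2)] that(3) by (auto simp: bij_betw_def)
  have Ka: "bij_betw (Ka p q) (arr C1 p q) (arr C2 (Ko p) (Ko q))" if "p \<in> Obj C1" "q \<in> Obj C1" for p q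
    using bij_betw_trans[OF bij_betw_trans[OF F1.bij[OF that] Tbij[OF that]]
      bij_betw_inv_into[OF F2.bij[OF Ko Ko]], OF that]
    unfolding Ka_def comp_def .
  have Kin: "Ka p q u \<in> arr C2 (Ko p) (Ko q)" if "p \<in> Obj C1" "q \<in> Obj C1" "u \<in> arr C1 p q" for p q u
    using Ka[OF that(1,2)] that(3) by (auto simp: bij_betw_def)
  have FK: "F2a (Ko p) (Ko q) (Ka p q u) = T p q (F1a p q u)"
    if "p \<in> Obj C1" "q \<in> Obj C1" "u \<in> arr C1 p q" for p q u
    unfolding Ka_def using F2.bij[OF Ko Ko, OF that(1,2)] that Tin
    by (intro bij_betw_inv_into_right) auto
  have Tnat: "Cmp E (F2o (Ko p)) (F2o (Ko q)) (F1o q) (\<theta> q) (T p q w) = Cmp E (F2o (Ko p)) (F1o p) (F1o q) w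
    (\<theta> p)"
    if "p \<in> Obj C1" "q \<in> Obj C1" "w \<in> arr E (F1o p) (F1o q)" for p q w
    unfolding T_def using that Ko \<theta>in \<theta>'in \<theta>'2 by (subst F1.E.Cmp_assoc) auto
  have Tid: "T p p (Idn E (F1o p)) = Idn E (F2o (Ko p))" if "p \<in> Obj C1" for p
    unfolding T_def using that Ko \<theta>in \<theta>'1 by simp
  have Tcmp: "T p r (Cmp E (F1o p) (F1o q) (F1o r) v u) =
      Cmp E (F2o (Ko p)) (F2o (Ko q)) (F2o (Ko r)) (T q r v) (T p q u)"
    if "p \<in> Obj C1" "q \<in> Obj C1" "r \<in> Obj C1" "u \<in> arr E (F1o p) (F1o q)" "v \<in> arr E (F1o q) (F1o r)"
      for p q r u v
  proof -
    have "Cmp E (F2o (Ko p)) (F2o (Ko q)) (F2o (Ko r)) (T q r v) (T p q u) =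
      Cmp E (F2o (Ko p)) (F1o r) (F2o (Ko r)) (\<theta>' r) (Cmp E (F2o (Ko p)) (F1o q) (F1o r) v
        (Cmp E (F2o (Ko p)) (F2o (Ko q)) (F1o q) (\<theta> q) (T p q u)))"
      unfolding T_def[of q r] using that Ko \<theta>in \<theta>'in Tin by (simp add: F1.E.Cmp_assoc)
    also have "\<dots> = T p r (Cmp E (F1o p) (F1o q) (F1o r) v u)"
      unfolding Tnat[OF that(1,2,4)] unfolding T_def using that Ko \<theta>in \<theta>'in by (simp add: F1.E.Cmp_assoc)
    finally show ?thesis by simp
  qed
  have "weak_equivalence C1 C2 Ko Ka"
  proof (rule weak_equivalenceI)
    \<comment> \<open>Some \<open>F1o p\<close> is isomorphic to \<open>F2o x\<close>; precomposing
      with \<open>\<theta> p\<close> gives an isomorphism between images of \<open>F2o\<close>,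
      which is reflected into \<open>C2\<close>.\<close>
    show "\<exists>p\<in>Obj C1. \<exists>w. is_iso C2 (Ko p) x w" if x: "x \<in> Obj C2" for x
    proof -
      obtain p w where p: "p \<in> Obj C1" "is_iso E (F1o p) (F2o x) w" using F1.eso[of "F2o x"] x by auto
      then have "is_iso E (F2o (Ko p)) (F2o x) (Cmp E (F2o (Ko p)) (F1o p) (F2o x) w (\<theta> p))"
        using x Ko \<theta> by (intro F1.E.is_iso_Cmp) auto
      then show ?thesis using F2.reflects_iso[of "Ko p" x] p x Ko by metis
    qed
    show "Idn C1 p \<in> arr C1 p p \<and> Ka p p (Idn C1 p) = Idn C2 (Ko p)" if "p \<in> Obj C1" for p
      using that Ko Kin by (auto intro!: F2.faithful[of "Ko p" "Ko p"] simp: FK Tid)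
    show "Cmp C1 p q r v u \<in> arr C1 p r \<and>
         Ka p r (Cmp C1 p q r v u) = Cmp C2 (Ko p) (Ko q) (Ko r) (Ka q r v) (Ka p q u)"
      if "p \<in> Obj C1" "q \<in> Obj C1" "r \<in> Obj C1" "u \<in> arr C1 p q" "v \<in> arr C1 q r" for p q r u v
      using that Ko Kin by (auto intro!: F2.faithful[of "Ko p" "Ko r"] simp: FK Tcmp)
    show "le (Hom C1 p q) u v \<longleftrightarrow> le (Hom C2 (Ko p) (Ko q)) (Ka p q u) (Ka p q v)"
      if "p \<in> Obj C1" "q \<in> Obj C1" "u \<in> arr C1 p q" "v \<in> arr C1 p q" for p q u v
      using that Ko Kin by (simp add: F1.ord F2.ord FK Tord)
    show "eq (Hom C1 p q) = (=)" if "p \<in> Obj C1" "q \<in> Obj C1" for p q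
      using F1.C.Hom_po[OF that] by (simp add: partial_order.eq_is_equal)
  qed (use Ko Ka F2.C.quantaloid in auto)
  moreover have "natural_iso C1 E (\<lambda>p. F2o (Ko p)) (\<lambda>p q u. F2a (Ko p) (Ko q) (Ka p q u)) F1o F1a \<theta>"
    unfolding natural_iso_def using \<theta> by (simp add: FK Tnat)
  ultimately show ?thesis by blast
qed

text \<open>The cospan construction with the identity of \<open>E\<close> as first leg yields a
  functor back, together with the counit \<open>\<theta>\<close>. The unit at \<open>p\<close> is
  the arrow of \<open>C\<close> whose image is the inverse of \<open>\<theta>\<close> at
  \<open>Fo p\<close>.\<close>

lemma weak_equivalence_imp_equiv:
  assumes "weak_equivalence C E Fo Fa"
  shows "C \<simeq>\<^sub>q E"
proof -
  interpret weak_equiv C E Fo Fa by (simp add: weak_equiv_iff assms)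
  obtain Go Ga \<theta> where G: "weak_equivalence E C Go Ga"
    and \<theta>: "natural_iso E E (\<lambda>p. Fo (Go p)) (\<lambda>p q u. Fa (Go p) (Go q) (Ga p q u)) (\<lambda>p. p) (\<lambda>p q u. u) \<theta>"
    using weak_equivalence_cospan[OF weak_equivalence_id[OF E.quantaloid] assms] by blast
  interpret G: weak_equiv E C Go Ga by (simp add: weak_equiv_iff G)
  have iso: "is_iso E (Fo (Go x)) x (\<theta> x)" if "x \<in> Obj E" for x
    using \<theta> that unfolding natural_iso_def by blast
  have nat: "Cmp E (Fo (Go x)) (Fo (Go y)) y (\<theta> y) (Fa (Go x) (Go y) (Ga x y w)) = Cmp E (Fo (Go x)) x y w
    (\<theta> x)"
    if "x \<in> Obj E" "y \<in> Obj E" "w \<in> arr E x y" for x y w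
    using \<theta> that unfolding natural_iso_def by blast
  have "\<exists>h. is_iso C p (Go (Fo p)) h \<and>
      Cmp E (Fo p) (Fo (Go (Fo p))) (Fo p) (\<theta> (Fo p)) (Fa p (Go (Fo p)) h) = Idn E (Fo p) \<and>
      Cmp E (Fo (Go (Fo p))) (Fo p) (Fo (Go (Fo p))) (Fa p (Go (Fo p)) h) (\<theta> (Fo p)) = Idn E (Fo (Go (Fo p)))"
    if p: "p \<in> Obj C" for p
  proof -
    obtain v where v: "Cmp E (Fo (Go (Fo p))) (Fo p) (Fo (Go (Fo p))) v (\<theta> (Fo p)) = Idn E (Fo (Go (Fo p)))"
      "Cmp E (Fo p) (Fo (Go (Fo p))) (Fo p) (\<theta> (Fo p)) v = Idn E (Fo p)" "is_iso E (Fo p) (Fo (Go (Fo p))) v"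
      using E.is_iso_inverse[OF iso[OF obj[OF p]]] by blast
    obtain h where "is_iso C p (Go (Fo p)) h" "Fa p (Go (Fo p)) h = v"
      using reflects_iso[OF _ _ v(3)] p by auto
    with v show ?thesis by blast
  qed
  then obtain \<eta> where \<eta>iso: "\<And>p. p \<in> Obj C \<Longrightarrow> is_iso C p (Go (Fo p)) (\<eta> p)"
    and \<eta>1: "\<And>p. p \<in> Obj C \<Longrightarrow> Cmp E (Fo p) (Fo (Go (Fo p))) (Fo p) (\<theta> (Fo p)) (Fa p (Go (Fo p)) (\<eta> p)) = Idn E
      (Fo p)"
    and \<eta>2: "\<And>p. p \<in> Obj C \<Longrightarrow> Cmp E (Fo (Go (Fo p))) (Fo p) (Fo (Go (Fo p))) (Fa p (Go (Fo p)) (\<eta> p))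
      (\<theta> (Fo p)) = Idn E (Fo (Go (Fo p)))"
    by metis
  have \<eta>in: "\<eta> p \<in> arr C p (Go (Fo p))" if "p \<in> Obj C" for p using \<eta>iso[OF that] by (simp add: is_iso_def)
  have \<theta>in: "\<theta> p \<in> arr E (Fo (Go p)) p" if "p \<in> Obj E" for p using iso[OF that] by (simp add: is_iso_def)
  \<comment> \<open>Checked after applying the faithful \<open>Fa\<close>: there the unit is inverse
    to \<open>\<theta>\<close>, so the naturality square of \<open>\<theta>\<close> can be turned
    around.\<close>
  have \<eta>nat: "Cmp C p q (Go (Fo q)) (\<eta> q) u = Cmp C p (Go (Fo p)) (Go (Fo q)) (Ga (Fo p) (Fo q) (Fa p q u))
    (\<eta> p)"
    if *: "p \<in> Obj C" "q \<in> Obj C" "u \<in> arr C p q" for p q u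
  proof (rule faithful)
    let ?f = "Fa p q u" and ?p = "Fo p" and ?q = "Fo q"
    let ?g = "Fa (Go ?p) (Go ?q) (Ga ?p ?q ?f)" and ?P = "Fo (Go ?p)" and ?Q = "Fo (Go ?q)"
    let ?hp = "Fa p (Go ?p) (\<eta> p)" and ?hq = "Fa q (Go ?q) (\<eta> q)"
    have "Cmp E ?p ?q ?Q ?hq ?f = Cmp E ?p ?q ?Q ?hq (Cmp E ?p ?p ?q ?f (Cmp E ?p ?P ?p (\<theta> ?p) ?hp))"
      using * by (simp add: \<eta>1)
    also have "\<dots> = Cmp E ?p ?q ?Q ?hq (Cmp E ?p ?P ?q (Cmp E ?P ?p ?q ?f (\<theta> ?p)) ?hp)"
      using * \<theta>in \<eta>in by (simp add: E.Cmp_assoc)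
    also have "\<dots> = Cmp E ?p ?q ?Q ?hq (Cmp E ?p ?P ?q (Cmp E ?P ?Q ?q (\<theta> ?q) ?g) ?hp)"
      using * by (simp add: nat)
    also have "\<dots> = Cmp E ?p ?Q ?Q (Cmp E ?Q ?q ?Q ?hq (\<theta> ?q)) (Cmp E ?p ?P ?Q ?g ?hp)"
      using * \<theta>in \<eta>in by (simp add: E.Cmp_assoc)
    also have "\<dots> = Cmp E ?p ?P ?Q ?g ?hp"
      using * \<eta>in by (simp add: \<eta>2)
    finally show "Fa p (Go ?q) (Cmp C p q (Go ?q) (\<eta> q) u) =
      Fa p (Go ?q) (Cmp C p (Go ?p) (Go ?q) (Ga ?p ?q ?f) (\<eta> p))"
      using * \<eta>in by simp
  qed (use that \<eta>in in auto)
  have "category_equivalence C E Fo Fa"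
    unfolding category_equivalence_def
  proof (intro conjI exI)
    show "is_functor C E Fo Fa" "is_functor E C Go Ga"
      by (fact is_functor, fact G.is_functor)
    show "natural_iso C C (\<lambda>p. p) (\<lambda>p q u. u) (\<lambda>p. Go (Fo p)) (\<lambda>p q u. Ga (Fo p) (Fo q) (Fa p q u)) \<eta>"
      unfolding natural_iso_def using \<eta>iso \<eta>nat by blast
    show "natural_iso E E (\<lambda>p. Fo (Go p)) (\<lambda>p q u. Fa (Go p) (Go q) (Ga p q u)) (\<lambda>p. p) (\<lambda>p q u. u) \<theta>"
      by (rule \<theta>)
  qed
  with quantaloid_hom show ?thesis unfolding quantaloid_equiv_def by blast
qed

corollary cospan_equiv:
  assumes "weak_equivalence C1 E F1o F1a" and "weak_equivalence C2 E F2o F2a"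
  shows "C1 \<simeq>\<^sub>q C2"
  proof -
  obtain Ko Ka where "weak_equivalence C1 C2 Ko Ka"
    using weak_equivalence_cospan[OF assms] by (elim exE conjE)
  then show ?thesis by (rule weak_equivalence_imp_equiv)
qed

text \<open>\<open>R\<close> is the kernel of a full functor, so a class is a whole fibre and
  corresponds to one arrow of \<open>E\<close>. Binary joins enter because the order of the quotient
  is defined by \<open>f \<squnion> g\<close> lying in the class of \<open>g\<close>.\<close>

lemma weak_equivalence_quotient:
  assumes E: "quantaloid E"
    and obj: "\<And>p. p \<in> Obj C \<Longrightarrow> Fo p \<in> Obj E"
    and idn: "\<And>p. p \<in> Obj C \<Longrightarrow> Idn C p \<in> arr C p p \<and> Fa p p (Idn C p) = Idn E (Fo p)"
    and cmp: "\<And>p q r u v. \<lbrakk>p \<in> Obj C; q \<in> Obj C; r \<in> Obj C; u \<in> arr C p q; v \<in> arr C q r\<rbrakk> \<Longrightarrow>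
      Cmp C p q r v u \<in> arr C p r \<and>
      Fa p r (Cmp C p q r v u) = Cmp E (Fo p) (Fo q) (Fo r) (Fa q r v) (Fa p q u)"
    and surj: "\<And>p q. \<lbrakk>p \<in> Obj C; q \<in> Obj C\<rbrakk> \<Longrightarrow> Fa p q ` arr C p q = arr E (Fo p) (Fo q)"
    and join: "\<And>p q u v. \<lbrakk>p \<in> Obj C; q \<in> Obj C; u \<in> arr C p q; v \<in> arr C p q\<rbrakk> \<Longrightarrow>
      u \<squnion>\<^bsub>Hom C p q\<^esub> v \<in> arr C p q \<and>
      Fa p q (u \<squnion>\<^bsub>Hom C p q\<^esub> v) = \<Squnion>\<^bsub>Hom E (Fo p) (Fo q)\<^esub> {Fa p q u, Fa p q v}"
    and R: "\<And>p q. \<lbrakk>p \<in> Obj C; q \<in> Obj C\<rbrakk> \<Longrightarrow>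
      R p q = {(u, v). u \<in> arr C p q \<and> v \<in> arr C p q \<and> Fa p q u = Fa p q v}"
    and eso: "\<And>x. x \<in> Obj E \<Longrightarrow> \<exists>p\<in>Obj C. \<exists>w. is_iso E (Fo p) x w"
  shows "weak_equivalence (quotient_quantaloid C R) E Fo (\<lambda>p q X. Fa p q (SOME u. u \<in> X))"
proof -
  interpret E: quantaloid_loc E by standard (rule E)
  define K where "K p q w = {u \<in> arr C p q. Fa p q u = w}" for p q w
  define G where "G p q X = Fa p q (SOME u. u \<in> X)" for p q X
  let ?D = "quotient_quantaloid C R"
  have Kne: "\<exists>u. u \<in> K p q w" if "p \<in> Obj C" "q \<in> Obj C" "w \<in> arr E (Fo p) (Fo q)" for p q w
  proof -
    have "w \<in> Fa p q ` arr C p q" using that by (simp add: surj)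
    then show ?thesis by (auto simp: K_def)
  qed
  have GK: "G p q (K p q w) = w" if "p \<in> Obj C" "q \<in> Obj C" "w \<in> arr E (Fo p) (Fo q)" for p q w
    unfolding G_def using someI_ex[OF Kne[OF that]] by (simp add: K_def)
  have RK: "R p q `` {u} = K p q (Fa p q u)" if "p \<in> Obj C" "q \<in> Obj C" "u \<in> arr C p q" for p q u
    using that by (auto simp: R K_def)
  have arrD: "arr ?D p q = K p q ` arr E (Fo p) (Fo q)" if "p \<in> Obj C" "q \<in> Obj C" for p q
  proof -
    have "arr ?D p q = (\<lambda>u. R p q `` {u}) ` arr C p q"
      unfolding quotient_quantaloid_def quotient_def by auto
    also have "\<dots> = (\<lambda>u. K p q (Fa p q u)) ` arr C p q"
      using RK[OF that] by (intro image_cong) auto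
    also have "\<dots> = K p q ` arr E (Fo p) (Fo q)"
      unfolding surj[OF that, symmetric] image_image ..
    finally show ?thesis .
  qed
  have idnD: "Idn ?D p = K p p (Idn E (Fo p))" if "p \<in> Obj C" for p
    unfolding quotient_quantaloid_def using that idn RK by simp
  have cmpD: "Cmp ?D p q r (K q r w') (K p q w) = K p r (Cmp E (Fo p) (Fo q) (Fo r) w' w)"
    if *: "p \<in> Obj C" "q \<in> Obj C" "r \<in> Obj C" "w \<in> arr E (Fo p) (Fo q)" "w' \<in> arr E (Fo q) (Fo r)"
      for p q r w w'
  proof -
    have "R p r `` {Cmp C p q r g f} = K p r (Cmp E (Fo p) (Fo q) (Fo r) w' w)"
      if "f \<in> K p q w" "g \<in> K q r w'" for f g
      using that * cmp by (subst RK) (auto simp: K_def)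
    then show ?thesis
      using Kne[OF *(1,2,4)] Kne[OF *(2,3,5)] unfolding quotient_quantaloid_def by auto
  qed
  have leD: "le (Hom ?D p q) (K p q w) (K p q w') \<longleftrightarrow> le (Hom E (Fo p) (Fo q)) w w'"
    if *: "p \<in> Obj C" "q \<in> Obj C" "w \<in> arr E (Fo p) (Fo q)" "w' \<in> arr E (Fo p) (Fo q)" for p q w w'
  proof -
    have "le (Hom ?D p q) (K p q w) (K p q w') \<longleftrightarrow> (\<exists>f\<in>K p q w. \<exists>g\<in>K p q w'. f \<squnion>\<^bsub>Hom C p q\<^esub> g \<in> K p q w')"
      by (simp add: quotient_quantaloid_def)
    also have "\<dots> \<longleftrightarrow> (\<exists>f\<in>K p q w. \<exists>g\<in>K p q w'. \<Squnion>\<^bsub>Hom E (Fo p) (Fo q)\<^esub> {w, w'} = w')"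
      using * join by (intro bex_cong refl) (auto simp: K_def)
    also have "\<dots> \<longleftrightarrow> le (Hom E (Fo p) (Fo q)) w w'"
      using Kne[OF *(1,2,3)] Kne[OF *(1,2,4)] * E.le_iff_sup obj by auto
    finally show ?thesis .
  qed
  have "weak_equivalence ?D E Fo G"
  proof (rule weak_equivalenceI[OF E])
    fix p q assume "p \<in> Obj ?D" "q \<in> Obj ?D"
    then have *: "p \<in> Obj C" "q \<in> Obj C" by (auto simp: quotient_quantaloid_def)
    show "bij_betw (G p q) (arr ?D p q) (arr E (Fo p) (Fo q))"
      unfolding arrD[OF *] by (rule bij_betwI[where g = "K p q"]) (auto simp: * GK)
    fix u v assume "u \<in> arr ?D p q" "v \<in> arr ?D p q"
    then show "le (Hom ?D p q) u v \<longleftrightarrow> le (Hom E (Fo p) (Fo q)) (G p q u) (G p q v)"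
      unfolding arrD[OF *] using * leD GK by auto
  next
    fix p q r u v assume "p \<in> Obj ?D" "q \<in> Obj ?D" "r \<in> Obj ?D" and u: "u \<in> arr ?D p q" "v \<in> arr ?D q r"
    then have *: "p \<in> Obj C" "q \<in> Obj C" "r \<in> Obj C" by (auto simp: quotient_quantaloid_def)
    show "Cmp ?D p q r v u \<in> arr ?D p r \<and>
      G p r (Cmp ?D p q r v u) = Cmp E (Fo p) (Fo q) (Fo r) (G q r v) (G p q u)"
      using u * obj unfolding arrD[OF *(1,2)] arrD[OF *(2,3)] arrD[OF *(1,3)]
      by (auto simp: cmpD GK)
  next
    fix p assume "p \<in> Obj ?D"
    then have *: "p \<in> Obj C" by (auto simp: quotient_quantaloid_def)
    show "Idn ?D p \<in> arr ?D p p \<and> G p p (Idn ?D p) = Idn E (Fo p)"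
      using * obj by (auto simp: idnD arrD GK)
  qed (use obj eso in \<open>auto simp: quotient_quantaloid_def\<close>)
  then show ?thesis by (simp add: G_def[abs_def])
qed

section \<open>Residuals and negation\<close>

context quantaloid_loc
begin

text \<open>The residual is the join of all solutions of \<open>v \<circ> u \<le> w\<close>; that it
  is itself a solution is the preservation of joins by composition with \<open>u\<close>. Uniqueness
  makes the definite description in \<open>lres\<close> meaningful.\<close>

lemma lres_char:
  assumes o: "p \<in> Obj C" "q \<in> Obj C" "r \<in> Obj C" and u: "u \<in> arr C p q" and w: "w \<in> arr C p r"
  shows "lres C p q r w u \<in> arr C q r"
    and "v \<in> arr C q r \<Longrightarrow> le (Hom C p r) (Cmp C p q r v u) w \<longleftrightarrow> le (Hom C q r) v (lres C p q r w u)"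
proof -
  let ?P = "\<lambda>x. x \<in> arr C q r \<and>
    (\<forall>v\<in>arr C q r. le (Hom C p r) (Cmp C p q r v u) w \<longleftrightarrow> le (Hom C q r) v x)"
  let ?V = "{v \<in> arr C q r. le (Hom C p r) (Cmp C p q r v u) w}"
  have V: "?V \<subseteq> arr C q r" by auto
  have "?P (\<Squnion>\<^bsub>Hom C q r\<^esub> ?V)"
  proof (intro conjI ballI iffI)
    fix v assume v: "v \<in> arr C q r"
    show "le (Hom C q r) v (\<Squnion>\<^bsub>Hom C q r\<^esub> ?V)" if "le (Hom C p r) (Cmp C p q r v u) w"
      using that v o V by (intro le_sup) auto
    assume "le (Hom C q r) v (\<Squnion>\<^bsub>Hom C q r\<^esub> ?V)"
    then have "le (Hom C p r) (Cmp C p q r v u) (Cmp C p q r (\<Squnion>\<^bsub>Hom C q r\<^esub> ?V) u)"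
      using v o u V by (intro Cmp_mono_left) auto
    moreover have "le (Hom C p r) (Cmp C p q r (\<Squnion>\<^bsub>Hom C q r\<^esub> ?V) u) w"
      using o u w V by (subst Cmp_sup_left_le_iff) auto
    ultimately show "le (Hom C p r) (Cmp C p q r v u) w"
      using v o u w V by (elim le_trans[rotated -2]) auto
  qed (use o V in auto)
  moreover have "x = y" if "?P x" "?P y" for x y
    using that o by (intro le_antisym[of q r]) auto
  ultimately have "?P (lres C p q r w u)"
    unfolding lres_def by (intro theI[of ?P "\<Squnion>\<^bsub>Hom C q r\<^esub> ?V"])
  then show "lres C p q r w u \<in> arr C q r"
    and "v \<in> arr C q r \<Longrightarrow> le (Hom C p r) (Cmp C p q r v u) w \<longleftrightarrow> le (Hom C q r) v (lres C p q r w u)"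
    by auto
qed

lemma rres_char:
  assumes o: "p \<in> Obj C" "q \<in> Obj C" "r \<in> Obj C" and v: "v \<in> arr C q r" and w: "w \<in> arr C p r"
  shows "rres C p q r v w \<in> arr C p q"
    and "u \<in> arr C p q \<Longrightarrow> le (Hom C p r) (Cmp C p q r v u) w \<longleftrightarrow> le (Hom C p q) u (rres C p q r v w)"
proof -
  let ?P = "\<lambda>x. x \<in> arr C p q \<and>
    (\<forall>u\<in>arr C p q. le (Hom C p r) (Cmp C p q r v u) w \<longleftrightarrow> le (Hom C p q) u x)"
  let ?V = "{u \<in> arr C p q. le (Hom C p r) (Cmp C p q r v u) w}"
  have V: "?V \<subseteq> arr C p q" by auto
  have "?P (\<Squnion>\<^bsub>Hom C p q\<^esub> ?V)"
  proof (intro conjI ballI iffI)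
    fix u assume u: "u \<in> arr C p q"
    show "le (Hom C p q) u (\<Squnion>\<^bsub>Hom C p q\<^esub> ?V)" if "le (Hom C p r) (Cmp C p q r v u) w"
      using that u o V by (intro le_sup) auto
    assume "le (Hom C p q) u (\<Squnion>\<^bsub>Hom C p q\<^esub> ?V)"
    then have "le (Hom C p r) (Cmp C p q r v u) (Cmp C p q r v (\<Squnion>\<^bsub>Hom C p q\<^esub> ?V))"
      using v o u V by (intro Cmp_mono_right) auto
    moreover have "le (Hom C p r) (Cmp C p q r v (\<Squnion>\<^bsub>Hom C p q\<^esub> ?V)) w"
      using o v w V by (subst Cmp_sup_right_le_iff) auto
    ultimately show "le (Hom C p r) (Cmp C p q r v u) w"
      using v o u w V by (elim le_trans[rotated -2]) auto
  qed (use o V in auto)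
  moreover have "x = y" if "?P x" "?P y" for x y
    using that o by (intro le_antisym[of p q]) auto
  ultimately have "?P (rres C p q r v w)"
    unfolding rres_def by (intro theI[of ?P "\<Squnion>\<^bsub>Hom C p q\<^esub> ?V"])
  then show "rres C p q r v w \<in> arr C p q"
    and "u \<in> arr C p q \<Longrightarrow> le (Hom C p r) (Cmp C p q r v u) w \<longleftrightarrow> le (Hom C p q) u (rres C p q r v w)"
    by auto
qed

end

text \<open>The dualizing arrows are forgotten and only the negation is kept: an involution with a
  rotation law lifts pointwise from \<open>Q\<close> to distributors, so one locale serves both
  levels.\<close>

locale star_quantaloid = quantaloid_loc C for C :: "('o, 'a) quantaloid_data" +
  fixes n :: "'o \<Rightarrow> 'o \<Rightarrow> 'a \<Rightarrow> 'a"
  assumes neg_in [simp, intro]: "\<lbrakk>p \<in> Obj C; q \<in> Obj C; u \<in> arr C p q\<rbrakk> \<Longrightarrow> n p q u \<in> arr C q p"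
    and neg_neg [simp]: "\<lbrakk>p \<in> Obj C; q \<in> Obj C; u \<in> arr C p q\<rbrakk> \<Longrightarrow> n q p (n p q u) = u"
    and rotate: "\<lbrakk>p \<in> Obj C; q \<in> Obj C; r \<in> Obj C; u \<in> arr C p q; v \<in> arr C q r; w \<in> arr C p r\<rbrakk> \<Longrightarrow>
      le (Hom C p r) (Cmp C p q r v u) w \<longleftrightarrow> le (Hom C q p) (Cmp C q r p (n p r w) v) (n p q u)"
begin

lemma neg_le_iff:
  assumes "p \<in> Obj C" "q \<in> Obj C" "u \<in> arr C p q" "v \<in> arr C p q"
  shows "le (Hom C q p) (n p q v) (n p q u) \<longleftrightarrow> le (Hom C p q) u v"
  using rotate[of p q q u "Idn C q" v] assms by simp

lemma neg_le_swap:
  assumes "p \<in> Obj C" "q \<in> Obj C" "u \<in> arr C p q" "v \<in> arr C q p"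
  shows "le (Hom C q p) v (n p q u) \<longleftrightarrow> le (Hom C p q) u (n q p v)"
  using neg_le_iff[of p q u "n q p v"] assms by simp

text \<open>Rotating twice, with double negations cancelled.\<close>

lemma rotate':
  assumes "p \<in> Obj C" "q \<in> Obj C" "r \<in> Obj C" "u \<in> arr C p q" "v \<in> arr C q r" "w \<in> arr C p r"
  shows "le (Hom C p r) (Cmp C p q r v u) w \<longleftrightarrow> le (Hom C r q) (Cmp C r p q u (n p r w)) (n q r v)"
  using rotate[of q r p v "n p r w" "n p q u"] rotate[of p q r u v w] assms by simp

lemma le_neg_iff:
  assumes "p \<in> Obj C" "q \<in> Obj C" "r \<in> Obj C" "u \<in> arr C p q" "v \<in> arr C q r" "w \<in> arr C p r"
  shows "le (Hom C q r) v (n r q (Cmp C r p q u (n p r w))) \<longleftrightarrow> le (Hom C p r) (Cmp C p q r v u) w"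
    and "le (Hom C p q) u (n q p (Cmp C q r p (n p r w) v)) \<longleftrightarrow> le (Hom C p r) (Cmp C p q r v u) w"
  using assms rotate[OF assms] rotate'[OF assms] by (simp_all add: neg_le_swap)

lemma lres_eq:
  assumes "p \<in> Obj C" "q \<in> Obj C" "r \<in> Obj C" "u \<in> arr C p q" "w \<in> arr C p r"
  shows "lres C p q r w u = n r q (Cmp C r p q u (n p r w))"
  using assms lres_char[OF assms] by (intro eq_iff[of q r]) (auto simp: le_neg_iff)

lemma rres_eq:
  assumes "p \<in> Obj C" "q \<in> Obj C" "r \<in> Obj C" "v \<in> arr C q r" "w \<in> arr C p r"
  shows "rres C p q r v w = n q p (Cmp C q r p (n p r w) v)"
  using assms rres_char[OF assms] by (intro eq_iff[of p q]) (auto simp: le_neg_iff)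

lemma neg_eq_iff:
  assumes "p \<in> Obj C" "q \<in> Obj C" "u \<in> arr C p q" "v \<in> arr C p q"
  shows "n p q u = n p q v \<longleftrightarrow> u = v"
  using assms neg_neg by metis

end

text \<open>The two negations by \<open>d\<close> coincide, so the Girard identities make negation
  an involution. For rotation: \<open>w\<close> is the residual of \<open>d\<close> by
  \<open>\<not>w\<close>, hence \<open>x \<le> w\<close> iff
  \<open>\<not>w \<circ> x \<le> d\<close>; for \<open>x = v \<circ> u\<close>, associativity moves
  the bracket and \<open>u\<close> is negated.\<close>

lemma girard_star_quantaloid:
  assumes "girard_quantaloid C d"
  shows "star_quantaloid C (\<lambda>p q u. lres C p q p (d p) u)"
proof -
  interpret quantaloid_loc C
    using assms by (simp add: quantaloid_loc_def girard_quantaloid_def)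
  have d: "d q \<in> arr C q q" if "q \<in> Obj C" for q
    using assms that by (simp add: girard_quantaloid_def)
  have 1: "lres C p q p (d p) u = rres C q p q u (d q)"
    and 2: "rres C p q p (lres C p q p (d p) u) (d p) = u"
    and 3: "lres C q p q (d q) (rres C q p q u (d q)) = u"
    if "p \<in> Obj C" "q \<in> Obj C" "u \<in> arr C p q" for p q u
    using assms that unfolding girard_quantaloid_def by blast+
  show ?thesis
  proof
    fix p q u assume *: "p \<in> Obj C" "q \<in> Obj C" "u \<in> arr C p q"
    show "lres C p q p (d p) u \<in> arr C q p" using * d by (simp add: lres_char)
    show "lres C q p q (d q) (lres C p q p (d p) u) = u" using 1[OF *] 3[OF *] by simp
  next
    fix p q r u v w
    assume *: "p \<in> Obj C" "q \<in> Obj C" "r \<in> Obj C" "u \<in> arr C p q" "v \<in> arr C q r" "w \<in> arr C p r"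
    let ?n = "lres C p r p (d p) w"
    have n: "?n \<in> arr C r p" using * d by (simp add: lres_char)
    have "le (Hom C p r) (Cmp C p q r v u) w \<longleftrightarrow> le (Hom C p p) (Cmp C p r p ?n (Cmp C p q r v u)) (d p)"
      using * n d rres_char(2)[of p r p ?n "d p" "Cmp C p q r v u"] 2[of p r w] by simp
    also have "\<dots> \<longleftrightarrow> le (Hom C q p) (Cmp C q r p ?n v) (lres C p q p (d p) u)"
      using * n d by (simp add: Cmp_assoc lres_char)
    finally show "le (Hom C p r) (Cmp C p q r v u) w \<longleftrightarrow>
      le (Hom C q p) (Cmp C q r p ?n v) (lres C p q p (d p) u)" .
  qed
qed

section \<open>The quantaloid of doubly factored arrows\<close>

text \<open>
  An arrow from \<open>u : p \<rightarrow> q\<close> to \<open>v : p' \<rightarrow> q'\<close> is the diagonal \<open>w = v \<circ> s = t \<circ> u\<close> of a commutative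
  square, which is all that \<open>D(C)\<close> remembers of \<open>(s, t)\<close>.
\<close>

definition diagonals ::
  "('o, 'a) quantaloid_data \<Rightarrow> 'o \<times> 'o \<times> 'a \<Rightarrow> 'o \<times> 'o \<times> 'a \<Rightarrow> 'a set" where
  "diagonals C = (\<lambda>(p, q, u) (p', q', v).
     {w \<in> arr C p q'. (\<exists>s\<in>arr C p p'. w = Cmp C p p' q' v s) \<and>
        (\<exists>t\<in>arr C q q'. w = Cmp C p q q' t u)})"

text \<open>Composition chooses some factor \<open>t\<close> with \<open>g = t \<circ> v\<close> and
  returns \<open>t \<circ> f\<close>. Since \<open>f = v \<circ> s\<close> for some
  \<open>s\<close>, the result is \<open>g \<circ> s\<close> and does not depend on the choice. The
  identity of the object \<open>u\<close> is the diagonal of its trivial square.\<close>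

definition diagonal_quantaloid ::
  "('o, 'a) quantaloid_data \<Rightarrow> ('o \<times> 'o \<times> 'a, 'a) quantaloid_data" where
  "diagonal_quantaloid C =
     \<lparr>Obj = Arrows C,
      Hom = (\<lambda>(p, q, u) (p', q', v).
        \<lparr>carrier = diagonals C (p, q, u) (p', q', v), eq = (=), le = le (Hom C p q')\<rparr>),
      Cmp = (\<lambda>(p, q, u) (p', q', v) (p'', q'', w) g f.
        Cmp C p q' q'' (SOME t. t \<in> arr C q' q'' \<and> g = Cmp C p' q' q'' t v) f),
      Idn = (\<lambda>(p, q, u). u)\<rparr>"

lemma diagonal_simps [simp]:
  "Obj (diagonal_quantaloid C) = Arrows C"
  "arr (diagonal_quantaloid C) x y = diagonals C x y"
  "eq (Hom (diagonal_quantaloid C) x y) = (=)"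
  "le (Hom (diagonal_quantaloid C) (p, q, u) (p', q', v)) = le (Hom C p q')"
  "Idn (diagonal_quantaloid C) (p, q, u) = u"
  by (auto simp: diagonal_quantaloid_def split: prod.splits)

context quantaloid_loc
begin

lemma diagonals_iff:
  "w \<in> diagonals C (p, q, u) (p', q', v) \<longleftrightarrow> w \<in> arr C p q' \<and>
     (\<exists>s\<in>arr C p p'. w = Cmp C p p' q' v s) \<and> (\<exists>t\<in>arr C q q'. w = Cmp C p q q' t u)"
  by (simp add: diagonals_def)

lemma diagonalI:
  assumes "(p, q, u) \<in> Arrows C" "(p', q', v) \<in> Arrows C" "s \<in> arr C p p'" "t \<in> arr C q q'"
    "w = Cmp C p p' q' v s" "w = Cmp C p q q' t u"
  shows "w \<in> diagonals C (p, q, u) (p', q', v)"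
proof -
  have "w \<in> arr C p q'" using assms unfolding Arrows_def by auto
  then show ?thesis using assms unfolding diagonals_iff by blast
qed

lemma diagonal_Cmp:
  assumes "(p, q, u) \<in> Arrows C" "(p', q', v) \<in> Arrows C" "(p'', q'', z) \<in> Arrows C"
    and f: "f \<in> diagonals C (p, q, u) (p', q', v)"
    and g: "t \<in> arr C q' q''" "g = Cmp C p' q' q'' t v"
  shows "Cmp (diagonal_quantaloid C) (p, q, u) (p', q', v) (p'', q'', z) g f = Cmp C p q' q'' t f"
proof -
  define k where "k = (SOME t. t \<in> arr C q' q'' \<and> g = Cmp C p' q' q'' t v)"
  have k: "k \<in> arr C q' q''" "g = Cmp C p' q' q'' k v"
    using someI[of "\<lambda>t. t \<in> arr C q' q'' \<and> g = Cmp C p' q' q'' t v" t] g unfolding k_def by auto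
  obtain s where s: "s \<in> arr C p p'" "f = Cmp C p p' q' v s" using f by (auto simp: diagonals_iff)
  have o: "p \<in> Obj C" "p' \<in> Obj C" "q' \<in> Obj C" "q'' \<in> Obj C" "v \<in> arr C p' q'"
    using assms by (auto simp: Arrows_def)
  have "Cmp C p q' q'' k f = Cmp C p p' q'' g s" using o s k by (simp add: Cmp_assoc)
  also have "\<dots> = Cmp C p q' q'' t f" using o s g by (simp add: Cmp_assoc)
  finally show ?thesis by (simp add: diagonal_quantaloid_def k_def)
qed

lemma diagonal_Cmp':
  assumes "(p, q, u) \<in> Arrows C" "(p', q', v) \<in> Arrows C" "(p'', q'', z) \<in> Arrows C"
    and f: "f \<in> diagonals C (p, q, u) (p', q', v)" "g \<in> diagonals C (p', q', v) (p'', q'', z)"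
    and s: "s \<in> arr C p p'" "f = Cmp C p p' q' v s"
  shows "Cmp (diagonal_quantaloid C) (p, q, u) (p', q', v) (p'', q'', z) g f = Cmp C p p' q'' g s"
proof -
  obtain t where t: "t \<in> arr C q' q''" "g = Cmp C p' q' q'' t v" using f by (auto simp: diagonals_iff)
  show ?thesis
    unfolding diagonal_Cmp[OF assms(1-3) f(1) t] using assms t by (auto simp: Arrows_def Cmp_assoc)
qed

lemma diagonal_Cmp_in:
  assumes "(p, q, u) \<in> Arrows C" "(p', q', v) \<in> Arrows C" "(p'', q'', z) \<in> Arrows C"
    and f: "f \<in> diagonals C (p, q, u) (p', q', v)" "g \<in> diagonals C (p', q', v) (p'', q'', z)"
  shows "Cmp (diagonal_quantaloid C) (p, q, u) (p', q', v) (p'', q'', z) g f \<in> diagonals C (p, q, u)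
    (p'', q'', z)"
proof -
  obtain t where t: "t \<in> arr C q' q''" "g = Cmp C p' q' q'' t v" using f by (auto simp: diagonals_iff)
  obtain t' where t': "t' \<in> arr C q q'" "f = Cmp C p q q' t' u" using f by (auto simp: diagonals_iff)
  obtain s where s: "s \<in> arr C p p'" "f = Cmp C p p' q' v s" using f by (auto simp: diagonals_iff)
  obtain s' where s': "s' \<in> arr C p' p''" "g = Cmp C p' p'' q'' z s'" using f by (auto simp: diagonals_iff)
  show ?thesis
  proof (rule diagonalI[OF assms(1,3)])
    show "Cmp C p p' p'' s' s \<in> arr C p p''" "Cmp C q q' q'' t t' \<in> arr C q q''"
      using assms s s' t t' by (auto simp: Arrows_def)
    show "Cmp (diagonal_quantaloid C) (p, q, u) (p', q', v) (p'', q'', z) g f = Cmp C p p'' q'' z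
      (Cmp C p p' p'' s' s)"
      unfolding diagonal_Cmp'[OF assms s] using assms s s' by (auto simp: Arrows_def Cmp_assoc)
    show "Cmp (diagonal_quantaloid C) (p, q, u) (p', q', v) (p'', q'', z) g f = Cmp C p q q''
      (Cmp C q q' q'' t t') u"
      unfolding diagonal_Cmp[OF assms(1-4) t] using assms t t' by (auto simp: Arrows_def Cmp_assoc)
  qed
qed

text \<open>Join all first factors and all second factors of members of \<open>V\<close>:
  composition preserves joins, so these two joins are factors of the join of \<open>V\<close>. Joins
  of diagonals are therefore computed in \<open>C\<close>.\<close>

lemma diagonal_sup_in:
  assumes x: "(p, q, u) \<in> Arrows C" "(p', q', v) \<in> Arrows C" and V: "V \<subseteq> diagonals C (p, q, u) (p', q', v)"
  shows "\<Squnion>\<^bsub>Hom C p q'\<^esub> V \<in> diagonals C (p, q, u) (p', q', v)"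
proof -
  have o: "p \<in> Obj C" "q \<in> Obj C" "p' \<in> Obj C" "q' \<in> Obj C" "u \<in> arr C p q" "v \<in> arr C p' q'"
    using x by (auto simp: Arrows_def)
  let ?S = "{s \<in> arr C p p'. Cmp C p p' q' v s \<in> V}" and ?T = "{t \<in> arr C q q'. Cmp C p q q' t u \<in> V}"
  have "(\<lambda>s. Cmp C p p' q' v s) ` ?S = V" "(\<lambda>t. Cmp C p q q' t u) ` ?T = V"
  proof -
    have "\<exists>s\<in>?S. w = Cmp C p p' q' v s" "\<exists>t\<in>?T. w = Cmp C p q q' t u" if "w \<in> V" for w
    proof -
      have "w \<in> diagonals C (p, q, u) (p', q', v)" using that V by blast
      then show "\<exists>s\<in>?S. w = Cmp C p p' q' v s" "\<exists>t\<in>?T. w = Cmp C p q q' t u"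
        using that unfolding diagonals_iff by auto
    qed
    then show "(\<lambda>s. Cmp C p p' q' v s) ` ?S = V" "(\<lambda>t. Cmp C p q q' t u) ` ?T = V" by auto
  qed
  then have "Cmp C p p' q' v (\<Squnion>\<^bsub>Hom C p p'\<^esub> ?S) = \<Squnion>\<^bsub>Hom C p q'\<^esub> V"
    "Cmp C p q q' (\<Squnion>\<^bsub>Hom C q q'\<^esub> ?T) u = \<Squnion>\<^bsub>Hom C p q'\<^esub> V"
    using o by (auto simp: Cmp_sup_right Cmp_sup_left)
  then show ?thesis
    using o by (intro diagonalI[OF x, of "\<Squnion>\<^bsub>Hom C p p'\<^esub> ?S" "\<Squnion>\<^bsub>Hom C q q'\<^esub> ?T"]) auto
qed

lemma diagonal_po:
  assumes "x \<in> Arrows C" "y \<in> Arrows C"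
  shows "partial_order (Hom (diagonal_quantaloid C) x y)"
proof -
  obtain p q u p' q' v where xy: "x = (p, q, u)" "y = (p', q', v)" by (metis prod_cases3)
  have o: "p \<in> Obj C" "q' \<in> Obj C" using assms by (auto simp: xy Arrows_def)
  show ?thesis
  proof (rule partial_orderI)
    show "f = g" if "f \<in> arr (diagonal_quantaloid C) x y" "g \<in> arr (diagonal_quantaloid C) x y"
      "le (Hom (diagonal_quantaloid C) x y) f g" "le (Hom (diagonal_quantaloid C) x y) g f" for f g
      using that o le_antisym[of p q' f g] by (simp add: xy diagonals_iff)
    show "le (Hom (diagonal_quantaloid C) x y) f h" if "f \<in> arr (diagonal_quantaloid C) x y"
      "g \<in> arr (diagonal_quantaloid C) x y" "h \<in> arr (diagonal_quantaloid C) x y"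
      "le (Hom (diagonal_quantaloid C) x y) f g" "le (Hom (diagonal_quantaloid C) x y) g h" for f g h
      using that o le_trans[of p q' f g h] by (simp add: xy diagonals_iff)
  qed (use o in \<open>auto simp: xy diagonals_iff\<close>)
qed

lemma diagonal_join_of:
  assumes x: "(p, q, u) \<in> Arrows C" "(p', q', v) \<in> Arrows C" and V: "V \<subseteq> diagonals C (p, q, u) (p', q', v)"
  shows "join_of (Hom (diagonal_quantaloid C) (p, q, u) (p', q', v)) V (\<Squnion>\<^bsub>Hom C p q'\<^esub> V)"
proof -
  have o: "p \<in> Obj C" "q' \<in> Obj C" using x by (auto simp: Arrows_def)
  have "V \<subseteq> arr C p q'" using V by (auto simp: diagonals_iff)
  from sup_join_of[OF o this] show ?thesis
    using diagonal_sup_in[OF assms] unfolding join_of_def by (auto simp: diagonals_iff)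
qed

lemma diagonal_sup:
  assumes "(p, q, u) \<in> Arrows C" "(p', q', v) \<in> Arrows C" and V: "V \<subseteq> diagonals C (p, q, u) (p', q', v)"
  shows "\<Squnion>\<^bsub>Hom (diagonal_quantaloid C) (p, q, u) (p', q', v)\<^esub> V = \<Squnion>\<^bsub>Hom C p q'\<^esub> V"
  by (rule sup_eqI) (use assms diagonal_po diagonal_join_of in auto)

lemma diagonal_Idn_in: "(p, q, u) \<in> Arrows C \<Longrightarrow> u \<in> diagonals C (p, q, u) (p, q, u)"
  by (rule diagonalI[where s = "Idn C p" and t = "Idn C q"]) (auto simp: Arrows_def)

text \<open>Composition with a fixed diagonal is composition in \<open>C\<close> with one fixed
  factor of it, whence preservation of joins; associativity follows by pasting such factors.\<close>

lemma quantaloid_diagonal: "quantaloid (diagonal_quantaloid C)" (is "quantaloid ?E")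
proof (rule quantaloidI)
  show "category ?E"
    unfolding category_def diagonal_simps(1,2)
  proof (intro conjI ballI)
    show "Idn ?E x \<in> diagonals C x x" if "x \<in> Arrows C" for x
      using that by (cases x) (auto intro: diagonal_Idn_in)
    show "Cmp ?E x y z g f \<in> diagonals C x z"
      if "x \<in> Arrows C" "y \<in> Arrows C" "z \<in> Arrows C" "f \<in> diagonals C x y" "g \<in> diagonals C y z"
        for x y z f g
      using that by (cases x; cases y; cases z) (auto intro: diagonal_Cmp_in)
  next
    fix x y f assume *: "x \<in> Arrows C" "y \<in> Arrows C" "f \<in> diagonals C x y"
    obtain p q u p' q' v where xy: "x = (p, q, u)" "y = (p', q', v)" by (metis prod_cases3)
    note a = *[unfolded xy]
    have o: "p \<in> Obj C" "q \<in> Obj C" "p' \<in> Obj C" "q' \<in> Obj C" "u \<in> arr C p q" "v \<in> arr C p' q'"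
      using a by (auto simp: Arrows_def)
    show "Cmp ?E x x y f (Idn ?E x) = f"
      unfolding xy using diagonal_Cmp'[OF a(1,1,2) diagonal_Idn_in[OF a(1)] a(3), of "Idn C p"] o a(3)
      by (auto simp: diagonals_iff)
    show "Cmp ?E x y y (Idn ?E y) f = f"
      unfolding xy using diagonal_Cmp[OF a(1,2,2) a(3), of "Idn C q'" v] o a(3)
      by (auto simp: diagonals_iff)
  next
    fix x y z y' f g h assume *: "x \<in> Arrows C" "y \<in> Arrows C" "z \<in> Arrows C" "y' \<in> Arrows C"
      "f \<in> diagonals C x y" "g \<in> diagonals C y z" "h \<in> diagonals C z y'"
    obtain p q u p' q' v p'' q'' w p3 q3 k where xy: "x = (p, q, u)" "y = (p', q', v)" "z = (p'', q'', w)"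
      "y' = (p3, q3, k)"
      by (metis prod_cases3)
    note a = *[unfolded xy]
    obtain t where t: "t \<in> arr C q'' q3" "h = Cmp C p'' q'' q3 t w" using a(7) by (auto simp: diagonals_iff)
    obtain t' where t': "t' \<in> arr C q' q''" "g = Cmp C p' q' q'' t' v" using a(6)
      by (auto simp: diagonals_iff)
    have o: "p \<in> Obj C" "p' \<in> Obj C" "q' \<in> Obj C" "q'' \<in> Obj C" "q3 \<in> Obj C" "v \<in> arr C p' q'"
      "f \<in> arr C p q'"
      using a by (auto simp: Arrows_def diagonals_iff)
    have hg: "Cmp ?E (p', q', v) (p'', q'', w) (p3, q3, k) h g = Cmp C p' q' q3 (Cmp C q' q'' q3 t t') v"
      unfolding diagonal_Cmp[OF a(2-4) a(6) t] using t' t o by (simp add: Cmp_assoc)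
    have "Cmp ?E x y y' (Cmp ?E y z y' h g) f = Cmp C p q' q3 (Cmp C q' q'' q3 t t') f"
      unfolding xy using t t' o hg by (intro diagonal_Cmp a) auto
    moreover have "Cmp ?E x z y' h (Cmp ?E x y z g f) = Cmp C p q'' q3 t (Cmp C p q' q'' t' f)"
      unfolding xy using diagonal_Cmp[OF a(1,3,4) diagonal_Cmp_in[OF a(1-3,5,6)] t]
      by (simp add: diagonal_Cmp[OF a(1-3) a(5) t'])
    ultimately show "Cmp ?E x z y' h (Cmp ?E x y z g f) = Cmp ?E x y y' (Cmp ?E y z y' h g) f"
      using t t' o by (simp add: Cmp_assoc)
  qed
next
  fix x y V assume *: "x \<in> Obj ?E" "y \<in> Obj ?E" "V \<subseteq> arr ?E x y"
  then show "\<exists>s. join_of (Hom ?E x y) V s"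
    by (cases x; cases y; simp) (blast intro: diagonal_join_of)
next
  fix x y z f V s assume *: "x \<in> Obj ?E" "y \<in> Obj ?E" "z \<in> Obj ?E" "f \<in> arr ?E x y" "V \<subseteq> arr ?E y z"
    "join_of (Hom ?E y z) V s"
  obtain p q u p' q' v p'' q'' w where xy: "x = (p, q, u)" "y = (p', q', v)" "z = (p'', q'', w)"
    by (metis prod_cases3)
  note a = *[unfolded xy diagonal_simps]
  have o: "p \<in> Obj C" "p' \<in> Obj C" "q'' \<in> Obj C" using a by (auto simp: Arrows_def)
  have V: "V \<subseteq> arr C p' q''" using a by (auto simp: diagonals_iff)
  have s: "s = \<Squnion>\<^bsub>Hom C p' q''\<^esub> V"
    using join_of_unique[OF diagonal_po[OF a(2,3)] a(6) diagonal_join_of[OF a(2,3,5)]] .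
  obtain k where k: "k \<in> arr C p p'" "f = Cmp C p p' q' v k" using a(4) by (auto simp: diagonals_iff)
  have c: "Cmp ?E x y z g f = Cmp C p p' q'' g k" if "g \<in> diagonals C (p', q', v) (p'', q'', w)" for g
    unfolding xy using diagonal_Cmp'[OF a(1-4) that k] .
  have im: "(\<lambda>g. Cmp ?E x y z g f) ` V = (\<lambda>g. Cmp C p p' q'' g k) ` V"
    using c a(5) by (intro image_cong) auto
  have "(\<lambda>g. Cmp ?E x y z g f) ` V \<subseteq> diagonals C x z"
    using a diagonal_Cmp_in unfolding xy by blast
  then have "join_of (Hom ?E x z) ((\<lambda>g. Cmp ?E x y z g f) ` V) (\<Squnion>\<^bsub>Hom C p q''\<^esub> ((\<lambda>g. Cmp ?E x y z g f) ` V))"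
    unfolding xy by (rule diagonal_join_of[OF a(1,3)])
  moreover have "\<Squnion>\<^bsub>Hom C p q''\<^esub> ((\<lambda>g. Cmp ?E x y z g f) ` V) = Cmp ?E x y z s f"
    using a o V k unfolding im s by (subst c) (auto simp: Cmp_sup_left intro: diagonal_sup_in)
  ultimately show "join_of (Hom ?E x z) ((\<lambda>g. Cmp ?E x y z g f) ` V) (Cmp ?E x y z s f)" by simp
next
  fix x y z f V s assume *: "x \<in> Obj ?E" "y \<in> Obj ?E" "z \<in> Obj ?E" "f \<in> arr ?E y z" "V \<subseteq> arr ?E x y"
    "join_of (Hom ?E x y) V s"
  obtain p q u p' q' v p'' q'' w where xy: "x = (p, q, u)" "y = (p', q', v)" "z = (p'', q'', w)"
    by (metis prod_cases3)
  note a = *[unfolded xy diagonal_simps]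
  have o: "p \<in> Obj C" "q' \<in> Obj C" "q'' \<in> Obj C" using a by (auto simp: Arrows_def)
  have V: "V \<subseteq> arr C p q'" using a by (auto simp: diagonals_iff)
  have s: "s = \<Squnion>\<^bsub>Hom C p q'\<^esub> V"
    using join_of_unique[OF diagonal_po[OF a(1,2)] a(6) diagonal_join_of[OF a(1,2,5)]] .
  obtain k where k: "k \<in> arr C q' q''" "f = Cmp C p' q' q'' k v" using a(4) by (auto simp: diagonals_iff)
  have c: "Cmp ?E x y z f g = Cmp C p q' q'' k g" if "g \<in> diagonals C (p, q, u) (p', q', v)" for g
    unfolding xy using diagonal_Cmp[OF a(1-3) that k] .
  have im: "(\<lambda>g. Cmp ?E x y z f g) ` V = (\<lambda>g. Cmp C p q' q'' k g) ` V"
    using c a(5) by (intro image_cong) auto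
  have "(\<lambda>g. Cmp ?E x y z f g) ` V \<subseteq> diagonals C x z"
    using a diagonal_Cmp_in unfolding xy by blast
  then have "join_of (Hom ?E x z) ((\<lambda>g. Cmp ?E x y z f g) ` V) (\<Squnion>\<^bsub>Hom C p q''\<^esub> ((\<lambda>g. Cmp ?E x y z f g) ` V))"
    unfolding xy by (rule diagonal_join_of[OF a(1,3)])
  moreover have "\<Squnion>\<^bsub>Hom C p q''\<^esub> ((\<lambda>g. Cmp ?E x y z f g) ` V) = Cmp ?E x y z f s"
    using a o V k unfolding im s by (subst c) (auto simp: Cmp_sup_right intro: diagonal_sup_in)
  ultimately show "join_of (Hom ?E x z) ((\<lambda>g. Cmp ?E x y z f g) ` V) (Cmp ?E x y z f s)" by simp
qed (simp add: diagonal_po)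

text \<open>The arrows \<open>v\<close> and \<open>u\<close>, read as diagonals between each other,
  are mutually inverse: their composites are \<open>t' \<circ> v = u\<close> and
  \<open>t \<circ> u = v\<close>, the identities of the two objects.\<close>

lemma diagonal_iso_domain:
  assumes "(p, q, u) \<in> Arrows C" "(p, q', v) \<in> Arrows C" "t \<in> arr C q q'" "t' \<in> arr C q' q"
    "v = Cmp C p q q' t u" "u = Cmp C p q' q t' v"
  shows "is_iso (diagonal_quantaloid C) (p, q, u) (p, q', v) v"
proof -
  have o: "p \<in> Obj C" "q \<in> Obj C" "q' \<in> Obj C" "u \<in> arr C p q" "v \<in> arr C p q'"
    using assms(1,2) by (auto simp: Arrows_def)
  have v: "v \<in> diagonals C (p, q, u) (p, q', v)"
    using o by (intro diagonalI[OF assms(1,2) Idn_in assms(3) _ assms(5)]) simp_all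
  have u: "u \<in> diagonals C (p, q', v) (p, q, u)"
    using o by (intro diagonalI[OF assms(2,1) Idn_in assms(4) _ assms(6)]) simp_all
  show ?thesis
    unfolding is_iso_def diagonal_simps
    using v u diagonal_Cmp[OF assms(1,2,1) v assms(4,6)] diagonal_Cmp[OF assms(2,1,2) u assms(3,5)]
    unfolding assms(5)[symmetric] assms(6)[symmetric] by (intro conjI bexI[of _ u])
qed

lemma diagonal_iso_codomain:
  assumes "(p, q, u) \<in> Arrows C" "(p', q, v) \<in> Arrows C" "s \<in> arr C p p'" "s' \<in> arr C p' p"
    "u = Cmp C p p' q v s" "v = Cmp C p' p q u s'"
  shows "is_iso (diagonal_quantaloid C) (p, q, u) (p', q, v) u"
proof -
  have o: "p \<in> Obj C" "p' \<in> Obj C" "q \<in> Obj C" "u \<in> arr C p q" "v \<in> arr C p' q"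
    using assms(1,2) by (auto simp: Arrows_def)
  have u: "u \<in> diagonals C (p, q, u) (p', q, v)"
    using o by (intro diagonalI[OF assms(1,2,3) Idn_in assms(5)]) simp_all
  have v: "v \<in> diagonals C (p', q, v) (p, q, u)"
    using o by (intro diagonalI[OF assms(2,1,4) Idn_in assms(6)]) simp_all
  show ?thesis
    unfolding is_iso_def diagonal_simps
    using v u diagonal_Cmp'[OF assms(1,2,1) u v assms(3,5)] diagonal_Cmp'[OF assms(2,1,2) v u assms(4,6)]
    unfolding assms(5)[symmetric] assms(6)[symmetric] by (intro conjI bexI[of _ v])
qed

section \<open>The constructions \<open>D\<close> and \<open>B\<close>\<close>

text \<open>\<open>H\<close> is an arbitrary set of pairs, so a join of pairs need not lie in it;
  membership of the componentwise join is assumed here and comes from \<open>square_join\<close> in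
  both uses.\<close>

lemma componentwise_join:
  assumes o: "p \<in> Obj C" "q \<in> Obj C" "p' \<in> Obj C" "q' \<in> Obj C" and H: "H \<subseteq> arr C p p' \<times> arr C q q'"
    and st: "(s, t) \<in> H" "(s', t') \<in> H" "(\<Squnion>\<^bsub>Hom C p p'\<^esub> {s, s'}, \<Squnion>\<^bsub>Hom C q q'\<^esub> {t, t'}) \<in> H"
  shows "(s, t) \<squnion>\<^bsub>\<lparr>carrier = H, eq = (=),
      le = (\<lambda>(s, t) (s', t'). le (Hom C p p') s s' \<and> le (Hom C q q') t t')\<rparr>\<^esub> (s', t') =
    (\<Squnion>\<^bsub>Hom C p p'\<^esub> {s, s'}, \<Squnion>\<^bsub>Hom C q q'\<^esub> {t, t'})" (is "_ \<squnion>\<^bsub>?L\<^esub> _ = _")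
proof (rule join_eqI)
  show "partial_order ?L"
  proof (rule partial_orderI)
    show "x = y" if "x \<in> carrier ?L" "y \<in> carrier ?L" "le ?L x y" "le ?L y x" for x y
    proof -
      obtain x1 x2 y1 y2 where "x = (x1, x2)" "y = (y1, y2)" by (metis surj_pair)
      then show ?thesis
        using that o H le_antisym[of p p' x1 y1] le_antisym[of q q' x2 y2] by auto
    qed
    show "le ?L x z" if "x \<in> carrier ?L" "y \<in> carrier ?L" "z \<in> carrier ?L" "le ?L x y" "le ?L y z" for x y z
    proof -
      obtain x1 x2 y1 y2 z1 z2 where "x = (x1, x2)" "y = (y1, y2)" "z = (z1, z2)"
        by (metis surj_pair)
      then show ?thesis
        using that o H le_trans[of p p' x1 y1 z1] le_trans[of q q' x2 y2 z2] by auto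
    qed
  qed (use o H in auto)
  have m: "s \<in> arr C p p'" "s' \<in> arr C p p'" "t \<in> arr C q q'" "t' \<in> arr C q q'" using st H by auto
  then show "join_of ?L {(s, t), (s', t')} (\<Squnion>\<^bsub>Hom C p p'\<^esub> {s, s'}, \<Squnion>\<^bsub>Hom C q q'\<^esub> {t, t'})"
    unfolding join_of_def using o H st(3) by (auto simp: sup_le_iff le_sup subset_iff)
qed (use st in auto)

lemma square_paste:
  assumes o: "x \<in> Obj C" "y \<in> Obj C" "z \<in> Obj C" "a \<in> Obj C" "b \<in> Obj C" "c \<in> Obj C"
    and m: "u \<in> arr C x a" "v \<in> arr C y b" "w \<in> arr C z c" "f \<in> arr C x y" "g \<in> arr C y z"
      "t \<in> arr C a b" "t' \<in> arr C b c"
    and sq: "Cmp C x y b v f = Cmp C x a b t u" "Cmp C y z c w g = Cmp C y b c t' v"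
  shows "Cmp C x z c w (Cmp C x y z g f) = Cmp C x a c (Cmp C a b c t' t) u"
proof -
  have "Cmp C x z c w (Cmp C x y z g f) = Cmp C x y c (Cmp C y z c w g) f"
    using o m by (simp add: Cmp_assoc)
  also have "\<dots> = Cmp C x b c t' (Cmp C x y b v f)"
    unfolding sq(2) by (rule Cmp_assoc[symmetric]) (use o m in auto)
  also have "\<dots> = Cmp C x a c (Cmp C a b c t' t) u"
    unfolding sq(1) using o m by (simp add: Cmp_assoc)
  finally show ?thesis .
qed

lemma square_join:
  assumes o: "x \<in> Obj C" "y \<in> Obj C" "a \<in> Obj C" "b \<in> Obj C"
    and m: "u \<in> arr C x a" "v \<in> arr C y b" "f \<in> arr C x y" "f' \<in> arr C x y" "t \<in> arr C a b" "t' \<in> arr C a b"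
    and sq: "Cmp C x y b v f = Cmp C x a b t u" "Cmp C x y b v f' = Cmp C x a b t' u"
  shows "Cmp C x y b v (\<Squnion>\<^bsub>Hom C x y\<^esub> {f, f'}) = Cmp C x a b (\<Squnion>\<^bsub>Hom C a b\<^esub> {t, t'}) u"
  using o m by (simp add: Cmp_sup_left Cmp_sup_right sq)

text \<open>
  Here \<open>\<sigma>\<close> selects the side of a square that determines it up to the congruence: the first component
  for \<open>D\<close>, the second for \<open>B\<close>, all of \<open>f\<close> for interior spaces.
\<close>

lemma weak_equivalence_squares:
  assumes obj: "\<And>S. S \<in> Obj I \<Longrightarrow> (X S, A S, u S) \<in> Arrows C"
    and sq: "\<And>S T f. \<lbrakk>S \<in> Obj I; T \<in> Obj I; f \<in> arr I S T\<rbrakk> \<Longrightarrow> \<sigma> f \<in> arr C (X S) (X T) \<and>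
      (\<exists>t\<in>arr C (A S) (A T). Cmp C (X S) (X T) (A T) (u T) (\<sigma> f) = Cmp C (X S) (A S) (A T) t (u S))"
    and full: "\<And>S T s t. \<lbrakk>S \<in> Obj I; T \<in> Obj I; s \<in> arr C (X S) (X T); t \<in> arr C (A S) (A T);
      Cmp C (X S) (X T) (A T) (u T) s = Cmp C (X S) (A S) (A T) t (u S)\<rbrakk> \<Longrightarrow> \<exists>f\<in>arr I S T. \<sigma> f = s"
    and idn: "\<And>S. S \<in> Obj I \<Longrightarrow> Idn I S \<in> arr I S S \<and> \<sigma> (Idn I S) = Idn C (X S)"
    and cmp: "\<And>S T V f g. \<lbrakk>S \<in> Obj I; T \<in> Obj I; V \<in> Obj I; f \<in> arr I S T; g \<in> arr I T V\<rbrakk> \<Longrightarrow>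
      Cmp I S T V g f \<in> arr I S V \<and> \<sigma> (Cmp I S T V g f) = Cmp C (X S) (X T) (X V) (\<sigma> g) (\<sigma> f)"
    and join: "\<And>S T f g. \<lbrakk>S \<in> Obj I; T \<in> Obj I; f \<in> arr I S T; g \<in> arr I S T\<rbrakk> \<Longrightarrow>
      f \<squnion>\<^bsub>Hom I S T\<^esub> g \<in> arr I S T \<and> \<sigma> (f \<squnion>\<^bsub>Hom I S T\<^esub> g) = \<Squnion>\<^bsub>Hom C (X S) (X T)\<^esub> {\<sigma> f, \<sigma> g}"
    and R: "\<And>S T. \<lbrakk>S \<in> Obj I; T \<in> Obj I\<rbrakk> \<Longrightarrow> R S T = {(f, g). f \<in> arr I S T \<and> g \<in> arr I S T \<and>
      Cmp C (X S) (X T) (A T) (u T) (\<sigma> f) = Cmp C (X S) (X T) (A T) (u T) (\<sigma> g)}"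
    and eso: "\<And>x. x \<in> Arrows C \<Longrightarrow> \<exists>S\<in>Obj I. \<exists>w. is_iso (diagonal_quantaloid C) (X S, A S, u S) x w"
  shows "\<exists>Fo Fa. weak_equivalence (quotient_quantaloid I R) (diagonal_quantaloid C) Fo Fa"
proof (intro exI, rule weak_equivalence_quotient[where Fo = "\<lambda>S. (X S, A S, u S)"
    and Fa = "\<lambda>S T f. Cmp C (X S) (X T) (A T) (u T) (\<sigma> f)"])
  let ?E = "diagonal_quantaloid C"
  let ?o = "\<lambda>S. (X S, A S, u S)" and ?F = "\<lambda>S T f. Cmp C (X S) (X T) (A T) (u T) (\<sigma> f)"
  have o: "X S \<in> Obj C" "A S \<in> Obj C" "u S \<in> arr C (X S) (A S)" if "S \<in> Obj I" for S
    using obj[OF that] by (auto simp: Arrows_def)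
  have Fin: "?F S T f \<in> diagonals C (?o S) (?o T)" if S: "S \<in> Obj I" "T \<in> Obj I" "f \<in> arr I S T" for S T f
    using sq[OF S] diagonalI[OF obj obj, OF S(1,2)] by blast
  show "quantaloid ?E" by (rule quantaloid_diagonal)
  show "Idn I S \<in> arr I S S \<and> ?F S S (Idn I S) = Idn ?E (?o S)" if "S \<in> Obj I" for S
    using o[OF that] idn[OF that] by simp
  show "?F S T ` arr I S T = arr ?E (?o S) (?o T)" if S: "S \<in> Obj I" "T \<in> Obj I" for S T
  proof (intro equalityI subsetI)
    fix w assume "w \<in> arr ?E (?o S) (?o T)"
    then obtain s t where s: "s \<in> arr C (X S) (X T)" "t \<in> arr C (A S) (A T)"
        "w = Cmp C (X S) (X T) (A T) (u T) s" "w = Cmp C (X S) (A S) (A T) t (u S)"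
      by (auto simp: diagonals_iff)
    obtain f where "f \<in> arr I S T" "\<sigma> f = s" using full[OF S s(1,2)] s(3,4) by auto
    with s(3) show "w \<in> ?F S T ` arr I S T" by blast
  qed (use Fin S in auto)
  show "Cmp I S T V g f \<in> arr I S V \<and> ?F S V (Cmp I S T V g f) = Cmp ?E (?o S) (?o T) (?o V) (?F T V g)
    (?F S T f)"
    if S: "S \<in> Obj I" "T \<in> Obj I" "V \<in> Obj I" and f: "f \<in> arr I S T" "g \<in> arr I T V" for S T V f g
  proof -
    have s: "\<sigma> f \<in> arr C (X S) (X T)" "\<sigma> g \<in> arr C (X T) (X V)" using sq S f by blast+
    show ?thesis
      unfolding diagonal_Cmp'[OF obj obj obj Fin Fin s(1) refl, OF S S(1,2) f(1) S(2,3) f(2)]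
      using cmp[OF S f] o[OF S(1)] o[OF S(2)] o[OF S(3)] s by (simp add: Cmp_assoc)
  qed
  show "f \<squnion>\<^bsub>Hom I S T\<^esub> g \<in> arr I S T \<and> ?F S T (f \<squnion>\<^bsub>Hom I S T\<^esub> g) = \<Squnion>\<^bsub>Hom ?E (?o S) (?o T)\<^esub>
    {?F S T f, ?F S T g}"
    if S: "S \<in> Obj I" "T \<in> Obj I" and f: "f \<in> arr I S T" "g \<in> arr I S T" for S T f g
  proof -
    have s: "\<sigma> f \<in> arr C (X S) (X T)" "\<sigma> g \<in> arr C (X S) (X T)" using sq S f by blast+
    show ?thesis
      using join[OF S f] diagonal_sup[OF obj obj, OF S, of "{?F S T f, ?F S T g}"] Fin S f s
        o[OF S(1)] o[OF S(2)] by (simp add: Cmp_sup_right)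
  qed
qed (use R eso obj in auto)

text \<open>Identity on objects: the congruence of \<open>D\<close> identifies squares with equal
  \<open>v \<circ> s\<close>, which is equality of diagonals.\<close>

lemma weak_equivalence_D:
  "\<exists>Fo Fa. weak_equivalence (D_quantaloid C) (diagonal_quantaloid C) Fo Fa"
  unfolding D_quantaloid_def
proof (rule weak_equivalence_squares[where X = fst and A = "\<lambda>x. fst (snd x)" and u = "\<lambda>x. snd (snd x)"
  and \<sigma> = fst])
  let ?A = "Arr_quantaloid C" and ?E = "diagonal_quantaloid C"
  have A: "Obj ?A = Arrows C" "Idn ?A (p, q, u) = (Idn C p, Idn C q)"
    "Cmp ?A (p, q, u) (p', q', v) (p'', q'', w) (s', t') (s, t) = (Cmp C p p' p'' s' s, Cmp C q q' q'' t' t)"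
    "arr ?A (p, q, u) (p', q', v) =
      {(s, t). s \<in> arr C p p' \<and> t \<in> arr C q q' \<and> Cmp C p p' q' v s = Cmp C p q q' t u}"
    for p q u p' q' v p'' q'' w s t s' t'
    by (auto simp: Arr_quantaloid_def componentwise_quantaloid_def)
  have AC: "(p, q, u) \<in> Arrows C \<longleftrightarrow> p \<in> Obj C \<and> q \<in> Obj C \<and> u \<in> arr C p q" for p q u
    by (simp add: Arrows_def)
  show "(fst x, fst (snd x), snd (snd x)) \<in> Arrows C" if "x \<in> Obj ?A" for x using that by (simp add: A)
  show "\<exists>y\<in>Obj ?A. \<exists>w. is_iso ?E (fst y, fst (snd y), snd (snd y)) x w" if "x \<in> Arrows C" for x
    using quantaloid_loc.is_iso_Idn[of ?E x] quantaloid_diagonal that by (auto simp: quantaloid_loc_def A)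
  show "Idn ?A x \<in> arr ?A x x \<and> fst (Idn ?A x) = Idn C (fst x)" if "x \<in> Obj ?A" for x
    using that by (cases x) (auto simp: A AC)
  show "Cmp ?A x y z g f \<in> arr ?A x z \<and> fst (Cmp ?A x y z g f) = Cmp C (fst x) (fst y) (fst z) (fst g)
    (fst f)"
    if "x \<in> Obj ?A" "y \<in> Obj ?A" "z \<in> Obj ?A" "f \<in> arr ?A x y" "g \<in> arr ?A y z" for x y z f g
    using that by (cases x; cases y; cases z; cases f; cases g) (auto simp: A AC intro!: square_paste)
  fix x y assume x: "x \<in> Obj ?A" and y: "y \<in> Obj ?A"
  obtain p q u p' q' v where xy: "x = (p, q, u)" "y = (p', q', v)" by (metis prod_cases3)
  have o: "p \<in> Obj C" "q \<in> Obj C" "u \<in> arr C p q" "p' \<in> Obj C" "q' \<in> Obj C" "v \<in> arr C p' q'"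
    using x y by (auto simp: xy A AC)
  show "\<exists>f\<in>arr ?A x y. fst f = s" if "s \<in> arr C (fst x) (fst y)" "t \<in> arr C (fst (snd x)) (fst (snd y))"
      "Cmp C (fst x) (fst y) (fst (snd y)) (snd (snd y)) s = Cmp C (fst x) (fst (snd x)) (fst (snd y)) t
        (snd (snd x))"
      for s t
    using that by (intro bexI[of _ "(s, t)"]) (auto simp: xy A)
  show "fst f \<in> arr C (fst x) (fst y) \<and> (\<exists>t\<in>arr C (fst (snd x)) (fst (snd y)).
      Cmp C (fst x) (fst y) (fst (snd y)) (snd (snd y)) (fst f) = Cmp C (fst x) (fst (snd x)) (fst (snd y)) t
        (snd (snd x)))"
    if "f \<in> arr ?A x y" for f
    using that by (auto simp: xy A)
  show "f \<squnion>\<^bsub>Hom ?A x y\<^esub> g \<in> arr ?A x y \<and> fst (f \<squnion>\<^bsub>Hom ?A x y\<^esub> g) = \<Squnion>\<^bsub>Hom C (fst x) (fst y)\<^esub> {fst f, fst g}"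
    if f: "f \<in> arr ?A x y" "g \<in> arr ?A x y" for f g
  proof -
    obtain s t s' t' where st: "f = (s, t)" "g = (s', t')" by (metis surj_pair)
    have mem: "(\<Squnion>\<^bsub>Hom C p p'\<^esub> {s, s'}, \<Squnion>\<^bsub>Hom C q q'\<^esub> {t, t'}) \<in> arr ?A x y"
      using f o by (auto simp: xy st A intro!: square_join)
    have H: "Hom ?A x y = \<lparr>carrier = arr ?A x y, eq = (=),
        le = (\<lambda>(s, t) (s', t'). le (Hom C p p') s s' \<and> le (Hom C q q') t t')\<rparr>"
      unfolding xy by (simp add: Arr_quantaloid_def componentwise_quantaloid_def)
    have "f \<squnion>\<^bsub>Hom ?A x y\<^esub> g = (\<Squnion>\<^bsub>Hom C p p'\<^esub> {s, s'}, \<Squnion>\<^bsub>Hom C q q'\<^esub> {t, t'})"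
      unfolding st by (subst H, rule componentwise_join) (use o f mem in \<open>auto simp: st xy A\<close>)
    then show ?thesis using mem by (simp add: xy st)
  qed
qed (auto split: prod.splits)

end

context star_quantaloid
begin

text \<open>Negating objects exchanges the roles of the components: \<open>(s, t)\<close> satisfies
  the residual condition from \<open>u\<close> to \<open>v\<close> exactly when \<open>t\<close> and
  \<open>s\<close> form a square from \<open>\<not>u : q \<rightarrow> p\<close> to
  \<open>\<not>v : q' \<rightarrow> p'\<close>. Hence \<open>\<sigma>\<close> is \<open>snd\<close>,
  while the direction of arrows is kept.\<close>

lemma weak_equivalence_B:
  "\<exists>Fo Fa. weak_equivalence (B_quantaloid C) (diagonal_quantaloid C) Fo Fa"
  unfolding B_quantaloid_def
proof (rule weak_equivalence_squares[where X = "\<lambda>x. fst (snd x)" and A = fst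
      and u = "\<lambda>x. n (fst x) (fst (snd x)) (snd (snd x))" and \<sigma> = snd])
  let ?A = "ChuCon_quantaloid C" and ?E = "diagonal_quantaloid C"
  have A: "Obj ?A = Arrows C" "Idn ?A (p, q, u) = (Idn C p, Idn C q)"
    "Cmp ?A (p, q, u) (p', q', v) (p'', q'', w) (s', t') (s, t) = (Cmp C p p' p'' s' s, Cmp C q q' q'' t' t)"
    for p q u p' q' v p'' q'' w s t s' t'
    by (auto simp: ChuCon_quantaloid_def componentwise_quantaloid_def)
  have AC: "(p, q, u) \<in> Arrows C \<longleftrightarrow> p \<in> Obj C \<and> q \<in> Obj C \<and> u \<in> arr C p q" for p q u
    by (simp add: Arrows_def)
  have sq: "(s, t) \<in> arr ?A (p, q, u) (p', q', v) \<longleftrightarrow> s \<in> arr C p p' \<and> t \<in> arr C q q' \<and>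
      Cmp C q q' p' (n p' q' v) t = Cmp C q p p' s (n p q u)"
    if "(p, q, u) \<in> Arrows C" "(p', q', v) \<in> Arrows C" for p q u p' q' v s t
  proof -
    have "lres C p p' q u s = rres C p' q q' t v \<longleftrightarrow>
        Cmp C q q' p' (n p' q' v) t = Cmp C q p p' s (n p q u)" if "s \<in> arr C p p'" "t \<in> arr C q q'"
      using that \<open>(p, q, u) \<in> Arrows C\<close> \<open>(p', q', v) \<in> Arrows C\<close> by (auto simp: AC lres_eq rres_eq neg_eq_iff)
    then show ?thesis by (auto simp: ChuCon_quantaloid_def componentwise_quantaloid_def)
  qed
  show "(fst (snd x), fst x, n (fst x) (fst (snd x)) (snd (snd x))) \<in> Arrows C" if "x \<in> Obj ?A" for x
    using that by (cases x) (auto simp: A AC)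
  show "\<exists>y\<in>Obj ?A. \<exists>w. is_iso ?E (fst (snd y), fst y, n (fst y) (fst (snd y)) (snd (snd y))) x w"
    if "x \<in> Arrows C" for x
  proof -
    obtain p q u where x: "x = (p, q, u)" by (rule prod_cases3)
    \<comment> \<open>Negation is an involution, so \<open>x\<close> is exactly the image of its
      negation and the identity serves as isomorphism.\<close>
    have "is_iso ?E x x (Idn ?E x)"
      using quantaloid_loc.is_iso_Idn[of ?E x] quantaloid_diagonal that by (simp add: quantaloid_loc_def)
    then show ?thesis
      using that by (intro bexI[of _ "(q, p, n p q u)"]) (auto simp: x A AC)
  qed
  show "Idn ?A x \<in> arr ?A x x \<and> snd (Idn ?A x) = Idn C (fst (snd x))" if "x \<in> Obj ?A" for x
    using that by (cases x) (auto simp: A sq AC)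
  show "Cmp ?A x y z g f \<in> arr ?A x z \<and>
      snd (Cmp ?A x y z g f) = Cmp C (fst (snd x)) (fst (snd y)) (fst (snd z)) (snd g) (snd f)"
    if "x \<in> Obj ?A" "y \<in> Obj ?A" "z \<in> Obj ?A" "f \<in> arr ?A x y" "g \<in> arr ?A y z" for x y z f g
    using that by (cases x; cases y; cases z; cases f; cases g)
      (auto simp: A sq, auto simp: AC intro!: square_paste)
  fix x y assume x: "x \<in> Obj ?A" and y: "y \<in> Obj ?A"
  obtain p q u p' q' v where xy: "x = (p, q, u)" "y = (p', q', v)" by (metis prod_cases3)
  have ob: "(p, q, u) \<in> Arrows C" "(p', q', v) \<in> Arrows C" using x y by (auto simp: xy A)
  have o: "p \<in> Obj C" "q \<in> Obj C" "u \<in> arr C p q" "p' \<in> Obj C" "q' \<in> Obj C" "v \<in> arr C p' q'"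
    using ob by (auto simp: AC)
  show "\<exists>f\<in>arr ?A x y. snd f = s"
    if "s \<in> arr C (fst (snd x)) (fst (snd y))" "t \<in> arr C (fst x) (fst y)"
      "Cmp C (fst (snd x)) (fst (snd y)) (fst y) (n (fst y) (fst (snd y)) (snd (snd y))) s =
       Cmp C (fst (snd x)) (fst x) (fst y) t (n (fst x) (fst (snd x)) (snd (snd x)))" for s t
    using that by (intro bexI[of _ "(t, s)"]) (auto simp: xy sq[OF ob])
  show "snd f \<in> arr C (fst (snd x)) (fst (snd y)) \<and> (\<exists>t\<in>arr C (fst x) (fst y).
      Cmp C (fst (snd x)) (fst (snd y)) (fst y) (n (fst y) (fst (snd y)) (snd (snd y))) (snd f) =
      Cmp C (fst (snd x)) (fst x) (fst y) t (n (fst x) (fst (snd x)) (snd (snd x))))"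
    if "f \<in> arr ?A x y" for f
    using that by (cases f) (auto simp: xy sq[OF ob])
  show "f \<squnion>\<^bsub>Hom ?A x y\<^esub> g \<in> arr ?A x y \<and>
      snd (f \<squnion>\<^bsub>Hom ?A x y\<^esub> g) = \<Squnion>\<^bsub>Hom C (fst (snd x)) (fst (snd y))\<^esub> {snd f, snd g}"
    if f: "f \<in> arr ?A x y" "g \<in> arr ?A x y" for f g
  proof -
    obtain s t s' t' where st: "f = (s, t)" "g = (s', t')" by (metis surj_pair)
    have mem: "(\<Squnion>\<^bsub>Hom C p p'\<^esub> {s, s'}, \<Squnion>\<^bsub>Hom C q q'\<^esub> {t, t'}) \<in> arr ?A x y"
      using f o by (auto simp: xy st sq[OF ob] intro!: square_join)
    have H: "Hom ?A x y = \<lparr>carrier = arr ?A x y, eq = (=),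
        le = (\<lambda>(s, t) (s', t'). le (Hom C p p') s s' \<and> le (Hom C q q') t t')\<rparr>"
      unfolding xy by (simp add: ChuCon_quantaloid_def componentwise_quantaloid_def)
    have "arr ?A x y \<subseteq> arr C p p' \<times> arr C q q'" unfolding xy using sq[OF ob] by auto
    then have "f \<squnion>\<^bsub>Hom ?A x y\<^esub> g = (\<Squnion>\<^bsub>Hom C p p'\<^esub> {s, s'}, \<Squnion>\<^bsub>Hom C q q'\<^esub> {t, t'})"
      unfolding st using o f mem by (subst H, intro componentwise_join) (auto simp: st)
    then show ?thesis using mem by (simp add: xy st)
  qed
  \<comment> \<open>The congruence of \<open>B\<close> is stated through \<open>s\<close>; negating
    and using the square moves it to \<open>t\<close>, the component selected by
    \<open>\<sigma>\<close>.\<close>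
  have "lres C p p' q u s = lres C p p' q u s' \<longleftrightarrow> Cmp C q q' p' (n p' q' v) t = Cmp C q q' p' (n p' q' v) t'"
    if "(s, t) \<in> arr ?A x y" "(s', t') \<in> arr ?A x y" for s t s' t'
    using that o unfolding xy sq[OF ob] by (simp add: lres_eq neg_eq_iff)
  then show "(case x of (p, q, u) \<Rightarrow> \<lambda>(p', q', v). {((s, t), (s', t')).
      (s, t) \<in> arr ?A (p, q, u) (p', q', v) \<and> (s', t') \<in> arr ?A (p, q, u) (p', q', v) \<and>
      lres C p p' q u s = lres C p p' q u s'}) y =
    {(f, g). f \<in> arr ?A x y \<and> g \<in> arr ?A x y \<and>
      Cmp C (fst (snd x)) (fst (snd y)) (fst y) (n (fst y) (fst (snd y)) (snd (snd y))) (snd f) =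
      Cmp C (fst (snd x)) (fst (snd y)) (fst y) (n (fst y) (fst (snd y)) (snd (snd y))) (snd g)}"
    unfolding xy by auto
qed

end

section \<open>Meets in hom-sets, and joins recognised by their upper bounds\<close>

context quantaloid_loc
begin

lemma eq_iff':
  assumes "p \<in> Obj C" "q \<in> Obj C" "u \<in> arr C p q" "v \<in> arr C p q"
    "\<And>f. f \<in> arr C p q \<Longrightarrow> le (Hom C p q) u f \<longleftrightarrow> le (Hom C p q) v f"
  shows "u = v"
  using assms le_antisym le_refl by meson

lemma inf_greatest:
  assumes "p \<in> Obj C" "q \<in> Obj C" "V \<subseteq> arr C p q"
  shows "\<Sqinter>\<^bsub>Hom C p q\<^esub> V \<in> arr C p q"
    and "w \<in> arr C p q \<Longrightarrow> le (Hom C p q) w (\<Sqinter>\<^bsub>Hom C p q\<^esub> V) \<longleftrightarrow> (\<forall>v\<in>V. le (Hom C p q) w v)"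
proof -
  interpret L: complete_lattice "Hom C p q" using assms by (simp add: Hom_cl)
  show in': "\<Sqinter>\<^bsub>Hom C p q\<^esub> V \<in> arr C p q" using assms by simp
  show "le (Hom C p q) w (\<Sqinter>\<^bsub>Hom C p q\<^esub> V) \<longleftrightarrow> (\<forall>v\<in>V. le (Hom C p q) w v)" if "w \<in> arr C p q"
  proof
    show "\<forall>v\<in>V. le (Hom C p q) w v" if "le (Hom C p q) w (\<Sqinter>\<^bsub>Hom C p q\<^esub> V)"
      using le_trans[OF assms(1,2) \<open>w \<in> arr C p q\<close> in' _ that] L.inf_lower[OF assms(3)] assms(3) by auto
    show "le (Hom C p q) w (\<Sqinter>\<^bsub>Hom C p q\<^esub> V)" if "\<forall>v\<in>V. le (Hom C p q) w v"
      by (rule L.inf_greatest) (use that assms \<open>w \<in> arr C p q\<close> in auto)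
  qed
qed

end

text \<open>Taking \<open>f = s\<close> shows that \<open>s\<close> bounds \<open>A\<close>; the
  remaining \<open>f\<close> give leastness.\<close>

lemma join_ofI:
  assumes "partial_order L" "s \<in> carrier L"
    and "\<And>f. f \<in> carrier L \<Longrightarrow> le L s f \<longleftrightarrow> (\<forall>a\<in>A. le L a f)"
  shows "join_of L A s"
proof -
  interpret partial_order L by (rule assms)
  show ?thesis unfolding join_of_def using assms(2,3) by blast
qed

section \<open>Distributors\<close>

text \<open>The base is named separately so that \<open>star_quantaloid\<close> can be interpreted
  once more, under the prefix \<open>QD\<close>, for the quantaloid of distributors over it.\<close>

locale distributors = star_quantaloid Q n for Q :: "('o, 'a) quantaloid_data" and n
begin

abbreviation leQ :: "'o \<Rightarrow> 'o \<Rightarrow> 'a \<Rightarrow> 'a \<Rightarrow> bool" where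
  "leQ p q \<equiv> le (Hom Q p q)"

lemma ty_in [simp, intro]: "\<lbrakk>qcat Q X; x \<in> pts X\<rbrakk> \<Longrightarrow> ty X x \<in> Obj Q"
  unfolding qcat_def by auto

lemma hm_in [simp, intro]: "\<lbrakk>qcat Q X; x \<in> pts X; y \<in> pts X\<rbrakk> \<Longrightarrow> hm X x y \<in> arr Q (ty X x) (ty X y)"
  unfolding qcat_def by (auto simp: PiE_iff)

lemma hm_refl: "\<lbrakk>qcat Q X; x \<in> pts X\<rbrakk> \<Longrightarrow> leQ (ty X x) (ty X x) (Idn Q (ty X x)) (hm X x x)"
  unfolding qcat_def by blast

lemma hm_trans: "\<lbrakk>qcat Q X; x \<in> pts X; y \<in> pts X; z \<in> pts X\<rbrakk> \<Longrightarrow>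
  leQ (ty X x) (ty X z) (Cmp Q (ty X x) (ty X y) (ty X z) (hm X y z) (hm X x y)) (hm X x z)"
  unfolding qcat_def by blast

lemma dist_in [simp, intro]:
  "\<lbrakk>\<phi> \<in> dists Q X Y; x \<in> pts X; y \<in> pts Y\<rbrakk> \<Longrightarrow> \<phi> x y \<in> arr Q (ty X x) (ty Y y)"
  unfolding dists_def by (auto simp: PiE_iff)

lemma le_Cmp_Idn:
  assumes "p \<in> Obj Q" "q \<in> Obj Q" "u \<in> arr Q p q"
  shows "\<lbrakk>f \<in> arr Q p p; leQ p p (Idn Q p) f\<rbrakk> \<Longrightarrow> leQ p q u (Cmp Q p p q u f)"
    and "\<lbrakk>g \<in> arr Q q q; leQ q q (Idn Q q) g\<rbrakk> \<Longrightarrow> leQ p q u (Cmp Q p q q g u)"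
  using Cmp_mono_right[of p p q u "Idn Q p" f] Cmp_mono_left[of p q q u "Idn Q q" g] assms by auto

text \<open>The defining inequality of a distributor is two-sided; the action of \<open>X\<close> is
  removed by inserting \<open>hm X x x\<close>, which lies above the identity.\<close>

lemma dist_left:
  assumes X: "qcat Q X" "qcat Q Y" and p: "\<phi> \<in> dists Q X Y" "x \<in> pts X" "y \<in> pts Y" "y' \<in> pts Y"
  shows "leQ (ty X x) (ty Y y') (Cmp Q (ty X x) (ty Y y) (ty Y y') (hm Y y y') (\<phi> x y)) (\<phi> x y')"
proof -
  have 1: "leQ (ty X x) (ty Y y) (\<phi> x y) (Cmp Q (ty X x) (ty X x) (ty Y y) (\<phi> x y) (hm X x x))"
    using X p hm_refl by (intro le_Cmp_Idn) auto
  have 2: "leQ (ty X x) (ty Y y') (Cmp Q (ty X x) (ty Y y) (ty Y y') (hm Y y y')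
      (Cmp Q (ty X x) (ty X x) (ty Y y) (\<phi> x y) (hm X x x))) (\<phi> x y')"
    using p unfolding dists_def by blast
  have "leQ (ty X x) (ty Y y') (Cmp Q (ty X x) (ty Y y) (ty Y y') (hm Y y y') (\<phi> x y))
    (Cmp Q (ty X x) (ty Y y) (ty Y y') (hm Y y y') (Cmp Q (ty X x) (ty X x) (ty Y y) (\<phi> x y) (hm X x x)))"
    using X p 1 by (intro Cmp_mono_right) auto
  from le_trans[OF _ _ _ _ _ this 2] show ?thesis using X p by simp
qed

lemma dist_right:
  assumes X: "qcat Q X" "qcat Q Y" and p: "\<phi> \<in> dists Q X Y" "x \<in> pts X" "x' \<in> pts X" "y \<in> pts Y"
  shows "leQ (ty X x') (ty Y y) (Cmp Q (ty X x') (ty X x) (ty Y y) (\<phi> x y) (hm X x' x)) (\<phi> x' y)"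
proof -
  let ?k = "Cmp Q (ty X x') (ty X x) (ty Y y) (\<phi> x y) (hm X x' x)"
  have 1: "leQ (ty X x') (ty Y y) ?k (Cmp Q (ty X x') (ty Y y) (ty Y y) (hm Y y y) ?k)"
    using X p hm_refl by (intro le_Cmp_Idn) auto
  have 2: "leQ (ty X x') (ty Y y) (Cmp Q (ty X x') (ty Y y) (ty Y y) (hm Y y y) ?k) (\<phi> x' y)"
    using p unfolding dists_def by blast
  from le_trans[OF _ _ _ _ _ 1 2] show ?thesis using X p by simp
qed

lemma distsI:
  assumes X: "qcat Q X" "qcat Q Y"
    and ext: "\<phi> \<in> (\<Pi>\<^sub>E x\<in>pts X. \<Pi>\<^sub>E y\<in>pts Y. arr Q (ty X x) (ty Y y))"
    and left: "\<And>x y y'. \<lbrakk>x \<in> pts X; y \<in> pts Y; y' \<in> pts Y\<rbrakk> \<Longrightarrow>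
      leQ (ty X x) (ty Y y') (Cmp Q (ty X x) (ty Y y) (ty Y y') (hm Y y y') (\<phi> x y)) (\<phi> x y')"
    and right: "\<And>x x' y. \<lbrakk>x \<in> pts X; x' \<in> pts X; y \<in> pts Y\<rbrakk> \<Longrightarrow>
      leQ (ty X x') (ty Y y) (Cmp Q (ty X x') (ty X x) (ty Y y) (\<phi> x y) (hm X x' x)) (\<phi> x' y)"
  shows "\<phi> \<in> dists Q X Y"
proof -
  have in': "\<phi> x y \<in> arr Q (ty X x) (ty Y y)" if "x \<in> pts X" "y \<in> pts Y" for x y
    using ext that by (auto simp: PiE_iff)
  have "leQ (ty X x') (ty Y y') (Cmp Q (ty X x') (ty Y y) (ty Y y') (hm Y y y')
      (Cmp Q (ty X x') (ty X x) (ty Y y) (\<phi> x y) (hm X x' x))) (\<phi> x' y')"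
    if p: "x \<in> pts X" "x' \<in> pts X" "y \<in> pts Y" "y' \<in> pts Y" for x x' y y'
  proof -
    have "leQ (ty X x') (ty Y y') (Cmp Q (ty X x') (ty Y y) (ty Y y') (hm Y y y')
        (Cmp Q (ty X x') (ty X x) (ty Y y) (\<phi> x y) (hm X x' x)))
        (Cmp Q (ty X x') (ty Y y) (ty Y y') (hm Y y y') (\<phi> x' y))"
      using X p in' right by (intro Cmp_mono_right) auto
    from le_trans[OF _ _ _ _ _ this left[OF p(2-4)]] show ?thesis using X p in' by simp
  qed
  with ext show ?thesis unfolding dists_def by blast
qed

lemma dist_eqI:
  assumes "\<phi> \<in> dists Q X Y" "\<psi> \<in> dists Q X Y" "\<And>x y. \<lbrakk>x \<in> pts X; y \<in> pts Y\<rbrakk> \<Longrightarrow> \<phi> x y = \<psi> x y"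
  shows "\<phi> = \<psi>"
proof -
  have "\<phi> \<in> extensional (pts X)" "\<psi> \<in> extensional (pts X)"
    and "x \<in> pts X \<Longrightarrow> \<phi> x \<in> extensional (pts Y)" "x \<in> pts X \<Longrightarrow> \<psi> x \<in> extensional (pts Y)" for x
    using assms(1,2) unfolding dists_def by (auto simp: PiE_iff)
  then show ?thesis using assms(3) by (intro extensionalityI[of _ "pts X"] extensionalityI[of _ "pts Y"]) auto
qed

lemma hm_dist [simp, intro]: "qcat Q X \<Longrightarrow> hm X \<in> dists Q X X"
  using hm_trans by (intro distsI) (auto simp: qcat_def)

section \<open>Composition of distributors\<close>

lemma dist_comp_app:
  "\<lbrakk>x \<in> pts X; z \<in> pts Z\<rbrakk> \<Longrightarrow> dist_comp Q X Y Z \<psi> \<phi> x z = \<Squnion>\<^bsub>Hom Q (ty X x) (ty Z z)\<^esub>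
     ((\<lambda>y. Cmp Q (ty X x) (ty Y y) (ty Z z) (\<psi> y z) (\<phi> x y)) ` pts Y)"
  by (simp add: dist_comp_def)

lemma dist_comp_ext: "\<lbrakk>x \<in> pts X; z \<in> pts Z; qcat Q X; qcat Q Y; qcat Q Z; \<phi> \<in> dists Q X Y; \<psi> \<in> dists Q Y Z\<rbrakk> \<Longrightarrow>
    dist_comp Q X Y Z \<psi> \<phi> x z \<in> arr Q (ty X x) (ty Z z)"
  unfolding dist_comp_app by (intro sup_in) auto

text \<open>Composites are handled through their upper bounds, where the join over \<open>y\<close>
  becomes a universal quantifier. This avoids computing with the join itself.\<close>

lemma dist_comp_le_iff:
  assumes "x \<in> pts X" "z \<in> pts Z" "qcat Q X" "qcat Q Y" "qcat Q Z" "\<phi> \<in> dists Q X Y" "\<psi> \<in> dists Q Y Z"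
    "f \<in> arr Q (ty X x) (ty Z z)"
  shows "leQ (ty X x) (ty Z z) (dist_comp Q X Y Z \<psi> \<phi> x z) f \<longleftrightarrow>
    (\<forall>y\<in>pts Y. leQ (ty X x) (ty Z z) (Cmp Q (ty X x) (ty Y y) (ty Z z) (\<psi> y z) (\<phi> x y)) f)"
  using assms unfolding dist_comp_app[OF assms(1,2)] by (subst sup_le_iff) auto

lemma le_dist_comp:
  assumes "x \<in> pts X" "z \<in> pts Z" "y \<in> pts Y" "qcat Q X" "qcat Q Y" "qcat Q Z" "\<phi> \<in> dists Q X Y"
    "\<psi> \<in> dists Q Y Z"
  shows "leQ (ty X x) (ty Z z) (Cmp Q (ty X x) (ty Y y) (ty Z z) (\<psi> y z) (\<phi> x y)) (dist_comp Q X Y Z \<psi> \<phi> x z)"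
  using assms unfolding dist_comp_app[OF assms(1,2)] by (intro le_sup) auto

lemma Cmp_dist_comp_le_iff:
  assumes "x \<in> pts X" "z \<in> pts Z" "qcat Q X" "qcat Q Y" "qcat Q Z" "\<phi> \<in> dists Q X Y" "\<psi> \<in> dists Q Y Z"
    "r \<in> Obj Q" "g \<in> arr Q (ty Z z) r" "f \<in> arr Q (ty X x) r"
  shows "leQ (ty X x) r (Cmp Q (ty X x) (ty Z z) r g (dist_comp Q X Y Z \<psi> \<phi> x z)) f \<longleftrightarrow>
    (\<forall>y\<in>pts Y. leQ (ty X x) r (Cmp Q (ty X x) (ty Y y) r (Cmp Q (ty Y y) (ty Z z) r g (\<psi> y z)) (\<phi> x y)) f)"
  using assms unfolding dist_comp_app[OF assms(1,2)]
  by (subst Cmp_sup_right_le_iff) (auto simp: Cmp_assoc)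

lemma dist_comp_Cmp_le_iff:
  assumes "x \<in> pts X" "z \<in> pts Z" "qcat Q X" "qcat Q Y" "qcat Q Z" "\<phi> \<in> dists Q X Y" "\<psi> \<in> dists Q Y Z"
    "r \<in> Obj Q" "g \<in> arr Q r (ty X x)" "f \<in> arr Q r (ty Z z)"
  shows "leQ r (ty Z z) (Cmp Q r (ty X x) (ty Z z) (dist_comp Q X Y Z \<psi> \<phi> x z) g) f \<longleftrightarrow>
    (\<forall>y\<in>pts Y. leQ r (ty Z z) (Cmp Q r (ty Y y) (ty Z z) (\<psi> y z) (Cmp Q r (ty X x) (ty Y y) (\<phi> x y) g)) f)"
  using assms unfolding dist_comp_app[OF assms(1,2)]
  by (subst Cmp_sup_left_le_iff) (auto simp: Cmp_assoc)

lemma dist_comp_dist [simp, intro]: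
  assumes X: "qcat Q X" "qcat Q Y" "qcat Q Z" and p: "\<phi> \<in> dists Q X Y" "\<psi> \<in> dists Q Y Z"
  shows "dist_comp Q X Y Z \<psi> \<phi> \<in> dists Q X Z"
proof (rule distsI[OF X(1,3)])
  show "dist_comp Q X Y Z \<psi> \<phi> \<in> (\<Pi>\<^sub>E x\<in>pts X. \<Pi>\<^sub>E z\<in>pts Z. arr Q (ty X x) (ty Z z))"
    using dist_comp_ext[OF _ _ X p] by (auto simp: dist_comp_def)
  fix x z z' assume *: "x \<in> pts X" "z \<in> pts Z" "z' \<in> pts Z"
  have "leQ (ty X x) (ty Z z') (Cmp Q (ty X x) (ty Y y) (ty Z z')
    (Cmp Q (ty Y y) (ty Z z) (ty Z z') (hm Z z z') (\<psi> y z)) (\<phi> x y))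
    (dist_comp Q X Y Z \<psi> \<phi> x z')" if "y \<in> pts Y" for y
  proof -
    have "leQ (ty X x) (ty Z z') (Cmp Q (ty X x) (ty Y y) (ty Z z')
      (Cmp Q (ty Y y) (ty Z z) (ty Z z') (hm Z z z') (\<psi> y z)) (\<phi> x y))
      (Cmp Q (ty X x) (ty Y y) (ty Z z') (\<psi> y z') (\<phi> x y))"
      using * that X p dist_left by (intro Cmp_mono_left) auto
    from le_trans[OF _ _ _ _ _ this le_dist_comp[of x X z' Z y Y \<phi> \<psi>]] show ?thesis
      using * that X p by (simp add: dist_comp_ext)
  qed
  then show "leQ (ty X x) (ty Z z') (Cmp Q (ty X x) (ty Z z) (ty Z z') (hm Z z z')
    (dist_comp Q X Y Z \<psi> \<phi> x z))
      (dist_comp Q X Y Z \<psi> \<phi> x z')"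
    using * X p by (subst Cmp_dist_comp_le_iff) (auto simp: dist_comp_ext)
next
  fix x x' z assume *: "x \<in> pts X" "x' \<in> pts X" "z \<in> pts Z"
  have "leQ (ty X x') (ty Z z) (Cmp Q (ty X x') (ty Y y) (ty Z z) (\<psi> y z)
    (Cmp Q (ty X x') (ty X x) (ty Y y) (\<phi> x y) (hm X x' x)))
    (dist_comp Q X Y Z \<psi> \<phi> x' z)" if "y \<in> pts Y" for y
  proof -
    have "leQ (ty X x') (ty Z z) (Cmp Q (ty X x') (ty Y y) (ty Z z) (\<psi> y z)
      (Cmp Q (ty X x') (ty X x) (ty Y y) (\<phi> x y) (hm X x' x)))
      (Cmp Q (ty X x') (ty Y y) (ty Z z) (\<psi> y z) (\<phi> x' y))"
      using * that X p dist_right by (intro Cmp_mono_right) auto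
    from le_trans[OF _ _ _ _ _ this le_dist_comp[of x' X z Z y Y \<phi> \<psi>]] show ?thesis
      using * that X p by (simp add: dist_comp_ext)
  qed
  then show "leQ (ty X x') (ty Z z) (Cmp Q (ty X x') (ty X x) (ty Z z) (dist_comp Q X Y Z \<psi> \<phi> x z)
    (hm X x' x))
      (dist_comp Q X Y Z \<psi> \<phi> x' z)"
    using * X p by (subst dist_comp_Cmp_le_iff) (auto simp: dist_comp_ext)
qed

text \<open>Both sides have the same upper bounds: one family of inequalities over \<open>y\<close>
  and \<open>z\<close>, with the quantifiers in either order.\<close>

lemma dist_comp_assoc:
  assumes X: "qcat Q X" "qcat Q Y" "qcat Q Z" "qcat Q W"
    and p: "\<phi> \<in> dists Q X Y" "\<psi> \<in> dists Q Y Z" "\<omega> \<in> dists Q Z W"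
  shows "dist_comp Q X Z W \<omega> (dist_comp Q X Y Z \<psi> \<phi>) = dist_comp Q X Y W (dist_comp Q Y Z W \<omega> \<psi>) \<phi>"
proof (rule dist_eqI[of _ X W])
  fix x w assume *: "x \<in> pts X" "w \<in> pts W"
  show "dist_comp Q X Z W \<omega> (dist_comp Q X Y Z \<psi> \<phi>) x w = dist_comp Q X Y W (dist_comp Q Y Z W \<omega> \<psi>) \<phi> x w"
  proof (rule eq_iff'[of "ty X x" "ty W w"])
    fix f assume f: "f \<in> arr Q (ty X x) (ty W w)"
    have "leQ (ty X x) (ty W w) (dist_comp Q X Z W \<omega> (dist_comp Q X Y Z \<psi> \<phi>) x w) f \<longleftrightarrow>
      (\<forall>z\<in>pts Z. \<forall>y\<in>pts Y. leQ (ty X x) (ty W w)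
        (Cmp Q (ty X x) (ty Y y) (ty W w) (Cmp Q (ty Y y) (ty Z z) (ty W w) (\<omega> z w) (\<psi> y z)) (\<phi> x y)) f)"
      using * X p f by (subst dist_comp_le_iff) (simp_all add: Cmp_dist_comp_le_iff)
    moreover have "leQ (ty X x) (ty W w) (dist_comp Q X Y W (dist_comp Q Y Z W \<omega> \<psi>) \<phi> x w) f \<longleftrightarrow>
      (\<forall>y\<in>pts Y. \<forall>z\<in>pts Z. leQ (ty X x) (ty W w)
        (Cmp Q (ty X x) (ty Y y) (ty W w) (Cmp Q (ty Y y) (ty Z z) (ty W w) (\<omega> z w) (\<psi> y z)) (\<phi> x y)) f)"
      using * X p f by (subst dist_comp_le_iff) (simp_all add: dist_comp_Cmp_le_iff Cmp_assoc)
    ultimately show "leQ (ty X x) (ty W w) (dist_comp Q X Z W \<omega> (dist_comp Q X Y Z \<psi> \<phi>) x w) f \<longleftrightarrow>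
        leQ (ty X x) (ty W w) (dist_comp Q X Y W (dist_comp Q Y Z W \<omega> \<psi>) \<phi> x w) f"
      by blast
  qed (use * X p in auto)
qed (use X p in auto)

lemma dist_comp_hm [simp]:
  assumes X: "qcat Q X" "qcat Q Y" and p: "\<phi> \<in> dists Q X Y"
  shows "dist_comp Q X X Y \<phi> (hm X) = \<phi>" "dist_comp Q X Y Y (hm Y) \<phi> = \<phi>"
proof -
  show "dist_comp Q X X Y \<phi> (hm X) = \<phi>"
  proof (rule dist_eqI[of _ X Y])
    fix x y assume *: "x \<in> pts X" "y \<in> pts Y"
    have "leQ (ty X x) (ty Y y) (\<phi> x y) (dist_comp Q X X Y \<phi> (hm X) x y)"
      using le_trans[OF _ _ _ _ _ le_Cmp_Idn(1)[of "ty X x" "ty Y y" "\<phi> x y" "hm X x x"]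
        le_dist_comp[of x X y Y x X "hm X" \<phi>]]
        * X p hm_refl[OF X(1) *(1)] by (auto simp: dist_comp_ext)
    then show "dist_comp Q X X Y \<phi> (hm X) x y = \<phi> x y"
      using * X p dist_right by (intro le_antisym[of "ty X x" "ty Y y"])
        (auto simp: dist_comp_ext dist_comp_le_iff)
  qed (use X p in auto)
  show "dist_comp Q X Y Y (hm Y) \<phi> = \<phi>"
  proof (rule dist_eqI[of _ X Y])
    fix x y assume *: "x \<in> pts X" "y \<in> pts Y"
    have "leQ (ty X x) (ty Y y) (\<phi> x y) (dist_comp Q X Y Y (hm Y) \<phi> x y)"
      using le_trans[OF _ _ _ _ _ le_Cmp_Idn(2)[of "ty X x" "ty Y y" "\<phi> x y" "hm Y y y"]
        le_dist_comp[of x X y Y y Y \<phi> "hm Y"]]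
        * X p hm_refl[OF X(2) *(2)] by (auto simp: dist_comp_ext)
    then show "dist_comp Q X Y Y (hm Y) \<phi> x y = \<phi> x y"
      using * X p dist_left by (intro le_antisym[of "ty X x" "ty Y y"])
        (auto simp: dist_comp_ext dist_comp_le_iff)
  qed (use X p in auto)
qed

lemma dist_comp_dist_le_iff:
  assumes "qcat Q X" "qcat Q Y" "qcat Q Z" "\<phi> \<in> dists Q X Y" "\<psi> \<in> dists Q Y Z" "\<xi> \<in> dists Q X Z"
  shows "dist_le Q X Z (dist_comp Q X Y Z \<psi> \<phi>) \<xi> \<longleftrightarrow>
    (\<forall>x\<in>pts X. \<forall>y\<in>pts Y. \<forall>z\<in>pts Z. leQ (ty X x) (ty Z z) (Cmp Q (ty X x) (ty Y y) (ty Z z) (\<psi> y z) (\<phi> x y))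
      (\<xi> x z))"
  using assms unfolding dist_le_def by (auto simp: dist_comp_le_iff)

section \<open>Pointwise joins and the quantaloid of distributors\<close>

definition dsup :: "('x, 'o, 'a) qcat_data \<Rightarrow> ('y, 'o, 'a) qcat_data \<Rightarrow> ('x \<Rightarrow> 'y \<Rightarrow> 'a) set \<Rightarrow> 'x \<Rightarrow> 'y \<Rightarrow> 'a" where
  "dsup X Y S = (\<lambda>x\<in>pts X. \<lambda>y\<in>pts Y. \<Squnion>\<^bsub>Hom Q (ty X x) (ty Y y)\<^esub> ((\<lambda>\<phi>. \<phi> x y) ` S))"

text \<open>The actions survive pointwise joins because composition with a hom-arrow preserves
  joins.\<close>

lemma dsup_dist:
  assumes X: "qcat Q X" "qcat Q Y" and S: "S \<subseteq> dists Q X Y"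
  shows "dsup X Y S \<in> dists Q X Y"
proof -
  have V: "(\<lambda>\<phi>. \<phi> x y) ` S \<subseteq> arr Q (ty X x) (ty Y y)" if "x \<in> pts X" "y \<in> pts Y" for x y
    using that S by auto
  have ub: "leQ (ty X x) (ty Y y) (\<phi> x y) (\<Squnion>\<^bsub>Hom Q (ty X x) (ty Y y)\<^esub> ((\<lambda>\<phi>. \<phi> x y) ` S))"
    if "x \<in> pts X" "y \<in> pts Y" "\<phi> \<in> S" for x y \<phi>
    using that X V by (intro le_sup) auto
  show ?thesis
  proof (rule distsI[OF X])
    show "dsup X Y S \<in> (\<Pi>\<^sub>E x\<in>pts X. \<Pi>\<^sub>E y\<in>pts Y. arr Q (ty X x) (ty Y y))"
      unfolding dsup_def using X V by auto
    fix x y y' assume *: "x \<in> pts X" "y \<in> pts Y" "y' \<in> pts Y"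
    have "leQ (ty X x) (ty Y y') (Cmp Q (ty X x) (ty Y y) (ty Y y') (hm Y y y') (\<phi> x y))
       (\<Squnion>\<^bsub>Hom Q (ty X x) (ty Y y')\<^esub> ((\<lambda>\<phi>. \<phi> x y') ` S))" if "\<phi> \<in> S" for \<phi>
      using le_trans[OF _ _ _ _ _ dist_left[of X Y \<phi> x y y'] ub[of x y' \<phi>]] * X S V that by auto
    with * show "leQ (ty X x) (ty Y y') (Cmp Q (ty X x) (ty Y y) (ty Y y') (hm Y y y') (dsup X Y S x y))
      (dsup X Y S x y')"
      unfolding dsup_def using X V by (simp add: Cmp_sup_right_le_iff)
  next
    fix x x' y assume *: "x \<in> pts X" "x' \<in> pts X" "y \<in> pts Y"
    have "leQ (ty X x') (ty Y y) (Cmp Q (ty X x') (ty X x) (ty Y y) (\<phi> x y) (hm X x' x))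
       (\<Squnion>\<^bsub>Hom Q (ty X x') (ty Y y)\<^esub> ((\<lambda>\<phi>. \<phi> x' y) ` S))" if "\<phi> \<in> S" for \<phi>
      using le_trans[OF _ _ _ _ _ dist_right[of X Y \<phi> x x' y] ub[of x' y \<phi>]] * X S V that by auto
    with * show "leQ (ty X x') (ty Y y) (Cmp Q (ty X x') (ty X x) (ty Y y) (dsup X Y S x y) (hm X x' x))
      (dsup X Y S x' y)"
      unfolding dsup_def using X V by (simp add: Cmp_sup_left_le_iff)
  qed
qed

lemma dsup_le_iff:
  assumes X: "qcat Q X" "qcat Q Y" and S: "S \<subseteq> dists Q X Y" and f: "f \<in> dists Q X Y"
  shows "dist_le Q X Y (dsup X Y S) f \<longleftrightarrow> (\<forall>\<phi>\<in>S. dist_le Q X Y \<phi> f)"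
proof -
  have "leQ (ty X x) (ty Y y) (\<Squnion>\<^bsub>Hom Q (ty X x) (ty Y y)\<^esub> ((\<lambda>\<phi>. \<phi> x y) ` S)) (f x y) \<longleftrightarrow>
      (\<forall>\<phi>\<in>S. leQ (ty X x) (ty Y y) (\<phi> x y) (f x y))" if "x \<in> pts X" "y \<in> pts Y" for x y
    using that X S f by (subst sup_le_iff) auto
  then show ?thesis unfolding dist_le_def dsup_def by auto
qed

lemma dist_le_antisym:
  assumes "qcat Q X" "qcat Q Y" "\<phi> \<in> dists Q X Y" "\<psi> \<in> dists Q X Y" "dist_le Q X Y \<phi> \<psi>" "dist_le Q X Y \<psi> \<phi>"
  shows "\<phi> = \<psi>"
proof (rule dist_eqI[OF assms(3,4)])
  fix x y assume "x \<in> pts X" "y \<in> pts Y"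
  then show "\<phi> x y = \<psi> x y"
    using assms unfolding dist_le_def by (intro le_antisym[of "ty X x" "ty Y y"]) auto
qed

lemma dist_le_refl: "\<lbrakk>qcat Q X; qcat Q Y; \<phi> \<in> dists Q X Y\<rbrakk> \<Longrightarrow> dist_le Q X Y \<phi> \<phi>"
  unfolding dist_le_def by auto

lemma dist_le_trans:
  assumes "qcat Q X" "qcat Q Y" "\<phi> \<in> dists Q X Y" "\<psi> \<in> dists Q X Y" "\<xi> \<in> dists Q X Y"
    "dist_le Q X Y \<phi> \<psi>" "dist_le Q X Y \<psi> \<xi>"
  shows "dist_le Q X Y \<phi> \<xi>"
  unfolding dist_le_def
proof (intro ballI)
  fix x y assume "x \<in> pts X" "y \<in> pts Y"
  then show "leQ (ty X x) (ty Y y) (\<phi> x y) (\<xi> x y)"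
    using assms le_trans[of "ty X x" "ty Y y" "\<phi> x y" "\<psi> x y" "\<xi> x y"] unfolding dist_le_def by auto
qed

lemma QDist_simps [simp]:
  "Obj (QDist U Q) = {X. small_qcat U Q X}" "arr (QDist U Q) X Y = dists Q X Y"
  "eq (Hom (QDist U Q) X Y) = (=)" "le (Hom (QDist U Q) X Y) = dist_le Q X Y"
  "Cmp (QDist U Q) = dist_comp Q" "Idn (QDist U Q) = hm"
  by (simp_all add: QDist_def)

text \<open>Distributivity reduces to that of \<open>Q\<close>: an inequality out of a composite of
  distributors is a family of inequalities in \<open>Q\<close>, one for each triple of points, and
  joins are pointwise.\<close>

lemma quantaloid_QDist: "quantaloid (QDist U Q)" (is "quantaloid ?C")
proof (rule quantaloidI)
  show "category ?C"
    unfolding category_def by (auto simp: small_qcat_def dist_comp_assoc)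
  fix X Y assume "X \<in> Obj ?C" "Y \<in> Obj ?C"
  then have X: "qcat Q X" "qcat Q Y" by (auto simp: small_qcat_def)
  show po: "partial_order (Hom ?C X Y)"
    by (rule partial_orderI) (use X dist_le_refl dist_le_antisym dist_le_trans in auto)
  show "\<exists>s. join_of (Hom ?C X Y) V s" if "V \<subseteq> arr ?C X Y" for V
    by (rule exI[of _ "dsup X Y V"], rule join_ofI[OF po]) (use that X in \<open>auto simp: dsup_le_iff dsup_dist\<close>)
next
  have po: "partial_order (Hom ?C X Y)" if "qcat Q X" "qcat Q Y" for X Y
    by (rule partial_orderI) (use that dist_le_refl dist_le_antisym dist_le_trans in auto)
  have sup: "s = dsup X Y V" if "qcat Q X" "qcat Q Y" "V \<subseteq> dists Q X Y" "join_of (Hom ?C X Y) V s" for X Y V s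
    using that by (intro join_of_unique[OF po]) (auto intro!: join_ofI po simp: dsup_le_iff dsup_dist)
  {
    fix X Y Z u V s assume "X \<in> Obj ?C" "Y \<in> Obj ?C" "Z \<in> Obj ?C" "u \<in> arr ?C X Y" "V \<subseteq> arr ?C Y Z"
      and j: "join_of (Hom ?C Y Z) V s"
    then have X: "qcat Q X" "qcat Q Y" "qcat Q Z" and u: "u \<in> dists Q X Y" and V: "V \<subseteq> dists Q Y Z"
      by (auto simp: small_qcat_def)
    have s: "s = dsup Y Z V" using sup[OF X(2,3) V j] .
    have sd: "s \<in> dists Q Y Z" using dsup_dist X V s by auto
    have "dist_le Q X Z (dist_comp Q X Y Z s u) f \<longleftrightarrow> (\<forall>v\<in>V. dist_le Q X Z (dist_comp Q X Y Z v u) f)"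
      if f: "f \<in> dists Q X Z" for f
    proof -
      have "leQ (ty X x) (ty Z z) (Cmp Q (ty X x) (ty Y y) (ty Z z) (s y z) (u x y)) (f x z) \<longleftrightarrow>
        (\<forall>v\<in>V. leQ (ty X x) (ty Z z) (Cmp Q (ty X x) (ty Y y) (ty Z z) (v y z) (u x y)) (f x z))"
        if "x \<in> pts X" "y \<in> pts Y" "z \<in> pts Z" for x y z
        using that X u V f unfolding s dsup_def by (simp, subst Cmp_sup_left_le_iff) auto
      moreover have "v \<in> dists Q Y Z" if "v \<in> V" for v using that V by auto
      ultimately show ?thesis
        using X u V f sd by (simp add: dist_comp_dist_le_iff) blast
    qed
    then show "join_of (Hom ?C X Z) ((\<lambda>v. Cmp ?C X Y Z v u) ` V) (Cmp ?C X Y Z s u)"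
      using X u V sd by (intro join_ofI po) auto
  next
    fix X Y Z v V s assume "X \<in> Obj ?C" "Y \<in> Obj ?C" "Z \<in> Obj ?C" "v \<in> arr ?C Y Z" "V \<subseteq> arr ?C X Y"
      and j: "join_of (Hom ?C X Y) V s"
    then have X: "qcat Q X" "qcat Q Y" "qcat Q Z" and v: "v \<in> dists Q Y Z" and V: "V \<subseteq> dists Q X Y"
      by (auto simp: small_qcat_def)
    have s: "s = dsup X Y V" using sup[OF X(1,2) V j] .
    have sd: "s \<in> dists Q X Y" using dsup_dist X V s by auto
    have "dist_le Q X Z (dist_comp Q X Y Z v s) f \<longleftrightarrow> (\<forall>u\<in>V. dist_le Q X Z (dist_comp Q X Y Z v u) f)"
      if f: "f \<in> dists Q X Z" for f
    proof -
      have "leQ (ty X x) (ty Z z) (Cmp Q (ty X x) (ty Y y) (ty Z z) (v y z) (s x y)) (f x z) \<longleftrightarrow>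
        (\<forall>u\<in>V. leQ (ty X x) (ty Z z) (Cmp Q (ty X x) (ty Y y) (ty Z z) (v y z) (u x y)) (f x z))"
        if "x \<in> pts X" "y \<in> pts Y" "z \<in> pts Z" for x y z
        using that X v V f unfolding s dsup_def by (simp, subst Cmp_sup_right_le_iff) auto
      moreover have "u \<in> dists Q X Y" if "u \<in> V" for u using that V by auto
      ultimately show ?thesis
        using X v V f sd by (simp add: dist_comp_dist_le_iff) blast
    qed
    then show "join_of (Hom ?C X Z) ((\<lambda>u. Cmp ?C X Y Z v u) ` V) (Cmp ?C X Y Z v s)"
      using X v V sd by (intro join_ofI po) auto
  }
qed

section \<open>Negation of distributors\<close>

definition dneg :: "('x, 'o, 'a) qcat_data \<Rightarrow> ('y, 'o, 'a) qcat_data \<Rightarrow> ('x \<Rightarrow> 'y \<Rightarrow> 'a) \<Rightarrow> 'y \<Rightarrow> 'x \<Rightarrow> 'a" where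
  "dneg X Y \<phi> = (\<lambda>y\<in>pts Y. \<lambda>x\<in>pts X. n (ty X x) (ty Y y) (\<phi> x y))"

lemma dneg_app: "\<lbrakk>x \<in> pts X; y \<in> pts Y\<rbrakk> \<Longrightarrow> dneg X Y \<phi> y x = n (ty X x) (ty Y y) (\<phi> x y)"
  by (simp add: dneg_def)

text \<open>Negation exchanges the actions: the left action on \<open>\<not>\<phi>\<close> is the
  rotated right action on \<open>\<phi>\<close>, and conversely.\<close>

lemma dneg_dist [simp, intro]:
  assumes X: "qcat Q X" "qcat Q Y" and p: "\<phi> \<in> dists Q X Y"
  shows "dneg X Y \<phi> \<in> dists Q Y X"
proof (rule distsI[OF X(2,1)])
  show "dneg X Y \<phi> \<in> (\<Pi>\<^sub>E y\<in>pts Y. \<Pi>\<^sub>E x\<in>pts X. arr Q (ty Y y) (ty X x))"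
    unfolding dneg_def using X p by auto
  show "leQ (ty Y y) (ty X x') (Cmp Q (ty Y y) (ty X x) (ty X x') (hm X x x') (dneg X Y \<phi> y x))
    (dneg X Y \<phi> y x')"
    if "y \<in> pts Y" "x \<in> pts X" "x' \<in> pts X" for y x x'
    using that X p dist_right[OF X p, of x' x y]
      rotate'[of "ty X x" "ty X x'" "ty Y y" "hm X x x'" "\<phi> x' y" "\<phi> x y"] by (simp add: dneg_app)
  show "leQ (ty Y y') (ty X x) (Cmp Q (ty Y y') (ty Y y) (ty X x) (dneg X Y \<phi> y x) (hm Y y' y))
    (dneg X Y \<phi> y' x)"
    if "y \<in> pts Y" "y' \<in> pts Y" "x \<in> pts X" for y y' x
    using that X p dist_left[OF X p, of x y' y]
      rotate[of "ty X x" "ty Y y'" "ty Y y" "\<phi> x y'" "hm Y y' y" "\<phi> x y"] by (simp add: dneg_app)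
qed

lemma dneg_dneg [simp]:
  assumes X: "qcat Q X" "qcat Q Y" and p: "\<phi> \<in> dists Q X Y"
  shows "dneg Y X (dneg X Y \<phi>) = \<phi>"
  by (rule dist_eqI[of _ X Y]) (use X p in \<open>auto simp: dneg_app\<close>)

text \<open>Both inequalities unfold to families over \<open>x\<close>, \<open>y\<close>,
  \<open>z\<close> whose members are matched by \<open>rotate\<close> in \<open>Q\<close>.\<close>

lemma dist_rotate:
  assumes X: "qcat Q X" "qcat Q Y" "qcat Q Z"
    and p: "\<phi> \<in> dists Q X Y" "\<psi> \<in> dists Q Y Z" "\<xi> \<in> dists Q X Z"
  shows "dist_le Q X Z (dist_comp Q X Y Z \<psi> \<phi>) \<xi> \<longleftrightarrow>
    dist_le Q Y X (dist_comp Q Y Z X (dneg X Z \<xi>) \<psi>) (dneg X Y \<phi>)"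
proof -
  have "leQ (ty X x) (ty Z z) (Cmp Q (ty X x) (ty Y y) (ty Z z) (\<psi> y z) (\<phi> x y)) (\<xi> x z) \<longleftrightarrow>
    leQ (ty Y y) (ty X x) (Cmp Q (ty Y y) (ty Z z) (ty X x) (dneg X Z \<xi> z x) (\<psi> y z)) (dneg X Y \<phi> y x)"
    if "x \<in> pts X" "y \<in> pts Y" "z \<in> pts Z" for x y z
    using that X p rotate[of "ty X x" "ty Y y" "ty Z z" "\<phi> x y" "\<psi> y z" "\<xi> x z"] by (simp add: dneg_app)
  then show ?thesis using X p by (simp add: dist_comp_dist_le_iff) blast
qed

lemma star_QDist: "star_quantaloid (QDist U Q) dneg"
proof -
  interpret quantaloid_loc "QDist U Q" by standard (rule quantaloid_QDist)
  show ?thesis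
  proof
    show "le (Hom (QDist U Q) X Z) (Cmp (QDist U Q) X Y Z \<psi> \<phi>) \<xi> \<longleftrightarrow>
        le (Hom (QDist U Q) Y X) (Cmp (QDist U Q) Y Z X (dneg X Z \<xi>) \<psi>) (dneg X Y \<phi>)"
      if "X \<in> Obj (QDist U Q)" "Y \<in> Obj (QDist U Q)" "Z \<in> Obj (QDist U Q)"
        "\<phi> \<in> arr (QDist U Q) X Y" "\<psi> \<in> arr (QDist U Q) Y Z" "\<xi> \<in> arr (QDist U Q) X Z" for X Y Z \<phi> \<psi> \<xi>
      using that dist_rotate[of X Y Z \<phi> \<psi> \<xi>] by (simp add: small_qcat_def)
  qed (auto simp: small_qcat_def)
qed

section \<open>Presheaves\<close>

lemma singleton_simps [simp]:
  "pts (singleton_qcat Q q) = {()}" "ty (singleton_qcat Q q) y = q" "hm (singleton_qcat Q q) y y' = Idn Q q"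
  by (simp_all add: singleton_qcat_def)

lemma qcat_singleton [simp]: "q \<in> Obj Q \<Longrightarrow> qcat Q (singleton_qcat Q q)"
  unfolding qcat_def by (auto simp: PiE_iff extensional_def)

lemma presheaf_iff: "(q, \<mu>) \<in> presheaves Q X \<longleftrightarrow> q \<in> Obj Q \<and> \<mu> \<in> dists Q X (singleton_qcat Q q)"
  by (simp add: presheaves_def)

lemma presheaf_dist: "m \<in> presheaves Q X \<Longrightarrow> snd m \<in> dists Q X (singleton_qcat Q (fst m))"
  by (cases m) (simp add: presheaf_iff)

lemma presheaf_ty [simp, intro]: "m \<in> presheaves Q X \<Longrightarrow> fst m \<in> Obj Q"
  by (cases m) (simp add: presheaf_iff)

lemma presheaf_in [simp, intro]: "\<lbrakk>m \<in> presheaves Q X; x \<in> pts X\<rbrakk> \<Longrightarrow> snd m x () \<in> arr Q (ty X x) (fst m)"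
  using dist_in[OF presheaf_dist, of m X x "()"] by simp

lemma presheaf_eqI:
  assumes "m \<in> presheaves Q X" "m' \<in> presheaves Q X" "fst m = fst m'"
    "\<And>x. x \<in> pts X \<Longrightarrow> snd m x () = snd m' x ()"
  shows "m = m'"
proof -
  have "snd m = snd m'"
    by (rule dist_eqI[of _ X "singleton_qcat Q (fst m)"])
      (use assms presheaf_dist[of m X] presheaf_dist[of m' X] in auto)
  with assms(3) show ?thesis by (simp add: prod_eq_iff)
qed

text \<open>The one-point category acts by an identity, so the action of \<open>X\<close> is the
  only one left to check.\<close>

lemma presheafI:
  assumes X: "qcat Q X" and q: "q \<in> Obj Q"
    and ext: "\<mu> \<in> extensional (pts X)" "\<And>x. x \<in> pts X \<Longrightarrow> \<mu> x () \<in> arr Q (ty X x) q"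
    and right: "\<And>x x'. \<lbrakk>x \<in> pts X; x' \<in> pts X\<rbrakk> \<Longrightarrow>
      leQ (ty X x') q (Cmp Q (ty X x') (ty X x) q (\<mu> x ()) (hm X x' x)) (\<mu> x' ())"
  shows "(q, \<mu>) \<in> presheaves Q X"
  unfolding presheaf_iff
proof
  show "\<mu> \<in> dists Q X (singleton_qcat Q q)"
    by (rule distsI) (use X q ext right in \<open>auto simp: PiE_iff extensional_def\<close>)
qed fact

lemma presheaf_right:
  assumes "qcat Q X" "m \<in> presheaves Q X" "x \<in> pts X" "x' \<in> pts X"
  shows "leQ (ty X x') (fst m) (Cmp Q (ty X x') (ty X x) (fst m) (snd m x ()) (hm X x' x)) (snd m x' ())"
  using dist_right[of X "singleton_qcat Q (fst m)" "snd m" x x' "()"] presheaf_dist[OF assms(2)]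
    presheaf_ty[OF assms(2)] assms by simp

lemma P_simps [simp]:
  "pts (P Q X) = presheaves Q X" "m \<in> presheaves Q X \<Longrightarrow> ty (P Q X) m = fst m"
  by (simp_all add: P_def)

text \<open>The hom-arrow is defined as an infimum of pointwise residuals; its universal property as
  the largest \<open>f\<close> with \<open>f \<circ> m \<le> m'\<close> is the form used
  afterwards.\<close>

lemma P_hm:
  assumes X: "qcat Q X" and m: "m \<in> presheaves Q X" "m' \<in> presheaves Q X"
  shows "hm (P Q X) m m' \<in> arr Q (fst m) (fst m')"
    and "f \<in> arr Q (fst m) (fst m') \<Longrightarrow> leQ (fst m) (fst m') f (hm (P Q X) m m') \<longleftrightarrow>
      (\<forall>x\<in>pts X. leQ (ty X x) (fst m') (Cmp Q (ty X x) (fst m) (fst m') f (snd m x ())) (snd m' x ()))"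
proof -
  let ?V = "(\<lambda>x. lres Q (ty X x) (fst m) (fst m') (snd m' x ()) (snd m x ())) ` pts X"
  have h: "hm (P Q X) m m' = \<Sqinter>\<^bsub>Hom Q (fst m) (fst m')\<^esub> ?V"
    using m by (simp add: P_def dist_lres_def)
  have V: "?V \<subseteq> arr Q (fst m) (fst m')" using X m by (auto intro: lres_char)
  note i = inf_greatest[OF presheaf_ty[OF m(1)] presheaf_ty[OF m(2)] V]
  show "hm (P Q X) m m' \<in> arr Q (fst m) (fst m')" using i(1) h by simp
  show "leQ (fst m) (fst m') f (hm (P Q X) m m') \<longleftrightarrow>
      (\<forall>x\<in>pts X. leQ (ty X x) (fst m') (Cmp Q (ty X x) (fst m) (fst m') f (snd m x ())) (snd m' x ()))"
    if "f \<in> arr Q (fst m) (fst m')"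
    unfolding h i(2)[OF that] using X m that by (auto simp: lres_char)
qed

lemmas P_hm_in [simp, intro] = P_hm(1)

lemma P_hm_Cmp_le:
  assumes X: "qcat Q X" and m: "m \<in> presheaves Q X" "m' \<in> presheaves Q X" "x \<in> pts X"
  shows "leQ (ty X x) (fst m') (Cmp Q (ty X x) (fst m) (fst m') (hm (P Q X) m m') (snd m x ())) (snd m' x ())"
  using P_hm[OF X m(1,2)] m X by auto

lemma qcat_P [simp, intro]:
  assumes X: "qcat Q X"
  shows "qcat Q (P Q X)"
  unfolding qcat_def P_simps(1)
proof (intro conjI ballI)
  show "ty (P Q X) \<in> presheaves Q X \<rightarrow>\<^sub>E Obj Q" by (auto simp: P_def)
  show "hm (P Q X) \<in> (\<Pi>\<^sub>E x\<in>presheaves Q X. \<Pi>\<^sub>E y\<in>presheaves Q X. arr Q (ty (P Q X) x) (ty (P Q X) y))"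
    using X by (auto simp: PiE_iff) (simp_all add: P_def)
  show "leQ (ty (P Q X) m) (ty (P Q X) m) (Idn Q (ty (P Q X) m)) (hm (P Q X) m m)" if "m \<in> presheaves Q X"
    for m
    using that X by (auto simp: P_hm)
  fix m1 m2 m3 assume m: "m1 \<in> presheaves Q X" "m2 \<in> presheaves Q X" "m3 \<in> presheaves Q X"
  have "leQ (ty X x) (fst m3) (Cmp Q (ty X x) (fst m1) (fst m3)
      (Cmp Q (fst m1) (fst m2) (fst m3) (hm (P Q X) m2 m3) (hm (P Q X) m1 m2)) (snd m1 x ())) (snd m3 x ())"
    if x: "x \<in> pts X" for x
  proof -
    have e: "Cmp Q (ty X x) (fst m1) (fst m3) (Cmp Q (fst m1) (fst m2) (fst m3) (hm (P Q X) m2 m3)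
      (hm (P Q X) m1 m2)) (snd m1 x ())
      = Cmp Q (ty X x) (fst m2) (fst m3) (hm (P Q X) m2 m3)
        (Cmp Q (ty X x) (fst m1) (fst m2) (hm (P Q X) m1 m2) (snd m1 x ()))"
      using X m x by (simp add: Cmp_assoc)
    have "leQ (ty X x) (fst m3) \<dots> (Cmp Q (ty X x) (fst m2) (fst m3) (hm (P Q X) m2 m3) (snd m2 x ()))"
      using X m x by (intro Cmp_mono_right P_hm_Cmp_le) auto
    from le_trans[OF _ _ _ _ _ this P_hm_Cmp_le] show ?thesis
      unfolding e using X m x by simp
  qed
  then show "leQ (ty (P Q X) m1) (ty (P Q X) m3)
      (Cmp Q (ty (P Q X) m1) (ty (P Q X) m2) (ty (P Q X) m3) (hm (P Q X) m2 m3) (hm (P Q X) m1 m2))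
        (hm (P Q X) m1 m3)"
    using X m by (simp add: P_hm(2))
qed

lemma P_under_le:
  assumes X: "qcat Q X" and m: "m \<in> presheaves Q X" "m' \<in> presheaves Q X"
  shows "under_le Q (P Q X) m m' \<longleftrightarrow>
    fst m = fst m' \<and> (\<forall>x\<in>pts X. leQ (ty X x) (fst m) (snd m x ()) (snd m' x ()))"
proof (cases "fst m = fst m'")
  case True
  then obtain q \<mu> \<mu>' where q: "m = (q, \<mu>)" "m' = (q, \<mu>')" by (metis prod.collapse)
  have "\<mu> x () \<in> arr Q (ty X x) q" "q \<in> Obj Q" if "x \<in> pts X" for x
    using presheaf_in[OF m(1) that] presheaf_ty[OF m(1)] by (auto simp: q)
  then show ?thesis
    using P_hm(2)[OF X m, of "Idn Q q"] presheaf_ty[OF m(1)] m X unfolding under_le_def by (auto simp: q)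
qed (use m in \<open>simp add: under_le_def\<close>)

lemma column_presheaf [simp, intro]:
  assumes X: "qcat Q X" "qcat Q Y" and p: "\<phi> \<in> dists Q X Y" "y \<in> pts Y"
  shows "column X Y \<phi> y \<in> presheaves Q X"
  unfolding column_def by (rule presheafI) (use X p dist_right in auto)

lemma column_simps [simp]: "fst (column X Y \<phi> y) = ty Y y" "x \<in> pts X \<Longrightarrow> snd (column X Y \<phi> y) x () = \<phi> x y"
  by (simp_all add: column_def)

lemma pull_presheaf [simp, intro]:
  assumes X: "qcat Q X" "qcat Q Y" and p: "\<phi> \<in> dists Q X Y" "l \<in> presheaves Q Y"
  shows "pull Q X Y \<phi> l \<in> presheaves Q X"
  using X p presheaf_dist[OF p(2)] unfolding pull_def by (simp add: presheaf_iff)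

lemma fst_pull [simp]: "l \<in> presheaves Q Y \<Longrightarrow> fst (pull Q X Y \<phi> l) = fst l"
  by (simp add: pull_def)

lemma pull_app: "\<lbrakk>l \<in> presheaves Q Y; x \<in> pts X\<rbrakk> \<Longrightarrow> snd (pull Q X Y \<phi> l) x () =
   \<Squnion>\<^bsub>Hom Q (ty X x) (fst l)\<^esub> ((\<lambda>y. Cmp Q (ty X x) (ty Y y) (fst l) (snd l y ()) (\<phi> x y)) ` pts Y)"
  by (simp add: pull_def dist_comp_app)

lemma pull_le_iff:
  assumes X: "qcat Q X" "qcat Q Y" and p: "\<phi> \<in> dists Q X Y" "l \<in> presheaves Q Y" "x \<in> pts X"
    and f: "f \<in> arr Q (ty X x) (fst l)"
  shows "leQ (ty X x) (fst l) (snd (pull Q X Y \<phi> l) x ()) f \<longleftrightarrow>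
    (\<forall>y\<in>pts Y. leQ (ty X x) (fst l) (Cmp Q (ty X x) (ty Y y) (fst l) (snd l y ()) (\<phi> x y)) f)"
  unfolding pull_app[OF p(2,3)] using X p f by (subst sup_le_iff) auto

lemma le_pull:
  assumes X: "qcat Q X" "qcat Q Y" and p: "\<phi> \<in> dists Q X Y" "l \<in> presheaves Q Y" "x \<in> pts X" "y \<in> pts Y"
  shows "leQ (ty X x) (fst l) (Cmp Q (ty X x) (ty Y y) (fst l) (snd l y ()) (\<phi> x y))
    (snd (pull Q X Y \<phi> l) x ())"
  unfolding pull_app[OF p(2,3)] using X p by (intro le_sup) auto

end

section \<open>Smallness\<close>

context
  fixes U :: "'v set"
  assumes U: "inaccessible U"
begin

lemma small_subset: "\<lbrakk>small U B; A \<subseteq> B\<rbrakk> \<Longrightarrow> small U A"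
  unfolding small_def by (meson card_of_mono1 ordLeq_ordLess_trans)

lemma small_image: "small U A \<Longrightarrow> small U (f ` A)"
  unfolding small_def by (meson card_of_image ordLeq_ordLess_trans)

lemma Cinfinite_U: "Cinfinite |U|"
  using U unfolding inaccessible_def cinfinite_def
  by (metis Field_natLeq card_of_Card_order card_of_ordLeq_infinite infinite_UNIV_nat natLeq_Card_order
      card_of_Field_ordIso Field_card_of ordIso_ordLess_trans ordLess_imp_ordLeq ordLeq_ordIso_trans
        card_of_ordLeq_finite)

lemma small_finite: "finite A \<Longrightarrow> small U A"
  unfolding small_def using Cinfinite_U finite_ordLess_infinite[of "|A|" "|U|"]
  by (simp add: cinfinite_def Field_card_of card_of_well_order_on)

lemma small_UN: "\<lbrakk>small U I; \<And>i. i \<in> I \<Longrightarrow> small U (A i)\<rbrakk> \<Longrightarrow> small U (\<Union>i\<in>I. A i)"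
  unfolding small_def using U Cinfinite_U
  by (intro card_of_UNION_ordLess_infinite_Field_regularCard) (auto simp: inaccessible_def)

text \<open>A product is a union of unions of singletons, so regularity covers it.\<close>

lemma small_Times: "\<lbrakk>small U A; small U B\<rbrakk> \<Longrightarrow> small U (A \<times> B)"
proof -
  assume A: "small U A" "small U B"
  have "A \<times> B = (\<Union>a\<in>A. \<Union>b\<in>B. {(a, b)})" by auto
  then show ?thesis using A by (simp only:) (intro small_UN small_finite[of "{_}"], auto)
qed

text \<open>\<open>inaccessible\<close> speaks only of subsets of \<open>U\<close>; a small set of
  another type is first embedded into \<open>U\<close>, and its power set follows the
  embedding.\<close>

lemma small_Pow:
  assumes A: "small U A"
  shows "small U (Pow A)"
proof -
  have "|A| \<le>o |U|" using A by (simp add: small_def ordLess_imp_ordLeq)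
  then obtain f where f: "inj_on f A" "f ` A \<subseteq> U" by (auto simp flip: card_of_ordLeq)
  then have "small U (Pow (f ` A))"
    using U small_image[OF A] unfolding inaccessible_def by blast
  moreover have "|Pow A| \<le>o |Pow (f ` A)|"
    using inj_on_image_Pow[OF f(1)] by (intro card_of_ordLeq[THEN iffD1]) (auto intro!: exI[of _ "(`) f"])
  ultimately show ?thesis unfolding small_def by (rule ordLeq_ordLess_trans[rotated])
qed

end

locale universe = distributors Q n for Q :: "('o, 'a) quantaloid_data" and n +
  fixes U :: "'v set"
  assumes U: "inaccessible U" and small_Q: "small_quantaloid U Q"
begin

text \<open>A presheaf is determined by its type and its graph, a subset of \<open>pts X\<close>
  times the set of all arrows of \<open>Q\<close>. That product and its power set stay small by
  inaccessibility.\<close>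

lemma small_presheaves:
  assumes X: "small_qcat U Q X"
  shows "small U (presheaves Q X)"
proof -
  let ?M = "\<Union>p\<in>Obj Q. \<Union>q\<in>Obj Q. arr Q p q"
  let ?g = "\<lambda>(q, \<mu>). (q, (\<lambda>x. (x, \<mu> x ())) ` pts X)"
  have Q': "small U (Obj Q)" "\<And>p q. \<lbrakk>p \<in> Obj Q; q \<in> Obj Q\<rbrakk> \<Longrightarrow> small U (arr Q p q)"
    using small_Q by (auto simp: small_quantaloid_def)
  have X': "qcat Q X" "small U (pts X)" using X by (auto simp: small_qcat_def)
  have "small U (Obj Q \<times> Pow (pts X \<times> ?M))"
    using Q' X' by (intro small_Times[OF U] small_Pow[OF U] small_UN[OF U])
  moreover have "?g ` presheaves Q X \<subseteq> Obj Q \<times> Pow (pts X \<times> ?M)"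
  proof (rule image_subsetI)
    fix m assume m: "m \<in> presheaves Q X"
    then show "?g m \<in> Obj Q \<times> Pow (pts X \<times> ?M)"
      using presheaf_in[OF m] presheaf_ty[OF m] X'(1) by (cases m) auto
  qed
  ultimately have sm: "small U (?g ` presheaves Q X)" by (rule small_subset[OF U])
  have "inj_on ?g (presheaves Q X)"
  proof (rule inj_onI, clarsimp)
    fix q \<mu> \<nu> assume *: "(q, \<mu>) \<in> presheaves Q X" "(q, \<nu>) \<in> presheaves Q X"
      "(\<lambda>x. (x, \<mu> x ())) ` pts X = (\<lambda>x. (x, \<nu> x ())) ` pts X"
    have "\<mu> x () = \<nu> x ()" if "x \<in> pts X" for x
    proof -
      have "(x, \<mu> x ()) \<in> (\<lambda>x. (x, \<nu> x ())) ` pts X" unfolding *(3)[symmetric] using that by blast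
      then show ?thesis by auto
    qed
    moreover have "\<mu> \<in> extensional (pts X)" "\<nu> \<in> extensional (pts X)"
      using * by (auto simp: presheaves_def dists_def PiE_iff)
    ultimately show "\<mu> = \<nu>" by (intro extensionalityI[of _ "pts X"]) auto
  qed
  then have "|presheaves Q X| =o |?g ` presheaves Q X|"
    by (auto simp flip: card_of_ordIso intro: inj_on_imp_bij_betw)
  then show ?thesis
    using sm unfolding small_def by (rule ordIso_ordLess_trans)
qed

section \<open>Subcategories of presheaves\<close>

text \<open>
  A set of presheaves on a small \<open>Q\<close>-category is turned into a small \<open>Q\<close>-category by an arbitrary
  injection into the universe.
\<close>

definition enc :: "('v, 'o, 'a) qcat_data \<Rightarrow> ('v, 'o, 'a) presheaf \<Rightarrow> 'v" where
  "enc X = (SOME e. inj_on e (presheaves Q X) \<and> e ` presheaves Q X \<subseteq> U)"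

definition dec :: "('v, 'o, 'a) qcat_data \<Rightarrow> 'v \<Rightarrow> ('v, 'o, 'a) presheaf" where
  "dec X = inv_into (presheaves Q X) (enc X)"

definition sub :: "('v, 'o, 'a) qcat_data \<Rightarrow> ('v, 'o, 'a) presheaf set \<Rightarrow> ('v, 'o, 'a) qcat_data" where
  "sub X F = \<lparr>pts = enc X ` F, ty = (\<lambda>k\<in>enc X ` F. fst (dec X k)),
     hm = (\<lambda>j\<in>enc X ` F. \<lambda>k\<in>enc X ` F. hm (P Q X) (dec X j) (dec X k))\<rparr>"

text \<open>By Yoneda, the evaluation \<open>m(x)\<close> is the hom-arrow of presheaves from the
  representable at \<open>x\<close> to \<open>m\<close>, so this is the Yoneda embedding seen as a
  distributor into \<open>F\<close>.\<close>

definition incl :: "('v, 'o, 'a) qcat_data \<Rightarrow> ('v, 'o, 'a) presheaf set \<Rightarrow> 'v \<Rightarrow> 'v \<Rightarrow> 'a" where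
  "incl X F = (\<lambda>x\<in>pts X. \<lambda>k\<in>enc X ` F. snd (dec X k) x ())"

lemma enc:
  assumes "small_qcat U Q X"
  shows "inj_on (enc X) (presheaves Q X)" "enc X ` presheaves Q X \<subseteq> U"
proof -
  have "|presheaves Q X| \<le>o |U|"
    using small_presheaves[OF assms] by (simp add: small_def ordLess_imp_ordLeq)
  then have "\<exists>e. inj_on e (presheaves Q X) \<and> e ` presheaves Q X \<subseteq> U" by (simp flip: card_of_ordLeq)
  from someI_ex[OF this] show "inj_on (enc X) (presheaves Q X)" "enc X ` presheaves Q X \<subseteq> U"
    by (simp_all add: enc_def)
qed

lemma dec_enc [simp]: "\<lbrakk>small_qcat U Q X; m \<in> presheaves Q X\<rbrakk> \<Longrightarrow> dec X (enc X m) = m"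
  unfolding dec_def using enc(1) by simp

context
  fixes X F
  assumes X [simp]: "small_qcat U Q X" and F: "F \<subseteq> presheaves Q X"
begin

lemma sub_qX [simp]: "qcat Q X"
  using X unfolding small_qcat_def by blast

lemma F_psh [simp]: "m \<in> F \<Longrightarrow> m \<in> presheaves Q X"
  using F by blast

lemma enc_sub [simp, intro]: "m \<in> F \<Longrightarrow> enc X m \<in> pts (sub X F)"
  by (simp add: sub_def)

lemma dec_sub [simp, intro]: "k \<in> pts (sub X F) \<Longrightarrow> dec X k \<in> F"
  by (auto simp: sub_def)

lemma enc_dec [simp]: "k \<in> pts (sub X F) \<Longrightarrow> enc X (dec X k) = k"
  by (auto simp: sub_def)

lemma sub_simps [simp]:
  "k \<in> pts (sub X F) \<Longrightarrow> ty (sub X F) k = fst (dec X k)"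
  "\<lbrakk>j \<in> pts (sub X F); k \<in> pts (sub X F)\<rbrakk> \<Longrightarrow> hm (sub X F) j k = hm (P Q X) (dec X j) (dec X k)"
  "\<lbrakk>x \<in> pts X; k \<in> pts (sub X F)\<rbrakk> \<Longrightarrow> incl X F x k = snd (dec X k) x ()"
  by (simp_all add: sub_def incl_def)

lemma dec_psh [simp, intro]: "k \<in> pts (sub X F) \<Longrightarrow> dec X k \<in> presheaves Q X"
  using dec_sub F by blast

lemma small_sub: "small_qcat U Q (sub X F)"
proof -
  let ?A = "sub X F"
  have "qcat Q ?A"
    unfolding qcat_def
  proof (intro conjI ballI)
    show "ty ?A \<in> pts ?A \<rightarrow>\<^sub>E Obj Q" using F by (auto simp: sub_def)
    show "hm ?A \<in> (\<Pi>\<^sub>E x\<in>pts ?A. \<Pi>\<^sub>E y\<in>pts ?A. arr Q (ty ?A x) (ty ?A y))"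
      using F by (auto simp: sub_def PiE_iff subset_iff)
    show "leQ (ty ?A k) (ty ?A k) (Idn Q (ty ?A k)) (hm ?A k k)" if "k \<in> pts ?A" for k
      using hm_refl[OF qcat_P[OF sub_qX], of "dec X k"] that by simp
    show "leQ (ty ?A x) (ty ?A z) (Cmp Q (ty ?A x) (ty ?A y) (ty ?A z) (hm ?A y z) (hm ?A x y)) (hm ?A x z)"
      if "x \<in> pts ?A" "y \<in> pts ?A" "z \<in> pts ?A" for x y z
      using hm_trans[OF qcat_P[OF sub_qX], of "dec X x" "dec X y" "dec X z"] that by simp
  qed
  moreover have "pts ?A \<subseteq> U" using enc(2)[OF X] F by (auto simp: sub_def)
  moreover have "small U (pts ?A)"
    unfolding sub_def using small_image[OF U small_subset[OF U small_presheaves[OF X] F]] by simp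
  ultimately show ?thesis by (simp add: small_qcat_def)
qed

lemma qcat_sub [simp, intro]: "qcat Q (sub X F)"
  using small_sub by (simp add: small_qcat_def)

lemma incl_dist [simp, intro]: "incl X F \<in> dists Q X (sub X F)"
proof (rule distsI)
  show "incl X F \<in> (\<Pi>\<^sub>E x\<in>pts X. \<Pi>\<^sub>E y\<in>pts (sub X F). arr Q (ty X x) (ty (sub X F) y))"
    using F by (auto simp: incl_def sub_def)
  show "leQ (ty X x) (ty (sub X F) k) (Cmp Q (ty X x) (ty (sub X F) j) (ty (sub X F) k)
      (hm (sub X F) j k) (incl X F x j)) (incl X F x k)"
    if "x \<in> pts X" "j \<in> pts (sub X F)" "k \<in> pts (sub X F)" for x j k
    using P_hm_Cmp_le[OF sub_qX dec_psh[OF that(2)] dec_psh[OF that(3)] that(1)] that by simp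
  show "leQ (ty X x') (ty (sub X F) k) (Cmp Q (ty X x') (ty X x) (ty (sub X F) k)
      (incl X F x k) (hm X x' x)) (incl X F x' k)"
    if "x \<in> pts X" "x' \<in> pts X" "k \<in> pts (sub X F)" for x x' k
    using presheaf_right[OF sub_qX dec_psh[OF that(3)] that(1,2)] that by simp
qed auto

text \<open>Yoneda for \<open>F\<close>: the factor is \<open>t(m, y) = hm (P Q X) m w(-, y)\<close>.\<close>

lemma factor_incl:
  assumes Y: "qcat Q Y" and w: "w \<in> dists Q X Y" and col: "\<And>y. y \<in> pts Y \<Longrightarrow> column X Y w y \<in> F"
  shows "\<exists>t\<in>dists Q (sub X F) Y. dist_comp Q X (sub X F) Y t (incl X F) = w"
proof -
  let ?A = "sub X F"
  define t where "t = (\<lambda>k\<in>pts ?A. \<lambda>y\<in>pts Y. hm ?A k (enc X (column X Y w y)))"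
  have tle: "leQ (ty ?A k) (ty Y y) f (t k y) \<longleftrightarrow>
      (\<forall>x\<in>pts X. leQ (ty X x) (ty Y y) (Cmp Q (ty X x) (ty ?A k) (ty Y y) f (incl X F x k)) (w x y))"
    if "k \<in> pts ?A" "y \<in> pts Y" "f \<in> arr Q (ty ?A k) (ty Y y)" for k y f
    using that col[OF that(2)] P_hm(2)[of X "dec X k" "column X Y w y" f] unfolding t_def by simp
  have tin: "t k y \<in> arr Q (ty ?A k) (ty Y y)" if "k \<in> pts ?A" "y \<in> pts Y" for k y
    using that hm_in[OF qcat_sub, of k "enc X (column X Y w y)"] col[OF that(2)] unfolding t_def by simp
  have tapp: "leQ (ty X x) (ty Y y) (Cmp Q (ty X x) (ty ?A k) (ty Y y) (t k y) (incl X F x k)) (w x y)"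
    if "k \<in> pts ?A" "y \<in> pts Y" "x \<in> pts X" for k y x
    using tle[OF that(1,2) tin[OF that(1,2)]] tin[OF that(1,2)] that Y by auto
  have "t \<in> dists Q ?A Y"
  proof (rule distsI[OF qcat_sub Y])
    show "t \<in> (\<Pi>\<^sub>E x\<in>pts ?A. \<Pi>\<^sub>E y\<in>pts Y. arr Q (ty ?A x) (ty Y y))"
      using tin by (auto simp: t_def)
    show "leQ (ty ?A k) (ty Y y') (Cmp Q (ty ?A k) (ty Y y) (ty Y y') (hm Y y y') (t k y)) (t k y')"
      if "k \<in> pts ?A" "y \<in> pts Y" "y' \<in> pts Y" for k y y'
    proof -
      have "leQ (ty X x) (ty Y y') (Cmp Q (ty X x) (ty Y y) (ty Y y') (hm Y y y')
          (Cmp Q (ty X x) (ty ?A k) (ty Y y) (t k y) (incl X F x k))) (w x y')" if x: "x \<in> pts X" for x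
      proof -
        have "leQ (ty X x) (ty Y y') (Cmp Q (ty X x) (ty Y y) (ty Y y') (hm Y y y')
          (Cmp Q (ty X x) (ty ?A k) (ty Y y) (t k y) (incl X F x k)))
            (Cmp Q (ty X x) (ty Y y) (ty Y y') (hm Y y y') (w x y))"
          using x Y w tin tapp \<open>k \<in> pts ?A\<close> \<open>y \<in> pts Y\<close> \<open>y' \<in> pts Y\<close>
          by (intro Cmp_mono_right Cmp_in ty_in hm_in dist_in[of _ X ?A] dist_in[of _ X Y]) auto
        from le_trans[OF _ _ _ _ _ this dist_left[OF sub_qX Y w x]] show ?thesis
          using x Y w tin[of k y] dist_in[OF incl_dist x] \<open>k \<in> pts ?A\<close> \<open>y \<in> pts Y\<close> \<open>y' \<in> pts Y\<close>
            ty_in[OF qcat_sub, of k] by auto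
      qed
      then show ?thesis
        using that Y tin[of k y] tin[of k y'] dist_in[OF incl_dist, of _ k] ty_in[OF qcat_sub, of k]
        by (subst tle) (auto simp: Cmp_assoc)
    qed
    show "leQ (ty ?A k') (ty Y y) (Cmp Q (ty ?A k') (ty ?A k) (ty Y y) (t k y) (hm ?A k' k)) (t k' y)"
      if "k \<in> pts ?A" "k' \<in> pts ?A" "y \<in> pts Y" for k k' y
      using hm_trans[OF qcat_sub that(2,1), of "enc X (column X Y w y)"] that col[OF that(3)]
      by (simp add: t_def)
  qed
  moreover have "dist_comp Q X ?A Y t (incl X F) = w"
  proof (rule dist_eqI[of _ X Y])
    fix x y assume *: "x \<in> pts X" "y \<in> pts Y"
    let ?k = "enc X (column X Y w y)"
    have k: "?k \<in> pts ?A" "ty ?A ?k = ty Y y" "incl X F x ?k = w x y" using col * by auto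
    \<comment> \<open>The column at \<open>y\<close> is itself a point of \<open>F\<close>. At that
      point \<open>t\<close> lies above the identity, so the join defining the composite reaches
      \<open>w x y\<close>.\<close>
    have "leQ (ty ?A ?k) (ty Y y) (Idn Q (ty Y y)) (t ?k y)"
      using k hm_refl[OF qcat_sub k(1)] * unfolding t_def by simp
    then have "leQ (ty X x) (ty Y y) (w x y) (Cmp Q (ty X x) (ty ?A ?k) (ty Y y) (t ?k y) (incl X F x ?k))"
      unfolding k using * Y w tin[OF k(1) *(2)] by (intro le_Cmp_Idn) (auto simp: k)
    from le_trans[OF _ _ _ _ _ this le_dist_comp[OF * k(1) sub_qX qcat_sub Y incl_dist \<open>t \<in> dists Q ?A Y\<close>]]
    have "leQ (ty X x) (ty Y y) (w x y) (dist_comp Q X ?A Y t (incl X F) x y)"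
      using * Y w \<open>t \<in> dists Q ?A Y\<close> tin[OF k(1) *(2)] dist_in[OF incl_dist *(1) k(1)] ty_in[OF qcat_sub k(1)]
      by (simp add: k(2,3) dist_comp_ext)
    moreover have "leQ (ty X x) (ty Y y) (dist_comp Q X ?A Y t (incl X F) x y) (w x y)"
      using * Y w \<open>t \<in> dists Q ?A Y\<close> tapp by (subst dist_comp_le_iff) auto
    ultimately show "dist_comp Q X ?A Y t (incl X F) x y = w x y"
      using * Y w \<open>t \<in> dists Q ?A Y\<close> by (intro le_antisym[of "ty X x" "ty Y y"]) (auto simp: dist_comp_ext)
  qed (use Y w \<open>t \<in> dists Q ?A Y\<close> in auto)
  ultimately show ?thesis by blast
qed

end

end

context distributors
begin

section \<open>Endofunctors of presheaf categories\<close>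

lemma endo_in [simp, intro]: "\<lbrakk>a \<in> qfunctors Q (P Q X) (P Q X); m \<in> presheaves Q X\<rbrakk> \<Longrightarrow> a m \<in> presheaves Q X"
  unfolding qfunctors_def by auto

lemma endo_fst [simp]: "\<lbrakk>a \<in> qfunctors Q (P Q X) (P Q X); m \<in> presheaves Q X\<rbrakk> \<Longrightarrow> fst (a m) = fst m"
  using endo_in[of a X m] unfolding qfunctors_def by auto

lemma endo_in_arr [simp, intro]: "\<lbrakk>a \<in> qfunctors Q (P Q X) (P Q X); m \<in> presheaves Q X; x \<in> pts X\<rbrakk> \<Longrightarrow>
    snd (a m) x () \<in> arr Q (ty X x) (fst m)"
  using presheaf_in[OF endo_in] endo_fst by metis

text \<open>Functoriality in terms of elements: \<open>f \<circ> m \<le> m'\<close> means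
  \<open>f \<le> hm m m'\<close>, which lies below \<open>hm (a m) (a m')\<close>, and this means
  \<open>f \<circ> a m \<le> a m'\<close>.\<close>

lemma endo_tensor:
  assumes X: "qcat Q X" and a: "a \<in> qfunctors Q (P Q X) (P Q X)"
    and m: "m \<in> presheaves Q X" "m' \<in> presheaves Q X" and f: "f \<in> arr Q (fst m) (fst m')"
    and le: "\<And>x. x \<in> pts X \<Longrightarrow> leQ (ty X x) (fst m') (Cmp Q (ty X x) (fst m) (fst m') f (snd m x ()))
      (snd m' x ())"
    and x: "x \<in> pts X"
  shows "leQ (ty X x) (fst m') (Cmp Q (ty X x) (fst m) (fst m') f (snd (a m) x ())) (snd (a m') x ())"
proof -
  have h: "hm (P Q X) (a m) (a m') \<in> arr Q (fst m) (fst m')"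
    using P_hm(1)[OF X endo_in[OF a m(1)] endo_in[OF a m(2)]] a m by simp
  have 1: "leQ (fst m) (fst m') f (hm (P Q X) m m')" using P_hm(2)[OF X m f] le by blast
  have 2: "leQ (fst m) (fst m') (hm (P Q X) m m') (hm (P Q X) (a m) (a m'))"
    using a m unfolding qfunctors_def by auto
  have "leQ (fst m) (fst m') f (hm (P Q X) (a m) (a m'))"
    using le_trans[OF _ _ _ _ _ 1 2] X m f h by simp
  then show ?thesis
    using P_hm(2)[OF X endo_in[OF a m(1)] endo_in[OF a m(2)], of f] a m f x by simp
qed

lemma endo_mono:
  assumes X: "qcat Q X" and a: "a \<in> qfunctors Q (P Q X) (P Q X)"
    and m: "m \<in> presheaves Q X" "m' \<in> presheaves Q X" "fst m = fst m'"
    and le: "\<And>x. x \<in> pts X \<Longrightarrow> leQ (ty X x) (fst m) (snd m x ()) (snd m' x ())"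
    and x: "x \<in> pts X"
  shows "leQ (ty X x) (fst m) (snd (a m) x ()) (snd (a m') x ())"
proof -
  have in': "snd m x () \<in> arr Q (ty X x) (fst m')" if "x \<in> pts X" for x
    using presheaf_in[OF m(1) that] m(3) by simp
  have a': "snd (a m) x () \<in> arr Q (ty X x) (fst m')" using endo_in_arr[OF a m(1) x] m(3) by simp
  show ?thesis
    using endo_tensor[OF X a m(1,2), of "Idn Q (fst m)" x] m x X le in' a' by simp
qed

text \<open>Converse of \<open>endo_tensor\<close>: apply the hypothesis to the hom-arrow
  \<open>f = hm m m'\<close>.\<close>

lemma endoI:
  assumes X: "qcat Q X"
    and ext: "a \<in> extensional (presheaves Q X)"
    and a: "\<And>m. m \<in> presheaves Q X \<Longrightarrow> a m \<in> presheaves Q X \<and> fst (a m) = fst m"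
    and le: "\<And>m m' f x. \<lbrakk>m \<in> presheaves Q X; m' \<in> presheaves Q X; f \<in> arr Q (fst m) (fst m');
       \<And>x. x \<in> pts X \<Longrightarrow> leQ (ty X x) (fst m') (Cmp Q (ty X x) (fst m) (fst m') f (snd m x ())) (snd m' x ());
       x \<in> pts X\<rbrakk> \<Longrightarrow>
      leQ (ty X x) (fst m') (Cmp Q (ty X x) (fst m) (fst m') f (snd (a m) x ())) (snd (a m') x ())"
  shows "a \<in> qfunctors Q (P Q X) (P Q X)"
proof -
  have "leQ (fst m) (fst m') (hm (P Q X) m m') (hm (P Q X) (a m) (a m'))"
    if m: "m \<in> presheaves Q X" "m' \<in> presheaves Q X" for m m'
  proof -
    have "a m \<in> presheaves Q X" "a m' \<in> presheaves Q X" "fst (a m) = fst m" "fst (a m') = fst m'"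
      using a m by auto
    note * = P_hm(2)[OF X this(1,2), unfolded this(3,4), OF P_hm(1)[OF X m]]
    show ?thesis unfolding * using le[OF m P_hm(1)[OF X m]] P_hm_Cmp_le[OF X m] by blast
  qed
  then show ?thesis
    unfolding qfunctors_def using a ext by (auto simp: PiE_iff)
qed

lemma pointwise_le_endo:
  assumes X: "qcat Q X" and a: "\<And>m. m \<in> presheaves Q Y \<Longrightarrow> f m \<in> presheaves Q X \<and> g m \<in> presheaves Q X \<and>
    fst (f m) = fst m \<and> fst (g m) = fst m"
  shows "pointwise_le Q (P Q Y) (P Q X) f g \<longleftrightarrow>
    (\<forall>m\<in>presheaves Q Y. \<forall>x\<in>pts X. leQ (ty X x) (fst m) (snd (f m) x ()) (snd (g m) x ()))"
  unfolding pointwise_le_def using X a by (auto simp: P_under_le)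

lemma continuous_iff:
  assumes X: "qcat Q X" "qcat Q Y" and a: "a \<in> qfunctors Q (P Q X) (P Q X)" "b \<in> qfunctors Q (P Q Y) (P Q Y)"
  shows "\<zeta> \<in> continuous_dists Q (X, a) (Y, b) \<longleftrightarrow> \<zeta> \<in> dists Q X Y \<and> (\<forall>l\<in>presheaves Q Y. \<forall>x\<in>pts X.
     leQ (ty X x) (fst l) (snd (pull Q X Y \<zeta> (b l)) x ()) (snd (a (pull Q X Y \<zeta> l)) x ()))"
proof -
  have "pointwise_le Q (P Q Y) (P Q X) (\<lambda>l. pull Q X Y \<zeta> (b l)) (\<lambda>l. a (pull Q X Y \<zeta> l)) \<longleftrightarrow>
     (\<forall>l\<in>presheaves Q Y. \<forall>x\<in>pts X.
     leQ (ty X x) (fst l) (snd (pull Q X Y \<zeta> (b l)) x ()) (snd (a (pull Q X Y \<zeta> l)) x ()))"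
    if "\<zeta> \<in> dists Q X Y"
    by (rule pointwise_le_endo) (use that X a pull_presheaf in auto)
  then show ?thesis unfolding continuous_dists_def by auto
qed

lemma continuous_dist: "\<zeta> \<in> continuous_dists Q S T \<Longrightarrow> \<zeta> \<in> dists Q (fst S) (fst T)"
  unfolding continuous_dists_def by (auto split: prod.splits)

section \<open>Residuals of distributors\<close>

text \<open>\<open>dl X Y Z \<xi> \<phi>\<close> is \<open>\<xi> \<swarrow> \<phi>\<close> and \<open>dr X Y Z \<psi> \<xi>\<close> is \<open>\<psi> \<searrow> \<xi>\<close>.\<close>

definition dl :: "('x, 'o, 'a) qcat_data \<Rightarrow> ('y, 'o, 'a) qcat_data \<Rightarrow> ('z, 'o, 'a) qcat_data \<Rightarrow>
    ('x \<Rightarrow> 'z \<Rightarrow> 'a) \<Rightarrow> ('x \<Rightarrow> 'y \<Rightarrow> 'a) \<Rightarrow> 'y \<Rightarrow> 'z \<Rightarrow> 'a" where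
  "dl X Y Z \<xi> \<phi> = dneg Z Y (dist_comp Q Z X Y \<phi> (dneg X Z \<xi>))"

definition dr :: "('x, 'o, 'a) qcat_data \<Rightarrow> ('y, 'o, 'a) qcat_data \<Rightarrow> ('z, 'o, 'a) qcat_data \<Rightarrow>
    ('y \<Rightarrow> 'z \<Rightarrow> 'a) \<Rightarrow> ('x \<Rightarrow> 'z \<Rightarrow> 'a) \<Rightarrow> 'x \<Rightarrow> 'y \<Rightarrow> 'a" where
  "dr X Y Z \<psi> \<xi> = dneg Y X (dist_comp Q Y Z X (dneg X Z \<xi>) \<psi>)"

lemma dl_dist [simp, intro]: "\<lbrakk>qcat Q X; qcat Q Y; qcat Q Z; \<phi> \<in> dists Q X Y; \<xi> \<in> dists Q X Z\<rbrakk> \<Longrightarrow>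
    dl X Y Z \<xi> \<phi> \<in> dists Q Y Z"
  unfolding dl_def by auto

lemma dr_dist [simp, intro]: "\<lbrakk>qcat Q X; qcat Q Y; qcat Q Z; \<psi> \<in> dists Q Y Z; \<xi> \<in> dists Q X Z\<rbrakk> \<Longrightarrow>
    dr X Y Z \<psi> \<xi> \<in> dists Q X Y"
  unfolding dr_def by auto

text \<open>The negated composite has the universal property of the residual: swap the negation to
  the other side, split the join over \<open>x\<close>, and rotate each inequality in
  \<open>Q\<close>.\<close>

lemma le_dl:
  assumes X: "qcat Q X" "qcat Q Y" "qcat Q Z" and d: "\<phi> \<in> dists Q X Y" "\<xi> \<in> dists Q X Z"
    and p: "y \<in> pts Y" "z \<in> pts Z" "g \<in> arr Q (ty Y y) (ty Z z)"
  shows "leQ (ty Y y) (ty Z z) g (dl X Y Z \<xi> \<phi> y z) \<longleftrightarrow>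
    (\<forall>x\<in>pts X. leQ (ty X x) (ty Z z) (Cmp Q (ty X x) (ty Y y) (ty Z z) g (\<phi> x y)) (\<xi> x z))"
proof -
  let ?s = "dist_comp Q Z X Y \<phi> (dneg X Z \<xi>) z y"
  have s: "?s \<in> arr Q (ty Z z) (ty Y y)" using X d p by (intro dist_comp_ext) auto
  have "leQ (ty Y y) (ty Z z) g (dl X Y Z \<xi> \<phi> y z) \<longleftrightarrow> leQ (ty Z z) (ty Y y) ?s (n (ty Y y) (ty Z z) g)"
    unfolding dl_def dneg_app[OF p(2,1)] using X p s by (intro neg_le_swap) auto
  also have "\<dots> \<longleftrightarrow> (\<forall>x\<in>pts X. leQ (ty Z z) (ty Y y) (Cmp Q (ty Z z) (ty X x) (ty Y y) (\<phi> x y)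
      (n (ty X x) (ty Z z) (\<xi> x z))) (n (ty Y y) (ty Z z) g))"
    using X d p by (subst dist_comp_le_iff) (auto simp: dneg_app)
  also have "\<dots> \<longleftrightarrow> (\<forall>x\<in>pts X. leQ (ty X x) (ty Z z) (Cmp Q (ty X x) (ty Y y) (ty Z z) g (\<phi> x y)) (\<xi> x z))"
    using X d p rotate' by (intro ball_cong refl) (metis dist_in ty_in)
  finally show ?thesis .
qed

lemma le_dr:
  assumes X: "qcat Q X" "qcat Q Y" "qcat Q Z" and d: "\<psi> \<in> dists Q Y Z" "\<xi> \<in> dists Q X Z"
    and p: "x \<in> pts X" "y \<in> pts Y" "g \<in> arr Q (ty X x) (ty Y y)"
  shows "leQ (ty X x) (ty Y y) g (dr X Y Z \<psi> \<xi> x y) \<longleftrightarrow>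
    (\<forall>z\<in>pts Z. leQ (ty X x) (ty Z z) (Cmp Q (ty X x) (ty Y y) (ty Z z) (\<psi> y z) g) (\<xi> x z))"
proof -
  let ?s = "dist_comp Q Y Z X (dneg X Z \<xi>) \<psi> y x"
  have s: "?s \<in> arr Q (ty Y y) (ty X x)" using X d p by (intro dist_comp_ext) auto
  have "leQ (ty X x) (ty Y y) g (dr X Y Z \<psi> \<xi> x y) \<longleftrightarrow> leQ (ty Y y) (ty X x) ?s (n (ty X x) (ty Y y) g)"
    unfolding dr_def dneg_app[OF p(2,1)] using X p s by (intro neg_le_swap) auto
  also have "\<dots> \<longleftrightarrow> (\<forall>z\<in>pts Z. leQ (ty Y y) (ty X x) (Cmp Q (ty Y y) (ty Z z) (ty X x)
      (n (ty X x) (ty Z z) (\<xi> x z)) (\<psi> y z)) (n (ty X x) (ty Y y) g))"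
    using X d p by (subst dist_comp_le_iff) (auto simp: dneg_app)
  also have "\<dots> \<longleftrightarrow> (\<forall>z\<in>pts Z. leQ (ty X x) (ty Z z) (Cmp Q (ty X x) (ty Y y) (ty Z z) (\<psi> y z) g) (\<xi> x z))"
    using X d p rotate by (intro ball_cong refl) (metis dist_in ty_in)
  finally show ?thesis .
qed

lemma dl_Cmp_le:
  assumes X: "qcat Q X" "qcat Q Y" "qcat Q Z" and d: "\<phi> \<in> dists Q X Y" "\<xi> \<in> dists Q X Z"
    and p: "x \<in> pts X" "y \<in> pts Y" "z \<in> pts Z"
  shows "leQ (ty X x) (ty Z z) (Cmp Q (ty X x) (ty Y y) (ty Z z) (dl X Y Z \<xi> \<phi> y z) (\<phi> x y)) (\<xi> x z)"
  using le_dl[OF X d p(2,3), of "dl X Y Z \<xi> \<phi> y z"] X d p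
    dist_in[OF dl_dist[OF X d] p(2,3)] le_refl[OF ty_in[OF X(2) p(2)] ty_in[OF X(3) p(3)]] by blast

lemma dr_Cmp_le:
  assumes X: "qcat Q X" "qcat Q Y" "qcat Q Z" and d: "\<psi> \<in> dists Q Y Z" "\<xi> \<in> dists Q X Z"
    and p: "x \<in> pts X" "y \<in> pts Y" "z \<in> pts Z"
  shows "leQ (ty X x) (ty Z z) (Cmp Q (ty X x) (ty Y y) (ty Z z) (\<psi> y z) (dr X Y Z \<psi> \<xi> x y)) (\<xi> x z)"
  using le_dr[OF X d p(1,2), of "dr X Y Z \<psi> \<xi> x y"] X d p
    dist_in[OF dr_dist[OF X d] p(1,2)] le_refl[OF ty_in[OF X(1) p(1)] ty_in[OF X(2) p(2)]] by blast

lemma dists_eq_le_iffI: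
  assumes X: "qcat Q X" "qcat Q Y" and d: "\<phi> \<in> dists Q X Y" "\<psi> \<in> dists Q X Y"
    and "\<And>x y f. \<lbrakk>x \<in> pts X; y \<in> pts Y; f \<in> arr Q (ty X x) (ty Y y)\<rbrakk> \<Longrightarrow>
      leQ (ty X x) (ty Y y) f (\<phi> x y) \<longleftrightarrow> leQ (ty X x) (ty Y y) f (\<psi> x y)"
  shows "\<phi> = \<psi>"
  by (rule dist_eqI[OF d]) (use assms in \<open>auto intro!: eq_iff[of "ty X _" "ty Y _"]\<close>)

end

section \<open>Interior spaces\<close>

context universe
begin

sublocale QD: star_quantaloid "QDist U Q" dneg
  by (rule star_QDist)

definition fixed :: "('v, 'o, 'a) space \<Rightarrow> ('v, 'o, 'a) presheaf set" where
  "fixed S = {m \<in> presheaves Q (fst S). snd S m = m}"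

definition fixed_cat :: "('v, 'o, 'a) space \<Rightarrow> ('v, 'o, 'a) qcat_data" where
  "fixed_cat S = sub (fst S) (fixed S)"

definition fixed_incl :: "('v, 'o, 'a) space \<Rightarrow> 'v \<Rightarrow> 'v \<Rightarrow> 'a" where
  "fixed_incl S = incl (fst S) (fixed S)"

lemma fixed_psh: "fixed S \<subseteq> presheaves Q (fst S)"
  unfolding fixed_def by auto

text \<open>Precomposing evaluation with \<open>\<zeta>\<close> is pulling back along
  \<open>\<zeta>\<close>. This is how continuity, a condition on \<open>pull\<close>, becomes a
  condition on composites.\<close>

lemma incl_comp_app:
  assumes "small_qcat U Q Y" "F \<subseteq> presheaves Q Y" "x \<in> pts X" "k \<in> pts (sub Y F)"
  shows "dist_comp Q X Y (sub Y F) (incl Y F) \<zeta> x k = snd (pull Q X Y \<zeta> (dec Y k)) x ()"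
  using assms by (simp add: pull_app dist_comp_app cong: image_cong)

lemma column_incl_comp:
  assumes X: "qcat Q X" and Y: "small_qcat U Q Y" "F \<subseteq> presheaves Q Y" and k: "k \<in> pts (sub Y F)"
    and d: "\<zeta> \<in> dists Q X Y"
  shows "column X (sub Y F) (dist_comp Q X Y (sub Y F) (incl Y F) \<zeta>) k = pull Q X Y \<zeta> (dec Y k)"
proof -
  have q: "qcat Q Y" using Y by (simp add: small_qcat_def)
  show ?thesis
    by (rule presheaf_eqI[of _ X]) (use X q Y k d incl_comp_app in auto)
qed

lemma interior_iff:
  "interior_space U Q (X, a) \<longleftrightarrow> small_qcat U Q X \<and> a \<in> qfunctors Q (P Q X) (P Q X) \<and>
     (\<forall>m\<in>presheaves Q X. \<forall>x\<in>pts X. leQ (ty X x) (fst m) (snd (a m) x ()) (snd m x ())) \<and>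
     (\<forall>m\<in>presheaves Q X. a (a m) = a m)"
proof -
  have "pointwise_le Q (P Q X) (P Q X) a (\<lambda>m. m) \<longleftrightarrow>
     (\<forall>m\<in>presheaves Q X. \<forall>x\<in>pts X. leQ (ty X x) (fst m) (snd (a m) x ()) (snd m x ()))"
    if "small_qcat U Q X" "a \<in> qfunctors Q (P Q X) (P Q X)"
    by (rule pointwise_le_endo) (use that in \<open>auto simp: small_qcat_def\<close>)
  then show ?thesis unfolding interior_space_def by auto
qed

text \<open>Continuity means that pulling back along \<open>\<zeta>\<close> sends open presheaves
  (fixed points) of \<open>b\<close> to open ones of \<open>a\<close>. Then evaluation after
  \<open>\<zeta>\<close> has open columns, and by \<open>factor_incl\<close> this is a factorization
  through the evaluation of \<open>(X, a)\<close>.\<close>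

lemma interior_continuous_iff:
  assumes S: "interior_space U Q (X, a)" and T: "interior_space U Q (Y, b)"
  shows "continuous_dists Q (X, a) (Y, b) = {\<zeta> \<in> dists Q X Y. \<exists>t\<in>dists Q (fixed_cat (X, a))
    (fixed_cat (Y, b)).
    dist_comp Q X Y (fixed_cat (Y, b)) (fixed_incl (Y, b)) \<zeta> =
    dist_comp Q X (fixed_cat (X, a)) (fixed_cat (Y, b)) t (fixed_incl (X, a))}" (is "_ = ?R")
proof -
  let ?A = "fixed_cat (X, a)" and ?B = "fixed_cat (Y, b)" and ?u = "fixed_incl (X, a)"
    and ?v = "fixed_incl (Y, b)"
  note [simp] = fixed_cat_def fixed_incl_def
  have X: "small_qcat U Q X" "qcat Q X" "small_qcat U Q Y" "qcat Q Y"
    and a: "a \<in> qfunctors Q (P Q X) (P Q X)" and b: "b \<in> qfunctors Q (P Q Y) (P Q Y)"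
    and a1: "\<And>m x. \<lbrakk>m \<in> presheaves Q X; x \<in> pts X\<rbrakk> \<Longrightarrow> leQ (ty X x) (fst m) (snd (a m) x ()) (snd m x ())"
    and b1: "\<And>m x. \<lbrakk>m \<in> presheaves Q Y; x \<in> pts Y\<rbrakk> \<Longrightarrow> leQ (ty Y x) (fst m) (snd (b m) x ()) (snd m x ())"
    and b2: "\<And>m. m \<in> presheaves Q Y \<Longrightarrow> b (b m) = b m"
    using S T by (auto simp: interior_iff small_qcat_def)
  have FX: "fixed (X, a) \<subseteq> presheaves Q X" and FY: "fixed (Y, b) \<subseteq> presheaves Q Y"
    using fixed_psh by force+
  have A: "qcat Q ?A" "qcat Q ?B" "?u \<in> dists Q X ?A" "?v \<in> dists Q Y ?B"
    using qcat_sub incl_dist X FX FY by auto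
  have "\<zeta> \<in> ?R" if z: "\<zeta> \<in> continuous_dists Q (X, a) (Y, b)" for \<zeta>
  proof -
    have d: "\<zeta> \<in> dists Q X Y" and c: "\<And>l x. \<lbrakk>l \<in> presheaves Q Y; x \<in> pts X\<rbrakk> \<Longrightarrow>
      leQ (ty X x) (fst l) (snd (pull Q X Y \<zeta> (b l)) x ()) (snd (a (pull Q X Y \<zeta> l)) x ())"
      using z X a b by (auto simp: continuous_iff)
    have "column X ?B (dist_comp Q X Y ?B ?v \<zeta>) k \<in> fixed (X, a)" if k: "k \<in> pts ?B" for k
    proof -
      let ?l = "dec Y k"
      have "?l \<in> fixed (Y, b)" using dec_sub[OF X(3) FY] k by simp
      then have l: "?l \<in> presheaves Q Y" "b ?l = ?l" by (auto simp: fixed_def)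
      \<comment> \<open>As \<open>?l\<close> is fixed by \<open>b\<close>, continuity gives one
        inequality, and \<open>a m \<le> m\<close> gives the other.\<close>
      have "snd (a (pull Q X Y \<zeta> ?l)) x () = snd (pull Q X Y \<zeta> ?l) x ()" if "x \<in> pts X" for x
        using c[OF l(1) that] a1[OF pull_presheaf[OF X(2,4) d l(1)] that] l that X d a
          endo_in_arr[OF a pull_presheaf[OF X(2,4) d l(1)] that]
            presheaf_in[OF pull_presheaf[OF X(2,4) d l(1)] that]
        by (intro le_antisym[of "ty X x" "fst ?l"]) auto
      then have "a (pull Q X Y \<zeta> ?l) = pull Q X Y \<zeta> ?l"
        using X d l a by (intro presheaf_eqI[of _ X]) auto
      then show ?thesis
        using column_incl_comp[OF X(2,3) FY, of k \<zeta>] X d l k by (simp add: fixed_def)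
    qed
    then obtain t where t: "t \<in> dists Q ?A ?B" "dist_comp Q X ?A ?B t ?u = dist_comp Q X Y ?B ?v \<zeta>"
      using factor_incl[OF X(1) FX, of ?B "dist_comp Q X Y ?B ?v \<zeta>"] A X d by auto
    show ?thesis using d t(1) t(2)[symmetric] by blast
  qed
  moreover have "\<zeta> \<in> continuous_dists Q (X, a) (Y, b)" if "\<zeta> \<in> ?R" for \<zeta>
  proof -
    obtain t where d: "\<zeta> \<in> dists Q X Y" and t: "t \<in> dists Q ?A ?B"
      "dist_comp Q X Y ?B ?v \<zeta> = dist_comp Q X ?A ?B t ?u"
      using \<open>\<zeta> \<in> ?R\<close> by auto
    show ?thesis
      unfolding continuous_iff[OF X(2,4) a b]
    proof (intro conjI d ballI)
      fix l x assume l: "l \<in> presheaves Q Y" and x: "x \<in> pts X"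
      let ?k = "enc Y (b l)" and ?m = "pull Q X Y \<zeta> (b l)"
      have bl: "b l \<in> fixed (Y, b)" using l b b2 by (simp add: fixed_def)
      then have k: "?k \<in> pts ?B" "dec Y ?k = b l" using X FY l b by auto
      have m: "?m \<in> presheaves Q X" "fst ?m = fst l" using X d l b by auto
      have mx: "snd ?m x () = dist_comp Q X ?A ?B t ?u x ?k" if "x \<in> pts X" for x
        using incl_comp_app[OF X(3) FY that, of ?k \<zeta>] k t(2) by simp
      have tyk: "ty ?B ?k = fst l" using k l b X FY by simp
      \<comment> \<open>\<open>?m\<close> is the join of the multiples
        \<open>t j ?k \<circ> j\<close> of open presheaves \<open>j\<close>. Each multiple lies
        below \<open>a ?m\<close>, because \<open>a\<close> fixes \<open>j\<close> and respects
        multiples by \<open>endo_tensor\<close>.\<close>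
      have "leQ (ty X x) (fst l) (Cmp Q (ty X x) (ty ?A j) (fst l) (t j ?k) (?u x j)) (snd (a ?m) x ())"
        if j: "j \<in> pts ?A" for j
      proof -
        have "dec X j \<in> fixed (X, a)" using dec_sub[OF X(1) FX] j by simp
        then have dj: "dec X j \<in> presheaves Q X" "a (dec X j) = dec X j" by (auto simp: fixed_def)
        have uj: "?u x' j = snd (dec X j) x' ()" if "x' \<in> pts X" for x' using that j X FX by simp
        have tyj: "ty ?A j = fst (dec X j)" using j X FX by simp
        have tj: "t j ?k \<in> arr Q (fst (dec X j)) (fst l)" using dist_in[OF t(1) j k(1)] tyk tyj by simp
        have "leQ (ty X x') (fst ?m) (Cmp Q (ty X x') (fst (dec X j)) (fst ?m) (t j ?k) (snd (dec X j) x' ()))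
          (snd ?m x' ())"
          if x': "x' \<in> pts X" for x'
          unfolding mx[OF x'] m(2) using le_dist_comp[OF x' k(1) j X(2) A(1,2,3) t(1)]
          by (simp only: tyk tyj uj[OF x'])
        from endo_tensor[OF X(2) a dj(1) m(1) _ this x] show ?thesis
          using tj m dj uj x tyj by simp
      qed
      then have "leQ (ty X x) (fst l) (snd ?m x ()) (snd (a ?m) x ())"
        unfolding mx[OF x] using dist_comp_le_iff[OF x k(1) X(2) A(1,2,3) t(1), of "snd (a ?m) x ()"]
          endo_in_arr[OF a m(1) x] tyk m(2) by simp
      \<comment> \<open>Since \<open>b l \<le> l\<close>, the presheaf \<open>?m\<close> lies below
        the pullback of \<open>l\<close>, and \<open>a\<close> is monotone.\<close>
      moreover have "leQ (ty X x) (fst ?m) (snd (a ?m) x ()) (snd (a (pull Q X Y \<zeta> l)) x ())"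
      proof (rule endo_mono[OF X(2) a m(1)])
        fix x assume x: "x \<in> pts X"
        have "leQ (ty X x) (fst l) (Cmp Q (ty X x) (ty Y y) (fst l) (snd (b l) y ()) (\<zeta> x y))
          (snd (pull Q X Y \<zeta> l) x ())"
          if y: "y \<in> pts Y" for y
        proof -
          have "leQ (ty X x) (fst l) (Cmp Q (ty X x) (ty Y y) (fst l) (snd (b l) y ()) (\<zeta> x y))
            (Cmp Q (ty X x) (ty Y y) (fst l) (snd l y ()) (\<zeta> x y))"
            using X d l b b1 x y by (intro Cmp_mono_left) auto
          from le_trans[OF _ _ _ _ _ this le_pull[OF X(2,4) d l x y]] show ?thesis
            using X d l b x y presheaf_in[OF pull_presheaf[OF X(2,4) d l] x] by simp
        qed
        then show "leQ (ty X x) (fst ?m) (snd ?m x ()) (snd (pull Q X Y \<zeta> l) x ())"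
          using pull_le_iff[OF X(2,4) d endo_in[OF b l] x, of "snd (pull Q X Y \<zeta> l) x ()"]
            presheaf_in[OF pull_presheaf[OF X(2,4) d l] x] l b by simp
      qed (use X d l b x in auto)
      ultimately show "leQ (ty X x) (fst l) (snd (pull Q X Y \<zeta> (b l)) x ()) (snd (a (pull Q X Y \<zeta> l)) x ())"
        using le_trans[of "ty X x" "fst l" "snd ?m x ()" "snd (a ?m) x ()" "snd (a (pull Q X Y \<zeta> l)) x ()"]
          m l X d a x presheaf_in[OF m(1) x] endo_in_arr[OF a m(1) x]
            endo_in_arr[OF a pull_presheaf[OF X(2,4) d l] x]
        by simp
    qed
  qed
  ultimately show ?thesis by blast
qed

text \<open>The values \<open>b l\<close> are exactly the fixed points of \<open>b\<close>, and
  evaluation after \<open>\<zeta>\<close> has their pullbacks as columns.\<close>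

lemma interior_kernel:
  assumes S: "interior_space U Q (X, a)" and T: "interior_space U Q (Y, b)"
    and d: "\<zeta> \<in> dists Q X Y" "\<zeta>' \<in> dists Q X Y"
  shows "(\<forall>l\<in>presheaves Q Y. pull Q X Y \<zeta> (b l) = pull Q X Y \<zeta>' (b l)) \<longleftrightarrow>
    dist_comp Q X Y (fixed_cat (Y, b)) (fixed_incl (Y, b)) \<zeta> = dist_comp Q X Y (fixed_cat (Y, b))
      (fixed_incl (Y, b)) \<zeta>'"
    (is "?L \<longleftrightarrow> ?R")
proof
  let ?B = "fixed_cat (Y, b)"
  note [simp] = fixed_cat_def fixed_incl_def
  have X: "qcat Q X" "small_qcat U Q Y" "qcat Q Y" and b: "b \<in> qfunctors Q (P Q Y) (P Q Y)"
    and b2: "\<And>m. m \<in> presheaves Q Y \<Longrightarrow> b (b m) = b m"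
    using S T by (auto simp: interior_iff small_qcat_def)
  have FY: "fixed (Y, b) \<subseteq> presheaves Q Y" using fixed_psh by force
  have B: "qcat Q ?B" "fixed_incl (Y, b) \<in> dists Q Y ?B" using X FY by auto
  {
    assume L: ?L
    show ?R
    proof (rule dist_eqI[of _ X ?B])
      fix x k assume x: "x \<in> pts X" "k \<in> pts ?B"
      then have "dec Y k \<in> fixed (Y, b)" using dec_sub[OF X(2) FY] by simp
      then have "pull Q X Y \<zeta> (dec Y k) = pull Q X Y \<zeta>' (dec Y k)"
        using L by (auto simp: fixed_def)
      then show "dist_comp Q X Y ?B (fixed_incl (Y, b)) \<zeta> x k = dist_comp Q X Y ?B (fixed_incl (Y, b)) \<zeta>' x k"
        using incl_comp_app[OF X(2) FY x(1)] x(2) by simp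
    qed (use X B d in auto)
  }
  assume R: ?R
  show ?L
  proof
    fix l assume l: "l \<in> presheaves Q Y"
    have bl: "b l \<in> fixed (Y, b)" using l b b2 by (simp add: fixed_def)
    then have k: "enc Y (b l) \<in> pts (sub Y (fixed (Y, b)))" "dec Y (enc Y (b l)) = b l" using X FY l b by auto
    show "pull Q X Y \<zeta> (b l) = pull Q X Y \<zeta>' (b l)"
      using column_incl_comp[OF X(1,2) FY k(1) d(1)] column_incl_comp[OF X(1,2) FY k(1) d(2)] R k(2) by simp
  qed
qed

text \<open>The interior operator is \<open>m \<mapsto> (m \<swarrow> u) \<circ> u\<close>, from the Kan adjunction of \<open>u\<close>.\<close>

lemma interior_eso:
  assumes XY: "small_qcat U Q X" "small_qcat U Q Y" and u: "u \<in> dists Q X Y"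
  shows "\<exists>a w. interior_space U Q (X, a) \<and>
    is_iso (diagonal_quantaloid (QDist U Q)) (X, fixed_cat (X, a), fixed_incl (X, a)) (X, Y, u) w"
proof -
  have X: "qcat Q X" "qcat Q Y" using XY by (auto simp: small_qcat_def)
  define r where "r m = (fst m, dl X Y (singleton_qcat Q (fst m)) (snd m) u)" for m
  define a where "a = (\<lambda>m\<in>presheaves Q X. pull Q X Y u (r m))"
  have r: "r m \<in> presheaves Q Y" "fst (r m) = fst m" if "m \<in> presheaves Q X" for m
    using that X u presheaf_dist[OF that] unfolding r_def by (auto simp: presheaf_iff)
  have rin: "snd (r m) y () \<in> arr Q (ty Y y) (fst m)" if "m \<in> presheaves Q X" "y \<in> pts Y" for m y
    using presheaf_in[OF r(1)[OF that(1)] that(2)] r(2)[OF that(1)] by simp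
  have le_r: "leQ (ty Y y) (fst m) g (snd (r m) y ()) \<longleftrightarrow>
      (\<forall>x\<in>pts X. leQ (ty X x) (fst m) (Cmp Q (ty X x) (ty Y y) (fst m) g (u x y)) (snd m x ()))"
    if "m \<in> presheaves Q X" "y \<in> pts Y" "g \<in> arr Q (ty Y y) (fst m)" for m y g
    using le_dl[OF X qcat_singleton[OF presheaf_ty[OF that(1)]] u presheaf_dist[OF that(1)] that(2), of "()"
      g] that
    unfolding r_def by simp
  have ain: "a m \<in> presheaves Q X" "fst (a m) = fst m" if "m \<in> presheaves Q X" for m
    using that X u r unfolding a_def by auto
  have aarr: "snd (a m) x () \<in> arr Q (ty X x) (fst m)" if "m \<in> presheaves Q X" "x \<in> pts X" for m x
    using presheaf_in[OF ain(1)[OF that(1)] that(2)] ain(2)[OF that(1)] by simp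
  have a_le: "leQ (ty X x) (fst m) (snd (a m) x ()) f \<longleftrightarrow>
      (\<forall>y\<in>pts Y. leQ (ty X x) (fst m) (Cmp Q (ty X x) (ty Y y) (fst m) (snd (r m) y ()) (u x y)) f)"
    if "m \<in> presheaves Q X" "x \<in> pts X" "f \<in> arr Q (ty X x) (fst m)" for m x f
    using pull_le_iff[OF X u r(1)[OF that(1)] that(2), of f] that r unfolding a_def by simp
  have le_a: "leQ (ty X x) (fst m) (Cmp Q (ty X x) (ty Y y) (fst m) (snd (r m) y ()) (u x y))
    (snd (a m) x ())"
    if "m \<in> presheaves Q X" "x \<in> pts X" "y \<in> pts Y" for m x y
    using le_pull[OF X u r(1)[OF that(1)] that(2,3)] that r unfolding a_def by simp
  have ru: "leQ (ty X x) (fst m) (Cmp Q (ty X x) (ty Y y) (fst m) (snd (r m) y ()) (u x y)) (snd m x ())"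
    if "m \<in> presheaves Q X" "x \<in> pts X" "y \<in> pts Y" for m x y
    using le_r[OF that(1,3) rin[OF that(1,3)]] rin[OF that(1,3)] that X by auto
  have a1: "leQ (ty X x) (fst m) (snd (a m) x ()) (snd m x ())" if "m \<in> presheaves Q X" "x \<in> pts X" for m x
    using that ru X by (simp add: a_le)
  have a2: "a (a m) = a m" if m: "m \<in> presheaves Q X" for m
  proof (rule presheaf_eqI[of _ X])
    fix x assume x: "x \<in> pts X"
    \<comment> \<open>Idempotence: \<open>r m \<circ> u\<close> lies below \<open>a m\<close>, which
      says \<open>r m \<le> r (a m)\<close>, so a second application of \<open>a\<close> loses
      nothing.\<close>
    have rr: "leQ (ty Y y) (fst m) (snd (r m) y ()) (snd (r (a m)) y ())" if "y \<in> pts Y" for y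
      using le_r[OF ain(1)[OF m] that, of "snd (r m) y ()"] le_a[OF m _ that] rin[OF m that] ain[OF m] by simp
    have "leQ (ty X x) (fst m) (Cmp Q (ty X x) (ty Y y) (fst m) (snd (r m) y ()) (u x y))
      (snd (a (a m)) x ())"
      if y: "y \<in> pts Y" for y
    proof -
      have "leQ (ty X x) (fst m) (Cmp Q (ty X x) (ty Y y) (fst m) (snd (r m) y ()) (u x y))
        (Cmp Q (ty X x) (ty Y y) (fst m) (snd (r (a m)) y ()) (u x y))"
        using X u x y m rr rin[OF m y] rin[OF ain(1)[OF m] y] ain[OF m] by (intro Cmp_mono_left) auto
      from le_trans[OF _ _ _ _ _ this] le_a[OF ain(1)[OF m] x y] show ?thesis
        using X u x y m rin[OF m y] rin[OF ain(1)[OF m] y] ain[OF m] aarr[OF ain(1)[OF m] x] by simp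
    qed
    then have "leQ (ty X x) (fst m) (snd (a m) x ()) (snd (a (a m)) x ())"
      using a_le[OF m x, of "snd (a (a m)) x ()"] aarr[OF ain(1)[OF m] x] ain[OF m] by simp
    then show "snd (a (a m)) x () = snd (a m) x ()"
      using a1[OF ain(1)[OF m] x] aarr[OF ain(1)[OF m] x] aarr[OF m x] ain[OF m] X x m
      by (intro le_antisym[of "ty X x" "fst m"]) auto
  qed (use m ain in auto)
  have afun: "a \<in> qfunctors Q (P Q X) (P Q X)"
  proof (rule endoI[OF X(1)])
    fix m m' f x
    assume m: "m \<in> presheaves Q X" "m' \<in> presheaves Q X" and f: "f \<in> arr Q (fst m) (fst m')"
      and le: "\<And>x. x \<in> pts X \<Longrightarrow> leQ (ty X x) (fst m') (Cmp Q (ty X x) (fst m) (fst m') f (snd m x ()))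
        (snd m' x ())"
      and x: "x \<in> pts X"
    have 1: "leQ (ty Y y) (fst m') (Cmp Q (ty Y y) (fst m) (fst m') f (snd (r m) y ())) (snd (r m') y ())"
      if y: "y \<in> pts Y" for y
    proof -
      have "leQ (ty X z) (fst m') (Cmp Q (ty X z) (fst m) (fst m') f
        (Cmp Q (ty X z) (ty Y y) (fst m) (snd (r m) y ()) (u z y))) (snd m' z ())"
        if z: "z \<in> pts X" for z
      proof -
        have "leQ (ty X z) (fst m') (Cmp Q (ty X z) (fst m) (fst m') f
          (Cmp Q (ty X z) (ty Y y) (fst m) (snd (r m) y ()) (u z y)))
          (Cmp Q (ty X z) (fst m) (fst m') f (snd m z ()))"
          using X u m f y z rin[OF m(1) y] ru[OF m(1) z y] by (intro Cmp_mono_right) auto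
        from le_trans[OF _ _ _ _ _ this le[OF z]] show ?thesis
          using X u m f y z rin[OF m(1) y] by simp
      qed
      then show ?thesis using X u m f y rin[OF m(1) y] by (subst le_r) (auto simp: Cmp_assoc)
    qed
    have "leQ (ty X x) (fst m') (Cmp Q (ty X x) (fst m) (fst m') f
      (Cmp Q (ty X x) (ty Y y) (fst m) (snd (r m) y ()) (u x y))) (snd (a m') x ())"
      if y: "y \<in> pts Y" for y
    proof -
      have "leQ (ty X x) (fst m') (Cmp Q (ty X x) (ty Y y) (fst m')
        (Cmp Q (ty Y y) (fst m) (fst m') f (snd (r m) y ())) (u x y))
        (Cmp Q (ty X x) (ty Y y) (fst m') (snd (r m') y ()) (u x y))"
        using X u m f y x rin[OF m(1) y] rin[OF m(2) y] 1[OF y] by (intro Cmp_mono_left) auto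
      from le_trans[OF _ _ _ _ _ this le_a[OF m(2) x y]] show ?thesis
        using X u m f y x rin[OF m(1) y] rin[OF m(2) y] aarr[OF m(2) x] by (simp add: Cmp_assoc)
    qed
    then show "leQ (ty X x) (fst m') (Cmp Q (ty X x) (fst m) (fst m') f (snd (a m) x ())) (snd (a m') x ())"
      using X u m f x r[OF m(1)] rin[OF m(1)] aarr[OF m(2) x]
      unfolding a_def by (simp add: pull_app, subst Cmp_sup_right_le_iff) (auto simp: a_def)
  qed (use ain in \<open>auto simp: a_def\<close>)
  have int: "interior_space U Q (X, a)"
    unfolding interior_iff using XY afun a1 a2 by blast
  let ?F = "fixed (X, a)" and ?A = "sub X (fixed (X, a))" and ?i = "incl X (fixed (X, a))"
  have F: "?F \<subseteq> presheaves Q X" using fixed_psh by force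
  have A: "qcat Q ?A" "?i \<in> dists Q X ?A" "small_qcat U Q ?A" using XY F small_sub by auto
  \<comment> \<open>The columns of \<open>u\<close> are open: for the column at \<open>y\<close>,
    its residual \<open>r\<close> lies above the identity at \<open>y\<close>, so composing with
    \<open>u\<close> recovers the column. Hence \<open>u\<close> factors through evaluation.\<close>
  have "column X Y u y \<in> ?F" if y: "y \<in> pts Y" for y
  proof -
    let ?c = "column X Y u y"
    have c: "?c \<in> presheaves Q X" "fst ?c = ty Y y" using X u y by auto
    have 1: "leQ (ty Y y) (ty Y y) (Idn Q (ty Y y)) (snd (r ?c) y ())"
      using X u y c by (subst le_r[OF c(1) y, unfolded c(2)]) auto
    have "leQ (ty X x) (ty Y y) (u x y) (snd (a ?c) x ())" if x: "x \<in> pts X" for x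
    proof -
      have "leQ (ty X x) (ty Y y) (u x y) (Cmp Q (ty X x) (ty Y y) (ty Y y) (snd (r ?c) y ()) (u x y))"
        using X u x y 1 rin[OF c(1) y] by (intro le_Cmp_Idn) auto
      from le_trans[OF _ _ _ _ _ this] le_a[OF c(1) x y] show ?thesis
        using X u x y c rin[OF c(1) y] aarr[OF c(1) x] by simp
    qed
    then have "a ?c = ?c"
      using X u y c ain[OF c(1)] a1[OF c(1)] aarr[OF c(1)]
      by (intro presheaf_eqI[of _ X]) (auto intro!: le_antisym[of "ty X _" "ty Y y"])
    then show ?thesis using c by (simp add: fixed_def)
  qed
  then obtain t where t: "t \<in> dists Q ?A Y" "dist_comp Q X ?A Y t ?i = u"
    using factor_incl[OF XY(1) F X(2) u] by blast
  \<comment> \<open>Conversely evaluation factors through \<open>u\<close>: an open \<open>m\<close>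
    equals \<open>(m \<swarrow> u) \<circ> u\<close>, and \<open>?t\<close> collects the residuals
    \<open>m \<swarrow> u\<close> of all open \<open>m\<close>.\<close>
  let ?t = "dl X Y ?A ?i u"
  have t': "?t \<in> dists Q Y ?A" using X A u by auto
  have "dist_comp Q X Y ?A ?t u = ?i"
  proof (rule dist_eqI[of _ X ?A])
    fix x k assume x: "x \<in> pts X" and k: "k \<in> pts ?A"
    let ?m = "dec X k"
    have m: "?m \<in> presheaves Q X" "a ?m = ?m" using dec_sub[OF XY(1) F k] by (auto simp: fixed_def)
    have ik: "?i x' k = snd ?m x' ()" if "x' \<in> pts X" for x' using that k XY F by simp
    have tk: "ty ?A k = fst ?m" using k XY F by simp
    have ct: "dist_comp Q X Y ?A ?t u x k \<in> arr Q (ty X x) (fst ?m)"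
      using dist_comp_ext[OF x k X(1,2) A(1) u t'] tk by simp
    have "leQ (ty X x) (fst ?m) (Cmp Q (ty X x) (ty Y y) (fst ?m) (snd (r ?m) y ()) (u x y))
      (dist_comp Q X Y ?A ?t u x k)"
      if y: "y \<in> pts Y" for y
    proof -
      have "leQ (ty Y y) (fst ?m) (snd (r ?m) y ()) (?t y k)"
        using le_dl[OF X A(1) u A(2) y k, of "snd (r ?m) y ()"] rin[OF m(1) y] ru[OF m(1) _ y] tk ik by simp
      then have "leQ (ty X x) (fst ?m) (Cmp Q (ty X x) (ty Y y) (fst ?m) (snd (r ?m) y ()) (u x y))
        (Cmp Q (ty X x) (ty Y y) (fst ?m) (?t y k) (u x y))"
        using X u x y m rin[OF m(1) y] dist_in[OF t' y k] tk by (intro Cmp_mono_left) auto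
      from le_trans[OF _ _ _ _ _ this le_dist_comp[OF x k y X(1,2) A(1) u t', unfolded tk]] show ?thesis
        using X u x y m rin[OF m(1) y] dist_in[OF t' y k] tk ct by auto
    qed
    then have "leQ (ty X x) (fst ?m) (snd ?m x ()) (dist_comp Q X Y ?A ?t u x k)"
      using a_le[OF m(1) x ct] m(2) by simp
    moreover have "leQ (ty X x) (fst ?m) (dist_comp Q X Y ?A ?t u x k) (snd ?m x ())"
      using dist_comp_le_iff[OF x k X A(1) u t', of "snd ?m x ()"] dl_Cmp_le[OF X A(1) u A(2) x _ k] tk
        ik[OF x] m x by simp
    ultimately show "dist_comp Q X Y ?A ?t u x k = ?i x k"
      using ik[OF x] ct m x X by (intro le_antisym[of "ty X x" "fst ?m"]) auto
  qed (use X A u t' in auto)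
  then have "is_iso (diagonal_quantaloid (QDist U Q)) (X, ?A, ?i) (X, Y, u) u"
    using XY A u t t' by (intro QD.diagonal_iso_domain[of _ _ _ _ _ t ?t]) (auto simp: Arrows_def)
  with int show ?thesis unfolding fixed_cat_def fixed_incl_def by auto
qed

text \<open>By \<open>interior_continuous_iff\<close>, continuity of \<open>\<zeta>\<close> is the
  existence of the other side of a square, and by \<open>interior_kernel\<close> the congruence is
  equality of diagonals, so the criterion for squares applies.\<close>

lemma weak_equivalence_IntDist:
  "\<exists>Fo Fa. weak_equivalence (IntDist_o U Q) (diagonal_quantaloid (QDist U Q)) Fo Fa"
proof -
  let ?I = "IntDist U Q"
  have I: "Obj ?I = {S. interior_space U Q S}" "arr ?I S T = continuous_dists Q S T" "eq (Hom ?I S T) = (=)"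
    "le (Hom ?I S T) = dist_le Q (fst S) (fst T)" "Cmp ?I S T V = dist_comp Q (fst S) (fst T) (fst V)"
    "Idn ?I S = hm (fst S)" for S T V
    by (simp_all add: IntDist_def)
  have small: "small_qcat U Q (fst S)" if "interior_space U Q S" for S
    using that by (cases S) (simp add: interior_iff)
  let ?u = "\<lambda>S T. dist_comp Q (fst S) (fst T) (fixed_cat T) (fixed_incl T)"
    and ?t = "\<lambda>S T t. dist_comp Q (fst S) (fixed_cat S) (fixed_cat T) t (fixed_incl S)"
  have o: "(fst S, fixed_cat S, fixed_incl S) \<in> Arrows (QDist U Q)" if "S \<in> Obj ?I" for S
    using that small small_sub fixed_psh
    by (auto simp: I Arrows_def fixed_cat_def fixed_incl_def intro!: incl_dist)
  then have o': "fst S \<in> Obj (QDist U Q)" "fixed_cat S \<in> Obj (QDist U Q)"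
    "fixed_incl S \<in> arr (QDist U Q) (fst S) (fixed_cat S)" if "S \<in> Obj ?I" for S
    using that by (auto simp: Arrows_def)
  have q: "qcat Q (fst S)" "qcat Q (fixed_cat S)" if "S \<in> Obj ?I" for S
    using o'[OF that] by (auto simp: small_qcat_def)
  have cont: "f \<in> arr ?I S T \<longleftrightarrow> f \<in> dists Q (fst S) (fst T) \<and>
      (\<exists>t\<in>dists Q (fixed_cat S) (fixed_cat T). ?u S T f = ?t S T t)"
    if "S \<in> Obj ?I" "T \<in> Obj ?I" for S T f
    using that interior_continuous_iff[of "fst S" "snd S" "fst T" "snd T"] by (simp add: I)
  show ?thesis
    unfolding IntDist_o_def
  proof (rule QD.weak_equivalence_squares[where X = fst and A = fixed_cat and u = fixed_incl and \<sigma> = "\<lambda>f. f"])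
    show "Idn ?I S \<in> arr ?I S S \<and> Idn ?I S = Idn (QDist U Q) (fst S)" if S: "S \<in> Obj ?I" for S
      unfolding cont[OF S S] using q[OF S] o'(3)[OF S] by (auto simp: I intro!: bexI[of _ "hm (fixed_cat S)"])
    show "Cmp ?I S T V g f \<in> arr ?I S V \<and> Cmp ?I S T V g f = Cmp (QDist U Q) (fst S) (fst T) (fst V) g f"
      if S: "S \<in> Obj ?I" "T \<in> Obj ?I" "V \<in> Obj ?I" and f: "f \<in> arr ?I S T" "g \<in> arr ?I T V" for S T V f g
    proof -
      obtain t t' where t: "f \<in> dists Q (fst S) (fst T)" "t \<in> dists Q (fixed_cat S) (fixed_cat T)"
        "?u S T f = ?t S T t"
        "g \<in> dists Q (fst T) (fst V)" "t' \<in> dists Q (fixed_cat T) (fixed_cat V)" "?u T V g = ?t T V t'"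
        using f unfolding cont[OF S(1,2)] cont[OF S(2,3)] by blast
      have "?u S V (dist_comp Q (fst S) (fst T) (fst V) g f) = ?t S V
        (dist_comp Q (fixed_cat S) (fixed_cat T) (fixed_cat V) t' t)"
        using QD.square_paste[OF o'(1)[OF S(1)] o'(1)[OF S(2)] o'(1)[OF S(3)] o'(2)[OF S(1)] o'(2)[OF S(2)]
          o'(2)[OF S(3)]
          o'(3)[OF S(1)] o'(3)[OF S(2)] o'(3)[OF S(3)], of f g t t'] t by simp
      then show ?thesis
        unfolding cont[OF S(1,3)] using t q[OF S(1)] q[OF S(2)] q[OF S(3)]
        by (auto simp: I intro!: bexI[of _ "dist_comp Q (fixed_cat S) (fixed_cat T) (fixed_cat V) t' t"])
    qed
    fix S T assume S: "S \<in> Obj ?I" "T \<in> Obj ?I"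
    show "f \<squnion>\<^bsub>Hom ?I S T\<^esub> g \<in> arr ?I S T \<and> f \<squnion>\<^bsub>Hom ?I S T\<^esub> g = \<Squnion>\<^bsub>Hom (QDist U Q) (fst S) (fst T)\<^esub> {f, g}"
      if f: "f \<in> arr ?I S T" "g \<in> arr ?I S T" for f g
    proof -
      let ?j = "\<Squnion>\<^bsub>Hom (QDist U Q) (fst S) (fst T)\<^esub> {f, g}"
      note X = q(1)[OF S(1)] q(1)[OF S(2)]
      obtain t t' where t: "f \<in> dists Q (fst S) (fst T)" "t \<in> dists Q (fixed_cat S) (fixed_cat T)"
        "?u S T f = ?t S T t"
        "g \<in> dists Q (fst S) (fst T)" "t' \<in> dists Q (fixed_cat S) (fixed_cat T)" "?u S T g = ?t S T t'"
        using f unfolding cont[OF S] by blast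
      have V: "{f, g} \<subseteq> arr (QDist U Q) (fst S) (fst T)"
        "{t, t'} \<subseteq> arr (QDist U Q) (fixed_cat S) (fixed_cat T)"
        using t by auto
      have j: "?j \<in> arr ?I S T"
        unfolding cont[OF S] using QD.sup_in[OF o'(1)[OF S(1)] o'(1)[OF S(2)] V(1)]
          QD.sup_in[OF o'(2)[OF S(1)] o'(2)[OF S(2)] V(2)]
          QD.square_join[OF o'(1)[OF S(1)] o'(1)[OF S(2)] o'(2)[OF S(1)] o'(2)[OF S(2)] o'(3)[OF S(1)]
            o'(3)[OF S(2)], of f g t t'] t
        by auto
      have sub: "arr ?I S T \<subseteq> dists Q (fst S) (fst T)" using cont[OF S] by blast
      have "partial_order (Hom ?I S T)"
        by (rule partial_orderI)
          (use sub in \<open>auto simp: I intro: dist_le_refl[OF X] dist_le_antisym[OF X] dist_le_trans[OF X]\<close>)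
      moreover have "join_of (Hom ?I S T) {f, g} ?j"
        using QD.sup_join_of[OF o'(1)[OF S(1)] o'(1)[OF S(2)] V(1)] j sub unfolding join_of_def
          by (auto simp: I)
      ultimately have "f \<squnion>\<^bsub>Hom ?I S T\<^esub> g = ?j" using f by (intro join_eqI)
      with j show ?thesis by simp
    qed
    obtain X a Y b where ST: "S = (X, a)" "T = (Y, b)" "interior_space U Q (X, a)" "interior_space U Q (Y, b)"
      using S by (cases S; cases T) (auto simp: I)
    show "(case S of (X, a) \<Rightarrow> \<lambda>(Y, b). {(\<zeta>, \<zeta>'). \<zeta> \<in> continuous_dists Q (X, a) (Y, b) \<and>
        \<zeta>' \<in> continuous_dists Q (X, a) (Y, b) \<and>
          (\<forall>l\<in>presheaves Q Y. pull Q X Y \<zeta> (b l) = pull Q X Y \<zeta>' (b l))}) T =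
      {(f, g). f \<in> arr ?I S T \<and> g \<in> arr ?I S T \<and>
        Cmp (QDist U Q) (fst S) (fst T) (fixed_cat T) (fixed_incl T) f =
        Cmp (QDist U Q) (fst S) (fst T) (fixed_cat T) (fixed_incl T) g}"
    proof -
      have "(\<forall>l\<in>presheaves Q Y. pull Q X Y \<zeta> (b l) = pull Q X Y \<zeta>' (b l)) \<longleftrightarrow>
        dist_comp Q X Y (fixed_cat T) (fixed_incl T) \<zeta> = dist_comp Q X Y (fixed_cat T) (fixed_incl T) \<zeta>'"
        if "\<zeta> \<in> continuous_dists Q (X, a) (Y, b)" "\<zeta>' \<in> continuous_dists Q (X, a) (Y, b)" for \<zeta> \<zeta>'
        using interior_kernel[OF ST(3,4)] continuous_dist[OF that(1)] continuous_dist[OF that(2)]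
        by (simp add: ST(2))
      then show ?thesis by (auto simp: I ST(1,2))
    qed
  next
    show "\<exists>S\<in>Obj ?I. \<exists>w. is_iso (diagonal_quantaloid (QDist U Q)) (fst S, fixed_cat S, fixed_incl S) x w"
      if x: "x \<in> Arrows (QDist U Q)" for x
    proof -
      obtain X Y u where x': "x = (X, Y, u)" by (rule prod_cases3)
      then have "small_qcat U Q X" "small_qcat U Q Y" "u \<in> dists Q X Y" using x by (auto simp: Arrows_def)
      from interior_eso[OF this] show ?thesis unfolding x' by (force simp: I)
    qed
  qed (use cont o in \<open>auto simp: I\<close>)
qed

end

section \<open>Closure spaces\<close>

context distributors
begin

text \<open>A closed \<open>m'\<close> cannot tell \<open>m\<close> from \<open>c m\<close>: one
  direction closes the inequality, using \<open>c m' = m'\<close>, the other uses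
  \<open>m \<le> c m\<close>.\<close>

lemma closed_absorb:
  assumes X: "qcat Q X" and c: "c \<in> qfunctors Q (P Q X) (P Q X)"
    and c1: "\<And>x. x \<in> pts X \<Longrightarrow> leQ (ty X x) (fst m) (snd m x ()) (snd (c m) x ())"
    and m: "m \<in> presheaves Q X" "m' \<in> presheaves Q X" "c m' = m'" and f: "f \<in> arr Q (fst m) (fst m')"
  shows "(\<forall>x\<in>pts X. leQ (ty X x) (fst m') (Cmp Q (ty X x) (fst m) (fst m') f (snd (c m) x ())) (snd m' x ()))
    \<longleftrightarrow>
    (\<forall>x\<in>pts X. leQ (ty X x) (fst m') (Cmp Q (ty X x) (fst m) (fst m') f (snd m x ())) (snd m' x ()))"
    (is "?L \<longleftrightarrow> ?R")
proof
  assume ?R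
  then show ?L using endo_tensor[OF X c m(1,2) f] m(3) by simp
next
  assume L: ?L
  show ?R
  proof
    fix x assume x: "x \<in> pts X"
    have "leQ (ty X x) (fst m') (Cmp Q (ty X x) (fst m) (fst m') f (snd m x ()))
        (Cmp Q (ty X x) (fst m) (fst m') f (snd (c m) x ()))"
      using X c m f x c1 by (intro Cmp_mono_right) auto
    from le_trans[OF _ _ _ _ _ this] L show "leQ (ty X x) (fst m')
      (Cmp Q (ty X x) (fst m) (fst m') f (snd m x ())) (snd m' x ())"
      using X c m f x by auto
  qed
qed

end

context universe
begin

lemma closure_iff:
  "closure_space U Q (X, c) \<longleftrightarrow> small_qcat U Q X \<and> c \<in> qfunctors Q (P Q X) (P Q X) \<and>
     (\<forall>m\<in>presheaves Q X. \<forall>x\<in>pts X. leQ (ty X x) (fst m) (snd m x ()) (snd (c m) x ())) \<and>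
     (\<forall>m\<in>presheaves Q X. c (c m) = c m)"
proof -
  have "pointwise_le Q (P Q X) (P Q X) (\<lambda>m. m) c \<longleftrightarrow>
     (\<forall>m\<in>presheaves Q X. \<forall>x\<in>pts X. leQ (ty X x) (fst m) (snd m x ()) (snd (c m) x ()))"
    if "small_qcat U Q X" "c \<in> qfunctors Q (P Q X) (P Q X)"
    by (rule pointwise_le_endo) (use that in \<open>auto simp: small_qcat_def\<close>)
  then show ?thesis unfolding closure_space_def by auto
qed

lemma closure_facts:
  assumes "closure_space U Q S"
  shows "small_qcat U Q (fst S)" "qcat Q (fst S)" "snd S \<in> qfunctors Q (P Q (fst S)) (P Q (fst S))"
    and "\<lbrakk>m \<in> presheaves Q (fst S); x \<in> pts (fst S)\<rbrakk> \<Longrightarrow> leQ (ty (fst S) x) (fst m) (snd m x ())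
      (snd (snd S m) x ())"
    and "m \<in> presheaves Q (fst S) \<Longrightarrow> snd S (snd S m) = snd S m"
    and "small_qcat U Q (fixed_cat S)" "qcat Q (fixed_cat S)" "fixed_incl S \<in> dists Q (fst S) (fixed_cat S)"
    and "m \<in> presheaves Q (fst S) \<Longrightarrow> snd S m \<in> fixed S"
proof -
  obtain X c where S: "S = (X, c)" by (cases S)
  have F: "fixed S \<subseteq> presheaves Q (fst S)" by (rule fixed_psh)
  show a: "small_qcat U Q (fst S)" "qcat Q (fst S)" "snd S \<in> qfunctors Q (P Q (fst S)) (P Q (fst S))"
    and "\<lbrakk>m \<in> presheaves Q (fst S); x \<in> pts (fst S)\<rbrakk> \<Longrightarrow> leQ (ty (fst S) x) (fst m) (snd m x ())
      (snd (snd S m) x ())"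
    and b: "m \<in> presheaves Q (fst S) \<Longrightarrow> snd S (snd S m) = snd S m"
    using assms by (auto simp: S closure_iff small_qcat_def)
  show "small_qcat U Q (fixed_cat S)" "qcat Q (fixed_cat S)" "fixed_incl S \<in> dists Q (fst S) (fixed_cat S)"
    using small_sub[OF a(1) F] qcat_sub[OF a(1) F] incl_dist[OF a(1) F]
      by (auto simp: fixed_cat_def fixed_incl_def)
  show "m \<in> presheaves Q (fst S) \<Longrightarrow> snd S m \<in> fixed S" using a b by (auto simp: fixed_def)
qed

lemma fixed_simps:
  assumes S: "closure_space U Q S"
  shows "k \<in> pts (fixed_cat S) \<Longrightarrow> dec (fst S) k \<in> presheaves Q (fst S)"
    and "k \<in> pts (fixed_cat S) \<Longrightarrow> snd S (dec (fst S) k) = dec (fst S) k"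
    and "k \<in> pts (fixed_cat S) \<Longrightarrow> ty (fixed_cat S) k = fst (dec (fst S) k)"
    and "\<lbrakk>x \<in> pts (fst S); k \<in> pts (fixed_cat S)\<rbrakk> \<Longrightarrow> fixed_incl S x k = snd (dec (fst S) k) x ()"
    and "m \<in> fixed S \<Longrightarrow> enc (fst S) m \<in> pts (fixed_cat S)"
    and "m \<in> fixed S \<Longrightarrow> dec (fst S) (enc (fst S) m) = m"
    and "m \<in> fixed S \<Longrightarrow> ty (fixed_cat S) (enc (fst S) m) = fst m"
    and "\<lbrakk>x \<in> pts (fst S); m \<in> fixed S\<rbrakk> \<Longrightarrow> fixed_incl S x (enc (fst S) m) = snd m x ()"
proof -
  note X = closure_facts(1)[OF S] and F = fixed_psh[of S]
  show "k \<in> pts (fixed_cat S) \<Longrightarrow> dec (fst S) k \<in> presheaves Q (fst S)"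
    and "k \<in> pts (fixed_cat S) \<Longrightarrow> snd S (dec (fst S) k) = dec (fst S) k"
    using dec_sub[OF X F, of k] by (auto simp: fixed_cat_def fixed_def)
  show "k \<in> pts (fixed_cat S) \<Longrightarrow> ty (fixed_cat S) k = fst (dec (fst S) k)"
    and "\<lbrakk>x \<in> pts (fst S); k \<in> pts (fixed_cat S)\<rbrakk> \<Longrightarrow> fixed_incl S x k = snd (dec (fst S) k) x ()"
    using X F by (auto simp: fixed_cat_def fixed_incl_def)
  show m: "m \<in> fixed S \<Longrightarrow> enc (fst S) m \<in> pts (fixed_cat S)" "m \<in> fixed S \<Longrightarrow> dec (fst S) (enc (fst S) m) = m"
    using X F by (auto simp: fixed_cat_def)
  show "m \<in> fixed S \<Longrightarrow> ty (fixed_cat S) (enc (fst S) m) = fst m"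
    and "\<lbrakk>x \<in> pts (fst S); m \<in> fixed S\<rbrakk> \<Longrightarrow> fixed_incl S x (enc (fst S) m) = snd m x ()"
    using X F m by (auto simp: fixed_cat_def fixed_incl_def)
qed

text \<open>The counterpart of \<open>factor_incl\<close> for meets: with \<open>v\<close> the
  evaluation and \<open>t = v \<swarrow> w\<close>, the distributor \<open>w\<close> is recovered as
  \<open>t \<searrow> v\<close>. The column of \<open>w\<close> at \<open>z\<close> is itself a
  closed point, where \<open>t\<close> lies above the identity; this member bounds the whole meet by
  \<open>w\<close>.\<close>

lemma residual_incl:
  assumes S: "closure_space U Q S" and Z: "qcat Q Z" and w: "w \<in> dists Q (fst S) Z"
    and col: "\<And>z. z \<in> pts Z \<Longrightarrow> column (fst S) Z w z \<in> fixed S"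
  shows "\<exists>t\<in>dists Q Z (fixed_cat S). dr (fst S) Z (fixed_cat S) t (fixed_incl S) = w"
proof -
  let ?Y = "fst S" and ?B = "fixed_cat S" and ?v = "fixed_incl S"
  let ?t = "dl ?Y Z ?B ?v w"
  note Y = closure_facts(2)[OF S] and B = closure_facts(7,8)[OF S]
  have t: "?t \<in> dists Q Z ?B" using Y Z B w by auto
  have "dr ?Y Z ?B ?t ?v = w"
  proof (rule dists_eq_le_iffI[OF Y Z])
    fix y z f assume y: "y \<in> pts ?Y" and z: "z \<in> pts Z" and f: "f \<in> arr Q (ty ?Y y) (ty Z z)"
    let ?j = "enc ?Y (column ?Y Z w z)"
    have j: "?j \<in> pts ?B" "ty ?B ?j = ty Z z" and vj: "\<And>y. y \<in> pts ?Y \<Longrightarrow> ?v y ?j = w y z"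
      using fixed_simps[OF S] col[OF z] by auto
    have tj: "?t z ?j \<in> arr Q (ty Z z) (ty Z z)" using dist_in[OF t z j(1)] j(2) by simp
    have 1: "leQ (ty Z z) (ty Z z) (Idn Q (ty Z z)) (?t z ?j)"
      using le_dl[OF Y Z B(1) w B(2) z j(1), of "Idn Q (ty Z z)"] Y Z w z vj by (simp add: j(2))
    have "leQ (ty ?Y y) (ty Z z) f (w y z)" if *:
      "\<forall>j\<in>pts ?B. leQ (ty ?Y y) (ty ?B j) (Cmp Q (ty ?Y y) (ty Z z) (ty ?B j) (?t z j) f) (?v y j)"
    proof -
      have "leQ (ty ?Y y) (ty Z z) f (Cmp Q (ty ?Y y) (ty Z z) (ty Z z) (?t z ?j) f)"
        using Y Z y z f tj 1 by (intro le_Cmp_Idn) auto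
      from le_trans[OF _ _ _ _ _ this] bspec[OF * j(1)] show ?thesis
        using Y Z y z f tj w by (simp add: j(2) vj)
    qed
    moreover have "leQ (ty ?Y y) (ty ?B j) (Cmp Q (ty ?Y y) (ty Z z) (ty ?B j) (?t z j) f) (?v y j)"
      if *: "leQ (ty ?Y y) (ty Z z) f (w y z)" and j: "j \<in> pts ?B" for j
    proof -
      have "leQ (ty ?Y y) (ty ?B j) (Cmp Q (ty ?Y y) (ty Z z) (ty ?B j) (?t z j) f)
        (Cmp Q (ty ?Y y) (ty Z z) (ty ?B j) (?t z j) (w y z))"
        using Y Z y z f w j B t * by (intro Cmp_mono_right) auto
      from le_trans[OF _ _ _ _ _ this dl_Cmp_le[OF Y Z B(1) w B(2) y z j]] show ?thesis
        using Y Z y z f w j B t by auto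
    qed
    ultimately show "leQ (ty ?Y y) (ty Z z) f (dr ?Y Z ?B ?t ?v y z) \<longleftrightarrow> leQ (ty ?Y y) (ty Z z) f (w y z)"
      unfolding le_dr[OF Y Z B(1) t B(2) y z f] by blast
  qed (use Y Z B w t in auto)
  with t show ?thesis by blast
qed

definition clo :: "('v, 'o, 'a) space \<Rightarrow> 'v \<Rightarrow> 'v \<Rightarrow> 'a" where
  "clo S = dneg (fst S) (fixed_cat S) (fixed_incl S)"

lemma clo_dist: "closure_space U Q S \<Longrightarrow> clo S \<in> dists Q (fixed_cat S) (fst S)"
  unfolding clo_def using closure_facts by auto

lemma clo_Arrows: "closure_space U Q S \<Longrightarrow> (fixed_cat S, fst S, clo S) \<in> Arrows (QDist U Q)"
  using closure_facts(1,6) clo_dist by (auto simp: Arrows_def)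

text \<open>Residuals against evaluation are negated composites with \<open>clo\<close>, so
  equations between such composites can be proved as equations between residuals, where closedness
  is usable.\<close>

lemma dl_clo: "dl (fst S) Y (fixed_cat S) (fixed_incl S) \<zeta> = dneg (fixed_cat S) Y
  (dist_comp Q (fixed_cat S) (fst S) Y \<zeta> (clo S))"
  unfolding dl_def clo_def ..

lemma dr_clo: "dr (fst S) Y (fixed_cat S) t (fixed_incl S) = dneg Y (fst S)
  (dist_comp Q Y (fixed_cat S) (fst S) (clo S) t)"
  unfolding dr_def clo_def ..

lemma le_dl_clo:
  assumes S: "closure_space U Q S" and Y: "qcat Q Y" and d: "\<zeta> \<in> dists Q (fst S) Y"
    and p: "y \<in> pts Y" "k \<in> pts (fixed_cat S)" "f \<in> arr Q (ty Y y) (ty (fixed_cat S) k)"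
  shows "leQ (ty Y y) (ty (fixed_cat S) k) f (dl (fst S) Y (fixed_cat S) (fixed_incl S) \<zeta> y k) \<longleftrightarrow>
    (\<forall>x\<in>pts (fst S). leQ (ty (fst S) x) (fst (dec (fst S) k))
      (Cmp Q (ty (fst S) x) (ty Y y) (fst (dec (fst S) k)) f (\<zeta> x y)) (snd (dec (fst S) k) x ()))"
  using le_dl[OF closure_facts(2)[OF S] Y closure_facts(7)[OF S] d closure_facts(8)[OF S] p]
    fixed_simps(3,4)[OF S] p
  by simp

text \<open>The residual \<open>w = u \<swarrow> \<zeta>\<close>, with \<open>u\<close> the
  evaluation of \<open>S\<close>, has as column at a closed \<open>k\<close> the largest presheaf on
  \<open>fst T\<close> whose pullback lies below \<open>k\<close>. Continuity says that these
  columns are closed in \<open>T\<close>, and by \<open>residual_incl\<close> that is a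
  factorization through \<open>clo T\<close> after negation. The factorization through
  \<open>clo S\<close> is given by \<open>\<zeta>\<close> itself.\<close>

lemma closure_continuous_iff:
  assumes S: "closure_space U Q S" and T: "closure_space U Q T" and d: "\<zeta> \<in> dists Q (fst S) (fst T)"
  shows "\<zeta> \<in> continuous_dists Q S T \<longleftrightarrow>
    dist_comp Q (fixed_cat S) (fst S) (fst T) \<zeta> (clo S) \<in>
      diagonals (QDist U Q) (fixed_cat S, fst S, clo S) (fixed_cat T, fst T, clo T)"
proof -
  let ?X = "fst S" and ?Y = "fst T" and ?A = "fixed_cat S" and ?B = "fixed_cat T"
    and ?u = "fixed_incl S" and ?v = "fixed_incl T" and ?c = "snd S" and ?d = "snd T"
  let ?w = "dl ?X ?Y ?A ?u \<zeta>"
  note X = closure_facts(2)[OF S] closure_facts(2)[OF T]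
  note c = closure_facts(3)[OF S] and e = closure_facts(3)[OF T]
  note A = closure_facts(7,8)[OF S] closure_facts(7,8)[OF T]
  note fS = fixed_simps[OF S] and fT = fixed_simps[OF T]
  have w: "?w \<in> dists Q ?Y ?A" using X A d by auto
  note le_w = le_dl_clo[OF S X(2) d]
  have cont: "\<zeta> \<in> continuous_dists Q S T \<longleftrightarrow> (\<forall>l\<in>presheaves Q ?Y. \<forall>x\<in>pts ?X.
     leQ (ty ?X x) (fst l) (snd (pull Q ?X ?Y \<zeta> (?d l)) x ()) (snd (?c (pull Q ?X ?Y \<zeta> l)) x ()))"
    using continuous_iff[OF X c e] d by simp
  have diag: "dist_comp Q ?A ?X ?Y \<zeta> (clo S) \<in> diagonals (QDist U Q) (?A, ?X, clo S) (?B, ?Y, clo T) \<longleftrightarrow>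
      (\<exists>t\<in>dists Q ?A ?B. dr ?Y ?A ?B t ?v = ?w)"
  proof -
    have "dist_comp Q ?A ?X ?Y \<zeta> (clo S) = dist_comp Q ?A ?B ?Y (clo T) t \<longleftrightarrow> dr ?Y ?A ?B t ?v = ?w"
      if t: "t \<in> dists Q ?A ?B" for t
      unfolding dl_clo dr_clo
      using dneg_dneg[of ?A ?Y "dist_comp Q ?A ?X ?Y \<zeta> (clo S)"]
        dneg_dneg[of ?A ?Y "dist_comp Q ?A ?B ?Y (clo T) t"]
        X A d t clo_dist[OF S] clo_dist[OF T] by fastforce
    then show ?thesis
      unfolding QD.diagonals_iff using X A d clo_dist[OF S] by auto
  qed
  have col: "column ?Y ?A ?w k \<in> presheaves Q ?Y" "fst (column ?Y ?A ?w k) = fst (dec ?X k)"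
    if "k \<in> pts ?A" for k
    using X A w that fS by auto
  have "\<exists>t\<in>dists Q ?A ?B. dr ?Y ?A ?B t ?v = ?w" if cz: "\<zeta> \<in> continuous_dists Q S T"
  proof (rule residual_incl[OF T A(1) w])
    fix k assume k: "k \<in> pts ?A"
    let ?m = "column ?Y ?A ?w k" and ?q = "fst (dec ?X k)"
    note m = col[OF k]
    have dk: "dec ?X k \<in> presheaves Q ?X" "?c (dec ?X k) = dec ?X k" using fS k by auto
    have p: "pull Q ?X ?Y \<zeta> ?m \<in> presheaves Q ?X" using X d m by auto
    have parr: "snd (pull Q ?X ?Y \<zeta> ?m) x () \<in> arr Q (ty ?X x) ?q" if "x \<in> pts ?X" for x
      using presheaf_in[OF p that] m by simp
    \<comment> \<open>The pullback of \<open>?m\<close> lies below the closed presheaf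
      \<open>dec ?X k\<close>; so does its closure, and by continuity also the pullback of
      \<open>?d ?m\<close>. Since \<open>?m\<close> is largest with that property,
      \<open>?d ?m \<le> ?m\<close>.\<close>
    have 1: "leQ (ty ?X x) ?q (snd (pull Q ?X ?Y \<zeta> ?m) x ()) (snd (dec ?X k) x ())" if x: "x \<in> pts ?X" for x
      using pull_le_iff[OF X d m(1) x, of "snd (dec ?X k) x ()"] dl_Cmp_le[OF X A(1) d A(2) x _ k] m dk x k fS
        by simp
    have 2: "leQ (ty ?X x) ?q (snd (?c (pull Q ?X ?Y \<zeta> ?m)) x ()) (snd (dec ?X k) x ())" if x: "x \<in> pts ?X"
      for x
      using endo_mono[OF X(1) c p dk(1) _ _ x] 1 m dk by simp
    have 3: "leQ (ty ?X x) ?q (snd (pull Q ?X ?Y \<zeta> (?d ?m)) x ()) (snd (?c (pull Q ?X ?Y \<zeta> ?m)) x ())"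
      if x: "x \<in> pts ?X" for x
      using cz m x unfolding cont by auto
    have dm: "?d ?m \<in> presheaves Q ?Y" "fst (?d ?m) = ?q" using e m by auto
    have "leQ (ty ?Y y) ?q (snd (?d ?m) y ()) (?w y k)" if y: "y \<in> pts ?Y" for y
    proof -
      have ar: "snd (?d ?m) y () \<in> arr Q (ty ?Y y) ?q" using presheaf_in[OF dm(1) y] dm(2) by simp
      have "leQ (ty ?X x) ?q (Cmp Q (ty ?X x) (ty ?Y y) ?q (snd (?d ?m) y ()) (\<zeta> x y)) (snd (dec ?X k) x ())"
        if x: "x \<in> pts ?X" for x
      proof -
        have p2: "snd (pull Q ?X ?Y \<zeta> (?d ?m)) x () \<in> arr Q (ty ?X x) ?q"
          using presheaf_in[OF pull_presheaf[OF X d dm(1)] x] dm by simp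
        have p3: "snd (?c (pull Q ?X ?Y \<zeta> ?m)) x () \<in> arr Q (ty ?X x) ?q"
          using endo_in_arr[OF c p x] m by simp
        have 4: "leQ (ty ?X x) ?q (snd (pull Q ?X ?Y \<zeta> (?d ?m)) x ()) (snd (dec ?X k) x ())"
          using le_trans[OF _ _ p2 p3 _ 3[OF x] 2[OF x]] X x dk by auto
        show ?thesis
          using le_trans[OF _ _ _ p2 _ le_pull[OF X d dm(1) x y, unfolded dm(2)] 4] X x y dk ar d by auto
      qed
      then show ?thesis using le_w[OF y k, of "snd (?d ?m) y ()"] ar fS k by simp
    qed
    then have "?d ?m = ?m"
      using X A w m dm e k fS closure_facts(4)[OF T m(1)] presheaf_in[OF dm(1)] presheaf_in[OF m(1)]
      by (intro presheaf_eqI[of _ ?Y]) (auto intro!: le_antisym[of "ty ?Y _" ?q])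
    then show "?m \<in> fixed T" using m by (simp add: fixed_def)
  qed
  moreover have "\<zeta> \<in> continuous_dists Q S T" if t: "t \<in> dists Q ?A ?B" "dr ?Y ?A ?B t ?v = ?w" for t
    unfolding cont
  proof (intro ballI)
    fix l x assume l: "l \<in> presheaves Q ?Y" and x: "x \<in> pts ?X"
    let ?p = "pull Q ?X ?Y \<zeta> l"
    have p: "?p \<in> presheaves Q ?X" "fst ?p = fst l" using X d l by auto
    have cp: "?c ?p \<in> presheaves Q ?X" "fst (?c ?p) = fst l" "?c ?p \<in> fixed S"
      using p c closure_facts(9)[OF S] by auto
    \<comment> \<open>The closed presheaf to test with is the closure of the pullback of
      \<open>l\<close>: its column \<open>?m\<close> lies above \<open>l\<close> and is closed in
      \<open>T\<close>, so it lies above \<open>?d l\<close> too.\<close>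
    let ?k = "enc ?X (?c ?p)"
    have k: "?k \<in> pts ?A" "ty ?A ?k = fst l" "dec ?X ?k = ?c ?p" using fS cp by auto
    let ?m = "column ?Y ?A ?w ?k"
    have m: "?m \<in> presheaves Q ?Y" "fst ?m = fst l" using col[OF k(1)] k cp by auto
    have le_wk: "leQ (ty ?Y y) (fst l) f (?w y ?k) \<longleftrightarrow>
        (\<forall>x\<in>pts ?X. leQ (ty ?X x) (fst l) (Cmp Q (ty ?X x) (ty ?Y y) (fst l) f (\<zeta> x y)) (snd (?c ?p) x ()))"
      if "y \<in> pts ?Y" "f \<in> arr Q (ty ?Y y) (fst l)" for y f
      using le_w[OF that(1) k(1), of f] that k cp by simp
    have cparr: "snd (?c ?p) x () \<in> arr Q (ty ?X x) (fst l)" if "x \<in> pts ?X" for x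
      using presheaf_in[OF cp(1) that] cp by simp
    have parr: "snd ?p x () \<in> arr Q (ty ?X x) (fst l)" if "x \<in> pts ?X" for x
      using presheaf_in[OF p(1) that] p by simp
    have "leQ (ty ?Y y) (fst l) (snd l y ()) (?w y ?k)" if y: "y \<in> pts ?Y" for y
      unfolding le_wk[OF y presheaf_in[OF l y]]
    proof
      fix x assume x: "x \<in> pts ?X"
      show "leQ (ty ?X x) (fst l) (Cmp Q (ty ?X x) (ty ?Y y) (fst l) (snd l y ()) (\<zeta> x y)) (snd (?c ?p) x ())"
        using le_trans[OF _ _ _ parr[OF x] cparr[OF x] le_pull[OF X d l x y]
          closure_facts(4)[OF S p(1) x, unfolded p(2)]]
          X x y d l by auto
    qed
    then have 1: "leQ (ty ?Y y) (fst l) (snd (?d l) y ()) (snd (?d ?m) y ())" if y: "y \<in> pts ?Y" for y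
      using endo_mono[OF X(2) e l m(1) _ _ y] m by simp
    \<comment> \<open>\<open>?m\<close> is a meet of residuals into closed presheaves
      \<open>j\<close>; closing each inequality into \<open>j\<close> by \<open>endo_tensor\<close>
      shows \<open>?d ?m \<le> ?m\<close>.\<close>
    have 2: "leQ (ty ?Y y) (fst l) (snd (?d ?m) y ()) (?w y ?k)" if y: "y \<in> pts ?Y" for y
    proof -
      have ar: "snd (?d ?m) y () \<in> arr Q (ty ?Y y) (fst l)" using endo_in_arr[OF e m(1) y] m by simp
      have "leQ (ty ?Y y) (ty ?B j) (Cmp Q (ty ?Y y) (fst l) (ty ?B j) (t ?k j) (snd (?d ?m) y ())) (?v y j)"
        if j: "j \<in> pts ?B" for j
      proof -
        have tj: "t ?k j \<in> arr Q (fst l) (fst (dec ?Y j))" using dist_in[OF t(1) k(1) j] k fT j by simp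
        have "leQ (ty ?Y y) (fst (dec ?Y j)) (Cmp Q (ty ?Y y) (fst l) (fst (dec ?Y j)) (t ?k j) (?w y ?k))
          (snd (dec ?Y j) y ())"
          if "y \<in> pts ?Y" for y
          using dr_Cmp_le[OF X(2) A(1,3) t(1) A(4) that k(1) j] fT j that k by (simp add: t(2))
        then show ?thesis
          using endo_tensor[OF X(2) e m(1) fT(1)[OF j], of "t ?k j" y] fT j y tj m by simp
      qed
      then have "leQ (ty ?Y y) (ty ?A ?k) (snd (?d ?m) y ()) (dr ?Y ?A ?B t ?v y ?k)"
        using le_dr[OF X(2) A(1,3) t(1) A(4) y k(1), of "snd (?d ?m) y ()"] ar k by simp
      then show ?thesis by (simp add: k t(2))
    qed
    have "leQ (ty ?X x) (fst l) (Cmp Q (ty ?X x) (ty ?Y y) (fst l) (snd (?d l) y ()) (\<zeta> x y))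
      (snd (?c ?p) x ())"
      if y: "y \<in> pts ?Y" for y
    proof -
      have ar: "snd (?d l) y () \<in> arr Q (ty ?Y y) (fst l)" "snd (?d ?m) y () \<in> arr Q (ty ?Y y) (fst l)"
        "?w y ?k \<in> arr Q (ty ?Y y) (fst l)"
        using endo_in_arr[OF e l y] endo_in_arr[OF e m(1) y] m dist_in[OF w y k(1)] k by auto
      have "leQ (ty ?Y y) (fst l) (snd (?d l) y ()) (?w y ?k)"
        using le_trans[OF _ _ ar 1[OF y] 2[OF y]] X y l by auto
      then show ?thesis using le_wk[OF y ar(1)] x by blast
    qed
    then show "leQ (ty ?X x) (fst l) (snd (pull Q ?X ?Y \<zeta> (?d l)) x ()) (snd (?c ?p) x ())"
      using pull_le_iff[OF X d endo_in[OF e l] x, of "snd (?c ?p) x ()"] cparr[OF x] e l by simp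
  qed
  ultimately show ?thesis using diag by blast
qed

section \<open>The closure of a distributor\<close>

lemma cl_app: "\<lbrakk>x \<in> pts (fst S); y \<in> pts (fst T)\<rbrakk> \<Longrightarrow> cl S T \<zeta> x y = snd (snd S (column (fst S) (fst T) \<zeta> y)) x
  ()"
  unfolding cl_def by (auto split: prod.splits)

context
  fixes S T \<zeta>
  assumes S: "closure_space U Q S" and T: "closure_space U Q T" and d: "\<zeta> \<in> dists Q (fst S) (fst T)"
begin

lemma cl_dist: "cl S T \<zeta> \<in> dists Q (fst S) (fst T)"
proof (rule distsI)
  let ?X = "fst S" and ?Y = "fst T" and ?c = "snd S"
  note X = closure_facts(2)[OF S] closure_facts(2)[OF T] and c = closure_facts(3)[OF S]
  show "qcat Q ?X" "qcat Q ?Y" using X .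
  have col: "column ?X ?Y \<zeta> y \<in> presheaves Q ?X" if "y \<in> pts ?Y" for y using X d that by auto
  have ar: "cl S T \<zeta> x y \<in> arr Q (ty ?X x) (ty ?Y y)" if "x \<in> pts ?X" "y \<in> pts ?Y" for x y
    using endo_in_arr[OF c col[OF that(2)] that(1)] that by (simp add: cl_app)
  then show "cl S T \<zeta> \<in> (\<Pi>\<^sub>E x\<in>pts ?X. \<Pi>\<^sub>E y\<in>pts ?Y. arr Q (ty ?X x) (ty ?Y y))"
    unfolding cl_def by (auto split: prod.splits)
  show "leQ (ty ?X x) (ty ?Y y') (Cmp Q (ty ?X x) (ty ?Y y) (ty ?Y y') (hm ?Y y y') (cl S T \<zeta> x y))
    (cl S T \<zeta> x y')"
    if "x \<in> pts ?X" "y \<in> pts ?Y" "y' \<in> pts ?Y" for x y y'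
    using endo_tensor[OF X(1) c col[OF that(2)] col[OF that(3)], of "hm ?Y y y'" x]
      dist_left[OF X d _ that(2,3)] that X
    by (simp add: cl_app)
  show "leQ (ty ?X x') (ty ?Y y) (Cmp Q (ty ?X x') (ty ?X x) (ty ?Y y) (cl S T \<zeta> x y) (hm ?X x' x))
    (cl S T \<zeta> x' y)"
    if "x \<in> pts ?X" "x' \<in> pts ?X" "y \<in> pts ?Y" for x x' y
    using presheaf_right[OF X(1) endo_in[OF c col[OF that(3)]] that(1,2)] that c col[OF that(3)]
      by (simp add: cl_app)
qed

lemma column_cl: "y \<in> pts (fst T) \<Longrightarrow> column (fst S) (fst T) (cl S T \<zeta>) y = snd S (column (fst S) (fst T) \<zeta> y)"
  using closure_facts(2,3)[OF S] closure_facts(2)[OF T] d cl_dist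
  by (intro presheaf_eqI[of _ "fst S"]) (auto simp: cl_app)

lemma cl_cl: "cl S T (cl S T \<zeta>) = cl S T \<zeta>"
proof -
  have "snd S (column (fst S) (fst T) (cl S T \<zeta>) y) = snd S (column (fst S) (fst T) \<zeta> y)" if "y \<in> pts (fst T)"
    for y
    unfolding column_cl[OF that] using closure_facts(2,5)[OF S] closure_facts(2)[OF T] d that by auto
  then show ?thesis
    unfolding cl_def[of] by (auto split: prod.splits intro!: restrict_ext)
qed

text \<open>By \<open>closed_absorb\<close>, residuals into closed presheaves do not change when
  \<open>\<zeta>\<close> is replaced by its closure, so both represent the same diagonal.\<close>

lemma cl_clo: "dist_comp Q (fixed_cat S) (fst S) (fst T) (cl S T \<zeta>) (clo S) = dist_comp Q (fixed_cat S)
  (fst S) (fst T) \<zeta> (clo S)"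
proof -
  let ?X = "fst S" and ?Y = "fst T" and ?A = "fixed_cat S" and ?u = "fixed_incl S"
  note X = closure_facts(2)[OF S] closure_facts(2)[OF T] and c = closure_facts(3)[OF S]
  note A = closure_facts(7,8)[OF S] and fS = fixed_simps[OF S]
  have "dl ?X ?Y ?A ?u (cl S T \<zeta>) = dl ?X ?Y ?A ?u \<zeta>"
  proof (rule dists_eq_le_iffI[OF X(2) A(1)])
    fix y k f assume y: "y \<in> pts ?Y" and k: "k \<in> pts ?A" and f: "f \<in> arr Q (ty ?Y y) (ty ?A k)"
    have col: "column ?X ?Y \<zeta> y \<in> presheaves Q ?X" using X d y by auto
    show "leQ (ty ?Y y) (ty ?A k) f (dl ?X ?Y ?A ?u (cl S T \<zeta>) y k) \<longleftrightarrow> leQ (ty ?Y y) (ty ?A k) f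
      (dl ?X ?Y ?A ?u \<zeta> y k)"
      unfolding le_dl_clo[OF S X(2) d y k f] le_dl_clo[OF S X(2) cl_dist y k f]
      using closed_absorb[OF X(1) c closure_facts(4)[OF S col] col fS(1,2)[OF k], of f] f fS(3)[OF k] y
      by (simp add: cl_app)
  qed (use X A d cl_dist in auto)
  then show ?thesis
    unfolding dl_clo
    using dneg_dneg[of ?A ?Y "dist_comp Q ?A ?X ?Y \<zeta> (clo S)"]
      dneg_dneg[of ?A ?Y "dist_comp Q ?A ?X ?Y (cl S T \<zeta>) (clo S)"]
      X A d cl_dist clo_dist[OF S] by simp
qed

end

text \<open>For order reflection, the column of the closed \<open>\<zeta>'\<close> at
  \<open>y\<close> is a closed point \<open>?k\<close>. The residual of \<open>\<zeta>'\<close> at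
  \<open>(y, ?k)\<close> lies above the identity, hence so does that of \<open>\<zeta>\<close>, and
  this says that the column of \<open>\<zeta>\<close> lies below that of
  \<open>\<zeta>'\<close>.\<close>

lemma clo_le_iff:
  assumes S: "closure_space U Q S" and T: "closure_space U Q T"
    and d: "\<zeta> \<in> dists Q (fst S) (fst T)" "\<zeta>' \<in> dists Q (fst S) (fst T)" and closed: "cl S T \<zeta>' = \<zeta>'"
  shows "dist_le Q (fst S) (fst T) \<zeta> \<zeta>' \<longleftrightarrow> dist_le Q (fixed_cat S) (fst T)
    (dist_comp Q (fixed_cat S) (fst S) (fst T) \<zeta> (clo S))
      (dist_comp Q (fixed_cat S) (fst S) (fst T) \<zeta>' (clo S))"
proof
  let ?X = "fst S" and ?Y = "fst T" and ?A = "fixed_cat S" and ?u = "fixed_incl S"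
  note X = closure_facts(2)[OF S] closure_facts(2)[OF T] and c = closure_facts(3)[OF S]
  note A = closure_facts(7,8)[OF S] and fS = fixed_simps[OF S]
  have o: "?A \<in> Obj (QDist U Q)" "?X \<in> Obj (QDist U Q)" "?Y \<in> Obj (QDist U Q)"
    using closure_facts(1,6)[OF S] closure_facts(1)[OF T] by auto
  show "dist_le Q ?A ?Y (dist_comp Q ?A ?X ?Y \<zeta> (clo S)) (dist_comp Q ?A ?X ?Y \<zeta>' (clo S))"
    if "dist_le Q ?X ?Y \<zeta> \<zeta>'"
    using QD.Cmp_mono_left[OF o, of "clo S" \<zeta> \<zeta>'] clo_dist[OF S] d that by simp
  assume "dist_le Q ?A ?Y (dist_comp Q ?A ?X ?Y \<zeta> (clo S)) (dist_comp Q ?A ?X ?Y \<zeta>' (clo S))"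
  then have le: "dist_le Q ?Y ?A (dl ?X ?Y ?A ?u \<zeta>') (dl ?X ?Y ?A ?u \<zeta>)"
    unfolding dl_clo using QD.neg_le_iff[OF o(1,3)] X A d clo_dist[OF S] by simp
  show "dist_le Q ?X ?Y \<zeta> \<zeta>'"
    unfolding dist_le_def
  proof (intro ballI)
    fix x y assume x: "x \<in> pts ?X" and y: "y \<in> pts ?Y"
    let ?m = "column ?X ?Y \<zeta>' y" and ?q = "ty ?Y y"
    have m: "?m \<in> presheaves Q ?X" using X d y by auto
    have "?m = snd S ?m" using column_cl[OF S T d(2) y] closed by simp
    then have mf: "?m \<in> fixed S" using m by (simp add: fixed_def)
    let ?k = "enc ?X ?m"
    have k: "?k \<in> pts ?A" "ty ?A ?k = ?q" "dec ?X ?k = ?m" using fS mf by auto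
    have ar: "dl ?X ?Y ?A ?u \<zeta> y ?k \<in> arr Q ?q ?q" "dl ?X ?Y ?A ?u \<zeta>' y ?k \<in> arr Q ?q ?q"
      using dist_in[OF dl_dist[OF X A(1) d(1) A(2)] y k(1)] dist_in[OF dl_dist[OF X A(1) d(2) A(2)] y k(1)] k
        by auto
    have "leQ ?q ?q (Idn Q ?q) (dl ?X ?Y ?A ?u \<zeta>' y ?k)"
      using le_dl_clo[OF S X(2) d(2) y k(1), of "Idn Q ?q"] X y d by (simp add: k)
    moreover have "leQ ?q ?q (dl ?X ?Y ?A ?u \<zeta>' y ?k) (dl ?X ?Y ?A ?u \<zeta> y ?k)"
      using le y k unfolding dist_le_def by fastforce
    ultimately have "leQ ?q ?q (Idn Q ?q) (dl ?X ?Y ?A ?u \<zeta> y ?k)"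
      using le_trans[of ?q ?q "Idn Q ?q" "dl ?X ?Y ?A ?u \<zeta>' y ?k"] ar X y by auto
    then show "leQ (ty ?X x) ?q (\<zeta> x y) (\<zeta>' x y)"
      using le_dl_clo[OF S X(2) d(1) y k(1), of "Idn Q ?q"] X y d x by (simp add: k)
  qed
qed

text \<open>The closure operator is \<open>m \<mapsto> (\<phi> \<swarrow> m) \<searrow> \<phi>\<close> for \<open>\<phi> = \<not>u\<close>, from the Isbell adjunction of \<open>\<phi>\<close>.\<close>

lemma closure_eso:
  assumes XY: "small_qcat U Q X" "small_qcat U Q Y" and u: "u \<in> dists Q Y X"
  shows "\<exists>S w. closure_space U Q S \<and>
    is_iso (diagonal_quantaloid (QDist U Q)) (fixed_cat S, fst S, clo S) (Y, X, u) w"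
proof -
  have X: "qcat Q X" "qcat Q Y" using XY by (auto simp: small_qcat_def)
  define \<phi> where "\<phi> = dneg Y X u"
  have \<phi>: "\<phi> \<in> dists Q X Y" "dneg X Y \<phi> = u" using X u unfolding \<phi>_def by auto
  define s where "s m y = dl X (singleton_qcat Q (fst m)) Y \<phi> (snd m) () y" for m y
  define c where "c = (\<lambda>m\<in>presheaves Q X. (fst m, dr X (singleton_qcat Q (fst m)) Y
    (dl X (singleton_qcat Q (fst m)) Y \<phi> (snd m)) \<phi>))"
  have dlm: "dl X (singleton_qcat Q (fst m)) Y \<phi> (snd m) \<in> dists Q (singleton_qcat Q (fst m)) Y"
    if "m \<in> presheaves Q X" for m
    using X \<phi> presheaf_dist[OF that] presheaf_ty[OF that] by auto
  have sin: "s m y \<in> arr Q (fst m) (ty Y y)" if "m \<in> presheaves Q X" "y \<in> pts Y" for m y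
    using dist_in[OF dlm[OF that(1)], of "()" y] that unfolding s_def by simp
  have le_s: "leQ (fst m) (ty Y y) g (s m y) \<longleftrightarrow>
      (\<forall>x\<in>pts X. leQ (ty X x) (ty Y y) (Cmp Q (ty X x) (fst m) (ty Y y) g (snd m x ())) (\<phi> x y))"
    if "m \<in> presheaves Q X" "y \<in> pts Y" "g \<in> arr Q (fst m) (ty Y y)" for m y g
    using le_dl[OF X(1) qcat_singleton[OF presheaf_ty[OF that(1)]] X(2) presheaf_dist[OF that(1)] \<phi>(1) _
      that(2), of "()" g] that
    unfolding s_def by simp
  have cin: "c m \<in> presheaves Q X" "fst (c m) = fst m" if "m \<in> presheaves Q X" for m
    using X \<phi> that dlm[OF that] presheaf_ty[OF that] unfolding c_def by (auto simp: presheaf_iff)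
  have carr: "snd (c m) x () \<in> arr Q (ty X x) (fst m)" if "m \<in> presheaves Q X" "x \<in> pts X" for m x
    using presheaf_in[OF cin(1)[OF that(1)] that(2)] cin(2)[OF that(1)] by simp
  have le_c: "leQ (ty X x) (fst m) f (snd (c m) x ()) \<longleftrightarrow>
      (\<forall>y\<in>pts Y. leQ (ty X x) (ty Y y) (Cmp Q (ty X x) (fst m) (ty Y y) (s m y) f) (\<phi> x y))"
    if "m \<in> presheaves Q X" "x \<in> pts X" "f \<in> arr Q (ty X x) (fst m)" for m x f
    using le_dr[OF X(1) qcat_singleton[OF presheaf_ty[OF that(1)]] X(2) dlm[OF that(1)] \<phi>(1) that(2), of "()"
      f] that
    unfolding s_def c_def by simp
  have sm: "leQ (ty X x) (ty Y y) (Cmp Q (ty X x) (fst m) (ty Y y) (s m y) (snd m x ())) (\<phi> x y)"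
    if "m \<in> presheaves Q X" "x \<in> pts X" "y \<in> pts Y" for m x y
    using le_s[OF that(1,3) sin[OF that(1,3)]] sin[OF that(1,3)] that X by auto
  have scm: "leQ (ty X x) (ty Y y) (Cmp Q (ty X x) (fst m) (ty Y y) (s m y) (snd (c m) x ())) (\<phi> x y)"
    if "m \<in> presheaves Q X" "x \<in> pts X" "y \<in> pts Y" for m x y
    using le_c[OF that(1,2) carr[OF that(1,2)]] carr[OF that(1,2)] that X by auto
  have c1: "leQ (ty X x) (fst m) (snd m x ()) (snd (c m) x ())" if "m \<in> presheaves Q X" "x \<in> pts X" for m x
    using that sm by (simp add: le_c)
  have c2: "c (c m) = c m" if m: "m \<in> presheaves Q X" for m
  proof (rule presheaf_eqI[of _ X])
    fix x assume x: "x \<in> pts X"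
    \<comment> \<open>The Galois argument: \<open>s m\<close> satisfies its defining inequality for
      \<open>c m\<close> as well, so \<open>s m \<le> s (c m)\<close>, and therefore
      \<open>c (c m) \<le> c m\<close>.\<close>
    have ss: "leQ (fst m) (ty Y y) (s m y) (s (c m) y)" if "y \<in> pts Y" for y
      using le_s[OF cin(1)[OF m] that, of "s m y"] scm[OF m _ that] sin[OF m that] cin[OF m] by simp
    have "leQ (ty X x) (ty Y y) (Cmp Q (ty X x) (fst m) (ty Y y) (s m y) (snd (c (c m)) x ())) (\<phi> x y)"
      if y: "y \<in> pts Y" for y
    proof -
      have "leQ (ty X x) (ty Y y) (Cmp Q (ty X x) (fst m) (ty Y y) (s m y) (snd (c (c m)) x ()))
        (Cmp Q (ty X x) (fst m) (ty Y y) (s (c m) y) (snd (c (c m)) x ()))"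
        using X x y m ss sin[OF m y] sin[OF cin(1)[OF m] y] cin[OF m] carr[OF cin(1)[OF m] x]
        by (intro Cmp_mono_left) auto
      from le_trans[OF _ _ _ _ _ this] scm[OF cin(1)[OF m] x y] show ?thesis
        using X \<phi> x y m sin[OF m y] sin[OF cin(1)[OF m] y] cin[OF m] carr[OF cin(1)[OF m] x] by simp
    qed
    then have "leQ (ty X x) (fst m) (snd (c (c m)) x ()) (snd (c m) x ())"
      using le_c[OF m x, of "snd (c (c m)) x ()"] carr[OF cin(1)[OF m] x] cin[OF m] by simp
    then show "snd (c (c m)) x () = snd (c m) x ()"
      using c1[OF cin(1)[OF m] x] carr[OF cin(1)[OF m] x] carr[OF m x] cin[OF m] X x m
      by (intro le_antisym[of "ty X x" "fst m"]) auto
  qed (use m cin in auto)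
  have cfun: "c \<in> qfunctors Q (P Q X) (P Q X)"
  proof (rule endoI[OF X(1)])
    fix m m' f x
    assume m: "m \<in> presheaves Q X" "m' \<in> presheaves Q X" and f: "f \<in> arr Q (fst m) (fst m')"
      and le: "\<And>x. x \<in> pts X \<Longrightarrow> leQ (ty X x) (fst m') (Cmp Q (ty X x) (fst m) (fst m') f (snd m x ()))
        (snd m' x ())"
      and x: "x \<in> pts X"
    have 1: "leQ (fst m) (ty Y y) (Cmp Q (fst m) (fst m') (ty Y y) (s m' y) f) (s m y)" if y: "y \<in> pts Y"
      for y
    proof -
      have "leQ (ty X z) (ty Y y) (Cmp Q (ty X z) (fst m') (ty Y y) (s m' y)
        (Cmp Q (ty X z) (fst m) (fst m') f (snd m z ()))) (\<phi> z y)"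
        if z: "z \<in> pts X" for z
      proof -
        have "leQ (ty X z) (ty Y y) (Cmp Q (ty X z) (fst m') (ty Y y) (s m' y)
          (Cmp Q (ty X z) (fst m) (fst m') f (snd m z ())))
          (Cmp Q (ty X z) (fst m') (ty Y y) (s m' y) (snd m' z ()))"
          using X m f y z sin[OF m(2) y] le[OF z] by (intro Cmp_mono_right) auto
        from le_trans[OF _ _ _ _ _ this sm[OF m(2) z y]] show ?thesis
          using X \<phi> m f y z sin[OF m(2) y] by simp
      qed
      then show ?thesis using X m f y sin[OF m(2) y] by (subst le_s) (auto simp: Cmp_assoc)
    qed
    have "leQ (ty X x) (ty Y y) (Cmp Q (ty X x) (fst m') (ty Y y) (s m' y)
      (Cmp Q (ty X x) (fst m) (fst m') f (snd (c m) x ()))) (\<phi> x y)"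
      if y: "y \<in> pts Y" for y
    proof -
      have "leQ (ty X x) (ty Y y) (Cmp Q (ty X x) (fst m) (ty Y y)
        (Cmp Q (fst m) (fst m') (ty Y y) (s m' y) f) (snd (c m) x ()))
        (Cmp Q (ty X x) (fst m) (ty Y y) (s m y) (snd (c m) x ()))"
        using X m f y x sin[OF m(1) y] sin[OF m(2) y] carr[OF m(1) x] 1[OF y] by (intro Cmp_mono_left) auto
      from le_trans[OF _ _ _ _ _ this scm[OF m(1) x y]] show ?thesis
        using X \<phi> m f y x sin[OF m(1) y] sin[OF m(2) y] carr[OF m(1) x] by (simp add: Cmp_assoc)
    qed
    then show "leQ (ty X x) (fst m') (Cmp Q (ty X x) (fst m) (fst m') f (snd (c m) x ())) (snd (c m') x ())"
      using X m f x carr[OF m(1) x] by (subst le_c) auto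
  qed (use cin in \<open>auto simp: c_def\<close>)
  let ?S = "(X, c)"
  have S: "closure_space U Q ?S"
    unfolding closure_iff using XY cfun c1 c2 by blast
  let ?A = "fixed_cat ?S" and ?i = "fixed_incl ?S"
  note A = closure_facts(7,8)[OF S, simplified] and sA = closure_facts(6)[OF S]
    and fS = fixed_simps[OF S, simplified]
  \<comment> \<open>Columns of \<open>\<phi>\<close> are closed: \<open>s\<close> of the column at
    \<open>y\<close> lies above the identity at \<open>y\<close>, which bounds the closure by the
    column.\<close>
  have "column X Y \<phi> y \<in> fixed ?S" if y: "y \<in> pts Y" for y
  proof -
    let ?m = "column X Y \<phi> y"
    have m: "?m \<in> presheaves Q X" "fst ?m = ty Y y" using X \<phi> y by auto
    have 1: "leQ (ty Y y) (ty Y y) (Idn Q (ty Y y)) (s ?m y)"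
      using X \<phi> y m by (subst le_s[OF m(1) y, unfolded m(2)]) auto
    have "leQ (ty X x) (ty Y y) (snd (c ?m) x ()) (\<phi> x y)" if x: "x \<in> pts X" for x
    proof -
      have "leQ (ty X x) (ty Y y) (snd (c ?m) x ())
        (Cmp Q (ty X x) (ty Y y) (ty Y y) (s ?m y) (snd (c ?m) x ()))"
        using X \<phi> x y 1 sin[OF m(1) y] carr[OF m(1) x] by (intro le_Cmp_Idn) auto
      from le_trans[OF _ _ _ _ _ this] scm[OF m(1) x y] show ?thesis
        using X \<phi> x y m sin[OF m(1) y] carr[OF m(1) x] by simp
    qed
    then have "c ?m = ?m"
      using X \<phi> y m cin[OF m(1)] c1[OF m(1)] carr[OF m(1)]
      by (intro presheaf_eqI[of _ X]) (auto intro!: le_antisym[of "ty X _" "ty Y y"])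
    then show ?thesis using m by (simp add: fixed_def)
  qed
  then obtain t where t: "t \<in> dists Q Y ?A" "dr X Y ?A t ?i = \<phi>"
    using residual_incl[OF S X(2)] \<phi> by auto
  then have "dist_comp Q Y ?A X (clo ?S) t = u"
    using dr_clo[of ?S Y t] \<phi>(2) X A clo_dist[OF S] dneg_dneg[of Y X "dist_comp Q Y ?A X (clo ?S) t"] by simp
  note 1 = this[symmetric]
  \<comment> \<open>Conversely a closed \<open>m\<close> equals
    \<open>(\<phi> \<swarrow> m) \<searrow> \<phi>\<close>. \<open>?s\<close> gathers
    \<open>\<phi> \<swarrow> m\<close> over all closed \<open>m\<close>, and negation turns this
    into a factorization of \<open>clo ?S\<close> through \<open>u\<close>.\<close>
  let ?s = "dl X ?A Y \<phi> ?i"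
  have s: "?s \<in> dists Q ?A Y" using X A \<phi> by auto
  have "dr X ?A Y ?s \<phi> = ?i"
  proof (rule dists_eq_le_iffI[OF X(1) A(1)])
    fix x k f assume x: "x \<in> pts X" and k: "k \<in> pts ?A" and f: "f \<in> arr Q (ty X x) (ty ?A k)"
    let ?m = "dec X k"
    have m: "?m \<in> presheaves Q X" "c ?m = ?m" using fS(1,2)[OF k] by auto
    have "?s k y = s ?m y" if y: "y \<in> pts Y" for y
      using dist_in[OF s k y] sin[OF m(1) y] X y m fS(3,4) k
        le_dl[OF X(1) A(1) X(2) A(2) \<phi>(1) k y] le_s[OF m(1) y]
      by (intro eq_iff[of "fst ?m" "ty Y y"]) auto
    then show "leQ (ty X x) (ty ?A k) f (dr X ?A Y ?s \<phi> x k) \<longleftrightarrow> leQ (ty X x) (ty ?A k) f (?i x k)"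
      using le_dr[OF X(1) A(1) X(2) s \<phi>(1) x k f] le_c[OF m(1) x, of f] f m fS(3,4) k x by simp
  qed (use X A s \<phi> in auto)
  then have "dneg ?A X (dist_comp Q ?A Y X u ?s) = ?i"
    unfolding dr_def \<phi>(2) .
  then have 2: "clo ?S = dist_comp Q ?A Y X u ?s"
    unfolding clo_def using X A u s dneg_dneg[of ?A X "dist_comp Q ?A Y X u ?s"] by auto
  have "is_iso (diagonal_quantaloid (QDist U Q)) (?A, X, clo ?S) (Y, X, u) (clo ?S)"
  proof (rule QD.diagonal_iso_codomain)
    show "(?A, X, clo ?S) \<in> Arrows (QDist U Q)" using clo_Arrows[OF S] by simp
    show "(Y, X, u) \<in> Arrows (QDist U Q)" using XY u by (simp add: Arrows_def)
    show "?s \<in> arr (QDist U Q) ?A Y" "t \<in> arr (QDist U Q) Y ?A" using s t by simp_all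
    show "clo ?S = Cmp (QDist U Q) ?A Y X u ?s" unfolding QDist_simps by (rule 2)
    show "u = Cmp (QDist U Q) Y ?A X (clo ?S) t" unfolding QDist_simps by (rule 1)
  qed
  with S show ?thesis by (intro exI[of _ ?S]) auto
qed

section \<open>Closure spaces compared with diagonals\<close>

lemma ClsDist_simps:
  "Obj (ClsDist_cl U Q) = {S. closure_space U Q S}"
  "arr (ClsDist_cl U Q) S T = {\<zeta> \<in> continuous_dists Q S T. cl S T \<zeta> = \<zeta>}"
  "eq (Hom (ClsDist_cl U Q) S T) = (=)" "le (Hom (ClsDist_cl U Q) S T) = dist_le Q (fst S) (fst T)"
  "Cmp (ClsDist_cl U Q) S T V \<eta> \<zeta> = cl S V (dist_comp Q (fst S) (fst T) (fst V) \<eta> \<zeta>)"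
  "Idn (ClsDist_cl U Q) S = cl S S (hm (fst S))"
  by (simp_all add: ClsDist_cl_def)

text \<open>Closed distributors are canonical representatives, so the bijection on hom-sets is
  direct, without a quotient: any factor \<open>\<zeta>\<close> of a diagonal may be closed by
  \<open>cl_clo\<close>, and closed factors are unique by \<open>clo_le_iff\<close>.\<close>

lemma weak_equivalence_ClsDist:
  "weak_equivalence (ClsDist_cl U Q) (diagonal_quantaloid (QDist U Q)) (\<lambda>S. (fixed_cat S, fst S, clo S))
    (\<lambda>S T \<zeta>. dist_comp Q (fixed_cat S) (fst S) (fst T) \<zeta> (clo S))" (is "weak_equivalence ?K ?E ?Fo ?Fa")
proof (rule weak_equivalenceI)
  show "quantaloid ?E" by (rule QD.quantaloid_diagonal)
  show "?Fo S \<in> Obj ?E" if "S \<in> Obj ?K" for S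
    using that clo_Arrows by (simp add: ClsDist_simps)
  \<comment> \<open>Stated for arbitrary \<open>\<zeta>\<close>, so that it serves for identities,
    composites and surjectivity alike, all of which arise as closures.\<close>
  have in_iff: "cl S T \<zeta> \<in> arr ?K S T \<longleftrightarrow> ?Fa S T \<zeta> \<in> arr ?E (?Fo S) (?Fo T)"
    if "closure_space U Q S" "closure_space U Q T" "\<zeta> \<in> dists Q (fst S) (fst T)" for S T \<zeta>
    using closure_continuous_iff[OF that(1,2) cl_dist[OF that]] cl_cl[OF that] cl_clo[OF that]
    by (simp add: ClsDist_simps)
  have arrd: "\<zeta> \<in> dists Q (fst S) (fst T)" if "\<zeta> \<in> arr ?K S T" for S T \<zeta>
    using that continuous_dist[of \<zeta> S T] by (simp add: ClsDist_simps)
  have Fin: "?Fa S T \<zeta> \<in> diagonals (QDist U Q) (?Fo S) (?Fo T)"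
    if "closure_space U Q S" "closure_space U Q T" "\<zeta> \<in> arr ?K S T" for S T \<zeta>
    using closure_continuous_iff[OF that(1,2)] that(3) continuous_dist[of \<zeta> S T] by (simp add: ClsDist_simps)
  show "Idn ?K S \<in> arr ?K S S \<and> ?Fa S S (Idn ?K S) = Idn ?E (?Fo S)" if "S \<in> Obj ?K" for S
  proof -
    have S: "closure_space U Q S" using that by (simp add: ClsDist_simps)
    note X = closure_facts(2)[OF S] and A = closure_facts(7)[OF S]
    show ?thesis
      using in_iff[OF S S hm_dist[OF X]] cl_clo[OF S S hm_dist[OF X]] QD.diagonal_Idn_in[OF clo_Arrows[OF S]]
        X A clo_dist[OF S]
      by (simp add: ClsDist_simps)
  qed
  show "Cmp ?K S T V \<eta> \<zeta> \<in> arr ?K S V \<and> ?Fa S V (Cmp ?K S T V \<eta> \<zeta>) = Cmp ?E (?Fo S) (?Fo T) (?Fo V)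
    (?Fa T V \<eta>) (?Fa S T \<zeta>)"
    if *: "S \<in> Obj ?K" "T \<in> Obj ?K" "V \<in> Obj ?K" "\<zeta> \<in> arr ?K S T" "\<eta> \<in> arr ?K T V" for S T V \<zeta> \<eta>
  proof -
    have S: "closure_space U Q S" "closure_space U Q T" "closure_space U Q V" using *
      by (auto simp: ClsDist_simps)
    note X = closure_facts(2)[OF S(1)] closure_facts(2)[OF S(2)] closure_facts(2)[OF S(3)]
      and A = closure_facts(7)[OF S(1)]
    have d: "\<zeta> \<in> dists Q (fst S) (fst T)" "\<eta> \<in> dists Q (fst T) (fst V)"
      by (fact arrd[OF *(4)], fact arrd[OF *(5)])
    have c: "dist_comp Q (fst S) (fst T) (fst V) \<eta> \<zeta> \<in> dists Q (fst S) (fst V)" using X d by auto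
    note o = clo_Arrows[OF S(1)] clo_Arrows[OF S(2)] clo_Arrows[OF S(3)]
    have "Cmp ?E (?Fo S) (?Fo T) (?Fo V) (?Fa T V \<eta>) (?Fa S T \<zeta>) = dist_comp Q (fixed_cat S) (fst T) (fst V) \<eta>
      (?Fa S T \<zeta>)"
      using QD.diagonal_Cmp[OF o Fin[OF S(1,2) *(4)], of \<eta> "?Fa T V \<eta>"] d by simp
    then have e: "Cmp ?E (?Fo S) (?Fo T) (?Fo V) (?Fa T V \<eta>) (?Fa S T \<zeta>) = ?Fa S V
      (dist_comp Q (fst S) (fst T) (fst V) \<eta> \<zeta>)"
      using X A d clo_dist[OF S(1)] by (simp add: dist_comp_assoc)
    then show ?thesis
      using in_iff[OF S(1,3) c] cl_clo[OF S(1,3) c]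
        QD.diagonal_Cmp_in[OF o Fin[OF S(1,2) *(4)] Fin[OF S(2,3) *(5)]]
      by (simp add: ClsDist_simps)
  qed
  show ord: "le (Hom ?K S T) \<zeta> \<zeta>' \<longleftrightarrow> le (Hom ?E (?Fo S) (?Fo T)) (?Fa S T \<zeta>) (?Fa S T \<zeta>')"
    if "S \<in> Obj ?K" "T \<in> Obj ?K" "\<zeta> \<in> arr ?K S T" "\<zeta>' \<in> arr ?K S T" for S T \<zeta> \<zeta>'
    using that clo_le_iff[of S T \<zeta> \<zeta>'] arrd[OF that(3)] arrd[OF that(4)] by (simp add: ClsDist_simps)
  show "bij_betw (?Fa S T) (arr ?K S T) (arr ?E (?Fo S) (?Fo T))" if *: "S \<in> Obj ?K" "T \<in> Obj ?K" for S T
  proof -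
    have S: "closure_space U Q S" "closure_space U Q T" using * by (auto simp: ClsDist_simps)
    note X = closure_facts(2)[OF S(1)] closure_facts(2)[OF S(2)] and A = closure_facts(7)[OF S(1)]
    have "\<zeta> = \<zeta>'" if "\<zeta> \<in> arr ?K S T" "\<zeta>' \<in> arr ?K S T" "?Fa S T \<zeta> = ?Fa S T \<zeta>'" for \<zeta> \<zeta>'
    proof -
      have d: "\<zeta> \<in> dists Q (fst S) (fst T)" "\<zeta>' \<in> dists Q (fst S) (fst T)"
        by (fact arrd[OF that(1)], fact arrd[OF that(2)])
      have "dist_le Q (fixed_cat S) (fst T) (?Fa S T \<zeta>) (?Fa S T \<zeta>')"
        "dist_le Q (fixed_cat S) (fst T) (?Fa S T \<zeta>') (?Fa S T \<zeta>)"
        using that(3) dist_le_refl[of "fixed_cat S" "fst T" "?Fa S T \<zeta>'"] X A d clo_dist[OF S(1)] by auto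
      then show ?thesis
        using ord[OF * that(1,2)] ord[OF * that(2,1)] X d
          by (intro dist_le_antisym[of "fst S" "fst T"]) (auto simp: ClsDist_simps)
    qed
    moreover have "w \<in> ?Fa S T ` arr ?K S T" if w: "w \<in> arr ?E (?Fo S) (?Fo T)" for w
    proof -
      obtain \<zeta> where \<zeta>: "\<zeta> \<in> dists Q (fst S) (fst T)" "w = ?Fa S T \<zeta>"
        using w by (auto simp: QD.diagonals_iff)
      have "cl S T \<zeta> \<in> arr ?K S T" unfolding in_iff[OF S \<zeta>(1)] using w \<zeta>(2) by simp
      moreover have "w = ?Fa S T (cl S T \<zeta>)" using cl_clo[OF S \<zeta>(1)] \<zeta>(2) by simp
      ultimately show ?thesis by blast
    qed
    ultimately show ?thesis
      using Fin[OF S] by (auto simp: bij_betw_def intro!: inj_onI)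
  qed
  show "\<exists>S\<in>Obj ?K. \<exists>w. is_iso ?E (?Fo S) x w" if x: "x \<in> Obj ?E" for x
  proof -
    obtain Y X u where x': "x = (Y, X, u)" by (rule prod_cases3)
    then have "small_qcat U Q X" "small_qcat U Q Y" "u \<in> dists Q Y X" using x by (auto simp: Arrows_def)
    from closure_eso[OF this] show ?thesis unfolding x' ClsDist_simps by blast
  qed
qed (simp add: ClsDist_simps)

end

section \<open>Complete \<open>Q\<close>-categories\<close>

context distributors
begin

lemma yoneda_app [simp]: "y \<in> pts X \<Longrightarrow> yoneda X y = column X X (hm X) y"
  by (simp add: yoneda_def)

lemma yoneda_presheaf: "\<lbrakk>qcat Q X; y \<in> pts X\<rbrakk> \<Longrightarrow> column X X (hm X) y \<in> presheaves Q X"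
  by auto

text \<open>Yoneda: the family over \<open>y\<close> is governed by its member at
  \<open>y = x\<close>, where \<open>hm X x x\<close> lies above the identity; the way back is the
  action of \<open>X\<close> on \<open>g\<close>.\<close>

lemma yoneda_le_iff:
  assumes X: "qcat Q X" and p: "x \<in> pts X" "z \<in> pts X" "r \<in> Obj Q" and f: "f \<in> arr Q (ty X x) r"
    and g: "\<And>y. y \<in> pts X \<Longrightarrow> g y \<in> arr Q (ty X y) r"
    and right: "\<And>y y'. \<lbrakk>y \<in> pts X; y' \<in> pts X\<rbrakk> \<Longrightarrow> leQ (ty X y') r
      (Cmp Q (ty X y') (ty X y) r (g y) (hm X y' y)) (g y')"
  shows "(\<forall>y\<in>pts X. leQ (ty X y) r (Cmp Q (ty X y) (ty X x) r f (hm X y x)) (g y)) \<longleftrightarrow> leQ (ty X x) r f (g x)"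
proof
  assume *: "\<forall>y\<in>pts X. leQ (ty X y) r (Cmp Q (ty X y) (ty X x) r f (hm X y x)) (g y)"
  have "leQ (ty X x) r f (Cmp Q (ty X x) (ty X x) r f (hm X x x))"
    using X p f hm_refl by (intro le_Cmp_Idn) auto
  from le_trans[OF _ _ _ _ _ this bspec[OF * p(1)]] show "leQ (ty X x) r f (g x)" using X p f g by auto
next
  assume *: "leQ (ty X x) r f (g x)"
  show "\<forall>y\<in>pts X. leQ (ty X y) r (Cmp Q (ty X y) (ty X x) r f (hm X y x)) (g y)"
  proof
    fix y assume y: "y \<in> pts X"
    have "leQ (ty X y) r (Cmp Q (ty X y) (ty X x) r f (hm X y x))
      (Cmp Q (ty X y) (ty X x) r (g x) (hm X y x))"
      using X p f g y * by (intro Cmp_mono_left) auto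
    from le_trans[OF _ _ _ _ _ this right[OF p(1) y]]
      show "leQ (ty X y) r (Cmp Q (ty X y) (ty X x) r f (hm X y x)) (g y)"
      using X p f g y by auto
  qed
qed

text \<open>Hom-arrows out of a point reverse the order, so graphs are antitone in the functor;
  negation reverses once more and the comparison becomes monotone.\<close>

lemma hm_mono_iff:
  assumes X: "qcat Q X" and p: "x \<in> pts X" "x' \<in> pts X" "ty X x = ty X x'"
  shows "under_le Q X x x' \<longleftrightarrow> (\<forall>z\<in>pts X. leQ (ty X x) (ty X z) (hm X x' z) (hm X x z))"
proof
  note i = hm_in[OF X p(1,2), unfolded p(3)]
  assume "under_le Q X x x'"
  then have *: "leQ (ty X x') (ty X x') (Idn Q (ty X x')) (hm X x x')"
    using p by (simp add: under_le_def)
  show "\<forall>z\<in>pts X. leQ (ty X x) (ty X z) (hm X x' z) (hm X x z)"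
  proof
    fix z assume z: "z \<in> pts X"
    have "leQ (ty X x') (ty X z) (hm X x' z) (Cmp Q (ty X x') (ty X x') (ty X z) (hm X x' z) (hm X x x'))"
      using X p z i * by (intro le_Cmp_Idn) auto
    from le_trans[OF _ _ _ _ _ this hm_trans[OF X p(1,2) z, unfolded p(3)]]
      show "leQ (ty X x) (ty X z) (hm X x' z) (hm X x z)"
      using X p z i hm_in[OF X p(1) z] by simp
  qed
next
  assume *: "\<forall>z\<in>pts X. leQ (ty X x) (ty X z) (hm X x' z) (hm X x z)"
  note i = hm_in[OF X p(1,2), unfolded p(3)]
  show "under_le Q X x x'"
    unfolding under_le_def
    using le_trans[OF _ _ _ _ _ hm_refl[OF X p(2)]] bspec[OF * p(2)] X p i by auto
qed

text \<open>Functoriality of \<open>s\<close> follows from the adjunction equation: at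
  \<open>k = s m'\<close> it gives the unit, \<open>m'\<close> below the representable at
  \<open>s m'\<close>, through which \<open>hm m m'\<close> is carried over.\<close>

lemma complete_qcatI:
  assumes A: "qcat Q A" and s: "s \<in> presheaves Q A \<rightarrow>\<^sub>E pts A" "\<And>m. m \<in> presheaves Q A \<Longrightarrow> ty A (s m) = fst m"
    and eq: "\<And>m k. \<lbrakk>m \<in> presheaves Q A; k \<in> pts A\<rbrakk> \<Longrightarrow> hm A (s m) k = hm (P Q A) m (column A A (hm A) k)"
  shows "complete_qcat Q A"
  unfolding complete_qcat_def adjoint_def
proof (intro exI[of _ s] conjI ballI)
  note y = yoneda_presheaf[OF A]
  show "yoneda A \<in> qfunctors Q A (P Q A)"
    unfolding qfunctors_def
  proof (intro CollectI conjI ballI)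
    show "yoneda A \<in> pts A \<rightarrow>\<^sub>E pts (P Q A)" using y by (auto simp: yoneda_def)
    show "ty (P Q A) (yoneda A x) = ty A x" if "x \<in> pts A" for x using that y by simp
    show "leQ (ty A x) (ty A x') (hm A x x') (hm (P Q A) (yoneda A x) (yoneda A x'))"
      if "x \<in> pts A" "x' \<in> pts A" for x x'
      using that P_hm(2)[OF A y[OF that(1)] y[OF that(2)], of "hm A x x'"] hm_trans[OF A _ that] A by simp
  qed
  show "s \<in> qfunctors Q (P Q A) A"
    unfolding qfunctors_def
  proof (intro CollectI conjI ballI)
    show "s \<in> pts (P Q A) \<rightarrow>\<^sub>E pts A" using s by simp
    show "ty A (s m) = ty (P Q A) m" if "m \<in> pts (P Q A)" for m using that s by simp
    fix m m' assume "m \<in> pts (P Q A)" "m' \<in> pts (P Q A)"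
    then have m: "m \<in> presheaves Q A" "m' \<in> presheaves Q A" by auto
    have sm: "s m \<in> pts A" "s m' \<in> pts A" using m s(1) by auto
    note sy = y[OF sm(2)]
    have 1: "leQ (ty A j) (fst m') (snd m' j ()) (hm A j (s m'))" if j: "j \<in> pts A" for j
    proof -
      have "leQ (fst m') (fst m') (Idn Q (fst m')) (hm (P Q A) m' (column A A (hm A) (s m')))"
        using hm_refl[OF A sm(2)] eq[OF m(2) sm(2)] s(2)[OF m(2)] by simp
      then show ?thesis
        using P_hm(2)[OF A m(2) sy, of "Idn Q (fst m')"] s(2)[OF m(2)] m j A by simp
    qed
    have "leQ (ty A j) (fst m') (Cmp Q (ty A j) (fst m) (fst m') (hm (P Q A) m m') (snd m j ()))
      (hm A j (s m'))"
      if j: "j \<in> pts A" for j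
      using le_trans[OF _ _ _ _ _ P_hm_Cmp_le[OF A m j] 1[OF j]] A m j sm hm_in[OF A j sm(2)] s(2)[OF m(2)]
        by simp
    then have "leQ (fst m) (fst m') (hm (P Q A) m m') (hm (P Q A) m (column A A (hm A) (s m')))"
      using P_hm(2)[OF A m(1) sy, of "hm (P Q A) m m'"] P_hm(1)[OF A m] s(2)[OF m(2)] sm by simp
    then show "leQ (ty (P Q A) m) (ty (P Q A) m') (hm (P Q A) m m') (hm A (s m) (s m'))"
      using m eq[OF m(1) sm(2)] by simp
  qed
  show "hm A (s m) k = hm (P Q A) m (yoneda A k)" if "m \<in> pts (P Q A)" "k \<in> pts A" for m k
    using that eq by simp
qed

lemma complete_qcatE:
  assumes A: "qcat Q A" and c: "complete_qcat Q A"
  obtains s where "\<And>m. m \<in> presheaves Q A \<Longrightarrow> s m \<in> pts A \<and> ty A (s m) = fst m"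
    and "\<And>m k f. \<lbrakk>m \<in> presheaves Q A; k \<in> pts A; f \<in> arr Q (fst m) (ty A k)\<rbrakk> \<Longrightarrow>
      leQ (fst m) (ty A k) f (hm A (s m) k) \<longleftrightarrow>
      (\<forall>x\<in>pts A. leQ (ty A x) (ty A k) (Cmp Q (ty A x) (fst m) (ty A k) f (snd m x ())) (hm A x k))"
proof -
  obtain s where s: "adjoint Q (P Q A) A s (yoneda A)" using c unfolding complete_qcat_def by blast
  show ?thesis
  proof (rule that[of s])
    show 1: "s m \<in> pts A \<and> ty A (s m) = fst m" if "m \<in> presheaves Q A" for m
      using s that unfolding adjoint_def qfunctors_def by auto
    fix m k f assume m: "m \<in> presheaves Q A" and k: "k \<in> pts A" and f: "f \<in> arr Q (fst m) (ty A k)"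
    have "hm A (s m) k = hm (P Q A) m (column A A (hm A) k)"
      using s m k unfolding adjoint_def by simp
    then show "leQ (fst m) (ty A k) f (hm A (s m) k) \<longleftrightarrow>
      (\<forall>x\<in>pts A. leQ (ty A x) (ty A k) (Cmp Q (ty A x) (fst m) (ty A k) f (snd m x ())) (hm A x k))"
      using P_hm(2)[OF A m yoneda_presheaf[OF A k], of f] f by simp
  qed
qed

section \<open>Graphs of \<open>Q\<close>-functors as adjoint pairs of distributors\<close>

definition graph :: "('x, 'o, 'a) qcat_data \<Rightarrow> ('y, 'o, 'a) qcat_data \<Rightarrow> ('x \<Rightarrow> 'y) \<Rightarrow> 'x \<Rightarrow> 'y \<Rightarrow> 'a" where
  "graph X Y f = (\<lambda>x\<in>pts X. \<lambda>y\<in>pts Y. hm Y (f x) y)"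

definition cograph :: "('x, 'o, 'a) qcat_data \<Rightarrow> ('y, 'o, 'a) qcat_data \<Rightarrow> ('x \<Rightarrow> 'y) \<Rightarrow> 'y \<Rightarrow> 'x \<Rightarrow> 'a" where
  "cograph X Y f = (\<lambda>y\<in>pts Y. \<lambda>x\<in>pts X. hm Y y (f x))"

lemma graph_app [simp]:
  "\<lbrakk>x \<in> pts X; y \<in> pts Y\<rbrakk> \<Longrightarrow> graph X Y f x y = hm Y (f x) y"
  "\<lbrakk>x \<in> pts X; y \<in> pts Y\<rbrakk> \<Longrightarrow> cograph X Y f y x = hm Y y (f x)"
  by (simp_all add: graph_def cograph_def)

lemma qfunctor_facts:
  assumes "f \<in> qfunctors Q X Y"
  shows "x \<in> pts X \<Longrightarrow> f x \<in> pts Y" "x \<in> pts X \<Longrightarrow> ty Y (f x) = ty X x" "f \<in> extensional (pts X)"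
    "\<lbrakk>x \<in> pts X; x' \<in> pts X\<rbrakk> \<Longrightarrow> leQ (ty X x) (ty X x') (hm X x x') (hm Y (f x) (f x'))"
  using assms unfolding qfunctors_def by (auto simp: PiE_iff)

lemma graph_dist [simp, intro]:
  assumes X: "qcat Q X" "qcat Q Y" and f: "f \<in> qfunctors Q X Y"
  shows "graph X Y f \<in> dists Q X Y"
proof (rule distsI[OF X])
  note f' = qfunctor_facts[OF f]
  have fin: "hm Y (f x) y \<in> arr Q (ty X x) (ty Y y)" if "x \<in> pts X" "y \<in> pts Y" for x y
    using hm_in[OF X(2) f'(1)[OF that(1)] that(2)] f'(2)[OF that(1)] by simp
  show "graph X Y f \<in> (\<Pi>\<^sub>E x\<in>pts X. \<Pi>\<^sub>E y\<in>pts Y. arr Q (ty X x) (ty Y y))"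
    using fin by (auto simp: graph_def)
  show "leQ (ty X x) (ty Y y') (Cmp Q (ty X x) (ty Y y) (ty Y y') (hm Y y y') (graph X Y f x y))
    (graph X Y f x y')"
    if "x \<in> pts X" "y \<in> pts Y" "y' \<in> pts Y" for x y y'
    using hm_trans[OF X(2) f'(1)[OF that(1)] that(2,3)] f'(2)[OF that(1)] that by simp
  fix x x' y assume *: "x \<in> pts X" "x' \<in> pts X" "y \<in> pts Y"
  have ff: "hm Y (f x') (f x) \<in> arr Q (ty X x') (ty X x)"
    using hm_in[OF X(2) f'(1)[OF *(2)] f'(1)[OF *(1)]] f'(2) * by simp
  have "leQ (ty X x') (ty Y y) (Cmp Q (ty X x') (ty X x) (ty Y y) (hm Y (f x) y) (hm X x' x))
     (Cmp Q (ty X x') (ty X x) (ty Y y) (hm Y (f x) y) (hm Y (f x') (f x)))"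
    using X * fin ff f'(4) by (intro Cmp_mono_right) auto
  from le_trans[OF _ _ _ _ _ this] hm_trans[OF X(2) f'(1)[OF *(2)] f'(1)[OF *(1)] *(3)]
  show "leQ (ty X x') (ty Y y) (Cmp Q (ty X x') (ty X x) (ty Y y) (graph X Y f x y) (hm X x' x))
    (graph X Y f x' y)"
    using X * fin ff f'(2) by simp
qed

lemma cograph_dist [simp, intro]:
  assumes X: "qcat Q X" "qcat Q Y" and f: "f \<in> qfunctors Q X Y"
  shows "cograph X Y f \<in> dists Q Y X"
proof (rule distsI[OF X(2,1)])
  note f' = qfunctor_facts[OF f]
  have fin: "hm Y y (f x) \<in> arr Q (ty Y y) (ty X x)" if "x \<in> pts X" "y \<in> pts Y" for x y
    using hm_in[OF X(2) that(2) f'(1)[OF that(1)]] f'(2)[OF that(1)] by simp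
  show "cograph X Y f \<in> (\<Pi>\<^sub>E y\<in>pts Y. \<Pi>\<^sub>E x\<in>pts X. arr Q (ty Y y) (ty X x))"
    using fin by (auto simp: cograph_def)
  show "leQ (ty Y y') (ty X x) (Cmp Q (ty Y y') (ty Y y) (ty X x) (cograph X Y f y x) (hm Y y' y))
    (cograph X Y f y' x)"
    if "y \<in> pts Y" "y' \<in> pts Y" "x \<in> pts X" for x y y'
    using hm_trans[OF X(2) that(2,1) f'(1)[OF that(3)]] f'(2)[OF that(3)] that by simp
  fix y x x' assume *: "y \<in> pts Y" "x \<in> pts X" "x' \<in> pts X"
  have ff: "hm Y (f x) (f x') \<in> arr Q (ty X x) (ty X x')"
    using hm_in[OF X(2) f'(1)[OF *(2)] f'(1)[OF *(3)]] f'(2) * by simp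
  have "leQ (ty Y y) (ty X x') (Cmp Q (ty Y y) (ty X x) (ty X x') (hm X x x') (hm Y y (f x)))
     (Cmp Q (ty Y y) (ty X x) (ty X x') (hm Y (f x) (f x')) (hm Y y (f x)))"
    using X * fin ff f'(4) by (intro Cmp_mono_left) auto
  from le_trans[OF _ _ _ _ _ this] hm_trans[OF X(2) *(1) f'(1)[OF *(2)] f'(1)[OF *(3)]]
  show "leQ (ty Y y) (ty X x') (Cmp Q (ty Y y) (ty X x) (ty X x') (hm X x x') (cograph X Y f y x))
    (cograph X Y f y x')"
    using X * fin ff f'(2) by simp
qed

text \<open>The join over \<open>Y\<close> is attained at \<open>y = f z\<close>, so composition
  with a cograph is substitution along \<open>f\<close>.\<close>

lemma cograph_comp:
  assumes X: "qcat Q X" "qcat Q Y" "qcat Q Z" and w: "w \<in> dists Q X Y" and f: "f \<in> qfunctors Q Z Y"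
    and p: "x \<in> pts X" "z \<in> pts Z"
  shows "dist_comp Q X Y Z (cograph Z Y f) w x z = w x (f z)"
proof (rule le_antisym[of "ty X x" "ty Z z"])
  note f' = qfunctor_facts[OF f]
  note c = cograph_dist[OF X(3,2) f]
  have tz: "ty Y (f z) = ty Z z" "f z \<in> pts Y" using f' p by auto
  show wi: "w x (f z) \<in> arr Q (ty X x) (ty Z z)" using dist_in[OF w p(1) tz(2)] tz by simp
  show "leQ (ty X x) (ty Z z) (dist_comp Q X Y Z (cograph Z Y f) w x z) (w x (f z))"
    using dist_left[OF X(1,2) w p(1) _ tz(2)] tz p X w c wi by (subst dist_comp_le_iff) auto
  have hi: "hm Y (f z) (f z) \<in> arr Q (ty Z z) (ty Z z)" using hm_in[OF X(2) tz(2,2)] tz by simp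
  have "leQ (ty X x) (ty Z z) (w x (f z)) (Cmp Q (ty X x) (ty Z z) (ty Z z) (hm Y (f z) (f z)) (w x (f z)))"
    using X p wi hi hm_refl[OF X(2) tz(2)] tz by (intro le_Cmp_Idn) auto
  from le_trans[OF _ _ _ _ _ this] le_dist_comp[OF p tz(2) X w c]
  show "leQ (ty X x) (ty Z z) (w x (f z)) (dist_comp Q X Y Z (cograph Z Y f) w x z)"
    using X p wi hi tz c w dist_comp_ext[OF p X w c] by simp
qed (use X p w f cograph_dist[OF X(3,2) f] in \<open>auto simp: dist_comp_ext\<close>)

text \<open>In negated form: the negated graph is the cograph composed with the negated identity
  distributor of \<open>Y\<close>, one of the two factorizations required of a diagonal. The
  equation itself is Yoneda.\<close>

lemma dl_hm_cograph:
  assumes X: "qcat Q X" "qcat Q Y" and f: "f \<in> qfunctors Q X Y"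
  shows "dl Y X Y (hm Y) (cograph X Y f) = graph X Y f"
proof (rule dists_eq_le_iffI[OF X])
  note f' = qfunctor_facts[OF f]
  fix x y g assume *: "x \<in> pts X" "y \<in> pts Y" "g \<in> arr Q (ty X x) (ty Y y)"
  show "leQ (ty X x) (ty Y y) g (dl Y X Y (hm Y) (cograph X Y f) x y) \<longleftrightarrow> leQ (ty X x) (ty Y y) g
    (graph X Y f x y)"
    using le_dl[OF X(2,1,2) cograph_dist[OF X f] hm_dist[OF X(2)] *]
      yoneda_le_iff[OF X(2) f'(1)[OF *(1)] *(2) ty_in[OF X(2) *(2)], of g "\<lambda>z. hm Y z y"] f' * X
        hm_trans[OF X(2)]
    by simp
qed (use X f in auto)

lemma coyoneda_le_iff:
  assumes X: "qcat Q X" and p: "x \<in> pts X" "z \<in> pts X" and f: "f \<in> arr Q (ty X z) (ty X x)"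
  shows "(\<forall>y\<in>pts X. leQ (ty X z) (ty X y) (Cmp Q (ty X z) (ty X x) (ty X y) (hm X x y) f) (hm X z y)) \<longleftrightarrow>
    leQ (ty X z) (ty X x) f (hm X z x)"
proof
  assume *: "\<forall>y\<in>pts X. leQ (ty X z) (ty X y) (Cmp Q (ty X z) (ty X x) (ty X y) (hm X x y) f) (hm X z y)"
  have "leQ (ty X z) (ty X x) f (Cmp Q (ty X z) (ty X x) (ty X x) (hm X x x) f)"
    using X p f hm_refl by (intro le_Cmp_Idn) auto
  from le_trans[OF _ _ _ _ _ this bspec[OF * p(1)]] show "leQ (ty X z) (ty X x) f (hm X z x)" using X p f
    by auto
next
  assume *: "leQ (ty X z) (ty X x) f (hm X z x)"
  show "\<forall>y\<in>pts X. leQ (ty X z) (ty X y) (Cmp Q (ty X z) (ty X x) (ty X y) (hm X x y) f) (hm X z y)"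
  proof
    fix y assume y: "y \<in> pts X"
    have "leQ (ty X z) (ty X y) (Cmp Q (ty X z) (ty X x) (ty X y) (hm X x y) f)
      (Cmp Q (ty X z) (ty X x) (ty X y) (hm X x y) (hm X z x))"
      using X p f y * by (intro Cmp_mono_right) auto
    from le_trans[OF _ _ _ _ _ this hm_trans[OF X p(2,1) y]]
      show "leQ (ty X z) (ty X y) (Cmp Q (ty X z) (ty X x) (ty X y) (hm X x y) f) (hm X z y)"
      using X p f y by auto
  qed
qed

text \<open>Meant for a right adjoint \<open>g\<close>: when \<open>f \<stileturn> g\<close>, the
  graph of \<open>f\<close> is the cograph of \<open>g\<close>, so this gives the other
  factorization of the negated graph of \<open>f\<close>.\<close>

lemma dr_hm_graph:
  assumes X: "qcat Q X" "qcat Q Y" and g: "g \<in> qfunctors Q Y X"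
  shows "dr X Y X (graph Y X g) (hm X) = cograph Y X g"
proof (rule dists_eq_le_iffI[OF X])
  note g' = qfunctor_facts[OF g]
  fix x y f assume *: "x \<in> pts X" "y \<in> pts Y" "f \<in> arr Q (ty X x) (ty Y y)"
  show "leQ (ty X x) (ty Y y) f (dr X Y X (graph Y X g) (hm X) x y) \<longleftrightarrow> leQ (ty X x) (ty Y y) f
    (cograph Y X g x y)"
    using le_dr[OF X X(1) graph_dist[OF X(2,1) g] hm_dist[OF X(1)] *]
      coyoneda_le_iff[OF X(1) g'(1)[OF *(2)] *(1), of f] g' * X
    by simp
qed (use X g in auto)

text \<open>
  The left adjoint sends \<open>x\<close> to the supremum of \<open>t(-, x)\<close>, its right adjoint sends \<open>y\<close> to the supremum
  of \<open>h(-, y)\<close>.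
\<close>

lemma left_adjoint_of_residual:
  assumes X: "qcat Q X" "qcat Q Y" and cX: "complete_qcat Q X" and cY: "complete_qcat Q Y"
    and t: "t \<in> dists Q Y X" and s: "s \<in> dists Q Y X"
    and h: "h = dl Y X Y (hm Y) t" "h = dr X Y X s (hm X)"
  shows "\<exists>f g. adjoint Q X Y f g \<and> graph X Y f = h"
proof -
  obtain sX where sX: "\<And>m. m \<in> presheaves Q X \<Longrightarrow> sX m \<in> pts X \<and> ty X (sX m) = fst m"
    and le_sX: "\<And>m k f. \<lbrakk>m \<in> presheaves Q X; k \<in> pts X; f \<in> arr Q (fst m) (ty X k)\<rbrakk> \<Longrightarrow>
      leQ (fst m) (ty X k) f (hm X (sX m) k) \<longleftrightarrow>
      (\<forall>x\<in>pts X. leQ (ty X x) (ty X k) (Cmp Q (ty X x) (fst m) (ty X k) f (snd m x ())) (hm X x k))"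
    using complete_qcatE[OF X(1) cX] by blast
  obtain sY where sY: "\<And>m. m \<in> presheaves Q Y \<Longrightarrow> sY m \<in> pts Y \<and> ty Y (sY m) = fst m"
    and le_sY: "\<And>m k f. \<lbrakk>m \<in> presheaves Q Y; k \<in> pts Y; f \<in> arr Q (fst m) (ty Y k)\<rbrakk> \<Longrightarrow>
      leQ (fst m) (ty Y k) f (hm Y (sY m) k) \<longleftrightarrow>
      (\<forall>x\<in>pts Y. leQ (ty Y x) (ty Y k) (Cmp Q (ty Y x) (fst m) (ty Y k) f (snd m x ())) (hm Y x k))"
    using complete_qcatE[OF X(2) cY] by blast
  have hd: "h \<in> dists Q X Y" unfolding h(1) using X t by auto
  define f where "f = (\<lambda>x\<in>pts X. sY (column Y X t x))"
  define g where "g = (\<lambda>y\<in>pts Y. sX (column X Y h y))"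
  have ct: "column Y X t x \<in> presheaves Q Y" if "x \<in> pts X" for x using that X t by auto
  have ch: "column X Y h y \<in> presheaves Q X" if "y \<in> pts Y" for y using that X hd by auto
  have f: "f x \<in> pts Y" "ty Y (f x) = ty X x" if "x \<in> pts X" for x
    using sY[OF ct[OF that]] that by (auto simp: f_def)
  have g: "g y \<in> pts X" "ty X (g y) = ty Y y" if "y \<in> pts Y" for y
    using sX[OF ch[OF that]] that by (auto simp: g_def)
  \<comment> \<open>The supremum of \<open>t(-, x)\<close> represents its upper bounds, that is
    \<open>hm Y \<swarrow> t(-, x)\<close>, which is the first form of \<open>h\<close>.\<close>
  have fh: "hm Y (f x) y = h x y" if p: "x \<in> pts X" "y \<in> pts Y" for x y
  proof (rule eq_iff[of "ty X x" "ty Y y"])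
    show "hm Y (f x) y \<in> arr Q (ty X x) (ty Y y)" using hm_in[OF X(2) f(1)[OF p(1)] p(2)] f(2)[OF p(1)]
      by simp
    show "leQ (ty X x) (ty Y y) k (hm Y (f x) y) \<longleftrightarrow> leQ (ty X x) (ty Y y) k (h x y)"
      if "k \<in> arr Q (ty X x) (ty Y y)" for k
      using le_dl[OF X(2,1,2) t hm_dist[OF X(2)] p that] le_sY[OF ct[OF p(1)] p(2), of k] that p
      by (simp add: h(1) f_def)
  qed (use p X hd in auto)
  \<comment> \<open>The second form of \<open>h\<close> enters here: \<open>s\<close> bounds each
    column \<open>h(-, y)\<close>, hence also its supremum \<open>g y\<close>, and the residual then
    puts \<open>hm X x (g y)\<close> below \<open>h x y\<close>. The other inequality says that a
    supremum is an upper bound.\<close>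
  have gh: "hm X x (g y) = h x y" if p: "x \<in> pts X" "y \<in> pts Y" for x y
  proof (rule le_antisym[of "ty X x" "ty Y y"])
    have i: "hm X x (g y) \<in> arr Q (ty X x) (ty Y y)" using hm_in[OF X(1) p(1) g(1)[OF p(2)]] g(2)[OF p(2)]
      by simp
    then show "hm X x (g y) \<in> arr Q (ty X x) (ty Y y)" .
    have le_g: "leQ (ty Y y) (ty X k) e (hm X (g y) k) \<longleftrightarrow>
      (\<forall>x\<in>pts X. leQ (ty X x) (ty X k) (Cmp Q (ty X x) (ty Y y) (ty X k) e (h x y)) (hm X x k))"
      if "k \<in> pts X" "e \<in> arr Q (ty Y y) (ty X k)" for k e
      using le_sX[OF ch[OF p(2)] that(1), of e] that p by (simp add: g_def)
    have "leQ (ty X x) (ty X (g y)) (Cmp Q (ty X x) (ty Y y) (ty X (g y)) (Idn Q (ty Y y)) (h x y))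
      (hm X x (g y))"
      using le_g[OF g(1)[OF p(2)], of "Idn Q (ty Y y)"] hm_refl[OF X(1) g(1)[OF p(2)]] g[OF p(2)] p X by simp
    then show "leQ (ty X x) (ty Y y) (h x y) (hm X x (g y))"
      using g[OF p(2)] p X hd by simp
    have "leQ (ty X x) (ty X b) (Cmp Q (ty X x) (ty Y y) (ty X b) (s y b) (hm X x (g y))) (hm X x b)"
      if b: "b \<in> pts X" for b
    proof -
      have "leQ (ty X z) (ty X b) (Cmp Q (ty X z) (ty Y y) (ty X b) (s y b) (h z y)) (hm X z b)"
        if "z \<in> pts X" for z
        unfolding h(2) using dr_Cmp_le[OF X X(1) s hm_dist[OF X(1)] that p(2) b] .
      then have 1: "leQ (ty Y y) (ty X b) (s y b) (hm X (g y) b)"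
        using le_g[OF b dist_in[OF s p(2) b]] by blast
      have gb: "hm X (g y) b \<in> arr Q (ty Y y) (ty X b)" using hm_in[OF X(1) g(1)[OF p(2)] b] g(2)[OF p(2)]
        by simp
      have "leQ (ty X x) (ty X b) (Cmp Q (ty X x) (ty Y y) (ty X b) (s y b) (hm X x (g y)))
        (Cmp Q (ty X x) (ty Y y) (ty X b) (hm X (g y) b) (hm X x (g y)))"
        using X p b i gb s 1 by (intro Cmp_mono_left) auto
      from le_trans[OF _ _ _ _ _ this] hm_trans[OF X(1) p(1) g(1)[OF p(2)] b] show ?thesis
        using X p b i gb s g[OF p(2)] by simp
    qed
    then show "leQ (ty X x) (ty Y y) (hm X x (g y)) (h x y)"
      unfolding h(2) using le_dr[OF X X(1) s hm_dist[OF X(1)] p i] by blast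
  qed (use p X hd in auto)
  have "f \<in> qfunctors Q X Y"
    unfolding qfunctors_def
  proof (intro CollectI conjI ballI)
    fix x x' assume p: "x \<in> pts X" "x' \<in> pts X"
    have fx: "hm Y (f x') (f x') \<in> arr Q (ty X x') (ty X x')" "hm Y (f x) (f x') \<in> arr Q (ty X x) (ty X x')"
      using hm_in[OF X(2) f(1)[OF p(2)] f(1)[OF p(2)]] hm_in[OF X(2) f(1)[OF p(1)] f(1)[OF p(2)]] f(2) p
        by auto
    have "leQ (ty X x) (ty X x') (hm X x x') (Cmp Q (ty X x) (ty X x') (ty X x') (hm Y (f x') (f x'))
      (hm X x x'))"
      using X p fx hm_refl[OF X(2) f(1)[OF p(2)]] f(2)[OF p(2)] by (intro le_Cmp_Idn) auto
    from le_trans[OF _ _ _ _ _ this] dist_right[OF X hd p(2,1) f(1)[OF p(2)]]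
    show "leQ (ty X x) (ty X x') (hm X x x') (hm Y (f x) (f x'))"
      using X p fx f fh by simp
  qed (use f in \<open>auto simp: f_def\<close>)
  moreover have "g \<in> qfunctors Q Y X"
    unfolding qfunctors_def
  proof (intro CollectI conjI ballI)
    fix y y' assume p: "y \<in> pts Y" "y' \<in> pts Y"
    have gx: "hm X (g y) (g y) \<in> arr Q (ty Y y) (ty Y y)" "hm X (g y) (g y') \<in> arr Q (ty Y y) (ty Y y')"
      using hm_in[OF X(1) g(1)[OF p(1)] g(1)[OF p(1)]] hm_in[OF X(1) g(1)[OF p(1)] g(1)[OF p(2)]] g(2) p
        by auto
    have "leQ (ty Y y) (ty Y y') (hm Y y y') (Cmp Q (ty Y y) (ty Y y) (ty Y y') (hm Y y y')
      (hm X (g y) (g y)))"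
      using X p gx hm_refl[OF X(1) g(1)[OF p(1)]] g(2)[OF p(1)] by (intro le_Cmp_Idn) auto
    from le_trans[OF _ _ _ _ _ this] dist_left[OF X hd g(1)[OF p(1)] p]
    show "leQ (ty Y y) (ty Y y') (hm Y y y') (hm X (g y) (g y'))"
      using X p gx g gh by simp
  qed (use g in \<open>auto simp: g_def\<close>)
  ultimately have "adjoint Q X Y f g" unfolding adjoint_def using fh gh by simp
  moreover have "graph X Y f = h"
    by (rule dist_eqI[of _ X Y]) (use X hd \<open>f \<in> qfunctors Q X Y\<close> fh in auto)
  ultimately show ?thesis by blast
qed

lemma adjoint_compose:
  assumes X: "qcat Q X" "qcat Q Y" "qcat Q Z" and a: "adjoint Q X Y f g" "adjoint Q Y Z f' g'"
  shows "adjoint Q X Z (compose (pts X) f' f) (compose (pts Z) g g')"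
proof -
  have c: "compose (pts A) k' k \<in> qfunctors Q A D"
    if q: "qcat Q A" "qcat Q B" "qcat Q D" and k: "k \<in> qfunctors Q A B" "k' \<in> qfunctors Q B D"
    for A :: "('p, 'o, 'a) qcat_data" and B :: "('q, 'o, 'a) qcat_data" and D :: "('r, 'o, 'a) qcat_data"
      and k k'
  proof -
    note 1 = qfunctor_facts[OF k(1)] and 2 = qfunctor_facts[OF k(2)]
    have "leQ (ty A x) (ty A y) (hm A x y) (hm D (k' (k x)) (k' (k y)))" if "x \<in> pts A" "y \<in> pts A" for x y
      using le_trans[OF _ _ _ _ _ 1(4)[OF that], of "hm D (k' (k x)) (k' (k y))"] 2(4)[of "k x" "k y"] 1(1,2)
        2(1,2) that q
        hm_in[OF q(2) 1(1)[OF that(1)] 1(1)[OF that(2)]]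
          hm_in[OF q(3) 2(1)[OF 1(1)[OF that(1)]] 2(1)[OF 1(1)[OF that(2)]]]
      by simp
    then show ?thesis unfolding qfunctors_def using 1 2 by (auto simp: compose_def)
  qed
  have f: "f \<in> qfunctors Q X Y" "g \<in> qfunctors Q Y X" "f' \<in> qfunctors Q Y Z" "g' \<in> qfunctors Q Z Y"
    using a unfolding adjoint_def by auto
  have "compose (pts X) f' f \<in> qfunctors Q X Z" by (rule c[OF X f(1,3)])
  moreover have "compose (pts Z) g g' \<in> qfunctors Q Z X" by (rule c[OF X(3,2,1) f(4,2)])
  moreover have "hm Z (f' (f x)) z = hm X x (g (g' z))" if "x \<in> pts X" "z \<in> pts Z" for x z
    using a that qfunctor_facts(1)[OF f(1)] qfunctor_facts(1)[OF f(4)] unfolding adjoint_def by simp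
  ultimately show ?thesis unfolding adjoint_def by (simp add: compose_def)
qed

lemma adjoint_id: "qcat Q X \<Longrightarrow> adjoint Q X X (restrict (\<lambda>x. x) (pts X)) (restrict (\<lambda>x. x) (pts X))"
  unfolding adjoint_def qfunctors_def by auto

end

section \<open>Fixed points of a closure operator as a complete category\<close>

context universe
begin

text \<open>The supremum of a presheaf on closed points is the closure of the corresponding weighted
  join of presheaves on \<open>fst S\<close>. Since the target \<open>k\<close> is closed,
  \<open>closed_absorb\<close> removes the closure, and what remains is the universal property of
  the join.\<close>

lemma fixed_complete:
  assumes S: "closure_space U Q S"
  shows "separated Q (fixed_cat S)" "complete_qcat Q (fixed_cat S)"
proof -
  let ?X = "fst S" and ?A = "fixed_cat S" and ?u = "fixed_incl S" and ?c = "snd S"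
  note X = closure_facts(2)[OF S] and c = closure_facts(3)[OF S] and A = closure_facts(7,8)[OF S]
  note fS = fixed_simps[OF S]
  have hm: "hm ?A j k = hm (P Q ?X) (dec ?X j) (dec ?X k)" if "j \<in> pts ?A" "k \<in> pts ?A" for j k
    using that closure_facts(1)[OF S] fixed_psh[of S] by (simp add: fixed_cat_def)
  have ed: "enc ?X (dec ?X k) = k" if "k \<in> pts ?A" for k
    using that closure_facts(1)[OF S] fixed_psh[of S] by (simp add: fixed_cat_def)
  show "separated Q ?A"
    unfolding separated_def
  proof (intro ballI impI)
    fix j k assume jk: "j \<in> pts ?A" "k \<in> pts ?A" and le: "under_le Q ?A j k \<and> under_le Q ?A k j"
    note d = fS(1)[OF jk(1)] fS(1)[OF jk(2)]
    have "under_le Q (P Q ?X) (dec ?X j) (dec ?X k)"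
      using conjunct1[OF le] unfolding under_le_def hm[OF jk] fS(3)[OF jk(1)] fS(3)[OF jk(2)]
        P_simps(2)[OF d(1)] P_simps(2)[OF d(2)] .
    moreover have "under_le Q (P Q ?X) (dec ?X k) (dec ?X j)"
      using conjunct2[OF le] unfolding under_le_def hm[OF jk(2,1)] fS(3)[OF jk(1)] fS(3)[OF jk(2)]
        P_simps(2)[OF d(1)] P_simps(2)[OF d(2)] .
    ultimately have q: "fst (dec ?X j) = fst (dec ?X k)"
      and le': "\<And>x. x \<in> pts ?X \<Longrightarrow> leQ (ty ?X x) (fst (dec ?X k)) (snd (dec ?X j) x ()) (snd (dec ?X k) x ())"
        "\<And>x. x \<in> pts ?X \<Longrightarrow> leQ (ty ?X x) (fst (dec ?X k)) (snd (dec ?X k) x ()) (snd (dec ?X j) x ())"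
      unfolding P_under_le[OF X d] P_under_le[OF X d(2,1)] by metis+
    have "dec ?X j = dec ?X k"
    proof (rule presheaf_eqI[OF d q])
      fix x assume x: "x \<in> pts ?X"
      show "snd (dec ?X j) x () = snd (dec ?X k) x ()"
        by (rule le_antisym[OF ty_in[OF X x] presheaf_ty[OF d(2)] presheaf_in[OF d(1) x, unfolded q]
              presheaf_in[OF d(2) x] le'(1)[OF x] le'(2)[OF x]])
    qed
    then show "j = k" using ed[OF jk(1)] ed[OF jk(2)] by metis
  qed
  define s where "s = (\<lambda>m\<in>presheaves Q ?A. enc ?X (?c (pull Q ?X ?A ?u m)))"
  have p: "pull Q ?X ?A ?u m \<in> presheaves Q ?X" "fst (pull Q ?X ?A ?u m) = fst m" if "m \<in> presheaves Q ?A"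
    for m
    using that X A by auto
  have cp: "?c (pull Q ?X ?A ?u m) \<in> fixed S" "?c (pull Q ?X ?A ?u m) \<in> presheaves Q ?X"
    "fst (?c (pull Q ?X ?A ?u m)) = fst m"
    if "m \<in> presheaves Q ?A" for m
    using p[OF that] closure_facts(9)[OF S p(1)[OF that]] c by auto
  show "complete_qcat Q ?A"
  proof (rule complete_qcatI[OF A(1)])
    show "s \<in> presheaves Q ?A \<rightarrow>\<^sub>E pts ?A" using fS(5)[OF cp(1)] by (auto simp: s_def)
    show "ty ?A (s m) = fst m" if "m \<in> presheaves Q ?A" for m
      using fS(7)[OF cp(1)[OF that]] cp(3)[OF that] that by (simp add: s_def)
    fix m k assume m: "m \<in> presheaves Q ?A" and k: "k \<in> pts ?A"
    let ?p = "pull Q ?X ?A ?u m" and ?q = "fst m" and ?r = "fst (dec ?X k)"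
    note y = yoneda_presheaf[OF A(1) k]
    have sm: "s m \<in> pts ?A" "dec ?X (s m) = ?c ?p" using fS(5,6)[OF cp(1)[OF m]] m by (auto simp: s_def)
    have dk: "dec ?X k \<in> presheaves Q ?X" "?c (dec ?X k) = dec ?X k" using fS k by auto
    have e: "hm ?A (s m) k = hm (P Q ?X) (?c ?p) (dec ?X k)" using hm[OF sm(1) k] sm(2) by simp
    show "hm ?A (s m) k = hm (P Q ?A) m (column ?A ?A (hm ?A) k)"
    proof (rule eq_iff[of ?q ?r])
      show "hm ?A (s m) k \<in> arr Q ?q ?r" using P_hm(1)[OF X cp(2)[OF m] dk(1)] cp(3)[OF m] e by simp
      show "hm (P Q ?A) m (column ?A ?A (hm ?A) k) \<in> arr Q ?q ?r" using P_hm(1)[OF A(1) m y] fS(3)[OF k]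
        by simp
      fix f assume f: "f \<in> arr Q ?q ?r"
      have "leQ ?q ?r f (hm ?A (s m) k) \<longleftrightarrow> (\<forall>x\<in>pts ?X. leQ (ty ?X x) ?r
        (Cmp Q (ty ?X x) ?q ?r f (snd (?c ?p) x ())) (snd (dec ?X k) x ()))"
        unfolding e using P_hm(2)[OF X cp(2)[OF m] dk(1), of f] f cp(3)[OF m] by simp
      also have "\<dots> \<longleftrightarrow> (\<forall>x\<in>pts ?X. leQ (ty ?X x) ?r (Cmp Q (ty ?X x) ?q ?r f (snd ?p x ()))
        (snd (dec ?X k) x ()))"
        using closed_absorb[OF X c closure_facts(4)[OF S p(1)[OF m]] p(1)[OF m] dk, of f] f p(2)[OF m] by simp
      also have "\<dots> \<longleftrightarrow> (\<forall>x\<in>pts ?X. \<forall>j\<in>pts ?A. leQ (ty ?X x) ?r (Cmp Q (ty ?X x) (ty ?A j) ?r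
          (Cmp Q (ty ?A j) ?q ?r f (snd m j ())) (?u x j)) (snd (dec ?X k) x ()))"
      proof (intro ball_cong refl)
        fix x assume x: "x \<in> pts ?X"
        show "leQ (ty ?X x) ?r (Cmp Q (ty ?X x) ?q ?r f (snd ?p x ())) (snd (dec ?X k) x ()) \<longleftrightarrow>
          (\<forall>j\<in>pts ?A. leQ (ty ?X x) ?r (Cmp Q (ty ?X x) (ty ?A j) ?r (Cmp Q (ty ?A j) ?q ?r f (snd m j ()))
            (?u x j)) (snd (dec ?X k) x ()))"
          unfolding pull_app[OF m x] using X A m x f dk
          by (subst Cmp_sup_right_le_iff) (auto simp: Cmp_assoc)
      qed
      also have "\<dots> \<longleftrightarrow> (\<forall>j\<in>pts ?A. leQ (ty ?A j) ?r (Cmp Q (ty ?A j) ?q ?r f (snd m j ())) (hm ?A j k))"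
      proof -
        have "leQ (ty ?A j) ?r (Cmp Q (ty ?A j) ?q ?r f (snd m j ())) (hm ?A j k) \<longleftrightarrow>
          (\<forall>x\<in>pts ?X. leQ (ty ?X x) ?r (Cmp Q (ty ?X x) (ty ?A j) ?r (Cmp Q (ty ?A j) ?q ?r f (snd m j ()))
            (?u x j)) (snd (dec ?X k) x ()))"
          if j: "j \<in> pts ?A" for j
          using P_hm(2)[OF X fS(1)[OF j] dk(1), of "Cmp Q (ty ?A j) ?q ?r f (snd m j ())"] fS(3,4) fS(1)[OF j]
            j X A m f dk hm[OF j k]
            presheaf_in[OF m j] by simp
        then show ?thesis by blast
      qed
      also have "\<dots> \<longleftrightarrow> leQ ?q ?r f (hm (P Q ?A) m (column ?A ?A (hm ?A) k))"
        using P_hm(2)[OF A(1) m y, of f] f fS(3)[OF k] by simp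
      finally show "leQ ?q ?r f (hm ?A (s m) k) \<longleftrightarrow> leQ ?q ?r f (hm (P Q ?A) m (column ?A ?A (hm ?A) k))" .
    qed (use m dk in auto)
  qed
qed

text \<open>Both arrows start at the fixed points. With \<open>u\<close> the evaluation and
  \<open>1\<close> the identity distributor there, \<open>u \<swarrow> u = 1\<close> and
  \<open>1 \<swarrow> (u \<searrow> 1) = u\<close>; after negation these say that
  \<open>\<not>1\<close> and \<open>clo S\<close> factor through each other.\<close>

lemma fixed_iso:
  assumes S: "closure_space U Q S"
  shows "is_iso (diagonal_quantaloid (QDist U Q))
    (fixed_cat S, fixed_cat S, dneg (fixed_cat S) (fixed_cat S) (hm (fixed_cat S)))
      (fixed_cat S, fst S, clo S) (clo S)"
proof -
  let ?X = "fst S" and ?A = "fixed_cat S" and ?u = "fixed_incl S" and ?c = "snd S"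
  let ?n = "dneg ?A ?A (hm ?A)"
  note X = closure_facts(2)[OF S] and c = closure_facts(3)[OF S] and A = closure_facts(7,8)[OF S]
  note fS = fixed_simps[OF S]
  have hm: "hm ?A j k = hm (P Q ?X) (dec ?X j) (dec ?X k)" if "j \<in> pts ?A" "k \<in> pts ?A" for j k
    using that closure_facts(1)[OF S] fixed_psh[of S] by (simp add: fixed_cat_def)
  have le_hm: "leQ (ty ?A j) (ty ?A k) f (hm ?A j k) \<longleftrightarrow>
      (\<forall>x\<in>pts ?X. leQ (ty ?X x) (ty ?A k) (Cmp Q (ty ?X x) (ty ?A j) (ty ?A k) f (?u x j)) (?u x k))"
    if "j \<in> pts ?A" "k \<in> pts ?A" "f \<in> arr Q (ty ?A j) (ty ?A k)" for j k f
    using P_hm(2)[OF X fS(1)[OF that(1)] fS(1)[OF that(2)], of f] that fS(3,4) by (simp add: hm)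
  have "dl ?X ?A ?A ?u ?u = hm ?A"
  proof (rule dists_eq_le_iffI[OF A(1,1)])
    fix j k f assume "j \<in> pts ?A" "k \<in> pts ?A" "f \<in> arr Q (ty ?A j) (ty ?A k)"
    then show "leQ (ty ?A j) (ty ?A k) f (dl ?X ?A ?A ?u ?u j k) \<longleftrightarrow> leQ (ty ?A j) (ty ?A k) f (hm ?A j k)"
      using le_dl[OF X A(1,1,2,2), of j k f] le_hm[of j k f] by simp
  qed (use X A in auto)
  then have "dneg ?A ?A (dist_comp Q ?A ?X ?A ?u (clo S)) = hm ?A" unfolding dl_clo .
  then have 1: "?n = dist_comp Q ?A ?X ?A ?u (clo S)"
    using dneg_dneg[of ?A ?A "dist_comp Q ?A ?X ?A ?u (clo S)"] X A clo_dist[OF S] by simp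
  let ?t = "dr ?A ?X ?A ?u (hm ?A)"
  have t: "?t \<in> dists Q ?A ?X" using X A by auto
  have "dl ?A ?X ?A (hm ?A) ?t = ?u"
  proof (rule dists_eq_le_iffI[OF X A(1)])
    fix x k f assume x: "x \<in> pts ?X" and k: "k \<in> pts ?A" and f: "f \<in> arr Q (ty ?X x) (ty ?A k)"
    have uk: "?u x k \<in> arr Q (ty ?X x) (ty ?A k)" using A x k by auto
    have "leQ (ty ?X x) (ty ?A k) f (?u x k)"
      if *: "\<forall>j\<in>pts ?A. leQ (ty ?A j) (ty ?A k) (Cmp Q (ty ?A j) (ty ?X x) (ty ?A k) f (?t j x)) (hm ?A j k)"
    proof -
      \<comment> \<open>The point to test at is the closure of the representable at
        \<open>x\<close>: by Yoneda and \<open>closed_absorb\<close>, \<open>?u x j\<close> lies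
        below \<open>hm ?A ?e j\<close> for every closed \<open>j\<close>, so \<open>?t\<close> lies
        above the identity there.\<close>
      let ?y = "column ?X ?X (hm ?X) x" and ?q = "ty ?X x"
      have y: "?y \<in> presheaves Q ?X" "fst ?y = ?q" using X x by auto
      have cy: "?c ?y \<in> fixed S" "?c ?y \<in> presheaves Q ?X" "fst (?c ?y) = ?q"
        using y closure_facts(9)[OF S y(1)] c by auto
      let ?e = "enc ?X (?c ?y)"
      have e: "?e \<in> pts ?A" "ty ?A ?e = ?q" "dec ?X ?e = ?c ?y" using fS cy by auto
      have ti: "?t ?e x \<in> arr Q ?q ?q" using dist_in[OF t e(1) x] e by simp
      have hi: "hm ?A ?e j \<in> arr Q ?q (ty ?A j)" if "j \<in> pts ?A" for j using hm_in[OF A(1) e(1) that] e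
        by simp
      have "leQ ?q (ty ?A j) (?u x j) (hm ?A ?e j)" if j: "j \<in> pts ?A" for j
      proof -
        note dj = fS(1,2)[OF j]
        have uj: "?u x j \<in> arr Q ?q (fst (dec ?X j))" using dist_in[OF A(2) x j] fS(3)[OF j] by simp
        have "leQ (ty ?X z) (fst (dec ?X j)) (Cmp Q (ty ?X z) ?q (fst (dec ?X j)) (?u x j) (hm ?X z x))
          (snd (dec ?X j) z ())"
          if "z \<in> pts ?X" for z
          using presheaf_right[OF X dj(1) x that] fS(4)[OF x j] by simp
        then have "leQ (ty ?X z) (fst (dec ?X j))
          (Cmp Q (ty ?X z) ?q (fst (dec ?X j)) (?u x j) (snd (?c ?y) z ())) (snd (dec ?X j) z ())"
          if "z \<in> pts ?X" for z
          using closed_absorb[OF X c closure_facts(4)[OF S y(1)] y(1) dj, of "?u x j"] uj y that by simp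
        then show ?thesis
          using P_hm(2)[OF X cy(2) dj(1), of "?u x j"] uj cy hm[OF e(1) j] e fS(3)[OF j] by simp
      qed
      then have te: "leQ ?q ?q (Idn Q ?q) (?t ?e x)"
        using le_dr[OF A(1) X A(1) A(2) hm_dist[OF A(1)] e(1) x, of "Idn Q ?q"] e X x A by simp
      have "leQ ?q (ty ?A k) f (Cmp Q ?q ?q (ty ?A k) f (?t ?e x))"
        using X x A k f ti te by (intro le_Cmp_Idn) auto
      from le_trans[OF _ _ _ _ _ this] bspec[OF * e(1)] have 2: "leQ ?q (ty ?A k) f (hm ?A ?e k)"
        using X x A k f ti hi[OF k] e by simp
      have cyx: "snd (?c ?y) x () \<in> arr Q ?q ?q" using presheaf_in[OF cy(2) x] cy by simp
      have "leQ ?q ?q (Idn Q ?q) (snd (?c ?y) x ())"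
        using le_trans[OF _ _ _ _ cyx hm_refl[OF X x]] closure_facts(4)[OF S y(1) x] X x y by simp
      then have 3: "leQ ?q (ty ?A k) f (Cmp Q ?q ?q (ty ?A k) f (snd (?c ?y) x ()))"
        using X x A k f cyx by (intro le_Cmp_Idn) auto
      have uex: "?u x ?e = snd (?c ?y) x ()" using fS(8)[OF x cy(1)] .
      have "leQ ?q (ty ?A k) (Cmp Q ?q ?q (ty ?A k) f (snd (?c ?y) x ())) (?u x k)"
        using le_hm[OF e(1) k, of f] 2 f e x uex by auto
      from le_trans[OF _ _ _ _ _ 3 this] show ?thesis using X x A k f cyx uk by simp
    qed
    moreover have "leQ (ty ?A j) (ty ?A k) (Cmp Q (ty ?A j) (ty ?X x) (ty ?A k) f (?t j x)) (hm ?A j k)"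
      if *: "leQ (ty ?X x) (ty ?A k) f (?u x k)" and j: "j \<in> pts ?A" for j
    proof -
      have "leQ (ty ?A j) (ty ?A k) (Cmp Q (ty ?A j) (ty ?X x) (ty ?A k) f (?t j x))
        (Cmp Q (ty ?A j) (ty ?X x) (ty ?A k) (?u x k) (?t j x))"
        using X A x j k f t uk * by (intro Cmp_mono_left) auto
      from le_trans[OF _ _ _ _ _ this dr_Cmp_le[OF A(1) X A(1) A(2) hm_dist[OF A(1)] j x k]] show ?thesis
        using X A x j k f t uk by simp
    qed
    ultimately show "leQ (ty ?X x) (ty ?A k) f (dl ?A ?X ?A (hm ?A) ?t x k) \<longleftrightarrow> leQ (ty ?X x) (ty ?A k) f
      (?u x k)"
      unfolding le_dl[OF A(1) X A(1) t hm_dist[OF A(1)] x k f] by blast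
  qed (use X A t in auto)
  then have "dneg ?A ?X (dist_comp Q ?A ?A ?X ?t ?n) = ?u" unfolding dl_def .
  then have 2: "clo S = dist_comp Q ?A ?A ?X ?t ?n"
    unfolding clo_def using dneg_dneg[of ?A ?X "dist_comp Q ?A ?A ?X ?t ?n"] X A t by auto
  show ?thesis
  proof (rule QD.diagonal_iso_domain)
    show "(?A, ?A, ?n) \<in> Arrows (QDist U Q)" using closure_facts(6)[OF S] A by (auto simp: Arrows_def)
    show "(?A, ?X, clo S) \<in> Arrows (QDist U Q)" by (rule clo_Arrows[OF S])
    show "?t \<in> arr (QDist U Q) ?A ?X" "?u \<in> arr (QDist U Q) ?X ?A" using t A by auto
    show "clo S = Cmp (QDist U Q) ?A ?A ?X ?t ?n" unfolding QDist_simps by (rule 2)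
    show "?n = Cmp (QDist U Q) ?A ?X ?A ?u (clo S)" unfolding QDist_simps by (rule 1)
  qed
qed

section \<open>Complete categories compared with diagonals\<close>

lemma QSup_op_simps:
  "Obj (op_quantaloid (QSup U Q)) = {X. small_qcat U Q X \<and> separated Q X \<and> complete_qcat Q X}"
  "arr (op_quantaloid (QSup U Q)) X Y = {f. \<exists>g. adjoint Q Y X f g}"
  "eq (Hom (op_quantaloid (QSup U Q)) X Y) = (=)"
  "le (Hom (op_quantaloid (QSup U Q)) X Y) = pointwise_le Q Y X"
  "Cmp (op_quantaloid (QSup U Q)) X Y Z g f = compose (pts Z) f g"
  "Idn (op_quantaloid (QSup U Q)) X = restrict (\<lambda>x. x) (pts X)"
  by (simp_all add: op_quantaloid_def QSup_def)

text \<open>A left adjoint from \<open>Y\<close> to \<open>X\<close> has its graph from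
  \<open>Y\<close> to \<open>X\<close>, and negation reverses it; this is why the opposite
  quantaloid appears. Objects are reached through closure spaces: an arrow is isomorphic to some
  \<open>clo S\<close>, and that to the negated identity of the fixed points.\<close>

lemma weak_equivalence_QSup:
  "weak_equivalence (op_quantaloid (QSup U Q)) (diagonal_quantaloid (QDist U Q))
    (\<lambda>X. (X, X, dneg X X (hm X))) (\<lambda>X Y f. dneg Y X (graph Y X f))" (is "weak_equivalence ?K ?E ?Fo ?Fa")
proof (rule weak_equivalenceI)
  show E: "quantaloid ?E" by (rule QD.quantaloid_diagonal)
  have q: "qcat Q X" "small_qcat U Q X" "separated Q X" "complete_qcat Q X" if "X \<in> Obj ?K" for X
    using that by (auto simp: QSup_op_simps small_qcat_def)
  show Fo: "?Fo X \<in> Obj ?E" if "X \<in> Obj ?K" for X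
    using q[OF that] by (auto simp: Arrows_def)
  have fn: "f \<in> qfunctors Q Y X" if "f \<in> arr ?K X Y" for X Y f
    using that by (auto simp: QSup_op_simps adjoint_def)
  have t_eq: "?Fa X Y f = dist_comp Q X X Y (cograph Y X f) (dneg X X (hm X))"
    if *: "X \<in> Obj ?K" "Y \<in> Obj ?K" "f \<in> arr ?K X Y" for X Y f
    using dl_hm_cograph[OF q(1)[OF *(2)] q(1)[OF *(1)] fn[OF *(3)]] q(1)[OF *(1)] q(1)[OF *(2)] fn[OF *(3)]
      dneg_dneg[of X Y "dist_comp Q X X Y (cograph Y X f) (dneg X X (hm X))"] unfolding dl_def by auto
  have s_eq: "?Fa X Y f = dist_comp Q X Y Y (dneg Y Y (hm Y)) (graph X Y g)"
    if *: "X \<in> Obj ?K" "Y \<in> Obj ?K" "adjoint Q Y X f g" for X Y f g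
  proof -
    have f: "f \<in> qfunctors Q Y X" "g \<in> qfunctors Q X Y" using *(3) by (auto simp: adjoint_def)
    note X = q(1)[OF *(1)] q(1)[OF *(2)]
    have "graph Y X f = cograph X Y g"
      by (rule dist_eqI[of _ Y X]) (use X f *(3) in \<open>auto simp: adjoint_def\<close>)
    then have "dneg X Y (dist_comp Q X Y Y (dneg Y Y (hm Y)) (graph X Y g)) = graph Y X f"
      using dr_hm_graph[OF X(2,1) f(2)] unfolding dr_def by simp
    from arg_cong[OF this, of "dneg Y X"] show ?thesis using X f by simp
  qed
  have Fin: "?Fa X Y f \<in> diagonals (QDist U Q) (?Fo X) (?Fo Y)"
    if *: "X \<in> Obj ?K" "Y \<in> Obj ?K" "f \<in> arr ?K X Y" for X Y f
  proof -
    obtain g where g: "adjoint Q Y X f g" using *(3) by (auto simp: QSup_op_simps)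
    then have "g \<in> qfunctors Q X Y" by (auto simp: adjoint_def)
    then show ?thesis
      using Fo[OF *(1)] Fo[OF *(2)] q(1)[OF *(1)] q(1)[OF *(2)] fn[OF *(3)] t_eq[OF *] s_eq[OF *(1,2) g]
      by (intro QD.diagonalI[of _ _ _ _ _ _ "graph X Y g" "cograph Y X f"]) auto
  qed
  show "Idn ?K X \<in> arr ?K X X \<and> ?Fa X X (Idn ?K X) = Idn ?E (?Fo X)" if X: "X \<in> Obj ?K" for X
  proof -
    have "graph X X (restrict (\<lambda>x. x) (pts X)) = hm X"
      by (rule dist_eqI[of _ X X]) (use q(1)[OF X] adjoint_id[OF q(1)[OF X]] in \<open>auto simp: adjoint_def\<close>)
    then show ?thesis using adjoint_id[OF q(1)[OF X]] by (auto simp: QSup_op_simps)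
  qed
  show "Cmp ?K X Y Z g f \<in> arr ?K X Z \<and> ?Fa X Z (Cmp ?K X Y Z g f) = Cmp ?E (?Fo X) (?Fo Y) (?Fo Z)
    (?Fa Y Z g) (?Fa X Y f)"
    if *: "X \<in> Obj ?K" "Y \<in> Obj ?K" "Z \<in> Obj ?K" "f \<in> arr ?K X Y" "g \<in> arr ?K Y Z" for X Y Z f g
  proof -
    note X = q(1)[OF *(1)] q(1)[OF *(2)] q(1)[OF *(3)]
    obtain f' g' where a: "adjoint Q Y X f f'" "adjoint Q Z Y g g'" using * by (auto simp: QSup_op_simps)
    have c: "Cmp ?K X Y Z g f \<in> arr ?K X Z"
      using adjoint_compose[OF X(3,2,1) a(2,1)] by (auto simp: QSup_op_simps)
    note f = fn[OF *(4)] and g = fn[OF *(5)]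
    \<comment> \<open>Composition of diagonals uses the cograph factor of \<open>?Fa Y Z g\<close>,
      which by \<open>cograph_comp\<close> acts as substitution along \<open>g\<close>.\<close>
    have "Cmp ?E (?Fo X) (?Fo Y) (?Fo Z) (?Fa Y Z g) (?Fa X Y f) = dist_comp Q X Y Z (cograph Z Y g)
      (?Fa X Y f)"
      using QD.diagonal_Cmp[OF Fo[OF *(1), simplified] Fo[OF *(2), simplified] Fo[OF *(3), simplified]
        Fin[OF *(1,2,4)], of "cograph Z Y g" "?Fa Y Z g"]
        t_eq[OF *(2,3,5)] X g by auto
    also have "\<dots> = ?Fa X Z (Cmp ?K X Y Z g f)"
    proof (rule dist_eqI[of _ X Z])
      fix x z assume x: "x \<in> pts X" and z: "z \<in> pts Z"
      have "dist_comp Q X Y Z (cograph Z Y g) (?Fa X Y f) x z = ?Fa X Y f x (g z)"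
        using X f g x z by (intro cograph_comp) auto
      then show "dist_comp Q X Y Z (cograph Z Y g) (?Fa X Y f) x z = ?Fa X Z (Cmp ?K X Y Z g f) x z"
        using qfunctor_facts(1,2)[OF g z] x z by (simp add: dneg_app QSup_op_simps compose_eq)
    qed (use X f g fn[OF c] in auto)
    finally show ?thesis using c by simp
  qed
  show ord: "le (Hom ?K X Y) f f' \<longleftrightarrow> le (Hom ?E (?Fo X) (?Fo Y)) (?Fa X Y f) (?Fa X Y f')"
    if *: "X \<in> Obj ?K" "Y \<in> Obj ?K" "f \<in> arr ?K X Y" "f' \<in> arr ?K X Y" for X Y f f'
  proof -
    note X = q(1)[OF *(1)] q(1)[OF *(2)] and f = fn[OF *(3)] fn[OF *(4)]
    note f1 = qfunctor_facts[OF f(1)] and f2 = qfunctor_facts[OF f(2)]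
    have "dist_le Q X Y (?Fa X Y f) (?Fa X Y f') \<longleftrightarrow> dist_le Q Y X (graph Y X f') (graph Y X f)"
      using QD.neg_le_iff[of Y X "graph Y X f'" "graph Y X f"] q(2)[OF *(1)] q(2)[OF *(2)] X f by auto
    also have "\<dots> \<longleftrightarrow> (\<forall>y\<in>pts Y. \<forall>x\<in>pts X. leQ (ty Y y) (ty X x) (hm X (f' y) x) (hm X (f y) x))"
      unfolding dist_le_def by auto
    also have "\<dots> \<longleftrightarrow> pointwise_le Q Y X f f'"
      unfolding pointwise_le_def using hm_mono_iff[OF X(1) f1(1) f2(1)] f1(2) f2(2) by (intro ball_cong) auto
    finally show ?thesis by (simp add: QSup_op_simps)
  qed
  show "bij_betw (?Fa X Y) (arr ?K X Y) (arr ?E (?Fo X) (?Fo Y))" if *: "X \<in> Obj ?K" "Y \<in> Obj ?K" for X Y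
  proof -
    note X = q(1)[OF *(1)] q(1)[OF *(2)]
    have "f = f'" if f: "f \<in> arr ?K X Y" "f' \<in> arr ?K X Y" "?Fa X Y f = ?Fa X Y f'" for f f'
    proof -
      note g = fn[OF f(1)] fn[OF f(2)]
      have "le (Hom ?E (?Fo X) (?Fo Y)) (?Fa X Y f) (?Fa X Y f')"
        "le (Hom ?E (?Fo X) (?Fo Y)) (?Fa X Y f') (?Fa X Y f)"
        using f(3) dist_le_refl[of X Y "?Fa X Y f'"] X g by auto
      then have "pointwise_le Q Y X f f'" "pointwise_le Q Y X f' f"
        using ord[OF * f(1,2)] ord[OF * f(2,1)] by (auto simp: QSup_op_simps)
      then have "f y = f' y" if "y \<in> pts Y" for y
        using q(3)[OF *(1)] that qfunctor_facts(1)[OF g(1) that] qfunctor_facts(1)[OF g(2) that]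
        unfolding separated_def pointwise_le_def by blast
      then show ?thesis
        using qfunctor_facts(3)[OF g(1)] qfunctor_facts(3)[OF g(2)]
          by (intro extensionalityI[of _ "pts Y"]) auto
    qed
    moreover have "w \<in> ?Fa X Y ` arr ?K X Y" if wE: "w \<in> arr ?E (?Fo X) (?Fo Y)" for w
    proof -
      obtain s t where w: "w \<in> dists Q X Y" and s: "s \<in> dists Q X Y"
        "w = dist_comp Q X Y Y (dneg Y Y (hm Y)) s"
        and t: "t \<in> dists Q X Y" "w = dist_comp Q X X Y t (dneg X X (hm X))"
        using wE unfolding diagonal_simps QD.diagonals_iff QDist_simps by blast
      \<comment> \<open>The two factorizations of \<open>w\<close> through negated identities are
        the two residual forms that characterise the graph of a left adjoint.\<close>
      have "dneg X Y w = dl X Y X (hm X) t" "dneg X Y w = dr Y X Y s (hm Y)"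
        unfolding dl_def dr_def s(2)[symmetric] t(2)[symmetric] by auto
      then obtain f g where f: "adjoint Q Y X f g" "graph Y X f = dneg X Y w"
        using left_adjoint_of_residual[OF X(2,1) q(4)[OF *(2)] q(4)[OF *(1)] t(1) s(1), of "dneg X Y w"]
          by auto
      then have "w = ?Fa X Y f" using X w by simp
      moreover have "f \<in> arr ?K X Y" using f by (auto simp: QSup_op_simps)
      ultimately show ?thesis by blast
    qed
    ultimately show ?thesis
      using Fin[OF *] by (auto simp: bij_betw_def intro!: inj_onI)
  qed
  show "\<exists>X\<in>Obj ?K. \<exists>w. is_iso ?E (?Fo X) x w" if x: "x \<in> Obj ?E" for x
  proof -
    obtain Y X u where x': "x = (Y, X, u)" by (rule prod_cases3)
    then have "small_qcat U Q X" "small_qcat U Q Y" "u \<in> dists Q Y X" using x by (auto simp: Arrows_def)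
    from closure_eso[OF this] obtain S w where S: "closure_space U Q S"
      and w: "is_iso ?E (fixed_cat S, fst S, clo S) x w"
      unfolding x' by blast
    have K: "fixed_cat S \<in> Obj ?K" using closure_facts(6)[OF S] fixed_complete[OF S]
      by (simp add: QSup_op_simps)
    interpret E: quantaloid_loc ?E by standard (rule E)
    show ?thesis
      using E.is_iso_Cmp[OF Fo[OF K] _ x fixed_iso[OF S] w] clo_Arrows[OF S] K by auto
  qed
qed (simp add: QSup_op_simps)

end

theorem theorem8p5:
  fixes U :: "'v set" and Q :: "('o, 'a) quantaloid_data" and d :: "'o \<Rightarrow> 'a"
  assumes "inaccessible U"
    and "small_quantaloid U Q"
    and "girard_quantaloid Q d"
  shows "D_quantaloid (QDist U Q) \<simeq>\<^sub>q B_quantaloid (QDist U Q) \<and>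
         B_quantaloid (QDist U Q) \<simeq>\<^sub>q IntDist_o U Q \<and>
         IntDist_o U Q \<simeq>\<^sub>q ClsDist_cl U Q \<and>
         ClsDist_cl U Q \<simeq>\<^sub>q op_quantaloid (QSup U Q)"
proof -
  \<comment> \<open>The negation of \<open>Q\<close> is \<open>u \<mapsto> d p \<swarrow> u\<close>;
    this is the only point where the dualizing family meets the comparison.\<close>
  interpret universe Q "\<lambda>p q u. lres Q p q p (d p) u" U
    using girard_star_quantaloid[OF assms(3)] assms(1,2)
    by (simp add: universe_def universe_axioms_def distributors_def)
  obtain Do Da Bo Ba Io Ia where
    D: "weak_equivalence (D_quantaloid (QDist U Q)) (diagonal_quantaloid (QDist U Q)) Do Da" and
    B: "weak_equivalence (B_quantaloid (QDist U Q)) (diagonal_quantaloid (QDist U Q)) Bo Ba" and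
    I: "weak_equivalence (IntDist_o U Q) (diagonal_quantaloid (QDist U Q)) Io Ia"
    using QD.weak_equivalence_D QD.weak_equivalence_B weak_equivalence_IntDist by (elim exE)
  note C = weak_equivalence_ClsDist and S = weak_equivalence_QSup
  show ?thesis
    by (intro conjI cospan_equiv[OF D B] cospan_equiv[OF B I] cospan_equiv[OF I C] cospan_equiv[OF C S])
qed

end
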